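(* Let $D$ be a classifying space (period domain) of graded-polarized mixed Hodge structures, let $F\in D$, and let $\nabla$ be the Chern connection of the mixed Hodge metric on the holomorphic tangent bundle $T(D)$. Then for every $u\in\mathfrak q_F\simeq T^{1,0}_F(D)$ the curvature at $F$, as an endomorphism of $\mathfrak q_F$, is $$R_\nabla(u,\bar u)=-\big[(\operatorname{ad}\bar u_+^* )_{\mathfrak q},(\operatorname{ad}\bar u_+)_{\mathfrak q}\big]-\operatorname{ad}[u,\bar u]_0-\big(\operatorname{ad}([u,\bar u]_++[u,\bar u]_+^* )\big)_{\mathfrak q}.$$
   Context: Classifying space: fix a finite-dimensional real vector space $V_{\mathbb R}$, an increasing (weight) filtration $W$ of it, non-degenerate $(-1)^k$-symmetric real bilinear forms $Q_k$ on $\operatorname{gr}^W_k$, and numbers $h^{p,q}$. $D$ is the set of decreasing filtrations $F$ of $V_{\mathbb C}$ such that $(F,W)$ is a mixed Hodge structure, graded-polarized by $\{Q_k\}$, with Hodge numbers $h^{p,q}$. For $F\in D$ the Deligne bigrading is the unique functorial $V_{\mathbb C}=\bigoplus I^{p,q}$ with $F^p=\bigoplus_{a\ge p}I^{a,b}$, $W_k=\bigoplus_{a+b\le k}I^{a,b}$, $\overline{I^{p,q}}\equiv I^{q,p}$ mod $\bigoplus_{a<q,b<p}I^{a,b}$. The mixed Hodge metric $h_F$ on $V_{\mathbb C}$ makes the bigrading orthogonal with $h_F(u,v)=\mathrm i^{p-q}Q_{p+q}([u],[\bar v])$ for $u,v\in I^{p,q}$; on $\operatorname{End}(V_{\mathbb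 C})$ put $h_F(\alpha,\beta)=\operatorname{Tr}(\alpha\beta^* )$, $\beta^*$ the $h_F$-adjoint. Lie theory: $G_{\mathbb C}$ is the group of complex automorphisms of $V_{\mathbb C}$ preserving $W$ and inducing automorphisms of the $Q_k$ on $\operatorname{gr}^W$; $G_{\mathbb R}=G_{\mathbb C}\cap GL(V_{\mathbb R})$; $\mathfrak g_{\mathbb C},\mathfrak g_{\mathbb R}$ are the Lie algebras; bar is complex conjugation. $\operatorname{End}(V)^{r,s}$ consists of the maps sending each $I^{p,q}$ to $I^{p+r,q+s}$, and $\mathfrak g^{r,s}=\mathfrak g_{\mathbb C}\cap\operatorname{End}(V)^{r,s}$. Put $\mathfrak q=\mathfrak q_F=\bigoplus_{r<0}\mathfrak g^{r,s}$, $\Lambda=\bigoplus_{r,s<0}\mathfrak g^{r,s}$, $\mathfrak n_+=\bigoplus_{a\ge0,b<0}\mathfrak g^{a,b}$, $\mathfrak n_-=\bigoplus_{a<0,b\ge0}\mathfrak g^{a,b}$, so $\mathfrak g_{\mathbb C}=\mathfrak n_+\oplus\mathfrak g^{0,0}\oplus\mathfrak n_-\oplus\Lambda$. $D$ is a complex manifold, open in $G_{\mathbb C}\cdot F$; $u\mapsto\frac{d}{dt}|_0e^{tu}\cdot F$ identifies $\mathfrak q_F$ with the holomorphic tangent space $T_F^{1,0}D$, and the mixed Hodge metric on $T(D)$ is $h_F$ restricted to $\mathfrak q_F$. Notation: for $x\in\operatorname{End}(V_{\mathbb C})$, $x_+,x_0,x_-,x_\Lambda$ are the orthogonal projection to $\mathfrak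 g_{\mathbb C}$ followed by projection to $\mathfrak n_+,\mathfrak g^{0,0},\mathfrak n_-,\Lambda$; $x_{\mathfrak q}$ is the orthogonal projection to $\mathfrak q$; for an operator $A$ on $\operatorname{End}(V_{\mathbb C})$, $A_{\mathfrak q}$ is $A$ followed by orthogonal projection to $\mathfrak q$, acting on $\mathfrak q$. Order of operations: conjugate, then project, then take adjoint: $\bar u_+=(\bar u)_+$, $\bar u_+^*=((\bar u)_+)^*$, $[x,y]_+^*=([x,y]_+)^*$. Curvature convention: $R_\nabla=\bar\partial\theta$ with $\theta$ the Chern connection form $\mathbf h^{-1}\partial\mathbf h$ in a local holomorphic frame ($\mathbf h$ the transposed Gram matrix); for a line bundle $R(\partial_z,\partial_{\bar z})=-\partial_z\partial_{\bar z}\log h$. *)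

theory Defs
  imports "HOL-Analysis.Analysis"
begin

text \<open>
  The real vector space is \<open>real ^ 'n\<close>, its complexification is \<open>complex ^ 'n\<close>, and endomorphisms
  of the complexification are matrices \<open>complex ^ 'n ^ 'n\<close>.  A filtration by complex subspaces is a
  function from the integers to sets.
\<close>

type_synonym 'n filt = "int \<Rightarrow> (complex ^ 'n) set"
type_synonym 'n weight = "int \<Rightarrow> (real ^ 'n) set"
type_synonym 'n forms = "int \<Rightarrow> real ^ 'n \<Rightarrow> real ^ 'n \<Rightarrow> real"

definition re_vec :: "complex ^ 'n \<Rightarrow> real ^ 'n" where
  "re_vec v = (\<chi> i. Re (v $ i))"

definition im_vec :: "complex ^ 'n \<Rightarrow> real ^ 'n" where
  "im_vec v = (\<chi> i. Im (v $ i))"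

definition cnj_vec :: "complex ^ 'n \<Rightarrow> complex ^ 'n" where
  "cnj_vec v = (\<chi> i. cnj (v $ i))"

definition cnj_mat :: "complex ^ 'n ^ 'n \<Rightarrow> complex ^ 'n ^ 'n" where
  "cnj_mat X = (\<chi> i j. cnj (X $ i $ j))"

definition cscale :: "complex \<Rightarrow> complex ^ 'n ^ 'n \<Rightarrow> complex ^ 'n ^ 'n" where
  "cscale c X = (\<chi> i j. c * X $ i $ j)"

definition subspace_sum :: "'a::plus set \<Rightarrow> 'a set \<Rightarrow> 'a set" where
  "subspace_sum A B = {a + b | a b. a \<in> A \<and> b \<in> B}"

text \<open>
  The component in \<open>A\<close> of an element of the direct sum of \<open>A\<close> and \<open>B\<close>.
\<close>

definition proj_along :: "'a::minus set \<Rightarrow> 'a set \<Rightarrow> 'a \<Rightarrow> 'a" where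
  "proj_along A B x = (THE y. y \<in> A \<and> x - y \<in> B)"


section \<open>Mixed Hodge structures and the classifying space\<close>

text \<open>
  A bilinear form on \<open>gr\<^sup>W\<^sub>k\<close> is given by its pullback to \<open>W\<^sub>k\<close>, that is, by a bilinear form
  \<open>Q k\<close> on \<open>W k\<close> which has \<open>W (k - 1)\<close> in its radical; values of \<open>Q k\<close> off \<open>W k\<close> are irrelevant.
\<close>

definition weight_filtration :: "'n::finite weight \<Rightarrow> bool" where
  "weight_filtration W \<longleftrightarrow>
     (\<forall>k. subspace (W k)) \<and> (\<forall>k l. k \<le> l \<longrightarrow> W k \<subseteq> W l) \<and>
     (\<exists>k. W k = {0}) \<and> (\<exists>k. W k = UNIV)"

definition graded_forms :: "'n::finite weight \<Rightarrow> 'n forms \<Rightarrow> bool" where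
  "graded_forms W Q \<longleftrightarrow> (\<forall>k.
     (\<forall>x\<in>W k. \<forall>y\<in>W k. \<forall>z\<in>W k. Q k (x + y) z = Q k x z + Q k y z) \<and>
     (\<forall>c. \<forall>x\<in>W k. \<forall>y\<in>W k. Q k (c *\<^sub>R x) y = c * Q k x y) \<and>
     (\<forall>x\<in>W k. \<forall>y\<in>W k. Q k y x = (- 1) powi k * Q k x y) \<and>
     (\<forall>x\<in>W (k - 1). \<forall>y\<in>W k. Q k x y = 0) \<and>
     (\<forall>x\<in>W k. (\<forall>y\<in>W k. Q k x y = 0) \<longrightarrow> x \<in> W (k - 1)))"

definition W_C :: "'n::finite weight \<Rightarrow> 'n filt" where
  "W_C W k = {v. re_vec v \<in> W k \<and> im_vec v \<in> W k}"

definition Q_C :: "'n::finite forms \<Rightarrow> int \<Rightarrow> complex ^ 'n \<Rightarrow> complex ^ 'n \<Rightarrow> complex" where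
  "Q_C Q k u v =
     Complex (Q k (re_vec u) (re_vec v) - Q k (im_vec u) (im_vec v))
             (Q k (re_vec u) (im_vec v) + Q k (im_vec u) (re_vec v))"

definition decreasing_filtration :: "'n::finite filt \<Rightarrow> bool" where
  "decreasing_filtration F \<longleftrightarrow>
     (\<forall>p. vec.subspace (F p)) \<and> (\<forall>p q. p \<le> q \<longrightarrow> F q \<subseteq> F p) \<and>
     (\<exists>p. F p = UNIV) \<and> (\<exists>p. F p = {0})"

text \<open>
  Subspaces of \<open>gr\<^sup>W\<^sub>k\<close> are represented by their preimages in \<open>W\<^sub>k\<close>: \<open>F_gr W F k p\<close> is the preimage of
  the filtration step \<open>F\<^sup>p gr\<^sup>W\<^sub>k\<close>, and \<open>H_gr W F p q\<close> that of the Hodge component \<open>H\<^sup>p\<^sup>,\<^sup>q\<close> of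
  \<open>gr\<^sup>W\<^sub>k\<close>, \<open>k = p + q\<close>.
\<close>

definition F_gr :: "'n::finite weight \<Rightarrow> 'n filt \<Rightarrow> int \<Rightarrow> int \<Rightarrow> (complex ^ 'n) set" where
  "F_gr W F k p = subspace_sum (F p \<inter> W_C W k) (W_C W (k - 1))"

definition H_gr :: "'n::finite weight \<Rightarrow> 'n filt \<Rightarrow> int \<Rightarrow> int \<Rightarrow> (complex ^ 'n) set" where
  "H_gr W F p q = F_gr W F (p + q) p \<inter> cnj_vec ` F_gr W F (p + q) q"

text \<open>
  The second clause says that \<open>gr\<^sup>W\<^sub>k\<close> is the direct sum of \<open>F\<^sup>p\<close> and the conjugate of
  \<open>F\<^sup>k\<^sup>-\<^sup>p\<^sup>+\<^sup>1\<close>, i.e. that \<open>F\<close> induces a pure Hodge structure of weight \<open>k\<close> on it.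
\<close>

definition mixed_hodge_structure :: "'n::finite weight \<Rightarrow> 'n filt \<Rightarrow> bool" where
  "mixed_hodge_structure W F \<longleftrightarrow> decreasing_filtration F \<and>
     (\<forall>k p. subspace_sum (F_gr W F k p) (cnj_vec ` F_gr W F k (k - p + 1)) = W_C W k \<and>
            F_gr W F k p \<inter> cnj_vec ` F_gr W F k (k - p + 1) = W_C W (k - 1))"

definition graded_polarized :: "'n::finite weight \<Rightarrow> 'n forms \<Rightarrow> 'n filt \<Rightarrow> bool" where
  "graded_polarized W Q F \<longleftrightarrow>
     (\<forall>k p. \<forall>u\<in>F_gr W F k p. \<forall>v\<in>F_gr W F k (k - p + 1). Q_C Q k u v = 0) \<and>
     (\<forall>p q. \<forall>u\<in>H_gr W F p q - W_C W (p + q - 1).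
        Im (\<i> powi (p - q) * Q_C Q (p + q) u (cnj_vec u)) = 0 \<and>
        0 < Re (\<i> powi (p - q) * Q_C Q (p + q) u (cnj_vec u)))"

definition hodge_numbers :: "'n::finite weight \<Rightarrow> 'n filt \<Rightarrow> (int \<Rightarrow> int \<Rightarrow> nat) \<Rightarrow> bool" where
  "hodge_numbers W F h \<longleftrightarrow>
     (\<forall>p q. vec.dim (H_gr W F p q) = h p q + vec.dim (W_C W (p + q - 1)))"

definition classifying_space ::
    "'n::finite weight \<Rightarrow> 'n forms \<Rightarrow> (int \<Rightarrow> int \<Rightarrow> nat) \<Rightarrow> 'n filt set" where
  "classifying_space W Q h =
     {F. mixed_hodge_structure W F \<and> graded_polarized W Q F \<and> hodge_numbers W F h}"


section \<open>Deligne bigrading and mixed Hodge metric\<close>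

definition bigrading :: "(int \<Rightarrow> int \<Rightarrow> (complex ^ 'n::finite) set) \<Rightarrow> bool" where
  "bigrading I \<longleftrightarrow> (\<forall>p q. vec.subspace (I p q)) \<and> finite {(p, q). I p q \<noteq> {0}} \<and>
     (\<forall>v. \<exists>!c. (\<forall>p q. c p q \<in> I p q) \<and> (\<Sum>(p, q)\<in>{(p, q). I p q \<noteq> {0}}. c p q) = v)"

definition bigrading_sum ::
    "(int \<Rightarrow> int \<Rightarrow> (complex ^ 'n::finite) set) \<Rightarrow> (int \<times> int) set \<Rightarrow> (complex ^ 'n) set" where
  "bigrading_sum I S = vec.span (\<Union>(a, b)\<in>S. I a b)"

definition is_deligne_bigrading ::
    "'n::finite weight \<Rightarrow> 'n filt \<Rightarrow> (int \<Rightarrow> int \<Rightarrow> (complex ^ 'n) set) \<Rightarrow> bool" where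
  "is_deligne_bigrading W F I \<longleftrightarrow> bigrading I \<and>
     (\<forall>p. F p = bigrading_sum I {(a, b). a \<ge> p}) \<and>
     (\<forall>k. W_C W k = bigrading_sum I {(a, b). a + b \<le> k}) \<and>
     (\<forall>p q. subspace_sum (cnj_vec ` I p q) (bigrading_sum I {(a, b). a < q \<and> b < p}) =
            subspace_sum (I q p) (bigrading_sum I {(a, b). a < q \<and> b < p}))"

definition deligne :: "'n::finite weight \<Rightarrow> 'n filt \<Rightarrow> int \<Rightarrow> int \<Rightarrow> (complex ^ 'n) set" where
  "deligne W F = (THE I. is_deligne_bigrading W F I)"

definition deligne_component ::
    "'n::finite weight \<Rightarrow> 'n filt \<Rightarrow> complex ^ 'n \<Rightarrow> int \<Rightarrow> int \<Rightarrow> complex ^ 'n" where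
  "deligne_component W F v = (THE c. (\<forall>p q. c p q \<in> deligne W F p q) \<and>
     (\<Sum>(p, q)\<in>{(p, q). deligne W F p q \<noteq> {0}}. c p q) = v)"

definition mh_metric ::
    "'n::finite weight \<Rightarrow> 'n forms \<Rightarrow> 'n filt \<Rightarrow> complex ^ 'n \<Rightarrow> complex ^ 'n \<Rightarrow> complex" where
  "mh_metric W Q F u v = (\<Sum>(p, q)\<in>{(p, q). deligne W F p q \<noteq> {0}}.
     \<i> powi (p - q) * Q_C Q (p + q) (deligne_component W F u p q)
                                   (cnj_vec (deligne_component W F v p q)))"

definition mh_adjoint ::
    "'n::finite weight \<Rightarrow> 'n forms \<Rightarrow> 'n filt \<Rightarrow> complex ^ 'n ^ 'n \<Rightarrow> complex ^ 'n ^ 'n" where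
  "mh_adjoint W Q F X =
     (THE Y. \<forall>u v. mh_metric W Q F (X *v u) v = mh_metric W Q F u (Y *v v))"

definition mh_metric_End ::
    "'n::finite weight \<Rightarrow> 'n forms \<Rightarrow> 'n filt \<Rightarrow> complex ^ 'n ^ 'n \<Rightarrow> complex ^ 'n ^ 'n \<Rightarrow> complex" where
  "mh_metric_End W Q F X Y = trace (X ** mh_adjoint W Q F Y)"

definition orth_proj ::
    "'n::finite weight \<Rightarrow> 'n forms \<Rightarrow> 'n filt \<Rightarrow> (complex ^ 'n ^ 'n) set
      \<Rightarrow> complex ^ 'n ^ 'n \<Rightarrow> complex ^ 'n ^ 'n" where
  "orth_proj W Q F S X =
     (THE Y. Y \<in> S \<and> (\<forall>Z\<in>S. mh_metric_End W Q F (X - Y) Z = 0))"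


section \<open>The group and its Lie algebra\<close>

definition G_C :: "'n::finite weight \<Rightarrow> 'n forms \<Rightarrow> (complex ^ 'n ^ 'n) set" where
  "G_C W Q = {g. invertible g \<and> (\<forall>k. (*v) g ` W_C W k = W_C W k) \<and>
     (\<forall>k. \<forall>u\<in>W_C W k. \<forall>v\<in>W_C W k. Q_C Q k (g *v u) (g *v v) = Q_C Q k u v)}"

definition filt_act :: "complex ^ 'n ^ 'n \<Rightarrow> 'n::finite filt \<Rightarrow> 'n filt" where
  "filt_act g F = (\<lambda>p. (*v) g ` F p)"

definition isotropy :: "'n::finite weight \<Rightarrow> 'n forms \<Rightarrow> 'n filt \<Rightarrow> (complex ^ 'n ^ 'n) set" where
  "isotropy W Q F = {g \<in> G_C W Q. filt_act g F = F}"

text \<open>The Lie algebra of a closed matrix group, as the tangent space at the identity.\<close>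

definition lie_algebra :: "(complex ^ 'n ^ 'n) set \<Rightarrow> (complex ^ 'n::finite ^ 'n) set" where
  "lie_algebra G = {X. \<exists>\<gamma>::real \<Rightarrow> complex ^ 'n ^ 'n.
     \<gamma> 0 = mat 1 \<and> (\<forall>t. \<gamma> t \<in> G) \<and> (\<gamma> has_vector_derivative X) (at 0)}"

definition g_C :: "'n::finite weight \<Rightarrow> 'n forms \<Rightarrow> (complex ^ 'n ^ 'n) set" where
  "g_C W Q = lie_algebra (G_C W Q)"

definition g_comp ::
    "'n::finite weight \<Rightarrow> 'n forms \<Rightarrow> 'n filt \<Rightarrow> int \<Rightarrow> int \<Rightarrow> (complex ^ 'n ^ 'n) set" where
  "g_comp W Q F r s = {X \<in> g_C W Q.
     \<forall>p q. \<forall>v\<in>deligne W F p q. X *v v \<in> deligne W F (p + r) (q + s)}"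

text \<open>
  Each \<open>g_comp W Q F r s\<close> is a complex subspace, so the real span of the union is the sum of complex
  subspaces.
\<close>

definition g_sum ::
    "'n::finite weight \<Rightarrow> 'n forms \<Rightarrow> 'n filt \<Rightarrow> (int \<times> int) set \<Rightarrow> (complex ^ 'n ^ 'n) set" where
  "g_sum W Q F S = span (\<Union>(r, s)\<in>S. g_comp W Q F r s)"

definition q_alg :: "'n::finite weight \<Rightarrow> 'n forms \<Rightarrow> 'n filt \<Rightarrow> (complex ^ 'n ^ 'n) set" where
  "q_alg W Q F = g_sum W Q F {(r, s). r < 0}"

definition Lambda_alg :: "'n::finite weight \<Rightarrow> 'n forms \<Rightarrow> 'n filt \<Rightarrow> (complex ^ 'n ^ 'n) set" where
  "Lambda_alg W Q F = g_sum W Q F {(r, s). r < 0 \<and> s < 0}"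

definition n_plus :: "'n::finite weight \<Rightarrow> 'n forms \<Rightarrow> 'n filt \<Rightarrow> (complex ^ 'n ^ 'n) set" where
  "n_plus W Q F = g_sum W Q F {(a, b). a \<ge> 0 \<and> b < 0}"

definition n_minus :: "'n::finite weight \<Rightarrow> 'n forms \<Rightarrow> 'n filt \<Rightarrow> (complex ^ 'n ^ 'n) set" where
  "n_minus W Q F = g_sum W Q F {(a, b). a < 0 \<and> b \<ge> 0}"

definition plus_part ::
    "'n::finite weight \<Rightarrow> 'n forms \<Rightarrow> 'n filt \<Rightarrow> complex ^ 'n ^ 'n \<Rightarrow> complex ^ 'n ^ 'n" where
  "plus_part W Q F X = proj_along (n_plus W Q F)
     (subspace_sum (g_comp W Q F 0 0) (subspace_sum (n_minus W Q F) (Lambda_alg W Q F)))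
     (orth_proj W Q F (g_C W Q) X)"

definition zero_part ::
    "'n::finite weight \<Rightarrow> 'n forms \<Rightarrow> 'n filt \<Rightarrow> complex ^ 'n ^ 'n \<Rightarrow> complex ^ 'n ^ 'n" where
  "zero_part W Q F X = proj_along (g_comp W Q F 0 0)
     (subspace_sum (n_plus W Q F) (subspace_sum (n_minus W Q F) (Lambda_alg W Q F)))
     (orth_proj W Q F (g_C W Q) X)"

text \<open>\<open>q_op W Q F A\<close> is the operator written with a subscript \<open>\<qq>\<close>; it is used on \<open>q_alg W Q F\<close>.\<close>

definition q_op ::
    "'n::finite weight \<Rightarrow> 'n forms \<Rightarrow> 'n filt \<Rightarrow> (complex ^ 'n ^ 'n \<Rightarrow> complex ^ 'n ^ 'n)
      \<Rightarrow> complex ^ 'n ^ 'n \<Rightarrow> complex ^ 'n ^ 'n" where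
  "q_op W Q F A = (\<lambda>v. orth_proj W Q F (q_alg W Q F) (A v))"

definition ad :: "complex ^ 'n ^ 'n \<Rightarrow> complex ^ 'n ^ 'n \<Rightarrow> complex ^ 'n::finite ^ 'n" where
  "ad X Y = X ** Y - Y ** X"

definition op_comm :: "('a \<Rightarrow> 'a) \<Rightarrow> ('a \<Rightarrow> 'a) \<Rightarrow> 'a \<Rightarrow> 'a::minus" where
  "op_comm A B = (\<lambda>v. A (B v) - B (A v))"


section \<open>Complex structure and holomorphic tangent bundle of the classifying space\<close>

text \<open>
  If \<open>c t = \<gamma> t \<cdot> c 0\<close> with \<open>\<gamma>\<close> a curve in \<open>G_C\<close> through the identity with velocity \<open>X\<close>, then the
  velocity of \<open>c\<close> at \<open>0\<close> is the class of \<open>X\<close> modulo the isotropy algebra of \<open>c 0\<close>.  It is represented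
  by the unique element \<open>w\<close> of \<open>q_alg W Q (c 0)\<close> in this class, i.e. it is the velocity of
  \<open>t \<mapsto> exp (t w) \<cdot> c 0\<close>.
\<close>

definition curve_velocity ::
    "'n::finite weight \<Rightarrow> 'n forms \<Rightarrow> (real \<Rightarrow> 'n filt) \<Rightarrow> complex ^ 'n ^ 'n" where
  "curve_velocity W Q c = (THE w. \<exists>\<gamma> X.
     \<gamma> 0 = mat 1 \<and> (\<gamma> has_vector_derivative X) (at 0) \<and>
     (\<forall>\<^sub>F t in nhds 0. \<gamma> t \<in> G_C W Q \<and> c t = filt_act (\<gamma> t) (c 0)) \<and>
     w = proj_along (q_alg W Q (c 0)) (lie_algebra (isotropy W Q (c 0))) X)"

definition tangent_map ::
    "'n::finite weight \<Rightarrow> 'n forms \<Rightarrow> (complex ^ 'm \<Rightarrow> 'n filt) \<Rightarrow> complex ^ 'm \<Rightarrow> complex ^ 'm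
      \<Rightarrow> complex ^ 'n ^ 'n" where
  "tangent_map W Q \<phi> z a = curve_velocity W Q (\<lambda>t. \<phi> (z + t *\<^sub>R a))"

text \<open>
  Coordinates take values in a complex subspace \<open>E\<close> of \<open>complex ^ 'm\<close> rather than in \<open>complex ^ 'm\<close>
  only, because an index type is never empty and \<open>D\<close> may have dimension 0.  Here \<open>U\<close> is a relatively
  open subset of \<open>E\<close>, so derivatives within \<open>U\<close> are determined on \<open>E\<close>.
\<close>

definition holo_on ::
    "(complex ^ 'm::finite) set \<Rightarrow> (complex ^ 'm) set \<Rightarrow> (complex ^ 'm \<Rightarrow> complex) \<Rightarrow> bool" where
  "holo_on E U f \<longleftrightarrow> (\<forall>z\<in>U. \<exists>L. (f has_derivative L) (at z within U) \<and>
     (\<forall>a\<in>E. L (\<i> *s a) = \<i> * L a))"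

text \<open>
  A map into \<open>D\<close> is holomorphic if it locally lifts along \<open>g \<mapsto> g \<cdot> F\<close> to a holomorphic map into
  \<open>G_C\<close>; this is the complex structure of \<open>D\<close> as an open subset of the homogeneous space
  \<open>G_C \<cdot> F\<close>.  A chart is given by its inverse \<open>\<phi>\<close>, an injective holomorphic map with bijective tangent
  maps; by the inverse function theorem it is a biholomorphism onto an open subset of \<open>D\<close>.
\<close>

definition holomorphic_chart ::
    "'n::finite weight \<Rightarrow> 'n forms \<Rightarrow> (int \<Rightarrow> int \<Rightarrow> nat)
      \<Rightarrow> (complex ^ 'm::finite) set \<Rightarrow> (complex ^ 'm) set \<Rightarrow> (complex ^ 'm \<Rightarrow> 'n filt) \<Rightarrow> bool" where
  "holomorphic_chart W Q h E U \<phi> \<longleftrightarrow>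
     vec.subspace E \<and> openin (top_of_set E) U \<and>
     \<phi> ` U \<subseteq> classifying_space W Q h \<and> inj_on \<phi> U \<and>
     (\<forall>z\<in>U. \<exists>N g. openin (top_of_set E) N \<and> z \<in> N \<and> N \<subseteq> U \<and>
        (\<forall>i j. holo_on E N (\<lambda>y. g y $ i $ j)) \<and>
        (\<forall>y\<in>N. g y \<in> G_C W Q \<and> \<phi> y = filt_act (g y) (\<phi> z))) \<and>
     (\<forall>z\<in>U. bij_betw (tangent_map W Q \<phi> z) E (q_alg W Q (\<phi> z)))"

text \<open>
  A holomorphic frame of the tangent bundle over the chart, expressed in the coordinates: the frame
  of \<open>T(D)\<close> at \<open>\<phi> z\<close> consists of the vectors \<open>tangent_map W Q \<phi> z (\<epsilon> j z)\<close>, \<open>j < vec.dim E\<close>.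
\<close>

definition holomorphic_frame ::
    "(complex ^ 'm::finite) set \<Rightarrow> (complex ^ 'm) set \<Rightarrow> (nat \<Rightarrow> complex ^ 'm \<Rightarrow> complex ^ 'm)
      \<Rightarrow> bool" where
  "holomorphic_frame E U \<epsilon> \<longleftrightarrow>
     (\<forall>j<vec.dim E. \<forall>i. holo_on E U (\<lambda>z. \<epsilon> j z $ i)) \<and>
     (\<forall>z\<in>U. inj_on (\<lambda>j. \<epsilon> j z) {..<vec.dim E} \<and>
        vec.independent ((\<lambda>j. \<epsilon> j z) ` {..<vec.dim E}) \<and>
        vec.span ((\<lambda>j. \<epsilon> j z) ` {..<vec.dim E}) = E)"


section \<open>Chern connection and curvature\<close>

definition dir_deriv ::
    "(complex ^ 'm::finite \<Rightarrow> complex) \<Rightarrow> complex ^ 'm \<Rightarrow> complex ^ 'm \<Rightarrow> complex" where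
  "dir_deriv f z a = vector_derivative (\<lambda>t. f (z + t *\<^sub>R a)) (at 0)"

text \<open>The values of \<open>\<partial>f\<close> on \<open>a\<close> and of \<open>\<partial>\<close>-bar \<open>f\<close> on the conjugate of \<open>a\<close>, for \<open>a\<close> of type (1,0).\<close>

definition d_holo ::
    "(complex ^ 'm::finite \<Rightarrow> complex) \<Rightarrow> complex ^ 'm \<Rightarrow> complex ^ 'm \<Rightarrow> complex" where
  "d_holo f z a = (dir_deriv f z a - \<i> * dir_deriv f z (\<i> *s a)) / 2"

definition d_antiholo ::
    "(complex ^ 'm::finite \<Rightarrow> complex) \<Rightarrow> complex ^ 'm \<Rightarrow> complex ^ 'm \<Rightarrow> complex" where
  "d_antiholo f z a = (dir_deriv f z a + \<i> * dir_deriv f z (\<i> *s a)) / 2"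

text \<open>Square matrices of size \<open>d\<close> are functions of two indices below \<open>d\<close>.\<close>

definition mat_inverse :: "nat \<Rightarrow> (nat \<Rightarrow> nat \<Rightarrow> complex) \<Rightarrow> nat \<Rightarrow> nat \<Rightarrow> complex" where
  "mat_inverse d H = (THE K.
     (\<forall>i j. \<not> (i < d \<and> j < d) \<longrightarrow> K i j = 0) \<and>
     (\<forall>i<d. \<forall>j<d. (\<Sum>k<d. H i k * K k j) = (if i = j then 1 else 0) \<and>
                  (\<Sum>k<d. K i k * H k j) = (if i = j then 1 else 0)))"

definition connection_form ::
    "nat \<Rightarrow> (complex ^ 'm::finite \<Rightarrow> nat \<Rightarrow> nat \<Rightarrow> complex) \<Rightarrow> complex ^ 'm \<Rightarrow> complex ^ 'm
      \<Rightarrow> nat \<Rightarrow> nat \<Rightarrow> complex" where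
  "connection_form d H z a i j =
     (\<Sum>k<d. mat_inverse d (H z) i k * d_holo (\<lambda>y. H y k j) z a)"

text \<open>
  For a (1,0)-form \<open>\<theta>\<close> one has \<open>(\<partial>\<close>-bar \<open>\<theta>)(a, b\<close>-bar\<open>)\<close> \<open>= - \<partial>\<close>-bar\<open>\<^sub>b (\<theta>(a))\<close> for constant \<open>a\<close> and
  \<open>b\<close>; in rank one this gives the sign \<open>- \<partial>\<^sub>z \<partial>\<^sub>z\<close>-bar \<open>log h\<close>.
\<close>

definition curvature_matrix ::
    "nat \<Rightarrow> (complex ^ 'm::finite \<Rightarrow> nat \<Rightarrow> nat \<Rightarrow> complex) \<Rightarrow> complex ^ 'm
      \<Rightarrow> complex ^ 'm \<Rightarrow> complex ^ 'm \<Rightarrow> nat \<Rightarrow> nat \<Rightarrow> complex" where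
  "curvature_matrix d H z a b i j = - d_antiholo (\<lambda>y. connection_form d H y a i j) z b"

definition frame_vector ::
    "'n::finite weight \<Rightarrow> 'n forms \<Rightarrow> (complex ^ 'm::finite \<Rightarrow> 'n filt)
      \<Rightarrow> (nat \<Rightarrow> complex ^ 'm \<Rightarrow> complex ^ 'm) \<Rightarrow> complex ^ 'm \<Rightarrow> nat \<Rightarrow> complex ^ 'n ^ 'n" where
  "frame_vector W Q \<phi> \<epsilon> z j = tangent_map W Q \<phi> z (\<epsilon> j z)"

text \<open>The transposed Gram matrix of the mixed Hodge metric on \<open>T(D)\<close> in the frame.\<close>

definition gram_matrix ::
    "'n::finite weight \<Rightarrow> 'n forms \<Rightarrow> (complex ^ 'm::finite \<Rightarrow> 'n filt)
      \<Rightarrow> (nat \<Rightarrow> complex ^ 'm \<Rightarrow> complex ^ 'm) \<Rightarrow> complex ^ 'm \<Rightarrow> nat \<Rightarrow> nat \<Rightarrow> complex" where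
  "gram_matrix W Q \<phi> \<epsilon> z i j =
     mh_metric_End W Q (\<phi> z) (frame_vector W Q \<phi> \<epsilon> z j) (frame_vector W Q \<phi> \<epsilon> z i)"

definition frame_coords ::
    "'n::finite weight \<Rightarrow> 'n forms \<Rightarrow> (complex ^ 'm::finite) set \<Rightarrow> (complex ^ 'm \<Rightarrow> 'n filt)
      \<Rightarrow> (nat \<Rightarrow> complex ^ 'm \<Rightarrow> complex ^ 'm) \<Rightarrow> complex ^ 'm \<Rightarrow> complex ^ 'n ^ 'n \<Rightarrow> nat \<Rightarrow> complex"
  where
  "frame_coords W Q E \<phi> \<epsilon> z v = (THE c. (\<forall>j\<ge>vec.dim E. c j = 0) \<and>
     v = (\<Sum>j<vec.dim E. cscale (c j) (frame_vector W Q \<phi> \<epsilon> z j)))"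

text \<open>
  \<open>R(u, w\<close>-bar\<open>)\<close> at the point \<open>\<phi> z\<close> of the Chern connection of the mixed Hodge metric, as an
  endomorphism of \<open>q_alg W Q (\<phi> z)\<close>, calculated in the chart \<open>\<phi>\<close> and the frame \<open>\<epsilon>\<close>.
\<close>

definition chern_curvature ::
    "'n::finite weight \<Rightarrow> 'n forms \<Rightarrow> (complex ^ 'm::finite) set \<Rightarrow> (complex ^ 'm \<Rightarrow> 'n filt)
      \<Rightarrow> (nat \<Rightarrow> complex ^ 'm \<Rightarrow> complex ^ 'm) \<Rightarrow> complex ^ 'm
      \<Rightarrow> complex ^ 'n ^ 'n \<Rightarrow> complex ^ 'n ^ 'n \<Rightarrow> complex ^ 'n ^ 'n \<Rightarrow> complex ^ 'n ^ 'n" where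
  "chern_curvature W Q E \<phi> \<epsilon> z u w v =
     (let a = the_inv_into E (tangent_map W Q \<phi> z) u;
          b = the_inv_into E (tangent_map W Q \<phi> z) w;
          R = curvature_matrix (vec.dim E) (gram_matrix W Q \<phi> \<epsilon>) z a b;
          c = frame_coords W Q E \<phi> \<epsilon> z v
      in \<Sum>i<vec.dim E. cscale (\<Sum>j<vec.dim E. R i j * c j) (frame_vector W Q \<phi> \<epsilon> z i))"

end

theory Submission
  imports Defs "HOL-Complex_Analysis.Cauchy_Integral_Formula" "HOL-Real_Asymp.Real_Asymp"
begin

text \<open>
  Fix \<open>F\<close> and a complex line through it with direction \<open>u\<close>.  After composing with elements of the isotropy
  group, the lift \<open>G\<close> of the line to \<open>G_C\<close> is holomorphic with \<open>G 0 = 1\<close> and derivative \<open>u\<close>.  Near \<open>0\<close>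
  it factors as \<open>G = k l f\<close> with \<open>k\<close> real, \<open>l\<close> in the group of \<open>\<Lambda>\<close> and \<open>f\<close> in the isotropy group of
  \<open>F\<close>.  Both \<open>k\<close> and \<open>l\<close> carry the Deligne bigrading and the mixed Hodge metric of a point isometrically
  to those of the translated point, so the Gram matrix at \<open>G(s) F\<close> of a holomorphic frame \<open>S\<^sub>j\<close> of \<open>\<qq>\<close>
  is that of \<open>a\<^sub>j = (Ad f S\<^sub>j)\<^sub>\<qq>\<close> in the fixed metric \<open>h\<^sub>F\<close>.

  Let \<open>\<psi>\<close> and \<open>\<psi>'\<close> be the values of the form \<open>df f\<^sup>-\<^sup>1\<close> on \<open>\<partial>\<^sub>s\<close> and on \<open>\<partial>\<close>-bar\<open>\<^sub>s\<close>.  Since \<open>G\<close> is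
  holomorphic and \<open>k\<close> is real, comparing components in the factorization gives
  \<open>\<psi> + \<psi>'\<^sup>* = \<alpha>\<^sub>+ + \<alpha>\<^sub>0 - \<beta>\<^sup>*\<close> with \<open>\<alpha> = Ad f (G\<^sup>-\<^sup>1 G')\<close> and \<open>\<beta>\<close> the \<open>\<nn>\<^sub>+\<close>-part of
  \<open>Ad l\<^sup>-\<^sup>1\<close> applied to the conjugate of \<open>Ad l \<alpha>\<close>.  Hence the holomorphic derivatives of the Gram matrix are
  inner products with explicit vectors, which determines the connection matrix, and its antiholomorphic
  derivative at \<open>0\<close> needs only the first derivatives of \<open>l\<close> and \<open>f\<close> there.
\<close>

text \<open>The obstacle is that an element of \<open>G_C\<close> carries the Hodge filtration of a
  point to that of its translate, but in general not the Deligne bigrading, so the metric cannot be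
  pulled back along the holomorphic lift \<open>G\<close>. Real elements do carry the bigrading, and
  the group of \<Lambda> does because it moves vectors only by terms that the congruence defining
  the bigrading ignores. Real directions, \<Lambda> and the isotropy algebra together span the Lie
  algebra, hence the factorization; the price is that the factors are not holomorphic. A connection
  matrix containing derivatives of \<open>f\<close> would bring second derivatives of
  \<open>f\<close> into the curvature. The equation for \<psi> and the adjoint of \<psi>' replaces
  them by an expression algebraic in \<open>l\<close>, \<open>f\<close> and the holomorphic form of
  \<open>G\<close>; this is why first derivatives suffice. The curvature is evaluated on
  \<open>u\<close> and its own conjugate, so a single complex line through the point carries all the
  information. The bigrading enters the definitions by a definite description, so its existence and
  uniqueness come before everything else.\<close>

lemma re_vec_nth [simp]: "re_vec v $ i = Re (v $ i)"
  and im_vec_nth [simp]: "im_vec v $ i = Im (v $ i)"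
  and cnj_vec_nth [simp]: "cnj_vec v $ i = cnj (v $ i)"
  by (simp_all add: re_vec_def im_vec_def cnj_vec_def)

lemma cnj_vec_cnj_vec [simp]: "cnj_vec (cnj_vec v) = v"
  by (simp add: vec_eq_iff)

lemma cnj_vec_add [simp]: "cnj_vec (u + v) = cnj_vec u + cnj_vec v"
  and cnj_vec_diff [simp]: "cnj_vec (u - v) = cnj_vec u - cnj_vec v"
  and cnj_vec_minus [simp]: "cnj_vec (- v) = - cnj_vec v"
  and cnj_vec_0 [simp]: "cnj_vec 0 = 0"
  and cnj_vec_smult [simp]: "cnj_vec (c *s v) = cnj c *s cnj_vec v"
  by (simp_all add: vec_eq_iff)

lemma cnj_vec_sum: "cnj_vec (sum f A) = (\<Sum>x\<in>A. cnj_vec (f x))"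
  by (induction A rule: infinite_finite_induct) auto

lemma mem_cnj_vec_image: "v \<in> cnj_vec ` S \<longleftrightarrow> cnj_vec v \<in> S"
  by (metis cnj_vec_cnj_vec image_iff)

lemma subspace_cnj_vec_image:
  assumes "vec.subspace S" shows "vec.subspace (cnj_vec ` S)"
  using assms by (auto simp: vec.subspace_def mem_cnj_vec_image)

lemma re_im_vec_add [simp]: "re_vec (u + v) = re_vec u + re_vec v" "im_vec (u + v) = im_vec u + im_vec v"
  by (simp_all add: vec_eq_iff)

lemma re_im_vec_0 [simp]: "re_vec 0 = 0" "im_vec 0 = 0"
  by (simp_all add: vec_eq_iff)

lemma re_im_vec_smult:
  "re_vec (c *s v) = Re c *\<^sub>R re_vec v - Im c *\<^sub>R im_vec v"
  "im_vec (c *s v) = Re c *\<^sub>R im_vec v + Im c *\<^sub>R re_vec v"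
  by (simp_all add: vec_eq_iff)

lemma re_im_vec_cnj [simp]: "re_vec (cnj_vec v) = re_vec v" "im_vec (cnj_vec v) = - im_vec v"
  by (simp_all add: vec_eq_iff)

lemma subspace_W_C:
  assumes "subspace (W k)" shows "vec.subspace (W_C W k)"
  using assms
  by (auto simp: vec.subspace_def W_C_def re_im_vec_smult subspace_0 subspace_add
      intro!: subspace_add subspace_diff subspace_scale)

lemma cnj_vec_W_C:
  assumes "subspace (W k)" shows "cnj_vec v \<in> W_C W k \<longleftrightarrow> v \<in> W_C W k"
  using assms subspace_neg[of "W k"] by (auto simp: W_C_def) (metis minus_minus)

lemma subspace_subspace_sum:
  "vec.subspace S \<Longrightarrow> vec.subspace T \<Longrightarrow> vec.subspace (subspace_sum S T)"
  unfolding subspace_sum_def using vec.subspace_sums[of S T] by simp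

lemma subspace_sumI: "a \<in> A \<Longrightarrow> b \<in> B \<Longrightarrow> a + b \<in> subspace_sum A B"
  unfolding subspace_sum_def by blast

lemma subspace_sumE:
  assumes "x \<in> subspace_sum A B" obtains a b where "a \<in> A" "b \<in> B" "x = a + b"
  using assms unfolding subspace_sum_def by blast

section \<open>Opposed filtrations and the subspaces of the Deligne bigrading\<close>

locale mixed_hodge =
  fixes W :: "'n::finite weight" and F :: "'n filt"
  assumes weight: "weight_filtration W" and mhs: "mixed_hodge_structure W F"
begin

lemma W_sub [intro]: "subspace (W k)"
  using weight by (auto simp: weight_filtration_def)

lemma Wc_sub [intro, simp]: "vec.subspace (W_C W k)"
  by (rule subspace_W_C) auto

lemma Wc_mono: "k \<le> l \<Longrightarrow> W_C W k \<subseteq> W_C W l"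
  using weight by (fastforce simp: weight_filtration_def W_C_def)

lemma Wc_mono': "x \<in> W_C W k \<Longrightarrow> k \<le> l \<Longrightarrow> x \<in> W_C W l"
  using Wc_mono by blast

lemma Wc_cnj [simp]: "cnj_vec v \<in> W_C W k \<longleftrightarrow> v \<in> W_C W k"
  by (rule cnj_vec_W_C) auto

lemma Wc_zero: "\<exists>k0. \<forall>k\<le>k0. W_C W k = {0}"
proof -
  obtain k0 where k0: "W k0 = {0}"
    using weight by (auto simp: weight_filtration_def)
  have "W k = {0}" if "k \<le> k0" for k
  proof -
    have "W k \<subseteq> W k0" using that weight by (auto simp: weight_filtration_def)
    then show ?thesis using k0 subspace_0[OF W_sub[of k]] by blast
  qed
  then show ?thesis
    by (intro exI[of _ k0]) (auto simp: W_C_def vec_eq_iff complex_eq_iff)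
qed

lemma Wc_full: "\<exists>k0. \<forall>k\<ge>k0. W_C W k = UNIV"
proof -
  obtain k0 where k0: "W k0 = UNIV"
    using weight by (auto simp: weight_filtration_def)
  then have "W_C W k0 = UNIV" by (auto simp: W_C_def)
  then show ?thesis using Wc_mono by (intro exI[of _ k0]) auto
qed

lemma F_dec: "decreasing_filtration F"
  using mhs by (simp add: mixed_hodge_structure_def)

lemma F_sub [intro, simp]: "vec.subspace (F p)"
  using F_dec by (simp add: decreasing_filtration_def)

lemma F_mono: "x \<in> F q \<Longrightarrow> p \<le> q \<Longrightarrow> x \<in> F p"
  using F_dec by (auto simp: decreasing_filtration_def)

lemma F_zero: "\<exists>p0. \<forall>p\<ge>p0. F p = {0}"
proof -
  obtain p0 where "F p0 = {0}" using F_dec by (auto simp: decreasing_filtration_def)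
  then show ?thesis using F_mono vec.subspace_0[OF F_sub] by (intro exI[of _ p0]) blast
qed

lemma F_full: "\<exists>p0. \<forall>p\<le>p0. F p = UNIV"
proof -
  obtain p0 where "F p0 = UNIV" using F_dec by (auto simp: decreasing_filtration_def)
  then show ?thesis using F_mono by (intro exI[of _ p0]) blast
qed

lemma Fb_sub [intro, simp]: "vec.subspace (cnj_vec ` F p)"
  by (rule subspace_cnj_vec_image) auto

lemma Fb_mono: "x \<in> cnj_vec ` F q \<Longrightarrow> p \<le> q \<Longrightarrow> x \<in> cnj_vec ` F p"
  using F_mono by (auto simp: mem_cnj_vec_image)

lemma FW_sub [intro, simp]: "vec.subspace (subspace_sum (F p) (W_C W k))"
  by (intro subspace_subspace_sum) auto

lemma FbW_sub [intro, simp]: "vec.subspace (subspace_sum (cnj_vec ` F p) (W_C W k))"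
  by (intro subspace_subspace_sum) auto

text \<open>The modular law: \<open>W_C W (k - 1)\<close> lies in \<open>W_C W k\<close>, so
  intersecting with \<open>W_C W k\<close> commutes with adding \<open>W_C W (k - 1)\<close>. In
  this form the two conditions can be checked separately.\<close>

lemma F_gr_iff: "x \<in> F_gr W F k p \<longleftrightarrow> x \<in> W_C W k \<and> x \<in> subspace_sum (F p) (W_C W (k - 1))"
proof
  assume "x \<in> F_gr W F k p"
  then obtain a b where "a \<in> F p" "a \<in> W_C W k" "b \<in> W_C W (k - 1)" "x = a + b"
    by (auto simp: F_gr_def elim!: subspace_sumE)
  then show "x \<in> W_C W k \<and> x \<in> subspace_sum (F p) (W_C W (k - 1))"
    using Wc_mono'[of b "k-1" k] by (auto intro!: subspace_sumI vec.subspace_add)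
next
  assume x: "x \<in> W_C W k \<and> x \<in> subspace_sum (F p) (W_C W (k - 1))"
  then obtain a b where ab: "a \<in> F p" "b \<in> W_C W (k - 1)" "x = a + b"
    by (auto elim!: subspace_sumE)
  have "x - b \<in> W_C W k"
    using x ab Wc_mono'[of b "k-1" k] by (intro vec.subspace_diff) auto
  then show "x \<in> F_gr W F k p"
    using ab by (auto simp: F_gr_def intro!: subspace_sumI)
qed

lemma cnj_F_gr_iff:
  "x \<in> cnj_vec ` F_gr W F k p \<longleftrightarrow> x \<in> W_C W k \<and> x \<in> subspace_sum (cnj_vec ` F p) (W_C W (k - 1))"
proof -
  have "cnj_vec x \<in> subspace_sum (F p) (W_C W (k - 1)) \<longleftrightarrow> x \<in> subspace_sum (cnj_vec ` F p) (W_C W (k - 1))"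
  proof
    assume "cnj_vec x \<in> subspace_sum (F p) (W_C W (k - 1))"
    then obtain a b where "a \<in> F p" "b \<in> W_C W (k - 1)" "cnj_vec x = a + b"
      by (auto elim!: subspace_sumE)
    then have "x = cnj_vec a + cnj_vec b" by (metis cnj_vec_add cnj_vec_cnj_vec)
    with \<open>a \<in> F p\<close> \<open>b \<in> _\<close> show "x \<in> subspace_sum (cnj_vec ` F p) (W_C W (k - 1))"
      by (auto intro!: subspace_sumI)
  next
    assume "x \<in> subspace_sum (cnj_vec ` F p) (W_C W (k - 1))"
    then show "cnj_vec x \<in> subspace_sum (F p) (W_C W (k - 1))"
      by (auto elim!: subspace_sumE intro!: subspace_sumI)
  qed
  then show ?thesis by (simp add: mem_cnj_vec_image F_gr_iff)
qed

text \<open>The indices \<open>a + 1\<close> and \<open>m - a\<close> add up to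
  \<open>m + 1\<close>, so the two filtrations meet only in 0 on the graded piece of weight
  \<open>m\<close>. The vanishing arguments for the bigrading descend one weight at a time with
  this.\<close>

lemma opposed:
  assumes "x \<in> W_C W m" "x \<in> subspace_sum (F (a + 1)) (W_C W (m - 1))"
    "x \<in> subspace_sum (cnj_vec ` F (m - a)) (W_C W (m - 1))"
  shows "x \<in> W_C W (m - 1)"
proof -
  have "x \<in> F_gr W F m (a + 1) \<inter> cnj_vec ` F_gr W F m (m - (a + 1) + 1)"
    using assms by (auto simp: F_gr_iff cnj_F_gr_iff)
  then show ?thesis using mhs unfolding mixed_hodge_structure_def by blast
qed

text \<open>The spanning half of opposedness, with classes of the graded piece replaced by
  representatives inside \<open>F p\<close> and inside the conjugate filtration; this costs the
  remainder \<open>w\<close>.\<close>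

lemma opposed_decomp:
  assumes "x \<in> W_C W m"
  obtains a b w where "a \<in> F p" "a \<in> W_C W m" "b \<in> cnj_vec ` F (m - p + 1)" "b \<in> W_C W m"
    "w \<in> W_C W (m - 1)" "x = a + b + w"
proof -
  have "x \<in> subspace_sum (F_gr W F m p) (cnj_vec ` F_gr W F m (m - p + 1))"
    using assms mhs unfolding mixed_hodge_structure_def by blast
  then obtain y c where y: "y \<in> F_gr W F m p" and c: "cnj_vec c \<in> F_gr W F m (m - p + 1)" and x: "x = y + c"
    by (elim subspace_sumE) (auto simp: mem_cnj_vec_image)
  obtain y1 y2 where y12: "y1 \<in> F p" "y1 \<in> W_C W m" "y2 \<in> W_C W (m - 1)" "y = y1 + y2"
    using y by (auto simp: F_gr_def elim!: subspace_sumE)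
  obtain c1 c2 where c12: "c1 \<in> F (m - p + 1)" "c1 \<in> W_C W m" "c2 \<in> W_C W (m - 1)" "cnj_vec c = c1 + c2"
    using c by (auto simp: F_gr_def elim!: subspace_sumE)
  have "c = cnj_vec c1 + cnj_vec c2" using c12 by (metis cnj_vec_add cnj_vec_cnj_vec)
  then have "x = y1 + cnj_vec c1 + (y2 + cnj_vec c2)" by (simp add: x y12)
  then show ?thesis
    using that[of y1 "cnj_vec c1" "y2 + cnj_vec c2"] y12 c12 vec.subspace_add[OF Wc_sub] by auto
qed

text \<open>Deligne's formula for \<open>I\<^sup>p\<^sup>,\<^sup>q\<close>, written with a family of congruences instead of a sum of subspaces.\<close>

definition dg :: "int \<Rightarrow> int \<Rightarrow> (complex ^ 'n) set" where
  "dg p q = {u \<in> F p \<inter> W_C W (p + q).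
     \<forall>j\<ge>0. u \<in> subspace_sum (cnj_vec ` F (q - j)) (W_C W (p + q - 2 - j))}"

lemma dg_sub [intro, simp]: "vec.subspace (dg p q)"
  unfolding vec.subspace_def dg_def
  by (auto intro!: vec.subspace_0 vec.subspace_add[OF FbW_sub] vec.subspace_scale[OF FbW_sub]
      vec.subspace_add[OF F_sub] vec.subspace_scale[OF F_sub] vec.subspace_add[OF Wc_sub] vec.subspace_scale[OF Wc_sub])

lemma dg_F: "u \<in> dg p q \<Longrightarrow> u \<in> F p" and dg_W: "u \<in> dg p q \<Longrightarrow> u \<in> W_C W (p + q)"
  and dg_Fb: "u \<in> dg p q \<Longrightarrow> 0 \<le> j \<Longrightarrow> u \<in> subspace_sum (cnj_vec ` F (q - j)) (W_C W (p + q - 2 - j))"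
  by (auto simp: dg_def)

lemma FbW_mono:
  "x \<in> subspace_sum (cnj_vec ` F q) (W_C W k) \<Longrightarrow> q' \<le> q \<Longrightarrow> k \<le> k' \<Longrightarrow>
   x \<in> subspace_sum (cnj_vec ` F q') (W_C W k')"
  by (elim subspace_sumE) (simp, intro subspace_sumI Fb_mono[of _ q q'] Wc_mono'[of _ k k'])

lemma FW_left: "x \<in> F q \<Longrightarrow> x \<in> subspace_sum (F q) (W_C W k)"
  using subspace_sumI[of x "F q" 0 "W_C W k"] by (simp add: vec.subspace_0)
lemma FW_right: "x \<in> W_C W k \<Longrightarrow> x \<in> subspace_sum (F q) (W_C W k)"
  using subspace_sumI[of 0 "F q" x "W_C W k"] by (simp add: vec.subspace_0)
lemma FbW_left: "x \<in> cnj_vec ` F q \<Longrightarrow> x \<in> subspace_sum (cnj_vec ` F q) (W_C W k)"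
  using subspace_sumI[of x "cnj_vec ` F q" 0 "W_C W k"] by (simp add: vec.subspace_0)
lemma FbW_right: "x \<in> W_C W k \<Longrightarrow> x \<in> subspace_sum (cnj_vec ` F q) (W_C W k)"
  using subspace_sumI[of 0 "cnj_vec ` F q" x "W_C W k"] by (simp add: vec.subspace_0)

lemma W_descent:
  assumes "x \<in> W_C W k" and "\<And>m. m \<le> k \<Longrightarrow> x \<in> W_C W m \<Longrightarrow> x \<in> W_C W (m - 1)"
  shows "x = 0"
proof -
  obtain k0 where k0: "\<forall>k\<le>k0. W_C W k = {0}" using Wc_zero by blast
  have "x \<in> W_C W (k - int n)" for n
  proof (induction n)
    case (Suc n) then show ?case using assms(2)[of "k - int n"] by (simp add: algebra_simps)
  qed (use assms in simp)
  from this[of "nat (k - k0)"] show ?thesis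
    using k0 by (cases "k \<le> k0") (use assms(1) in auto)
qed

text \<open>The congruence with index \<open>j = p + q - 1 - m\<close> serves the weight
  \<open>m\<close>: it puts \<open>u\<close> into the conjugate of \<open>F (m - p + 1)\<close>
  modulo \<open>W_C W (m - 1)\<close>, while \<open>u\<close> is in \<open>F p\<close>. Opposedness
  then lowers the weight until nothing is left.\<close>

lemma dg_W_inter:
  assumes u: "u \<in> dg p q" "u \<in> W_C W (p + q - 1)" shows "u = 0"
proof (rule W_descent[OF u(2)])
  fix m assume m: "m \<le> p + q - 1" "u \<in> W_C W m"
  have "u \<in> subspace_sum (cnj_vec ` F (m - (p - 1))) (W_C W (m - 1))"
    using dg_Fb[OF u(1), of "p + q - 1 - m"] m by (simp add: algebra_simps)
  with m show "u \<in> W_C W (m - 1)"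
    using dg_F[OF u(1)] by (intro opposed[of u m "p - 1"]) (auto intro: FW_left)
qed

text \<open>Successive correction: \<open>a\<close> stays in \<open>F p\<close>, \<open>y\<close>
  stays in the space \<open>Y\<close> cut out by the congruences, and the weight of
  \<open>a - y\<close> drops by one in each round. Opposedness splits the defect into a piece of
  \<open>F p\<close>, absorbed by \<open>a\<close>, a conjugate piece, absorbed by \<open>y\<close>,
  and a remainder of lower weight. When the weight is exhausted, \<open>a = y\<close> satisfies both
  kinds of condition.\<close>

lemma dg_lift:
  assumes x: "x \<in> F p" "x \<in> W_C W (p + q)" and xb: "x \<in> subspace_sum (cnj_vec ` F q) (W_C W (p + q - 1))"
  shows "\<exists>u\<in>dg p q. x - u \<in> W_C W (p + q - 1)"
proof -
  define Y where "Y = {y. \<forall>j\<ge>0. y \<in> subspace_sum (cnj_vec ` F (q - j)) (W_C W (p + q - 2 - j))}"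
  have Ysub: "vec.subspace Y"
    unfolding Y_def vec.subspace_def
    by (auto intro!: vec.subspace_0 vec.subspace_add[OF FbW_sub] vec.subspace_scale[OF FbW_sub])
  have YF: "y \<in> Y" if "y \<in> cnj_vec ` F q" for y
    unfolding Y_def using Fb_mono[OF that] by (auto intro!: FbW_left)
  \<comment> \<open>A correction made in round \<open>i\<close> meets the congruence
    \<open>j\<close> by its filtration index when \<open>i \<le> j\<close> and by its weight when
    \<open>j < i\<close>.\<close>
  have YFW: "y \<in> Y" if "y \<in> cnj_vec ` F (q - i)" "y \<in> W_C W (p + q - 1 - i)" "i \<ge> 0" for y i
    unfolding Y_def
  proof (intro CollectI allI impI)
    fix j :: int assume "j \<ge> 0"
    show "y \<in> subspace_sum (cnj_vec ` F (q - j)) (W_C W (p + q - 2 - j))"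
    proof (cases "i \<le> j")
      case True then show ?thesis by (intro FbW_left Fb_mono[OF that(1)]) auto
    next
      case False then show ?thesis by (intro FbW_right Wc_mono'[OF that(2)]) auto
    qed
  qed
  have step: "\<exists>a y. a \<in> F p \<and> a \<in> W_C W (p + q) \<and> x - a \<in> W_C W (p + q - 1) \<and> y \<in> Y \<and>
      a - y \<in> W_C W (p + q - 1 - int n)" for n
  proof (induction n)
    case 0
    obtain b w where bw: "b \<in> cnj_vec ` F q" "w \<in> W_C W (p + q - 1)" "x = b + w"
      using xb by (auto elim!: subspace_sumE)
    then show ?case using x YF by (intro exI[of _ x] exI[of _ b]) (auto simp: vec.subspace_0)
  next
    case (Suc n)
    then obtain a y where ay: "a \<in> F p" "a \<in> W_C W (p + q)" "x - a \<in> W_C W (p + q - 1)" "y \<in> Y"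
      "a - y \<in> W_C W (p + q - 1 - int n)" by blast
    obtain a' b w where *: "a' \<in> F p" "a' \<in> W_C W (p + q - 1 - int n)"
      "b \<in> cnj_vec ` F (p + q - 1 - int n - p + 1)" "b \<in> W_C W (p + q - 1 - int n)"
      "w \<in> W_C W (p + q - 1 - int n - 1)" "a - y = a' + b + w"
      using opposed_decomp[OF ay(5), of p] by blast
    have "b \<in> Y" using * by (intro YFW[of b "int n"]) auto
    moreover have a': "a' \<in> W_C W (p + q - 1)" by (rule Wc_mono'[OF *(2)]) simp
    moreover have "a' \<in> W_C W (p + q)" by (rule Wc_mono'[OF *(2)]) simp
    moreover have e1: "x - (a - a') = (x - a) + a'" by simp
    have e2: "(a - a') - (y + b) = w" using *(6) by (simp add: algebra_simps)
    have e3: "p + q - 1 - int (Suc n) = p + q - 1 - int n - 1" by simp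
    ultimately have "a - a' \<in> F p" "a - a' \<in> W_C W (p + q)" "x - (a - a') \<in> W_C W (p + q - 1)"
      "y + b \<in> Y" "(a - a') - (y + b) \<in> W_C W (p + q - 1 - int (Suc n))"
      using ay(1-4) *(1) *(5) Ysub unfolding e1 e2 e3
      by (blast intro: vec.subspace_diff[OF F_sub] vec.subspace_diff[OF Wc_sub] vec.subspace_add[OF Wc_sub]
          vec.subspace_add[OF Ysub])+
    then show ?case by blast
  qed
  obtain k0 where k0: "\<forall>k\<le>k0. W_C W k = {0}" using Wc_zero by blast
  obtain a y where ay: "a \<in> F p" "a \<in> W_C W (p + q)" "x - a \<in> W_C W (p + q - 1)" "y \<in> Y"
      "a - y \<in> W_C W (p + q - 1 - int (nat (p + q - 1 - k0)))"
    using step by blast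
  have "p + q - 1 - int (nat (p + q - 1 - k0)) \<le> k0" by simp
  then have "a = y" using ay(5) k0 by (metis eq_iff_diff_eq_0 singletonD)
  then have "a \<in> dg p q" using ay by (auto simp: dg_def Y_def)
  then show ?thesis using ay by blast
qed

text \<open>Among the components violating the conclusion, one of maximal weight \<open>m\<close>
  and, within that weight, of minimal first index \<open>a0\<close> is isolated: all other violating
  components and the whole sum \<open>y\<close> lie in \<open>F (a0 + 1)\<close> plus
  \<open>W_C W (m - 1)\<close>. Hence so does this component, and opposedness forces it to vanish.
  The lemma yields both the directness of the sum and the compatibility with \<open>F\<close> and
  \<open>W\<close>.\<close>

lemma dg_leading:
  assumes K: "finite K" and c: "\<And>a b. (a, b) \<in> K \<Longrightarrow> c (a, b) \<in> dg a b"
    and v: "(\<Sum>x\<in>K. c x) \<in> F p" "(\<Sum>x\<in>K. c x) \<in> W_C W k"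
    and ab: "(a, b) \<in> K" "c (a, b) \<noteq> 0"
  shows "p \<le> a \<and> a + b \<le> k"
proof (rule ccontr)
  define bad where "bad = {(a, b) \<in> K. c (a, b) \<noteq> 0 \<and> (a < p \<or> a + b > k)}"
  assume "\<not> (p \<le> a \<and> a + b \<le> k)"
  then have "(a, b) \<in> bad" using ab by (auto simp: bad_def)
  then have ne: "bad \<noteq> {}" by blast
  have fin: "finite bad" using K by (auto simp: bad_def intro: finite_subset)
  define m where "m = Max ((\<lambda>(a, b). a + b) ` bad)"
  have m_in: "m \<in> (\<lambda>(a, b). a + b) ` bad" unfolding m_def using ne fin by (intro Max_in) auto
  have m_max: "a + b \<le> m" if "(a, b) \<in> bad" for a b
    unfolding m_def using that fin by (intro Max_ge) force+
  define bm where "bm = {(a, b) \<in> bad. a + b = m}"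
  have bm_ne: "bm \<noteq> {}" using m_in by (auto simp: bm_def)
  have bm_fin: "finite bm" using fin by (auto simp: bm_def intro: finite_subset)
  define a0 where "a0 = Min (fst ` bm)"
  have "a0 \<in> fst ` bm" unfolding a0_def using bm_ne bm_fin by (intro Min_in) auto
  then obtain b0 where ab0: "(a0, b0) \<in> bm" by auto
  have a0_min: "a0 \<le> a" if "(a, b) \<in> bm" for a b
    unfolding a0_def using that bm_fin by (intro Min_le) force+
  have b0: "b0 = m - a0" and ab0': "(a0, b0) \<in> bad" using ab0 by (auto simp: bm_def)
  have ab0'': "(a0, b0) \<in> K" "c (a0, b0) \<noteq> 0" "a0 < p \<or> m > k"
    using ab0' b0 by (auto simp: bad_def)
  define y where "y = (\<Sum>x\<in>bad. c x)"
  have y_eq: "y = (\<Sum>x\<in>K. c x) - (\<Sum>x\<in>K - bad. c x)"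
    unfolding y_def using K by (subst sum_diff) (auto simp: bad_def)
  have good: "c x \<in> F p \<inter> W_C W k" if "x \<in> K - bad" for x
  proof (cases "c x = 0")
    case False
    obtain a b where x: "x = (a, b)" by force
    show ?thesis using that False c[of a b] dg_F[of "c (a,b)" a b] dg_W[of "c (a,b)" a b]
      by (auto simp: x bad_def intro: F_mono Wc_mono')
  qed (auto simp: vec.subspace_0)
  have yFW: "y \<in> F p" "y \<in> W_C W k"
    unfolding y_eq using v good by (auto intro!: vec.subspace_diff vec.subspace_sum)
  have rest: "c x \<in> subspace_sum (F (a0 + 1)) (W_C W (m - 1))" if x: "x \<in> bad - {(a0, b0)}" for x
  proof -
    obtain a b where xab: "x = (a, b)" by force
    have mem: "c (a, b) \<in> dg a b" using x c by (auto simp: xab bad_def)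
    show ?thesis
    proof (cases "a + b = m")
      case True
      then have "(a, b) \<in> bm" using x by (auto simp: bm_def xab)
      then have "a0 \<le> a" "a \<noteq> a0" using a0_min x True b0 xab by auto
      then show ?thesis using F_mono[OF dg_F[OF mem], of "a0 + 1"] xab by (auto intro: FW_left)
    next
      case False
      then have "a + b \<le> m - 1" using m_max[of a b] x xab by auto
      then show ?thesis using Wc_mono'[OF dg_W[OF mem], of "m - 1"] xab by (auto intro: FW_right)
    qed
  qed
  have c0: "c (a0, b0) = y - (\<Sum>x\<in>bad - {(a0, b0)}. c x)"
    unfolding y_def using fin ab0' by (subst sum.remove[of bad "(a0, b0)"]) auto
  have "y \<in> subspace_sum (F (a0 + 1)) (W_C W (m - 1))"
    using ab0''(3) F_mono[OF yFW(1), of "a0 + 1"] Wc_mono'[OF yFW(2), of "m - 1"]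
    by (auto intro: FW_left FW_right)
  then have "c (a0, b0) \<in> subspace_sum (F (a0 + 1)) (W_C W (m - 1))"
    unfolding c0 using rest by (auto intro!: vec.subspace_diff vec.subspace_sum)
  moreover have mem: "c (a0, b0) \<in> dg a0 b0" using c ab0'' by blast
  moreover have "c (a0, b0) \<in> subspace_sum (cnj_vec ` F (m - a0)) (W_C W (m - 1))"
    using dg_Fb[OF mem, of 0] b0 by (auto intro: FbW_mono)
  moreover have "c (a0, b0) \<in> W_C W m" using dg_W[OF mem] b0 by auto
  ultimately have "c (a0, b0) \<in> W_C W (m - 1)" by (intro opposed[of _ m a0]) auto
  then have "c (a0, b0) = 0" using dg_W_inter[OF mem] b0 by simp
  then show False using ab0'' by simp
qed

end

section \<open>Bigradings and the matrices of their projections\<close>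

lemma matrix_vector_mult_sum_right: "A *v (\<Sum>x\<in>S. f x) = (\<Sum>x\<in>S. A *v f x)"
  for A :: "complex ^ 'n::finite ^ 'm::finite"
  by (induction S rule: infinite_finite_induct) (auto simp: matrix_vector_right_distrib)

definition bg_supp :: "(int \<Rightarrow> int \<Rightarrow> (complex ^ 'n::finite) set) \<Rightarrow> (int \<times> int) set" where
  "bg_supp I = {(p, q). I p q \<noteq> {0}}"

text \<open>The description used in \<open>deligne_component\<close>, for an arbitrary bigrading, so
  that the two agree by unfolding once the bigrading is identified.\<close>

definition bg_comp :: "(int \<Rightarrow> int \<Rightarrow> (complex ^ 'n::finite) set) \<Rightarrow> complex ^ 'n \<Rightarrow> int \<Rightarrow> int \<Rightarrow> complex ^ 'n" where
  "bg_comp I v = (THE c. (\<forall>p q. c p q \<in> I p q) \<and> (\<Sum>(p, q)\<in>{(p, q). I p q \<noteq> {0}}. c p q) = v)"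

definition bg_proj :: "(int \<Rightarrow> int \<Rightarrow> (complex ^ 'n::finite) set) \<Rightarrow> int \<times> int \<Rightarrow> complex ^ 'n ^ 'n" where
  "bg_proj I x = matrix (\<lambda>v. bg_comp I v (fst x) (snd x))"

text \<open>Directness of the sum is not among the hypotheses: the lemma is applied to
  \<open>dg\<close> before that family is known to be a bigrading.\<close>

lemma bigrading_sum_decomp:
  assumes fin: "finite (bg_supp I)" and sub: "\<And>p q. vec.subspace (I p q)" and v: "v \<in> bigrading_sum I S"
  shows "\<exists>c. (\<forall>x. c x \<in> I (fst x) (snd x)) \<and> (\<forall>x. x \<notin> S \<longrightarrow> c x = 0) \<and> (\<Sum>x\<in>bg_supp I. c x) = v"
    (is "?P v")
proof -
  have "v \<in> vec.span (\<Union>(a, b)\<in>S. I a b)" using v by (simp add: bigrading_sum_def)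
  then show ?thesis
  proof (rule vec.span_induct)
    fix v assume "v \<in> (\<Union>(a, b)\<in>S. I a b)"
    then obtain a b where ab: "(a, b) \<in> S" "v \<in> I a b" by auto
    have "(\<Sum>x\<in>bg_supp I. if x = (a, b) then v else 0) = v"
      using fin ab by (auto simp: sum.delta bg_supp_def)
    then show "?P v" using ab sub
      by (intro exI[of _ "\<lambda>x. if x = (a, b) then v else 0"]) (auto simp: vec.subspace_0)
  next
    show "vec.subspace {v. ?P v}" 
    proof (rule vec.subspaceI, unfold mem_Collect_eq)
      show "?P 0" using sub by (intro exI[of _ "\<lambda>x. 0"]) (auto simp: vec.subspace_0)
    next
      fix v w assume "?P v" "?P w"
      then obtain c d where "\<forall>x. c x \<in> I (fst x) (snd x)" "\<forall>x. x \<notin> S \<longrightarrow> c x = 0" "(\<Sum>x\<in>bg_supp I. c x) = v"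
        "\<forall>x. d x \<in> I (fst x) (snd x)" "\<forall>x. x \<notin> S \<longrightarrow> d x = 0" "(\<Sum>x\<in>bg_supp I. d x) = w" by blast
      then show "?P (v + w)"
        using sub by (intro exI[of _ "\<lambda>x. c x + d x"]) (auto simp: sum.distrib vec.subspace_add)
    next
      fix r v assume "?P v"
      then obtain c where "\<forall>x. c x \<in> I (fst x) (snd x)" "\<forall>x. x \<notin> S \<longrightarrow> c x = 0" "(\<Sum>x\<in>bg_supp I. c x) = v"
        by blast
      then show "?P (r *s v)"
        using sub by (intro exI[of _ "\<lambda>x. r *s c x"]) (auto simp: vec.scale_sum_right vec.subspace_scale)
    qed
  qed
qed

locale bigraded =
  fixes I :: "int \<Rightarrow> int \<Rightarrow> (complex ^ 'n::finite) set"
  assumes bigr: "bigrading I"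
begin

abbreviation "K \<equiv> bg_supp I"
abbreviation "P \<equiv> bg_proj I"

lemma I_sub [intro, simp]: "vec.subspace (I p q)" and finK [intro, simp]: "finite K"
  using bigr by (auto simp: bigrading_def bg_supp_def)

lemma comp_ex1: "\<exists>!c. (\<forall>p q. c p q \<in> I p q) \<and> (\<Sum>(p, q)\<in>{(p, q). I p q \<noteq> {0}}. c p q) = v"
  using bigr by (auto simp: bigrading_def)

lemma comp_mem: "bg_comp I v p q \<in> I p q"
  and comp_sum: "(\<Sum>(p, q)\<in>K. bg_comp I v p q) = v"
  using theI'[OF comp_ex1[of v]] unfolding bg_comp_def bg_supp_def by blast+

lemma comp_unique:
  assumes "\<And>p q. c p q \<in> I p q" "(\<Sum>(p, q)\<in>K. c p q) = v" shows "bg_comp I v = c"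
  unfolding bg_comp_def using assms the1_equality[OF comp_ex1[of v], of c] by (auto simp: bg_supp_def)

lemma comp_add: "bg_comp I (v + w) = (\<lambda>p q. bg_comp I v p q + bg_comp I w p q)"
  by (rule comp_unique)
    (use comp_sum in \<open>auto simp: comp_mem vec.subspace_add sum.distrib case_prod_unfold\<close>)

lemma comp_scale: "bg_comp I (r *s v) = (\<lambda>p q. r *s bg_comp I v p q)"
  by (rule comp_unique)
    (use comp_sum[of v] in \<open>auto simp: comp_mem vec.subspace_scale vec.scale_sum_right[symmetric] case_prod_unfold\<close>)

lemma P_eq: "P x *v v = bg_comp I v (fst x) (snd x)"
  unfolding bg_proj_def
  by (rule matrix_works)
    (simp add: Vector_Spaces.linear_iff vec.vector_space_axioms comp_add comp_scale)

lemma P_mem [intro, simp]: "P (p, q) *v v \<in> I p q"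
  by (simp add: P_eq comp_mem)

lemma P_mem': "P x *v v \<in> I (fst x) (snd x)"
  by (simp add: P_eq comp_mem)

lemma P_sum: "(\<Sum>x\<in>K. P x *v v) = v"
  using comp_sum[of v] by (simp add: P_eq case_prod_unfold)

lemma K_notin: "(p, q) \<notin> K \<Longrightarrow> I p q = {0}"
  by (auto simp: bg_supp_def)

lemma P_on: "v \<in> I p q \<Longrightarrow> P x *v v = (if x = (p, q) then v else 0)"
proof -
  assume v: "v \<in> I p q"
  let ?f = "\<lambda>x. if x = (p, q) then v else 0"
  have "sum ?f K = v"
    using v K_notin[of p q] by (auto simp: sum.delta)
  moreover have "?f = (\<lambda>x. case x of (a, b) \<Rightarrow> if (a, b) = (p, q) then v else 0)" by auto
  ultimately have "(\<Sum>(a, b)\<in>K. if (a, b) = (p, q) then v else 0) = v" by metis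
  then have "bg_comp I v = (\<lambda>a b. if (a, b) = (p, q) then v else 0)"
    by (intro comp_unique) (use v in \<open>simp_all add: vec.subspace_0\<close>)
  then show ?thesis by (cases x) (simp add: P_eq)
qed

lemma P_mult: "P x ** P y = (if x = y then P x else 0)"
proof -
  obtain p q where y: "y = (p, q)" by force
  have "(P x ** P y) *v v = (if x = y then P x else 0) *v v" for v
    using P_on[OF P_mem[of p q v], of x] by (auto simp: y matrix_vector_mul_assoc[symmetric])
  then show ?thesis by (simp add: matrix_eq)
qed

lemma P_out: "x \<notin> K \<Longrightarrow> P x = 0"
  using K_notin[of "fst x" "snd x"] P_mem'[of x] by (simp add: matrix_eq)

lemma sum_matrix_vector: "(\<Sum>x\<in>A. f x) *v v = (\<Sum>x\<in>A. f x *v v)" for f :: "'b \<Rightarrow> complex ^ 'n ^ 'n"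
  by (induction A rule: infinite_finite_induct) (auto simp: matrix_vector_mult_add_rdistrib)

lemma P_sum_mat: "(\<Sum>x\<in>K. P x) = mat 1"
  by (simp add: matrix_eq sum_matrix_vector P_sum)

lemma mem_I_iff: "v \<in> I p q \<longleftrightarrow> P (p, q) *v v = v"
  by (metis P_mem P_on)

lemma bigrading_sum_sub [intro, simp]: "vec.subspace (bigrading_sum I S)"
  by (simp add: bigrading_sum_def)

lemma I_bigrading_sum: "(a, b) \<in> S \<Longrightarrow> v \<in> I a b \<Longrightarrow> v \<in> bigrading_sum I S"
  unfolding bigrading_sum_def by (auto intro!: vec.span_base)

lemma bigrading_sum_iff: "v \<in> bigrading_sum I S \<longleftrightarrow> (\<forall>x. x \<notin> S \<longrightarrow> P x *v v = 0)"
proof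
  assume "v \<in> bigrading_sum I S"
  then obtain c where c: "\<forall>x. c x \<in> I (fst x) (snd x)" "\<forall>x. x \<notin> S \<longrightarrow> c x = 0" "(\<Sum>x\<in>K. c x) = v"
    using bigrading_sum_decomp[of I v S] by auto
  have "bg_comp I v = (\<lambda>p q. c (p, q))"
    by (rule comp_unique) (use c in \<open>auto simp: case_prod_unfold\<close>)
  then show "\<forall>x. x \<notin> S \<longrightarrow> P x *v v = 0" using c by (simp add: P_eq)
next
  assume *: "\<forall>x. x \<notin> S \<longrightarrow> P x *v v = 0"
  have "P x *v v \<in> bigrading_sum I S" for x
    using *[rule_format, of x] I_bigrading_sum[of "fst x" "snd x" S, OF _ P_mem'[of x]]
    by (cases "x \<in> S") (simp_all add: vec.subspace_0)
  then have "(\<Sum>x\<in>K. P x *v v) \<in> bigrading_sum I S" by (intro vec.subspace_sum) auto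
  then show "v \<in> bigrading_sum I S" by (simp add: P_sum)
qed

lemma bigrading_sum_mono: "v \<in> bigrading_sum I S \<Longrightarrow> S \<subseteq> T \<Longrightarrow> v \<in> bigrading_sum I T"
  by (auto simp: bigrading_sum_iff)

text \<open>The map \<open>f\<close> is only additive, not complex linear, so that complex
  conjugation is admissible.\<close>

lemma bigrading_sum_induct:
  assumes v: "v \<in> bigrading_sum I S" and T: "vec.subspace T"
    and "\<And>a b w. (a, b) \<in> S \<Longrightarrow> w \<in> I a b \<Longrightarrow> f w \<in> T"
    and f: "\<And>x y. f (x + y) = f x + f y" "f 0 = 0"
  shows "f v \<in> T"
proof -
  have fs: "f (sum g A) = (\<Sum>x\<in>A. f (g x))" for A and g :: "int \<times> int \<Rightarrow> complex ^ 'n"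
    by (induction A rule: infinite_finite_induct) (auto simp: f)
  have "f (P x *v v) \<in> T" for x
    using v[unfolded bigrading_sum_iff, rule_format, of x] assms(3)[of "fst x" "snd x", OF _ P_mem'[of x]] f(2) T
    by (cases "x \<in> S") (simp_all add: vec.subspace_0)
  then have "f (\<Sum>x\<in>K. P x *v v) \<in> T" unfolding fs using T by (intro vec.subspace_sum) auto
  then show ?thesis by (simp add: P_sum)
qed

text \<open>By the inclusions, the \<open>J\<close>-components of a vector are also its
  \<open>I\<close>-components, and those are unique.\<close>

lemma bigrading_subset_eq:
  assumes J: "bigrading J" and sub: "\<And>p q. J p q \<subseteq> I p q" shows "J = I"
proof -
  interpret J: bigraded J by unfold_locales (rule J)
  have "v \<in> J p q" if v: "v \<in> I p q" for v p q
  proof -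
    have "P (p, q) *v v = P (p, q) *v (\<Sum>x\<in>J.K. J.P x *v v)" by (simp add: J.P_sum)
    also have "\<dots> = (\<Sum>x\<in>J.K. if (p, q) = x then J.P x *v v else 0)"
      unfolding matrix_vector_mult_sum_right
    proof (intro sum.cong refl)
      fix y
      have "J.P y *v v \<in> I (fst y) (snd y)" using J.P_mem'[of y v] sub by blast
      then show "P (p, q) *v (J.P y *v v) = (if (p, q) = y then J.P y *v v else 0)"
        using P_on[of "J.P y *v v" "fst y" "snd y" "(p, q)"] by (simp add: prod_eq_iff)
    qed
    also have "\<dots> = J.P (p, q) *v v"
      by (cases "(p, q) \<in> J.K") (auto simp: sum.delta J.P_out)
    finally show ?thesis using v by (metis J.P_mem mem_I_iff)
  qed
  with sub show ?thesis by (intro ext) blast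
qed

end

section \<open>The family \<open>dg\<close> is the Deligne bigrading, and the only one\<close>

context mixed_hodge begin

lemma dg_finite: "finite (bg_supp dg)"
proof -
  obtain p0 where p0: "\<forall>p\<ge>p0. F p = {0}" using F_zero by blast
  obtain k0 where k0: "\<forall>k\<le>k0. W_C W k = {0}" using Wc_zero by blast
  have "p < p0 \<and> q < p0 \<and> p + q > k0" if ne: "dg p q \<noteq> {0}" for p q
  proof -
    obtain u where u: "u \<in> dg p q" "u \<noteq> 0" 
    proof -
      have "\<exists>u\<in>dg p q. u \<noteq> 0" using ne vec.subspace_0[OF dg_sub, of p q] by (metis insertI1 singleton_iff subsetI subset_antisym)
      then show ?thesis using that by blast
    qed
    have "p < p0" using dg_F[OF u(1)] u(2) p0[rule_format, of p] by (cases "p < p0") auto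
    moreover have "p + q > k0" using dg_W[OF u(1)] u(2) k0[rule_format, of "p + q"] by (cases "p + q > k0") auto
    moreover have "q < p0"
    proof (rule ccontr)
      \<comment> \<open>With \<open>F q = {0}\<close> the congruence for \<open>j = 0\<close> alone
        puts \<open>u\<close> into weight \<open>p + q - 2\<close>, below its own weight.\<close>
      assume "\<not> q < p0"
      then have "F q = {0}" using p0 by auto
      then have "u \<in> W_C W (p + q - 2)" using dg_Fb[OF u(1), of 0] by (simp add: subspace_sum_def)
      then have "u \<in> W_C W (p + q - 1)" by (rule Wc_mono') simp
      then show False using dg_W_inter[OF u(1)] u(2) by blast
    qed
    ultimately show ?thesis by blast
  qed
  then have "x \<in> {k0 - p0..p0} \<times> {k0 - p0..p0}" if "x \<in> bg_supp dg" for x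
    using that unfolding bg_supp_def by (cases x) fastforce
  then have "bg_supp dg \<subseteq> {k0 - p0..p0} \<times> {k0 - p0..p0}" by blast
  then show ?thesis by (rule finite_subset) auto
qed

text \<open>Downward induction on the filtration index, starting where \<open>F\<close> vanishes.
  Splitting off a part in \<open>F (r + 1)\<close> leaves a vector of \<open>F r\<close> that is
  congruent to an element of the conjugate of \<open>F (k - r)\<close>, and such a vector lifts to
  \<open>dg r (k - r)\<close>.\<close>

lemma dg_gr_span:
  assumes "x \<in> F p" "x \<in> W_C W k"
  shows "x \<in> subspace_sum (bigrading_sum dg UNIV) (W_C W (k - 1))"
proof -
  let ?T = "subspace_sum (bigrading_sum dg UNIV) (W_C W (k - 1))"
  have Tsub: "vec.subspace ?T" by (intro subspace_subspace_sum) (auto simp: bigrading_sum_def)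
  have W_T: "w \<in> ?T" if "w \<in> W_C W (k - 1)" for w
    using subspace_sumI[of 0 "bigrading_sum dg UNIV" w] that by (simp add: bigrading_sum_def vec.span_zero)
  obtain p0 where p0: "\<forall>p\<ge>p0. F p = {0}" using F_zero by blast
  have *: "x \<in> ?T" if "x \<in> F (p0 - int n)" "x \<in> W_C W k" for n x
    using that
  proof (induction n arbitrary: x)
    case 0 then show ?case using p0 Tsub by (auto simp: vec.subspace_0)
  next
    case (Suc n)
    define r where "r = p0 - int n - 1"
    obtain a b w where abw: "a \<in> F (r + 1)" "a \<in> W_C W k" "b \<in> cnj_vec ` F (k - (r + 1) + 1)" "b \<in> W_C W k"
      "w \<in> W_C W (k - 1)" "x = a + b + w"
      using opposed_decomp[OF Suc.prems(2), of "r + 1"] by metis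
    define y where "y = x - a"
    have xr: "x \<in> F r" using Suc.prems(1) by (simp add: r_def algebra_simps)
    have y: "y \<in> F r" "y \<in> W_C W (r + (k - r))" "y = b + w"
      using vec.subspace_diff[OF F_sub xr F_mono[OF abw(1), of r]]
        vec.subspace_diff[OF Wc_sub Suc.prems(2) abw(2)] abw(6) by (simp_all add: y_def)
    have "y \<in> subspace_sum (cnj_vec ` F (k - r)) (W_C W (r + (k - r) - 1))"
      using abw(3,5) y(3) by (auto intro!: subspace_sumI)
    then obtain u where u: "u \<in> dg r (k - r)" "y - u \<in> W_C W (k - 1)" using dg_lift[OF y(1,2)] by auto
    have "a \<in> ?T" using Suc.IH[of a] abw by (simp add: r_def)
    moreover have "u + (y - u) \<in> ?T"
      using u by (intro subspace_sumI) (auto simp: bigrading_sum_def intro!: vec.span_base)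
    ultimately have "a + (u + (y - u)) \<in> ?T" using Tsub vec.subspace_add by blast
    then show ?case by (simp add: y_def)
  qed
  have "x \<in> F (p0 - int (nat (p0 - p)))" using F_mono[OF assms(1)] by simp
  then show ?thesis using * assms by blast
qed

lemma dg_span: "bigrading_sum dg UNIV = UNIV"
proof -
  obtain k0 where k0: "\<forall>k\<le>k0. W_C W k = {0}" using Wc_zero by blast
  obtain k1 where k1: "\<forall>k\<ge>k1. W_C W k = UNIV" using Wc_full by blast
  obtain p1 where p1: "\<forall>p\<le>p1. F p = UNIV" using F_full by blast
  have sub: "vec.subspace (bigrading_sum dg UNIV)" by (simp add: bigrading_sum_def)
  have "W_C W (k0 + int n) \<subseteq> bigrading_sum dg UNIV" for n
  proof (induction n)
    case 0 then show ?case using k0 sub by (simp add: vec.subspace_0)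
  next
    case (Suc n)
    show ?case
    proof
      fix x assume "x \<in> W_C W (k0 + int (Suc n))"
      then have "x \<in> subspace_sum (bigrading_sum dg UNIV) (W_C W (k0 + int (Suc n) - 1))"
        using p1 by (intro dg_gr_span[of _ p1]) auto
      then show "x \<in> bigrading_sum dg UNIV"
        using Suc.IH vec.subspace_add[OF sub] by (elim subspace_sumE) auto
    qed
  qed
  from this[of "nat (k1 - k0)"] show ?thesis using k1 k0
    by (cases "k0 \<le> k1") (auto dest!: spec[of _ k0])
qed

lemma dg_bigrading: "bigrading dg"
  unfolding bigrading_def
proof (intro conjI allI)
  show "finite {(p, q). dg p q \<noteq> {0}}" using dg_finite by (simp add: bg_supp_def)
  fix v
  obtain c where c: "\<forall>x. c x \<in> dg (fst x) (snd x)" "(\<Sum>x\<in>bg_supp dg. c x) = v"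
    using bigrading_sum_decomp[OF dg_finite, of v UNIV] dg_span by auto
  show "\<exists>!c. (\<forall>p q. c p q \<in> dg p q) \<and> (\<Sum>(p, q)\<in>{(p, q). dg p q \<noteq> {0}}. c p q) = v"
  proof (rule ex1I[of _ "\<lambda>p q. c (p, q)"])
    show "(\<forall>p q. c (p, q) \<in> dg p q) \<and> (\<Sum>(p, q)\<in>{(p, q). dg p q \<noteq> {0}}. c (p, q)) = v"
      using c by (auto simp: bg_supp_def case_prod_unfold)
  next
    fix d assume d: "(\<forall>p q. d p q \<in> dg p q) \<and> (\<Sum>(p, q)\<in>{(p, q). dg p q \<noteq> {0}}. d p q) = v"
    obtain p0 where p0: "\<forall>p\<ge>p0. F p = {0}" using F_zero by blast
    define e where "e = (\<lambda>x. d (fst x) (snd x) - c x)"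
    have e: "e (a, b) \<in> dg a b" for a b
      using c d by (auto simp: e_def intro!: vec.subspace_diff)
    have s0: "(\<Sum>x\<in>bg_supp dg. e x) = 0"
      using c d by (simp add: e_def sum_subtractf bg_supp_def case_prod_unfold)
    have "e (a, b) = 0" for a b
    proof (rule ccontr)
      assume ne: "e (a, b) \<noteq> 0"
      then have ab: "(a, b) \<in> bg_supp dg" using e[of a b] by (auto simp: bg_supp_def)
      \<comment> \<open>The zero sum lies in every \<open>F p\<close>, so the bound from
        \<open>dg_leading\<close> may be demanded with an index beyond \<open>a\<close>.\<close>
      have "max p0 (a + 1) \<le> a"
        using dg_leading[OF dg_finite, of e "max p0 (a + 1)" "a + b" a b] e s0 ab ne by (auto simp: vec.subspace_0)
      then show False by simp
    qed
    then show "d = (\<lambda>p q. c (p, q))" by (auto simp: e_def fun_eq_iff)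
  qed
qed auto

sublocale dg: bigraded dg
  by unfold_locales (rule dg_bigrading)

lemma dg_FW: assumes "v \<in> F p" "v \<in> W_C W k" "dg.P (a, b) *v v \<noteq> 0" shows "p \<le> a \<and> a + b \<le> k"
proof -
  have "(a, b) \<in> dg.K" using assms(3) dg.P_out by force
  then show ?thesis
    using assms dg_leading[OF dg_finite, of "\<lambda>x. dg.P x *v v" p k a b] by (auto simp: dg.P_sum)
qed

lemma F_bigrading_sum: "F p = bigrading_sum dg {(a, b). a \<ge> p}"
proof (intro set_eqI iffI)
  fix v assume v: "v \<in> F p"
  obtain k1 where k1: "\<forall>k\<ge>k1. W_C W k = UNIV" using Wc_full by blast
  show "v \<in> bigrading_sum dg {(a, b). a \<ge> p}"
    unfolding dg.bigrading_sum_iff using dg_FW[OF v, of k1] k1 by force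
next
  fix v assume "v \<in> bigrading_sum dg {(a, b). a \<ge> p}"
  then show "v \<in> F p" by (rule dg.bigrading_sum_induct[where f = "\<lambda>x. x"]) (auto dest: dg_F intro: F_mono)
qed

lemma W_bigrading_sum: "W_C W k = bigrading_sum dg {(a, b). a + b \<le> k}"
proof (intro set_eqI iffI)
  fix v assume v: "v \<in> W_C W k"
  obtain p1 where p1: "\<forall>p\<le>p1. F p = UNIV" using F_full by blast
  show "v \<in> bigrading_sum dg {(a, b). a + b \<le> k}"
    unfolding dg.bigrading_sum_iff using dg_FW[OF _ v, of p1] p1 by force
next
  fix v assume "v \<in> bigrading_sum dg {(a, b). a + b \<le> k}"
  then show "v \<in> W_C W k" by (rule dg.bigrading_sum_induct[where f = "\<lambda>x. x"]) (auto dest: dg_W intro: Wc_mono')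
qed

lemma mem_F_iff: "v \<in> F p \<longleftrightarrow> (\<forall>a b. a < p \<longrightarrow> dg.P (a, b) *v v = 0)"
  using dg.bigrading_sum_iff[of v "{(a, b). a \<ge> p}"] by (simp add: F_bigrading_sum[of p, symmetric] not_le)

lemma mem_W_iff: "v \<in> W_C W k \<longleftrightarrow> (\<forall>a b. a + b > k \<longrightarrow> dg.P (a, b) *v v = 0)"
  using dg.bigrading_sum_iff[of v "{(a, b). a + b \<le> k}"] by (simp add: W_bigrading_sum[of k, symmetric] not_le)

text \<open>From the conjugate \<open>v\<close> of \<open>u\<close> the expected leading term
  \<open>x\<close> and the expected error \<open>l\<close> are subtracted. The remainder
  \<open>r\<close> lies in \<open>F q\<close>, and it still satisfies the congruences with the
  conjugate filtration, since \<open>v\<close>, \<open>x\<close> and \<open>l\<close> all do;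
  opposedness then lowers its weight down to 0.\<close>

lemma dg_cnj:
  assumes u: "u \<in> dg p q"
  shows "cnj_vec u \<in> subspace_sum (dg q p) (bigrading_sum dg {(a, b). a < q \<and> b < p})"
proof -
  define k where "k = p + q"
  define S where "S = {(a, b). a < q \<and> b < p}"
  define v where "v = cnj_vec u"
  have vW: "v \<in> W_C W k" using dg_W[OF u] by (simp add: v_def k_def)
  have vFb: "v \<in> cnj_vec ` F p" using dg_F[OF u] by (simp add: v_def)
  have vF: "v \<in> subspace_sum (F (q - j)) (W_C W (k - 2 - j))" if "j \<ge> 0" for j
  proof -
    obtain a b where "a \<in> cnj_vec ` F (q - j)" "b \<in> W_C W (k - 2 - j)" "u = a + b"
      using dg_Fb[OF u \<open>j \<ge> 0\<close>] by (auto simp: k_def elim!: subspace_sumE)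
    then show ?thesis by (auto simp: v_def mem_cnj_vec_image intro!: subspace_sumI)
  qed
  \<comment> \<open>The conjugated congruence with \<open>j = q - a - 1\<close> writes
    \<open>v\<close> as a vector of \<open>F (a + 1)\<close>, invisible to the component
    \<open>(a, b)\<close>, plus a vector whose weight forces \<open>b < p\<close>.\<close>
  have low: "b < p" if "dg.P (a, b) *v v \<noteq> 0" "a < q" for a b
  proof -
    obtain x y where xy: "x \<in> F (a + 1)" "y \<in> W_C W (k - 2 - (q - a - 1))" "v = x + y"
      using vF[of "q - a - 1"] \<open>a < q\<close> by (auto elim!: subspace_sumE)
    have "dg.P (a, b) *v x = 0" using xy(1) unfolding mem_F_iff by simp
    then have "dg.P (a, b) *v y \<noteq> 0" using that by (simp add: xy matrix_vector_right_distrib)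
    then have "a + b \<le> k - 2 - (q - a - 1)" using xy(2) unfolding mem_W_iff by force
    then show ?thesis by (simp add: k_def)
  qed
  define x where "x = dg.P (q, p) *v v"
  define l where "l = (\<Sum>y\<in>dg.K \<inter> S. dg.P y *v v)"
  define r where "r = v - x - l"
  have x: "x \<in> dg q p" by (simp add: x_def)
  have l: "l \<in> bigrading_sum dg S"
    unfolding l_def by (intro vec.subspace_sum dg.I_bigrading_sum[OF _ dg.P_mem']) auto
  have Pl: "dg.P y *v l = (if y \<in> S then dg.P y *v v else 0)" for y
  proof -
    have "dg.P y *v l = (\<Sum>z\<in>dg.K \<inter> S. if y = z then dg.P y *v v else 0)"
      unfolding l_def matrix_vector_mult_sum_right
      by (intro sum.cong refl) (simp add: matrix_vector_mul_assoc dg.P_mult)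
    also have "\<dots> = (if y \<in> dg.K \<inter> S then dg.P y *v v else 0)" by (simp add: sum.delta)
    also have "\<dots> = (if y \<in> S then dg.P y *v v else 0)" using dg.P_out[of y] by auto
    finally show ?thesis .
  qed
  have Pr: "dg.P y *v r = (if y \<in> S \<or> y = (q, p) then 0 else dg.P y *v v)" for y
  proof -
    have "dg.P y *v x = (if y = (q, p) then dg.P y *v v else 0)"
      by (simp add: x_def matrix_vector_mul_assoc dg.P_mult)
    moreover have "(q, p) \<notin> S" by (simp add: S_def)
    ultimately show ?thesis by (auto simp: r_def matrix_vector_mult_diff_distrib Pl)
  qed
  have rF: "r \<in> F q"
  proof (rule mem_F_iff[THEN iffD2, rule_format])
    fix a b assume aq: "a < q"
    show "dg.P (a, b) *v r = 0"
    proof (cases "b < p")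
      case True then have "(a, b) \<in> S" using aq by (simp add: S_def)
      then show ?thesis by (simp only: Pr simp_thms if_True)
    next
      case False
      then have "dg.P (a, b) *v v = 0" using low aq by blast
      then show ?thesis by (simp only: Pr if_cancel)
    qed
  qed
  have rW: "r \<in> W_C W k"
  proof (rule mem_W_iff[THEN iffD2, rule_format])
    fix a b assume "k < a + b"
    then have "dg.P (a, b) *v v = 0" by (rule mem_W_iff[THEN iffD1, OF vW, rule_format])
    then show "dg.P (a, b) *v r = 0" by (simp only: Pr if_cancel)
  qed
  have l_Fb: "l \<in> subspace_sum (cnj_vec ` F (p - j)) (W_C W (k - 2 - j))" if j: "j \<ge> 0" for j
    using l
  proof (rule dg.bigrading_sum_induct[where f = "\<lambda>x. x"])
    fix a b w assume ab: "(a, b) \<in> S" and w: "w \<in> dg a b"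
    show "w \<in> subspace_sum (cnj_vec ` F (p - j)) (W_C W (k - 2 - j))"
    proof (cases "p - j \<le> b")
      case True
      then have "w \<in> subspace_sum (cnj_vec ` F (p - j)) (W_C W (a + (p - j) - 2))"
        using dg_Fb[OF w, of "b - (p - j)"] by (simp add: algebra_simps)
      then show ?thesis by (rule FbW_mono) (use ab in \<open>auto simp: S_def k_def\<close>)
    next
      case False
      then have "w \<in> W_C W (k - 2 - j)"
        by (intro Wc_mono'[OF dg_W[OF w]]) (use ab in \<open>auto simp: S_def k_def\<close>)
      then show ?thesis by (rule FbW_right)
    qed
  qed auto
  have r_Fb: "r \<in> subspace_sum (cnj_vec ` F (p - j)) (W_C W (k - 2 - j))" if j: "j \<ge> 0" for j
    unfolding r_def
  proof (intro vec.subspace_diff[OF FbW_sub])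
    show "v \<in> subspace_sum (cnj_vec ` F (p - j)) (W_C W (k - 2 - j))"
      by (rule FbW_left, rule Fb_mono[OF vFb]) (use j in simp)
    show "x \<in> subspace_sum (cnj_vec ` F (p - j)) (W_C W (k - 2 - j))"
      using dg_Fb[OF x j] by (simp add: k_def add.commute)
  qed (rule l_Fb[OF j])
  \<comment> \<open>A component of \<open>r\<close> has \<open>q \<le> a\<close> and
    \<open>a + b \<le> k\<close>, and its index is not \<open>(q, p)\<close>; thus either
    \<open>a > q\<close> or the weight is less than \<open>k\<close>.\<close>
  have "r \<in> subspace_sum (F (q + 1)) (W_C W (k - 1))"
  proof -
    have "(\<Sum>y\<in>dg.K. dg.P y *v r) = r" by (rule dg.P_sum)
    moreover have "dg.P y *v r \<in> subspace_sum (F (q + 1)) (W_C W (k - 1))" for y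
    proof (cases "dg.P y *v r = 0")
      case False
      obtain a b where y: "y = (a, b)" by force
      have *: "q \<le> a \<and> a + b \<le> k" "(a, b) \<noteq> (q, p)" using dg_FW[OF rF rW] False by (auto simp: y Pr split: if_splits)
      then consider "q + 1 \<le> a" | "a + b \<le> k - 1" unfolding k_def by (cases "a = q") force+
      then show ?thesis
      proof cases
        case 1 then show ?thesis unfolding y by (intro FW_left F_mono[OF dg_F[OF dg.P_mem]])
      next
        case 2 then show ?thesis unfolding y by (intro FW_right Wc_mono'[OF dg_W[OF dg.P_mem]])
      qed
    qed (auto simp: vec.subspace_0)
    ultimately show ?thesis
      using vec.subspace_sum[OF FW_sub, of dg.K "\<lambda>y. dg.P y *v r" "q + 1" "k - 1"] by simp
  qed
  then have rW1: "r \<in> W_C W (k - 1)"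
    using opposed[OF rW, of q] FbW_mono[OF r_Fb[of 0], of p "k - 1"] by (simp add: k_def)
  have "r = 0"
  proof (rule W_descent[OF rW1])
    fix m assume m: "m \<le> k - 1" "r \<in> W_C W m"
    show "r \<in> W_C W (m - 1)"
      using r_Fb[of "k - 1 - m"] m FW_left[OF rF, of "m - 1"]
      by (intro opposed[OF m(2), of "q - 1"]) (simp_all add: k_def algebra_simps)
  qed
  then have "v = x + l" by (simp add: r_def algebra_simps)
  then show ?thesis using x l by (auto simp: v_def S_def intro!: subspace_sumI)
qed

lemma bigrading_sum_cnj:
  assumes v: "v \<in> bigrading_sum dg {(a, b). a < p \<and> b < q}"
  shows "cnj_vec v \<in> bigrading_sum dg {(a, b). a < q \<and> b < p}"
proof (rule dg.bigrading_sum_induct[OF v, where f = cnj_vec])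
  fix a b w assume ab: "(a, b) \<in> {(a, b). a < p \<and> b < q}" and w: "w \<in> dg a b"
  obtain x y where "x \<in> dg b a" "y \<in> bigrading_sum dg {(a', b'). a' < b \<and> b' < a}" "cnj_vec w = x + y"
    using dg_cnj[OF w] by (auto elim!: subspace_sumE)
  moreover from this have "x \<in> bigrading_sum dg {(a, b). a < q \<and> b < p}"
    using ab by (intro dg.I_bigrading_sum[of b a]) auto
  moreover have "y \<in> bigrading_sum dg {(a, b). a < q \<and> b < p}"
    by (rule dg.bigrading_sum_mono[OF calculation(2)]) (use ab in auto)
  ultimately show "cnj_vec w \<in> bigrading_sum dg {(a, b). a < q \<and> b < p}"
    by (simp add: vec.subspace_add)
qed auto

lemma dg_deligne: "is_deligne_bigrading W F dg"
  unfolding is_deligne_bigrading_def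
proof (intro conjI allI)
  fix p q
  let ?L = "bigrading_sum dg {(a, b). a < q \<and> b < p}"
  show "subspace_sum (cnj_vec ` dg p q) ?L = subspace_sum (dg q p) ?L"
  proof (intro equalityI subsetI)
    fix x assume "x \<in> subspace_sum (cnj_vec ` dg p q) ?L"
    then obtain u l where ul: "u \<in> dg p q" "l \<in> ?L" "x = cnj_vec u + l" by (auto elim!: subspace_sumE)
    obtain y l' where "y \<in> dg q p" "l' \<in> ?L" "cnj_vec u = y + l'"
      using dg_cnj[OF ul(1)] by (auto elim!: subspace_sumE)
    then show "x \<in> subspace_sum (dg q p) ?L"
      using ul subspace_sumI[of y "dg q p" "l' + l" ?L] vec.subspace_add[of ?L l' l] by (simp add: add.assoc)
  next
    fix x assume "x \<in> subspace_sum (dg q p) ?L"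
    then obtain u l where ul: "u \<in> dg q p" "l \<in> ?L" "x = u + l" by (auto elim!: subspace_sumE)
    obtain y l' where yl: "y \<in> dg p q" "l' \<in> bigrading_sum dg {(a, b). a < p \<and> b < q}" "cnj_vec u = y + l'"
      using dg_cnj[OF ul(1)] by (auto elim!: subspace_sumE)
    have "u = cnj_vec y + cnj_vec l'" using yl(3) by (metis cnj_vec_add cnj_vec_cnj_vec)
    then show "x \<in> subspace_sum (cnj_vec ` dg p q) ?L"
      using ul yl bigrading_sum_cnj[OF yl(2)] subspace_sumI[of "cnj_vec y" "cnj_vec ` dg p q" "cnj_vec l' + l" ?L]
        vec.subspace_add[of ?L "cnj_vec l'" l] by (simp add: add.assoc)
  qed
qed (use dg_bigrading F_bigrading_sum W_bigrading_sum in auto)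

text \<open>The conjugation property of \<open>J\<close>, together with its description of
  \<open>F\<close> and \<open>W\<close>, implies Deligne's congruences for each
  \<open>J p q\<close>. This gives an inclusion in every bidegree, and inclusions between two
  bigradings are equalities.\<close>

lemma deligne_unique:
  assumes J: "is_deligne_bigrading W F J" shows "J = dg"
proof (rule dg.bigrading_subset_eq)
  show bJ: "bigrading J" using J by (simp add: is_deligne_bigrading_def)
  interpret J: bigraded J by unfold_locales (rule bJ)
  have JF: "F p = bigrading_sum J {(a, b). a \<ge> p}" and JW: "W_C W k = bigrading_sum J {(a, b). a + b \<le> k}" for p k
    using J by (auto simp: is_deligne_bigrading_def)
  fix p q
  show "J p q \<subseteq> dg p q"
  proof
    fix u assume u: "u \<in> J p q"
    let ?L = "bigrading_sum J {(a, b). a < q \<and> b < p}"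
    have "cnj_vec u \<in> subspace_sum (cnj_vec ` J p q) ?L"
      using u subspace_sumI[of "cnj_vec u" "cnj_vec ` J p q" 0 ?L] by (auto simp: vec.subspace_0)
    then have "cnj_vec u \<in> subspace_sum (J q p) ?L" using J by (auto simp: is_deligne_bigrading_def)
    then obtain x l where xl: "x \<in> J q p" "l \<in> ?L" "cnj_vec u = x + l" by (auto elim!: subspace_sumE)
    have "u \<in> subspace_sum (cnj_vec ` F (q - j)) (W_C W (p + q - 2 - j))" if j: "j \<ge> 0" for j
    proof -
      have "cnj_vec u \<in> subspace_sum (F (q - j)) (W_C W (p + q - 2 - j))"
        unfolding xl(3)
      proof (rule vec.subspace_add[OF FW_sub])
        show "x \<in> subspace_sum (F (q - j)) (W_C W (p + q - 2 - j))"
          using J.I_bigrading_sum[OF _ xl(1), of "{(a, b). q - j \<le> a}"] j by (intro FW_left) (auto simp: JF)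
        show "l \<in> subspace_sum (F (q - j)) (W_C W (p + q - 2 - j))"
          using xl(2)
        proof (rule J.bigrading_sum_induct[where f = "\<lambda>x. x"])
          fix a b w assume ab: "(a, b) \<in> {(a, b). a < q \<and> b < p}" and w: "w \<in> J a b"
          show "w \<in> subspace_sum (F (q - j)) (W_C W (p + q - 2 - j))"
          proof (cases "q - j \<le> a")
            case True then show ?thesis using w by (intro FW_left) (auto simp: JF intro: J.I_bigrading_sum)
          next
            case False then show ?thesis
              using ab J.I_bigrading_sum[OF _ w, of "{(a, b). a + b \<le> p + q - 2 - j}"]
              by (intro FW_right) (auto simp: JW)
          qed
        qed auto
      qed
      then obtain a b where "a \<in> F (q - j)" "b \<in> W_C W (p + q - 2 - j)" "cnj_vec u = a + b"
        by (auto elim!: subspace_sumE)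
      then have "u = cnj_vec a + cnj_vec b" by (metis cnj_vec_add cnj_vec_cnj_vec)
      then show ?thesis using \<open>a \<in> _\<close> \<open>b \<in> _\<close> by (auto intro!: subspace_sumI)
    qed
    moreover have "u \<in> F p" "u \<in> W_C W (p + q)" using u by (auto simp: JF JW intro: J.I_bigrading_sum)
    ultimately show "u \<in> dg p q" by (simp add: dg_def)
  qed
qed

end

section \<open>Matrices over the complex numbers\<close>

lemma matrix_inv:
  assumes "invertible A" shows "A ** matrix_inv A = mat 1" "matrix_inv A ** A = mat 1"
proof -
  have "\<exists>A'. A ** A' = mat 1 \<and> A' ** A = mat 1" using assms by (simp add: invertible_def)
  then have "A ** matrix_inv A = mat 1 \<and> matrix_inv A ** A = mat 1"
    unfolding matrix_inv_def by (rule someI_ex)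
  then show "A ** matrix_inv A = mat 1" "matrix_inv A ** A = mat 1" by auto
qed

lemma matrix_inv_unique:
  fixes A B :: "'a::field ^ 'n::finite ^ 'n"
  assumes "A ** B = mat 1" shows "matrix_inv A = B"
proof -
  have i: "invertible A" using assms by (meson invertible_right_inverse)
  have "matrix_inv A = matrix_inv A ** (A ** B)" by (simp add: assms)
  also have "\<dots> = B" by (simp add: matrix_mul_assoc matrix_inv[OF i])
  finally show ?thesis .
qed

lemma invertible_inv:
  fixes A :: "'a::field ^ 'n::finite ^ 'n"
  assumes "invertible A" shows "invertible (matrix_inv A)" "matrix_inv (matrix_inv A) = A"
  using matrix_inv[OF assms] by (auto simp: invertible_def intro: matrix_inv_unique)

lemma matrix_inv_cancel:
  fixes A :: "'a::field ^ 'n::finite ^ 'n"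
  assumes "invertible A"
  shows "A ** (matrix_inv A ** X) = X" "matrix_inv A ** (A ** X) = X"
    "X ** A ** matrix_inv A = X" "X ** matrix_inv A ** A = X"
    "A *v (matrix_inv A *v v) = v" "matrix_inv A *v (A *v v) = v"
  using matrix_inv[OF assms]
  by (simp_all add: matrix_mul_assoc matrix_vector_mul_assoc matrix_mul_assoc[symmetric, of X])

lemma matrix_inv_mult:
  fixes A B :: "'a::field ^ 'n::finite ^ 'n"
  assumes "invertible A" "invertible B"
  shows "matrix_inv (A ** B) = matrix_inv B ** matrix_inv A"
  by (rule matrix_inv_unique) (simp add: assms matrix_mul_assoc matrix_inv_cancel matrix_inv)

lemma matrix_add_rdistrib': "(A + B) ** C = A ** C + B ** (C :: 'a::semiring_1 ^ 'p::finite ^ 'n::finite)"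
  by (simp add: vec_eq_iff matrix_matrix_mult_def sum.distrib distrib_right)

lemma matrix_diff_distrib:
  fixes A B C :: "'a::ring_1 ^ 'n::finite ^ 'n"
  shows "(A - B) ** C = A ** C - B ** C" "C ** (A - B) = C ** A - C ** B"
  by (simp_all add: vec_eq_iff matrix_matrix_mult_def sum_subtractf algebra_simps)

lemma matrix_neg:
  fixes A B :: "'a::ring_1 ^ 'n::finite ^ 'n"
  shows "(- A) ** B = - (A ** B)" "A ** (- B) = - (A ** B)"
  by (simp_all add: vec_eq_iff matrix_matrix_mult_def sum_negf)

lemma matrix_zero [simp]:
  fixes A :: "'a::semiring_1 ^ 'n::finite ^ 'n"
  shows "0 ** A = 0" "A ** 0 = 0"
  by (simp_all add: vec_eq_iff matrix_matrix_mult_def)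

lemma matrix_sum:
  fixes f :: "'b \<Rightarrow> 'a::semiring_1 ^ 'n::finite ^ 'n"
  shows "(\<Sum>x\<in>S. f x) ** A = (\<Sum>x\<in>S. f x ** A)" "A ** (\<Sum>x\<in>S. f x) = (\<Sum>x\<in>S. A ** f x)"
  by (induction S rule: infinite_finite_induct) (auto simp: matrix_add_rdistrib' matrix_add_ldistrib)

lemma cscale_nth [simp]: "cscale c X $ i $ j = c * X $ i $ j"
  by (simp add: cscale_def)

lemma cscale_mult: "cscale c X ** Y = cscale c (X ** Y)" "X ** cscale c Y = cscale c (X ** Y)"
  by (simp_all add: vec_eq_iff matrix_matrix_mult_def sum_distrib_left mult_ac)

lemma cscale_simps [simp]:
  "cscale c 0 = 0" "cscale 0 X = 0" "cscale 1 X = X" "cscale c (cscale d X) = cscale (c * d) X"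
  by (simp_all add: vec_eq_iff mult_ac)

lemma cscale_distrib:
  "cscale c (X + Y) = cscale c X + cscale c Y" "cscale c (X - Y) = cscale c X - cscale c Y"
  "cscale (c + d) X = cscale c X + cscale d X" "cscale (c - d) X = cscale c X - cscale d X"
  "cscale c (- X) = - cscale c X" "cscale (- c) X = - cscale c X"
  by (simp_all add: vec_eq_iff algebra_simps)

lemma cscale_sum: "cscale c (\<Sum>x\<in>S. f x) = (\<Sum>x\<in>S. cscale c (f x))"
  by (induction S rule: infinite_finite_induct) (auto simp: cscale_distrib)

lemma cscale_of_real: "cscale (of_real r) X = r *\<^sub>R X"
  by (simp add: vec_eq_iff complex_eq_iff)

lemma cscale_vec: "cscale c X *v v = c *s (X *v v)" "X *v (c *s v) = c *s (X *v v)"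
  by (simp_all add: vec_eq_iff matrix_vector_mult_def sum_distrib_left mult_ac)

lemma cnj_mat_nth [simp]: "cnj_mat X $ i $ j = cnj (X $ i $ j)"
  by (simp add: cnj_mat_def)

lemma cnj_mat_simps [simp]:
  "cnj_mat (cnj_mat X) = X" "cnj_mat (X + Y) = cnj_mat X + cnj_mat Y"
  "cnj_mat (X - Y) = cnj_mat X - cnj_mat Y" "cnj_mat (- X) = - cnj_mat X" "cnj_mat 0 = 0"
  "cnj_mat (cscale c X) = cscale (cnj c) (cnj_mat X)"
  by (simp_all add: vec_eq_iff)

lemma cnj_mat_mult: "cnj_mat (X ** Y) = cnj_mat X ** cnj_mat Y"
  by (simp add: vec_eq_iff matrix_matrix_mult_def)

lemma cnj_mat_vec: "cnj_vec (X *v v) = cnj_mat X *v cnj_vec v"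
  by (simp add: vec_eq_iff matrix_vector_mult_def)

lemma cnj_mat_1 [simp]: "cnj_mat (mat 1) = mat 1"
  by (simp add: vec_eq_iff mat_def)

lemma cnj_mat_vec': "cnj_mat X *v v = cnj_vec (X *v cnj_vec v)"
  by (simp add: cnj_mat_vec)

lemma ad_simps: "ad (X + Y) Z = ad X Z + ad Y Z" "ad X (Y + Z) = ad X Y + ad X Z"
  "ad (X - Y) Z = ad X Z - ad Y Z" "ad X (Y - Z) = ad X Y - ad X Z"
  "ad (- X) Y = - ad X Y" "ad X (- Y) = - ad X Y" "ad 0 Y = 0" "ad X 0 = 0"
  "ad (cscale c X) Y = cscale c (ad X Y)" "ad X (cscale c Y) = cscale c (ad X Y)"
  by (simp_all add: ad_def matrix_add_ldistrib matrix_add_rdistrib' matrix_diff_distrib matrix_neg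
      cscale_mult cscale_distrib)

lemma bounded_bilinear_matrix_mult:
  "bounded_bilinear ((**) :: complex ^ 'n::finite ^ 'n \<Rightarrow> complex ^ 'n ^ 'n \<Rightarrow> complex ^ 'n ^ 'n)"
proof -
  have "bilinear ((**) :: complex ^ 'n::finite ^ 'n \<Rightarrow> complex ^ 'n ^ 'n \<Rightarrow> complex ^ 'n ^ 'n)"
    unfolding bilinear_def
    by (auto intro!: linearI simp: matrix_add_ldistrib matrix_add_rdistrib')
      (simp_all add: cscale_of_real[symmetric] cscale_mult)
  then show ?thesis by (simp add: bilinear_conv_bounded_bilinear)
qed

lemma trace_lin: "trace (X + Y) = trace X + trace Y" "trace (X - Y) = trace X - trace Y"
  "trace (cscale c X) = c * trace (X :: complex ^ 'n::finite ^ 'n)"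
  by (simp_all add: trace_def sum.distrib sum_subtractf sum_distrib_left)

lemma trace_commute: "trace (X ** Y) = trace (Y ** (X :: complex ^ 'n::finite ^ 'n))"
  unfolding trace_def matrix_matrix_mult_def
  by simp (subst sum.swap, simp add: mult.commute)

lemma linear_trace: "linear (trace :: complex ^ 'n::finite ^ 'n \<Rightarrow> complex)"
  by (rule linearI) (simp_all add: trace_lin cscale_of_real[symmetric] scaleR_conv_of_real)

definition csub :: "(complex ^ 'n::finite ^ 'n) set \<Rightarrow> bool" where
  "csub S \<longleftrightarrow> 0 \<in> S \<and> (\<forall>X\<in>S. \<forall>Y\<in>S. X + Y \<in> S) \<and> (\<forall>c. \<forall>X\<in>S. cscale c X \<in> S)"

lemma csubI: "0 \<in> S \<Longrightarrow> (\<And>X Y. X \<in> S \<Longrightarrow> Y \<in> S \<Longrightarrow> X + Y \<in> S) \<Longrightarrow> (\<And>c X. X \<in> S \<Longrightarrow> cscale c X \<in> S) \<Longrightarrow> csub S"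
  by (simp add: csub_def)

lemma csub_0: "csub S \<Longrightarrow> 0 \<in> S"
  and csub_add: "csub S \<Longrightarrow> X \<in> S \<Longrightarrow> Y \<in> S \<Longrightarrow> X + Y \<in> S"
  and csub_scale: "csub S \<Longrightarrow> X \<in> S \<Longrightarrow> cscale c X \<in> S"
  by (auto simp: csub_def)

lemma csub_neg: "csub S \<Longrightarrow> X \<in> S \<Longrightarrow> - X \<in> S"
  using csub_scale[of S X "-1"] by (simp add: cscale_distrib)

lemma csub_diff: "csub S \<Longrightarrow> X \<in> S \<Longrightarrow> Y \<in> S \<Longrightarrow> X - Y \<in> S"
  using csub_add[of S X "- Y"] csub_neg by force

lemma csub_sum: "csub S \<Longrightarrow> (\<And>x. x \<in> A \<Longrightarrow> f x \<in> S) \<Longrightarrow> (\<Sum>x\<in>A. f x) \<in> S"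
  by (induction A rule: infinite_finite_induct) (auto simp: csub_0 csub_add)

lemma csub_subspace: "csub S \<Longrightarrow> subspace S"
  unfolding subspace_def by (metis cscale_of_real csub_def)

section \<open>Hermitian inner products\<close>

text \<open>The metric in abstract form: adjoints, trace metric and orthogonal projections are
  needed at the base point and at every moved point.\<close>

locale hermitian =
  fixes h :: "complex ^ 'n::finite \<Rightarrow> complex ^ 'n \<Rightarrow> complex"
  assumes h_add: "h (u + v) w = h u w + h v w" and h_scale: "h (c *s u) v = c * h u v"
    and h_cnj: "h v u = cnj (h u v)" and h_pos: "u \<noteq> 0 \<Longrightarrow> 0 < Re (h u u)"
begin

lemma h_zero [simp]: "h 0 v = 0" "h v 0 = 0"
proof -
  show *: "h 0 v = 0" for v using h_scale[of 0 0 v] by simp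
  show "h v 0 = 0" by (subst h_cnj) (simp add: *)
qed

lemma h_diff: "h (u - v) w = h u w - h v w"
  using h_add[of "u - v" v w] by simp

lemma h_add_right: "h w (u + v) = h w u + h w v"
  by (subst (1 2 3) h_cnj) (simp add: h_add)

lemma h_diff_right: "h w (u - v) = h w u - h w v"
  by (subst (1 2 3) h_cnj) (simp add: h_diff)

lemma h_scale_right: "h w (c *s u) = cnj c * h w u"
  by (subst (1 2) h_cnj) (simp add: h_scale)

lemma h_sum: "h (\<Sum>x\<in>S. f x) w = (\<Sum>x\<in>S. h (f x) w)"
  by (induction S rule: infinite_finite_induct) (auto simp: h_add)

lemma h_nondeg: "(\<And>v. h v u = 0) \<Longrightarrow> u = 0"
  using h_pos[of u] by fastforce

lemma h_ext: "(\<And>v. h v u = h v u') \<Longrightarrow> u = u'"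
  using h_nondeg[of "u - u'"] by (simp add: h_diff_right)

lemma Im_h_self: "Im (h u u) = 0"
  using h_cnj[of u u] by (simp add: complex_eq_iff)

text \<open>Gram-Schmidt, one index of \<open>'n\<close> at a time. As long as \<open>S\<close>
  misses an index, a dimension count leaves a vector outside the span of the vectors already
  chosen.\<close>

lemma orthonormal_extend:
  assumes "finite (S :: 'n set)"
  shows "\<exists>e. \<forall>i\<in>S. \<forall>j\<in>S. h (e i) (e j) = (if i = j then 1 else 0)"
  using assms
proof (induction S rule: finite_induct)
  case (insert a S)
  then obtain e where e: "\<And>i j. i \<in> S \<Longrightarrow> j \<in> S \<Longrightarrow> h (e i) (e j) = (if i = j then 1 else 0)" by blast
  have "vec.dim (vec.span (e ` S)) \<le> card (e ` S)"
    using insert vec.dim_le_card[of "e ` S" "e ` S"] by (simp add: vec.span_superset)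
  also have "\<dots> \<le> card S" using insert by (simp add: card_image_le)
  also have "\<dots> < CARD('n)" using insert by (intro psubset_card_mono) auto
  finally have "vec.span (e ` S) \<noteq> UNIV" using vec_dim_card by (metis less_irrefl)
  then obtain w where w: "w \<notin> vec.span (e ` S)" by blast
  define w' where "w' = w - (\<Sum>i\<in>S. h w (e i) *s e i)"
  have "w' \<noteq> 0"
  proof
    assume "w' = 0"
    then have "w = (\<Sum>i\<in>S. h w (e i) *s e i)" by (simp add: w'_def)
    moreover have "(\<Sum>i\<in>S. h w (e i) *s e i) \<in> vec.span (e ` S)"
      by (intro vec.span_sum vec.span_scale vec.span_base) auto
    ultimately show False using w by simp
  qed
  have w'e: "h w' (e j) = 0" if "j \<in> S" for j
  proof -
    have "(\<Sum>i\<in>S. h w (e i) * h (e i) (e j)) = (\<Sum>i\<in>S. if i = j then h w (e j) else 0)"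
      using e that by (intro sum.cong) auto
    then show ?thesis using insert(1) that by (simp add: w'_def h_diff h_sum h_scale)
  qed
  define r where "r = complex_of_real (1 / sqrt (Re (h w' w')))"
  have r: "cnj r * (r * h w' w') = 1"
    using h_pos[OF \<open>w' \<noteq> 0\<close>] Im_h_self[of w']
    by (auto simp: r_def complex_eq_iff power2_eq_square[symmetric] real_sqrt_divide power_divide)
  have "h (e j) w' = 0" if "j \<in> S" for j using w'e[OF that] by (subst h_cnj) simp
  then show ?case
    using e w'e r insert(2)
    by (intro exI[of _ "e(a := r *s w')"]) (auto simp: h_scale h_scale_right mult.assoc)
qed auto

lemma ex_frame:
  "\<exists>B :: complex ^ 'n ^ 'n. invertible B \<and> (\<forall>u v. h u v = (\<Sum>i\<in>UNIV. (B *v u) $ i * cnj ((B *v v) $ i)))"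
proof -
  obtain e :: "'n \<Rightarrow> complex ^ 'n" where "\<forall>i\<in>UNIV. \<forall>j\<in>UNIV. h (e i) (e j) = (if i = j then 1 else 0)"
    using orthonormal_extend[of UNIV] by auto
  then have e: "h (e i) (e j) = (if i = j then 1 else 0)" for i j by blast
  define B where "B = matrix (\<lambda>v. \<chi> i. h v (e i))"
  have B: "B *v v = (\<chi> i. h v (e i))" for v
    unfolding B_def by (rule matrix_works)
      (simp add: Vector_Spaces.linear_iff vec.vector_space_axioms vec_eq_iff h_add h_scale)
  define E where "E = matrix (\<lambda>x. \<Sum>i\<in>UNIV. x $ i *s e i)"
  have E: "E *v x = (\<Sum>i\<in>UNIV. x $ i *s e i)" for x
    unfolding E_def by (rule matrix_works)
      (simp add: Vector_Spaces.linear_iff vec.vector_space_axioms sum.distrib vec.scale_left_distrib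
        vec.scale_sum_right)
  have "(B ** E) *v x = mat 1 *v x" for x
    by (simp add: matrix_vector_mul_assoc[symmetric] B E h_sum h_scale e vec_eq_iff if_distrib cong: if_cong)
  then have BE: "B ** E = mat 1" by (simp add: matrix_eq)
  then have EB: "E ** B = mat 1" by (simp add: matrix_left_right_inverse)
  have "h u v = (\<Sum>i\<in>UNIV. (B *v u) $ i * cnj ((B *v v) $ i))" for u v
  proof -
    have "u = E *v (B *v u)" by (simp add: matrix_vector_mul_assoc EB)
    then have "h u v = h (\<Sum>i\<in>UNIV. (B *v u) $ i *s e i) v" by (simp add: E)
    also have "\<dots> = (\<Sum>i\<in>UNIV. (B *v u) $ i * h (e i) v)" by (simp add: h_sum h_scale)
    also have "\<dots> = (\<Sum>i\<in>UNIV. (B *v u) $ i * cnj ((B *v v) $ i))"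
      by (intro sum.cong refl) (simp add: B h_cnj[of "e _" v, symmetric])
    finally show ?thesis .
  qed
  moreover have "invertible B" using BE EB unfolding invertible_def by blast
  ultimately show ?thesis by (intro exI[of _ B] conjI allI)
qed

definition frm :: "complex ^ 'n ^ 'n" where
  "frm = (SOME B. invertible B \<and> (\<forall>u v. h u v = (\<Sum>i\<in>UNIV. (B *v u) $ i * cnj ((B *v v) $ i))))"

lemma frm_inv: "invertible frm" and frm: "h u v = (\<Sum>i\<in>UNIV. (frm *v u) $ i * cnj ((frm *v v) $ i))"
  using someI_ex[OF ex_frame] unfolding frm_def by blast+

definition ct :: "complex ^ 'n ^ 'n \<Rightarrow> complex ^ 'n ^ 'n" where
  "ct X = (\<chi> i j. cnj (X $ j $ i))"

definition hadj :: "complex ^ 'n ^ 'n \<Rightarrow> complex ^ 'n ^ 'n" where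
  "hadj X = (THE Y. \<forall>u v. h (X *v u) v = h u (Y *v v))"

definition hE :: "complex ^ 'n ^ 'n \<Rightarrow> complex ^ 'n ^ 'n \<Rightarrow> complex" where
  "hE X Y = trace (X ** hadj Y)"

definition hproj :: "(complex ^ 'n ^ 'n) set \<Rightarrow> complex ^ 'n ^ 'n \<Rightarrow> complex ^ 'n ^ 'n" where
  "hproj S X = (THE Y. Y \<in> S \<and> (\<forall>Z\<in>S. hE (X - Y) Z = 0))"

lemma ct_std: "(\<Sum>i\<in>UNIV. (X *v u) $ i * cnj (v $ i)) = (\<Sum>i\<in>UNIV. u $ i * cnj ((ct X *v v) $ i))"
proof -
  have "(\<Sum>i\<in>UNIV. (X *v u) $ i * cnj (v $ i)) = (\<Sum>i\<in>UNIV. \<Sum>j\<in>UNIV. X $ i $ j * u $ j * cnj (v $ i))"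
    by (simp add: matrix_vector_mult_def sum_distrib_right)
  also have "\<dots> = (\<Sum>j\<in>UNIV. \<Sum>i\<in>UNIV. X $ i $ j * u $ j * cnj (v $ i))" by (rule sum.swap)
  also have "\<dots> = (\<Sum>i\<in>UNIV. u $ i * cnj ((ct X *v v) $ i))"
    by (simp add: matrix_vector_mult_def ct_def sum_distrib_left mult_ac)
  finally show ?thesis .
qed

text \<open>Conjugation into coordinates in which \<open>h\<close> is the standard Hermitian
  product. There the adjoint is the conjugate transpose and \<open>hE\<close> is the Frobenius
  product, whose real part is the Euclidean \<open>inner\<close> product of matrices.\<close>

definition tofr :: "complex ^ 'n ^ 'n \<Rightarrow> complex ^ 'n ^ 'n" where
  "tofr X = frm ** X ** matrix_inv frm"

definition unfr :: "complex ^ 'n ^ 'n \<Rightarrow> complex ^ 'n ^ 'n" where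
  "unfr X = matrix_inv frm ** X ** frm"

lemma tofr_unfr [simp]: "tofr (unfr X) = X" "unfr (tofr X) = X"
  by (simp_all add: tofr_def unfr_def matrix_mul_assoc[symmetric] matrix_inv_cancel[OF frm_inv] matrix_inv[OF frm_inv])

lemma adj_works: "h (X *v u) v = h u (unfr (ct (tofr X)) *v v)"
proof -
  have "frm *v (X *v u) = tofr X *v (frm *v u)"
    by (simp add: tofr_def matrix_vector_mul_assoc[symmetric] matrix_inv_cancel[OF frm_inv])
  moreover have "frm *v (unfr (ct (tofr X)) *v v) = ct (tofr X) *v (frm *v v)"
    by (simp add: unfr_def matrix_vector_mul_assoc[symmetric] matrix_inv_cancel[OF frm_inv])
  ultimately show ?thesis using ct_std[of "tofr X" "frm *v u" "frm *v v"]
    by (metis (no_types) frm)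
qed

lemma hadj_unique: "(\<And>u v. h (X *v u) v = h u (Y *v v)) \<Longrightarrow> hadj X = Y"
proof -
  assume Y: "\<And>u v. h (X *v u) v = h u (Y *v v)"
  have "Z = Y" if "\<forall>u v. h (X *v u) v = h u (Z *v v)" for Z
    unfolding matrix_eq using that Y by (auto intro!: h_ext)
  then show ?thesis unfolding hadj_def using Y by (intro the_equality) auto
qed

lemma hadj_eq: "hadj X = unfr (ct (tofr X))"
  by (rule hadj_unique) (rule adj_works)

lemma hadj: "h (X *v u) v = h u (hadj X *v v)"
  by (simp add: hadj_eq adj_works)

lemma hadj': "h u (X *v v) = h (hadj X *v u) v"
  by (subst (1 2) h_cnj) (simp add: hadj)

lemma hadj_hadj [simp]: "hadj (hadj X) = X"
  by (rule hadj_unique) (simp add: hadj')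

lemma hadj_add: "hadj (X + Y) = hadj X + hadj Y"
  by (rule hadj_unique) (simp add: matrix_vector_mult_add_rdistrib h_add h_add_right hadj)

lemma hadj_cscale: "hadj (cscale c X) = cscale (cnj c) (hadj X)"
  by (rule hadj_unique) (simp add: cscale_vec h_scale h_scale_right hadj)

lemma hadj_neg: "hadj (- X) = - hadj X"
  using hadj_cscale[of "-1" X] by (simp add: cscale_distrib)

lemma hadj_diff: "hadj (X - Y) = hadj X - hadj Y"
  using hadj_add[of X "- Y"] by (simp add: hadj_neg)

lemma hadj_0 [simp]: "hadj 0 = 0"
  using hadj_cscale[of 0 0] by simp

lemma hadj_mult: "hadj (X ** Y) = hadj Y ** hadj X"
  by (rule hadj_unique) (simp add: matrix_vector_mul_assoc[symmetric] hadj)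

lemma hE_add: "hE (X + Y) Z = hE X Z + hE Y Z" "hE Z (X + Y) = hE Z X + hE Z Y"
  by (simp_all add: hE_def hadj_add matrix_add_rdistrib' matrix_add_ldistrib trace_lin)

lemma hE_diff: "hE (X - Y) Z = hE X Z - hE Y Z" "hE Z (X - Y) = hE Z X - hE Z Y"
  by (simp_all add: hE_def hadj_diff matrix_diff_distrib trace_lin)

lemma hE_scale: "hE (cscale c X) Z = c * hE X Z" "hE Z (cscale c X) = cnj c * hE Z X"
  by (simp_all add: hE_def hadj_cscale cscale_mult trace_lin)

lemma hE_0 [simp]: "hE 0 X = 0" "hE X 0 = 0"
  by (simp_all add: hE_def trace_def)

lemma hE_sum: "hE (\<Sum>x\<in>S. f x) Z = (\<Sum>x\<in>S. hE (f x) Z)"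
  by (induction S rule: infinite_finite_induct) (auto simp: hE_add)

lemma hE_mult: "hE (X ** Y) Z = hE Y (hadj X ** Z)" "hE (Y ** X) Z = hE Y (Z ** hadj X)"
proof -
  show "hE (X ** Y) Z = hE Y (hadj X ** Z)"
    unfolding hE_def hadj_mult hadj_hadj
    by (metis matrix_mul_assoc trace_commute)
  show "hE (Y ** X) Z = hE Y (Z ** hadj X)"
    unfolding hE_def hadj_mult hadj_hadj by (simp add: matrix_mul_assoc)
qed

text \<open>Cyclicity of the trace. It is used to move the bracket with the antiholomorphic part of
  the form of \<open>f\<close> from one argument of the metric to the other.\<close>

lemma hE_ad: "hE (ad X Y) Z = hE Y (ad (hadj X) Z)"
  by (simp add: ad_def hE_diff hE_mult(1)[of X Y] hE_mult(2)[of Y X])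

lemma hE_tofr: "hE X Y = (\<Sum>i\<in>UNIV. \<Sum>j\<in>UNIV. tofr X $ i $ j * cnj (tofr Y $ i $ j))"
proof -
  have "X ** hadj Y = unfr (tofr X ** ct (tofr Y))"
    by (simp add: hadj_eq) (simp add: unfr_def tofr_def matrix_mul_assoc[symmetric] matrix_inv_cancel[OF frm_inv] matrix_inv[OF frm_inv])
  moreover have "trace (unfr Z) = trace Z" for Z
    unfolding unfr_def by (subst trace_commute) (simp add: matrix_mul_assoc matrix_inv[OF frm_inv])
  ultimately show ?thesis
    by (simp add: hE_def trace_def matrix_matrix_mult_def ct_def)
qed

lemma hE_cnj: "hE Y X = cnj (hE X Y)"
  by (simp add: hE_tofr mult.commute)

lemma Re_hE: "Re (hE X Y) = inner (tofr X) (tofr Y)"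
  by (simp add: hE_tofr inner_vec_def inner_complex_def)

lemma hE_nondeg: "hE X X = 0 \<Longrightarrow> X = 0"
proof -
  assume "hE X X = 0"
  then have "inner (tofr X) (tofr X) = 0" using Re_hE[of X X] by simp
  then have "unfr (tofr X) = unfr 0" by simp
  then show "X = 0" by (simp only: tofr_unfr) (simp add: unfr_def)
qed

lemma linear_tofr: "linear tofr"
  unfolding tofr_def
  by (rule linearI) (simp_all add: matrix_add_rdistrib' matrix_add_ldistrib cscale_of_real[symmetric] cscale_mult)

lemma hproj_ex:
  assumes S: "csub S" shows "\<exists>Y\<in>S. \<forall>Z\<in>S. hE (X - Y) Z = 0"
proof -
  have T: "subspace (tofr ` S)" using linear_tofr csub_subspace[OF S] by (rule linear_subspace_image)
  obtain y z where yz: "y \<in> span (tofr ` S)" "\<And>w. w \<in> span (tofr ` S) \<Longrightarrow> orthogonal z w" "tofr X = y + z"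
    using orthogonal_subspace_decomp_exists[of "tofr ` S" "tofr X"] by blast
  then obtain Y where Y: "Y \<in> S" "y = tofr Y" using T by (auto simp: span_eq_iff[THEN iffD2])
  have z: "z = tofr (X - Y)" using yz(3) Y linear_diff[OF linear_tofr] by simp
  \<comment> \<open>Euclidean orthogonality controls real parts only; the imaginary part follows by
    testing against \<open>\<i>\<close> times \<open>Z\<close>, which is where closure under complex
    scaling enters.\<close>
  have re: "Re (hE (X - Y) Z) = 0" if "Z \<in> S" for Z
    unfolding Re_hE z[symmetric] using yz(2)[of "tofr Z"] that by (auto simp: orthogonal_def span_base)
  have "hE (X - Y) Z = 0" if "Z \<in> S" for Z
    using re[OF that] re[OF csub_scale[OF S that, of \<i>]] by (simp add: hE_scale complex_eq_iff)
  then show ?thesis using Y by blast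
qed

lemma hproj_unique:
  assumes S: "csub S" and Y: "Y \<in> S" "\<And>Z. Z \<in> S \<Longrightarrow> hE (X - Y) Z = 0" shows "hproj S X = Y"
proof -
  have "Y' = Y" if Y': "Y' \<in> S \<and> (\<forall>Z\<in>S. hE (X - Y') Z = 0)" for Y'
  proof -
    have "hE (Y' - Y) (Y' - Y) = hE (X - Y) (Y' - Y) - hE (X - Y') (Y' - Y)" by (simp add: hE_diff)
    also have "\<dots> = 0" using Y Y' csub_diff[OF S, of Y' Y] by simp
    finally show ?thesis using hE_nondeg[of "Y' - Y"] by simp
  qed
  then show ?thesis unfolding hproj_def using Y by (intro the_equality) auto
qed

lemma hproj_mem: "csub S \<Longrightarrow> hproj S X \<in> S"
  and hproj_orth: "csub S \<Longrightarrow> Z \<in> S \<Longrightarrow> hE (hproj S X) Z = hE X Z"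
proof -
  assume S: "csub S"
  obtain Y where Y: "Y \<in> S" "\<forall>Z\<in>S. hE (X - Y) Z = 0" using hproj_ex[OF S] by blast
  have eq: "hproj S X = Y" using hproj_unique[OF S] Y by blast
  then show "hproj S X \<in> S" using Y by simp
  show "hE (hproj S X) Z = hE X Z" if "Z \<in> S" using eq Y that by (simp add: hE_diff)
qed

lemma hproj_id: "csub S \<Longrightarrow> X \<in> S \<Longrightarrow> hproj S X = X"
  by (rule hproj_unique) auto

lemma hproj_add: "csub S \<Longrightarrow> hproj S (X + Y) = hproj S X + hproj S Y"
  by (rule hproj_unique) (auto simp: hproj_mem csub_add hE_diff hE_add hproj_orth)

lemma hproj_cscale: "csub S \<Longrightarrow> hproj S (cscale c X) = cscale c (hproj S X)"
  by (rule hproj_unique) (auto simp: hproj_mem csub_scale hE_diff hE_scale hproj_orth)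

lemma bounded_bilinear_hE: "bounded_bilinear hE"
proof -
  have "bilinear hE" unfolding bilinear_def
    by (auto intro!: linearI simp: hE_add)
      (simp_all add: cscale_of_real[symmetric] hE_scale scaleR_conv_of_real)
  then show ?thesis by (simp add: bilinear_conv_bounded_bilinear)
qed

end

section \<open>Endomorphisms of a bigraded space\<close>

lemma matrix_vec_zero_iff: "A = 0 \<longleftrightarrow> (\<forall>v. A *v v = 0)" for A :: "complex ^ 'n::finite ^ 'n"
  by (simp add: matrix_eq)

context bigraded begin

text \<open>\<open>EE S\<close> is the sum of the \<open>End(V)\<^sup>r\<^sup>,\<^sup>s\<close> with \<open>(r, s) \<in> S\<close>.\<close>

definition EE :: "(int \<times> int) set \<Rightarrow> (complex ^ 'n ^ 'n) set" where
  "EE S = {X. \<forall>x y. y - x \<notin> S \<longrightarrow> P y ** X ** P x = 0}"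

definition epart :: "(int \<times> int) set \<Rightarrow> complex ^ 'n ^ 'n \<Rightarrow> complex ^ 'n ^ 'n" where
  "epart S X = (\<Sum>x\<in>K. \<Sum>y\<in>K. if y - x \<in> S then P y ** X ** P x else 0)"

lemma P_decomp: "X = (\<Sum>x\<in>K. \<Sum>y\<in>K. P y ** X ** P x)"
proof -
  have "X = (\<Sum>y\<in>K. P y) ** X ** (\<Sum>x\<in>K. P x)" by (simp add: P_sum_mat)
  also have "\<dots> = (\<Sum>x\<in>K. \<Sum>y\<in>K. P y ** X ** P x)" by (simp add: matrix_sum)
  finally show ?thesis .
qed

lemma EE_ext: "(\<And>x y. P y ** X ** P x = P y ** Y ** P x) \<Longrightarrow> X = Y"
  using P_decomp[of X] P_decomp[of Y] by simp

lemma EE_I: "(\<And>x y. y - x \<notin> S \<Longrightarrow> P y ** X ** P x = 0) \<Longrightarrow> X \<in> EE S"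
  and EE_D: "X \<in> EE S \<Longrightarrow> y - x \<notin> S \<Longrightarrow> P y ** X ** P x = 0"
  unfolding EE_def by blast+

lemma P_epart: "P y ** epart S X ** P x = (if y - x \<in> S then P y ** X ** P x else 0)"
proof -
  have "P y ** epart S X ** P x =
      (\<Sum>x'\<in>K. \<Sum>y'\<in>K. P y ** (if y' - x' \<in> S then P y' ** X ** P x' else 0) ** P x)"
    by (simp add: epart_def matrix_sum)
  also have "\<dots> = (\<Sum>x'\<in>K. \<Sum>y'\<in>K. if x' = x \<and> y' = y then (if y - x \<in> S then P y ** X ** P x else 0) else 0)"
  proof (intro sum.cong refl)
    fix x' y'
    have "P y ** (P y' ** X ** P x') ** P x = (P y ** P y') ** X ** (P x' ** P x)"
      by (simp add: matrix_mul_assoc)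
    then show "P y ** (if y' - x' \<in> S then P y' ** X ** P x' else 0) ** P x =
      (if x' = x \<and> y' = y then (if y - x \<in> S then P y ** X ** P x else 0) else 0)"
      by (auto simp: P_mult)
  qed
  also have "\<dots> = (\<Sum>x'\<in>K. if x' = x then (\<Sum>y'\<in>K. if y' = y then (if y - x \<in> S then P y ** X ** P x else 0) else 0) else 0)"
    by (intro sum.cong refl) auto
  also have "\<dots> = (if y - x \<in> S then P y ** X ** P x else 0)"
    using P_out[of x] P_out[of y] by (auto simp: sum.delta)
  finally show ?thesis .
qed

lemma EE_mem [intro, simp]: "epart S X \<in> EE S"
  by (rule EE_I) (simp add: P_epart)

lemma epart_id_iff: "epart S X = X \<longleftrightarrow> X \<in> EE S"
proof
  assume "epart S X = X" then show "X \<in> EE S" using EE_mem by metis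
next
  assume "X \<in> EE S" then show "epart S X = X"
    by (intro EE_ext[of "epart S X"]) (simp add: P_epart EE_D)
qed

lemma epart_id: "X \<in> EE S \<Longrightarrow> epart S X = X"
  by (simp add: epart_id_iff)

lemma epart_epart: "epart S (epart T X) = epart (S \<inter> T) X"
  by (rule EE_ext) (auto simp: P_epart)

lemma epart_add: "epart S (X + Y) = epart S X + epart S Y"
  by (rule EE_ext) (simp add: P_epart matrix_add_ldistrib matrix_add_rdistrib')

lemma epart_cscale: "epart S (cscale c X) = cscale c (epart S X)"
  by (rule EE_ext) (simp add: P_epart cscale_mult)

lemma epart_0 [simp]: "epart S 0 = 0"
  by (rule EE_ext) (simp add: P_epart)

lemma epart_neg: "epart S (- X) = - epart S X"
  using epart_cscale[of S "-1" X] by (simp add: cscale_distrib)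

lemma epart_diff: "epart S (X - Y) = epart S X - epart S Y"
  using epart_add[of S X "- Y"] by (simp add: epart_neg)

lemma epart_Un: "S \<inter> T = {} \<Longrightarrow> epart (S \<union> T) X = epart S X + epart T X"
  by (rule EE_ext) (auto simp: P_epart matrix_add_ldistrib matrix_add_rdistrib')

lemma EE_mono: "X \<in> EE S \<Longrightarrow> S \<subseteq> T \<Longrightarrow> X \<in> EE T"
  by (rule EE_I) (auto intro: EE_D)

lemma EE_Int: "X \<in> EE S \<Longrightarrow> X \<in> EE T \<Longrightarrow> X \<in> EE (S \<inter> T)"
  by (rule EE_I) (auto intro: EE_D)

lemma epart_EE: "X \<in> EE S \<Longrightarrow> epart T X \<in> EE S"
  by (rule EE_I) (simp add: P_epart EE_D)

lemma epart_EE': "X \<in> EE S \<Longrightarrow> epart T X = epart (S \<inter> T) X"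
  by (metis epart_epart epart_id_iff inf_commute)

lemma epart_disjoint: "X \<in> EE S \<Longrightarrow> S \<inter> T = {} \<Longrightarrow> epart T X = 0"
  by (subst epart_EE'[of X S], assumption) (rule EE_ext, simp add: P_epart)

lemma csub_EE: "csub (EE S)"
  by (rule csubI; rule EE_I) (simp_all add: EE_D matrix_add_ldistrib matrix_add_rdistrib' cscale_mult)

lemma P_mult_decomp: "P y ** (X ** Y) ** P x = (\<Sum>z\<in>K. (P y ** X ** P z) ** (P z ** Y ** P x))"
proof -
  have "P y ** (X ** Y) ** P x = P y ** X ** (\<Sum>z\<in>K. P z) ** Y ** P x"
    by (simp add: P_sum_mat matrix_mul_assoc)
  also have "\<dots> = (\<Sum>z\<in>K. P y ** X ** P z ** Y ** P x)" by (simp add: matrix_sum)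
  also have "\<dots> = (\<Sum>z\<in>K. (P y ** X ** P z) ** (P z ** Y ** P x))"
  proof (intro sum.cong refl)
    fix z
    have "(P y ** X ** P z) ** (P z ** Y ** P x) = P y ** X ** (P z ** P z) ** Y ** P x"
      by (simp add: matrix_mul_assoc)
    then show "P y ** X ** P z ** Y ** P x = (P y ** X ** P z) ** (P z ** Y ** P x)" by (simp add: P_mult)
  qed
  finally show ?thesis .
qed

lemma EE_mult:
  assumes "X \<in> EE S" "Y \<in> EE T" and "\<And>s t. s \<in> S \<Longrightarrow> t \<in> T \<Longrightarrow> s + t \<in> R"
  shows "X ** Y \<in> EE R"
proof (rule EE_I)
  fix x y assume "y - x \<notin> R"
  have "(P y ** X ** P z) ** (P z ** Y ** P x) = 0" for z
  proof -
    have "y - z \<notin> S \<or> z - x \<notin> T" using assms(3)[of "y - z" "z - x"] \<open>y - x \<notin> R\<close> by auto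
    then show ?thesis using EE_D[OF assms(1)] EE_D[OF assms(2)] by fastforce
  qed
  then show "P y ** (X ** Y) ** P x = 0" by (simp add: P_mult_decomp)
qed

lemma EE_ad:
  assumes "X \<in> EE S" "Y \<in> EE T" and "\<And>s t. s \<in> S \<Longrightarrow> t \<in> T \<Longrightarrow> s + t \<in> R"
  shows "ad X Y \<in> EE R"
  unfolding ad_def
  by (intro csub_diff[OF csub_EE] EE_mult[OF assms(1,2)] EE_mult[OF assms(2,1)])
    (use assms(3) add.commute in metis)+

lemma EE_one: "mat 1 \<in> EE {0}"
  by (rule EE_I) (simp add: P_mult)

lemma P_Y_decomp: "P y *v (X *v v) = (\<Sum>x\<in>K. (P y ** X ** P x) *v (P x *v v))"
proof -
  have "P y *v (X *v v) = P y *v (X *v (\<Sum>x\<in>K. P x *v v))" by (simp add: P_sum)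
  also have "\<dots> = (\<Sum>x\<in>K. P y *v (X *v (P x *v v)))" by (simp add: matrix_vector_mult_sum_right)
  also have "\<dots> = (\<Sum>x\<in>K. (P y ** X ** P x) *v (P x *v v))"
  proof (intro sum.cong refl)
    fix x
    have "P y ** X ** P x ** P x = P y ** X ** P x"
      using P_mult[of x x] by (simp add: matrix_mul_assoc[symmetric])
    then show "P y *v (X *v (P x *v v)) = (P y ** X ** P x) *v (P x *v v)"
      by (simp add: matrix_vector_mul_assoc matrix_mul_assoc)
  qed
  finally show ?thesis .
qed

lemma EE_vec:
  assumes X: "X \<in> EE S" and v: "v \<in> I p q" and y: "P y *v (X *v v) \<noteq> 0"
  shows "y - (p, q) \<in> S"
proof (rule ccontr)
  assume "y - (p, q) \<notin> S"
  then have "P y ** X ** P (p, q) = 0" using EE_D[OF X] by blast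
  moreover have "P y *v (X *v v) = (P y ** X ** P (p, q)) *v v"
    using v by (simp add: mem_I_iff matrix_vector_mul_assoc[symmetric])
  ultimately show False using y by simp
qed

text \<open>Stated for any integer functional \<open>f\<close> additive on shifts: the sum of the
  indices gives the weight filtration, minus the first index gives the Hodge filtration.\<close>

lemma EE_filtration:
  assumes f: "\<And>x y. f (y - x) = f y - (f x :: int)"
  shows "(\<forall>k. \<forall>v\<in>bigrading_sum I {x. f x \<le> k}. X *v v \<in> bigrading_sum I {x. f x \<le> k}) \<longleftrightarrow> X \<in> EE {d. f d \<le> 0}"
proof
  assume *: "\<forall>k. \<forall>v\<in>bigrading_sum I {x. f x \<le> k}. X *v v \<in> bigrading_sum I {x. f x \<le> k}"
  show "X \<in> EE {d. f d \<le> 0}"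
  proof (rule EE_I)
    fix x y assume "y - x \<notin> {d. f d \<le> 0}"
    then have fy: "y \<notin> {z. f z \<le> f x}" by (simp add: f)
    have "(P y ** X ** P x) *v v = 0" for v
    proof -
      have "P x *v v \<in> bigrading_sum I {z. f z \<le> f x}"
        using I_bigrading_sum[OF _ P_mem'[of x v], of "{z. f z \<le> f x}"] by simp
      then have "X *v (P x *v v) \<in> bigrading_sum I {z. f z \<le> f x}" using * by blast
      then have "P y *v (X *v (P x *v v)) = 0" using fy unfolding bigrading_sum_iff by blast
      then show ?thesis by (simp add: matrix_vector_mul_assoc matrix_mul_assoc)
    qed
    then show "P y ** X ** P x = 0" by (simp add: matrix_vec_zero_iff)
  qed
next
  assume X: "X \<in> EE {d. f d \<le> 0}"
  show "\<forall>k. \<forall>v\<in>bigrading_sum I {x. f x \<le> k}. X *v v \<in> bigrading_sum I {x. f x \<le> k}"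
  proof (intro allI ballI)
    fix k v assume v: "v \<in> bigrading_sum I {x. f x \<le> k}"
    show "X *v v \<in> bigrading_sum I {x. f x \<le> k}"
      unfolding bigrading_sum_iff P_Y_decomp
    proof (intro allI impI sum.neutral ballI)
      fix y x assume y: "y \<notin> {x. f x \<le> k}"
      show "(P y ** X ** P x) *v (P x *v v) = 0"
      proof (cases "f x \<le> k")
        case True
        then have "y - x \<notin> {d. f d \<le> 0}" using y by (simp add: f)
        then have "P y ** X ** P x = 0" using EE_D[OF X] by blast
        then show ?thesis by simp
      next
        case False
        then show ?thesis using v[unfolded bigrading_sum_iff, rule_format, of x] by simp
      qed
    qed
  qed
qed

lemma EE_single_iff: "X \<in> EE {(r, s)} \<longleftrightarrow> (\<forall>p q. \<forall>v\<in>I p q. X *v v \<in> I (p + r) (q + s))"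
proof
  assume X: "X \<in> EE {(r, s)}"
  show "\<forall>p q. \<forall>v\<in>I p q. X *v v \<in> I (p + r) (q + s)"
  proof (intro allI ballI)
    fix p q v assume v: "v \<in> I p q"
    have "X *v v \<in> bigrading_sum I {(p + r, q + s)}"
      unfolding bigrading_sum_iff
    proof (intro allI impI)
      fix y assume "y \<notin> {(p + r, q + s)}"
      then have "y - (p, q) \<notin> {(r, s)}" by (cases y) auto
      then show "P y *v (X *v v) = 0" using EE_vec[OF X v] by blast
    qed
    then have "P y *v (X *v v) = (if y = (p + r, q + s) then P (p + r, q + s) *v (X *v v) else 0)" for y
      unfolding bigrading_sum_iff by (metis singletonD)
    then have "(\<Sum>y\<in>K. P y *v (X *v v)) = (\<Sum>y\<in>K. if y = (p + r, q + s) then P (p + r, q + s) *v (X *v v) else 0)"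
      by (intro sum.cong refl)
    also have "\<dots> = P (p + r, q + s) *v (X *v v)" using P_out[of "(p + r, q + s)"] by (simp add: sum.delta)
    finally show "X *v v \<in> I (p + r) (q + s)" by (simp only: mem_I_iff P_sum)
  qed
next
  assume *: "\<forall>p q. \<forall>v\<in>I p q. X *v v \<in> I (p + r) (q + s)"
  show "X \<in> EE {(r, s)}"
  proof (rule EE_I)
    fix x y assume xy: "y - x \<notin> {(r, s)}"
    have "(P y ** X ** P x) *v v = 0" for v
    proof -
      have "X *v (P x *v v) \<in> I (fst x + r) (snd x + s)" using * P_mem' by blast
      moreover have "y \<noteq> (fst x + r, snd x + s)" using xy by (cases x; cases y) auto
      ultimately have "P y *v (X *v (P x *v v)) = 0" using P_on by simp
      then show ?thesis by (simp add: matrix_vector_mul_assoc matrix_mul_assoc)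
    qed
    then show "P y ** X ** P x = 0" by (simp add: matrix_vec_zero_iff)
  qed
qed

end

section \<open>The mixed Hodge metric at a point\<close>

locale polarized_hodge = mixed_hodge +
  fixes Q
  assumes forms: "graded_forms W Q" and pol: "graded_polarized W Q F"
begin

lemma
  shows Q_add: "x \<in> W k \<Longrightarrow> y \<in> W k \<Longrightarrow> z \<in> W k \<Longrightarrow> Q k (x + y) z = Q k x z + Q k y z"
    and Q_scale: "x \<in> W k \<Longrightarrow> y \<in> W k \<Longrightarrow> Q k (c *\<^sub>R x) y = c * Q k x y"
    and Q_sym: "x \<in> W k \<Longrightarrow> y \<in> W k \<Longrightarrow> Q k y x = (- 1) powi k * Q k x y"
    and Q_rad: "x \<in> W (k - 1) \<Longrightarrow> y \<in> W k \<Longrightarrow> Q k x y = 0"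
  using forms unfolding graded_forms_def by blast+

lemma Q_scale_right: "x \<in> W k \<Longrightarrow> z \<in> W k \<Longrightarrow> Q k z (c *\<^sub>R x) = c * Q k z x"
  using Q_sym[of "c *\<^sub>R x" k z] Q_sym[of x k z] Q_scale[of x k z c] subspace_scale[OF W_sub]
  by simp

lemma Q_diff: "x \<in> W k \<Longrightarrow> y \<in> W k \<Longrightarrow> z \<in> W k \<Longrightarrow> Q k (x - y) z = Q k x z - Q k y z"
  using Q_add[of "x - y" k y z] subspace_diff[OF W_sub] by fastforce

lemma Q_minus: "x \<in> W k \<Longrightarrow> z \<in> W k \<Longrightarrow> Q k (- x) z = - Q k x z" "x \<in> W k \<Longrightarrow> z \<in> W k \<Longrightarrow> Q k z (- x) = - Q k z x"
  using Q_scale[of x k z "-1"] Q_scale_right[of x k z "-1"] by simp_all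

lemma QC_add: "u \<in> W_C W k \<Longrightarrow> v \<in> W_C W k \<Longrightarrow> w \<in> W_C W k \<Longrightarrow> Q_C Q k (u + v) w = Q_C Q k u w + Q_C Q k v w"
  by (simp add: Q_C_def W_C_def complex_eq_iff Q_add)

lemma QC_scale: "u \<in> W_C W k \<Longrightarrow> w \<in> W_C W k \<Longrightarrow> Q_C Q k (c *s u) w = c * Q_C Q k u w"
  by (simp add: Q_C_def W_C_def complex_eq_iff re_im_vec_smult Q_add Q_diff Q_scale subspace_scale[OF W_sub] algebra_simps)

lemma QC_sym: "u \<in> W_C W k \<Longrightarrow> v \<in> W_C W k \<Longrightarrow> Q_C Q k v u = (- 1) powi k * Q_C Q k u v"
proof -
  assume uv: "u \<in> W_C W k" "v \<in> W_C W k"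
  define s :: real where "s = (- 1) powi k"
  have c: "(- 1 :: complex) powi k = of_real s" by (simp add: s_def)
  have Qs: "Q k y x = s * Q k x y" if "x \<in> W k" "y \<in> W k" for x y
    unfolding s_def by (rule Q_sym[OF that])
  have W: "re_vec u \<in> W k" "im_vec u \<in> W k" "re_vec v \<in> W k" "im_vec v \<in> W k"
    using uv by (auto simp: W_C_def)
  show ?thesis
    unfolding Q_C_def c Qs[OF W(1,3)] Qs[OF W(1,4)] Qs[OF W(2,3)] Qs[OF W(2,4)]
    by (simp add: complex_eq_iff algebra_simps)
qed

lemma QC_rad: "u \<in> W_C W (k - 1) \<Longrightarrow> v \<in> W_C W k \<Longrightarrow> Q_C Q k u v = 0"
  by (simp add: Q_C_def W_C_def complex_eq_iff Q_rad)

lemma QC_cnj: "u \<in> W_C W k \<Longrightarrow> v \<in> W_C W k \<Longrightarrow> Q_C Q k (cnj_vec u) (cnj_vec v) = cnj (Q_C Q k u v)"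
  by (simp add: Q_C_def W_C_def complex_eq_iff Q_minus subspace_neg[OF W_sub])

lemma QC_add_right: "u \<in> W_C W k \<Longrightarrow> v \<in> W_C W k \<Longrightarrow> w \<in> W_C W k \<Longrightarrow> Q_C Q k w (u + v) = Q_C Q k w u + Q_C Q k w v"
  using QC_sym[of "u + v" k w] QC_sym[of u k w] QC_sym[of v k w] QC_add[of u k v w] vec.subspace_add[OF Wc_sub]
  by (simp add: distrib_left)

lemma QC_rad_right: "u \<in> W_C W k \<Longrightarrow> v \<in> W_C W (k - 1) \<Longrightarrow> Q_C Q k u v = 0"
  using QC_sym[of v k u] QC_rad[of v k u] Wc_mono'[of v "k - 1" k] by simp

lemma QC_0 [simp]: "u \<in> W_C W k \<Longrightarrow> Q_C Q k 0 u = 0" "u \<in> W_C W k \<Longrightarrow> Q_C Q k u 0 = 0"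
  using QC_rad[of 0 k u] QC_rad_right[of u k 0] by (simp_all add: vec.subspace_0)

lemma QC_sum: "(\<And>x. x \<in> A \<Longrightarrow> f x \<in> W_C W k) \<Longrightarrow> w \<in> W_C W k \<Longrightarrow>
    Q_C Q k (\<Sum>x\<in>A. f x) w = (\<Sum>x\<in>A. Q_C Q k (f x) w)"
  by (induction A rule: infinite_finite_induct) (auto simp: QC_add vec.subspace_sum[OF Wc_sub])

lemma QC_sum_right: "(\<And>x. x \<in> A \<Longrightarrow> f x \<in> W_C W k) \<Longrightarrow> w \<in> W_C W k \<Longrightarrow>
    Q_C Q k w (\<Sum>x\<in>A. f x) = (\<Sum>x\<in>A. Q_C Q k w (f x))"
  by (induction A rule: infinite_finite_induct) (auto simp: QC_add_right vec.subspace_sum[OF Wc_sub])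

lemma QC_F:
  assumes "u \<in> F p" "u \<in> W_C W k" "v \<in> F q" "v \<in> W_C W k" "k < p + q" shows "Q_C Q k u v = 0"
proof -
  have "u \<in> F_gr W F k p" using assms by (simp add: F_gr_iff FW_left)
  moreover have "v \<in> F_gr W F k (k - p + 1)"
    using assms F_mono[of v q "k - p + 1"] by (simp add: F_gr_iff FW_left)
  ultimately show ?thesis using pol unfolding graded_polarized_def by blast
qed

lemma QC_Fb:
  assumes u: "u \<in> subspace_sum (cnj_vec ` F p) (W_C W (k - 1))" "u \<in> W_C W k"
    and v: "v \<in> subspace_sum (cnj_vec ` F q) (W_C W (k - 1))" "v \<in> W_C W k" and "k < p + q"
  shows "Q_C Q k u v = 0"
proof -
  obtain a b where ab: "cnj_vec a \<in> F p" "b \<in> W_C W (k - 1)" "u = a + b"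
    using u(1) by (elim subspace_sumE) (auto simp: mem_cnj_vec_image)
  obtain c d where cd: "cnj_vec c \<in> F q" "d \<in> W_C W (k - 1)" "v = c + d"
    using v(1) by (elim subspace_sumE) (auto simp: mem_cnj_vec_image)
  have bd: "b \<in> W_C W k" "d \<in> W_C W k" using ab cd by (auto intro: Wc_mono')
  have ac: "a \<in> W_C W k" "c \<in> W_C W k"
    using vec.subspace_diff[OF Wc_sub u(2) bd(1)] vec.subspace_diff[OF Wc_sub v(2) bd(2)] ab cd by auto
  have "Q_C Q k (cnj_vec a) (cnj_vec c) = 0" using QC_F[OF ab(1) _ cd(1)] ac assms by simp
  then have "Q_C Q k a c = 0" using QC_cnj[OF ac] by simp
  then show ?thesis using ac bd ab cd QC_rad QC_rad_right
    by (simp add: QC_add QC_add_right vec.subspace_add[OF Wc_sub])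
qed

text \<open>If the weights agree but the indices are not transposed, then \<open>p + p'\<close> or
  \<open>q + q'\<close> exceeds the weight, and the first bilinear relation applies to
  \<open>F\<close> or to its conjugate.\<close>

lemma QC_dg:
  assumes u: "u \<in> dg p q" and v: "v \<in> dg p' q'" and k: "p' + q' = p + q" and ne: "(p', q') \<noteq> (q, p)"
  shows "Q_C Q (p + q) u v = 0"
proof -
  have W: "u \<in> W_C W (p + q)" "v \<in> W_C W (p + q)" using dg_W[OF u] dg_W[OF v] k by auto
  consider "p + q < p + p'" | "p + q < q + q'" using k ne by (cases "p + q < p + p'") auto
  then show ?thesis
  proof cases
    case 1 then show ?thesis using QC_F[OF dg_F[OF u] W(1) dg_F[OF v] W(2)] by simp
  next
    case 2
    have "u \<in> subspace_sum (cnj_vec ` F q) (W_C W (p + q - 1))" by (rule FbW_mono) (use dg_Fb[OF u, of 0] in auto)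
    moreover have "v \<in> subspace_sum (cnj_vec ` F q') (W_C W (p + q - 1))" by (rule FbW_mono) (use dg_Fb[OF v, of 0] k in auto)
    ultimately show ?thesis using QC_Fb W 2 by blast
  qed
qed

lemma deligne_eq: "deligne W F = dg"
  unfolding deligne_def using dg_deligne deligne_unique by (rule the_equality)

lemma deligne_component_eq: "deligne_component W F v p q = dg.P (p, q) *v v"
  by (simp add: deligne_component_def deligne_eq dg.P_eq bg_comp_def)

lemma P_W: "dg.P (p, q) *v v \<in> W_C W (p + q)"
  using dg_W dg.P_mem by blast

abbreviation "mh \<equiv> mh_metric W Q F"

lemma mh_eq: "mh u v = (\<Sum>(p, q)\<in>dg.K. \<i> powi (p - q) * Q_C Q (p + q) (dg.P (p, q) *v u) (cnj_vec (dg.P (p, q) *v v)))"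
  by (simp add: mh_metric_def deligne_eq deligne_component_eq bg_supp_def)

text \<open>A nonzero vector of \<open>dg p q\<close> has a nonzero class in the graded piece by
  \<open>dg_W_inter\<close>, so the second bilinear relation applies to it.\<close>

lemma dg_pos:
  assumes u: "u \<in> dg p q" "u \<noteq> 0" shows "0 < Re (\<i> powi (p - q) * Q_C Q (p + q) u (cnj_vec u))"
proof -
  have "u \<in> subspace_sum (cnj_vec ` F q) (W_C W (p + q - 1))" by (rule FbW_mono) (use dg_Fb[OF u(1), of 0] in auto)
  then have "u \<in> H_gr W F p q" using dg_F[OF u(1)] dg_W[OF u(1)]
    by (simp add: H_gr_def F_gr_iff cnj_F_gr_iff FW_left)
  moreover have "u \<notin> W_C W (p + q - 1)" using dg_W_inter u by blast
  ultimately show ?thesis using pol unfolding graded_polarized_def by blast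
qed

text \<open>The sign that makes the metric Hermitian: conjugating the power of \<open>\<i>\<close>
  compensates the parity of the form \<open>Q (p + q)\<close>.\<close>

lemma i_powi_cnj: "cnj (\<i> powi (p - q)) * (- 1) powi (p + q) = \<i> powi (p - q)"
proof -
  have "cnj (\<i> powi (p - q)) = (- 1 * \<i>) powi (p - q)" by simp
  also have "\<dots> = (- 1) powi (p - q) * \<i> powi (p - q)" by (rule power_int_mult_distrib)
  finally have "cnj (\<i> powi (p - q)) * (- 1) powi (p + q) = ((- 1) powi (p - q) * (- 1) powi (p + q)) * \<i> powi (p - q)"
    by simp
  also have "(- 1 :: complex) powi (p - q) * (- 1) powi (p + q) = (- 1) powi (2 * p)"
    by (simp flip: power_int_add)
  also have "\<dots> = 1" by simp
  finally show ?thesis by simp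
qed

sublocale h: hermitian "mh_metric W Q F"
proof
  fix u v w c
  show "mh (u + v) w = mh u w + mh v w"
    by (simp add: mh_eq matrix_vector_right_distrib QC_add P_W distrib_left sum.distrib case_prod_unfold)
  show "mh (c *s u) v = c * mh u v"
    by (simp add: mh_eq cscale_vec QC_scale P_W sum_distrib_left case_prod_unfold mult_ac)
  show "mh v u = cnj (mh u v)"
    unfolding mh_eq cnj_sum
  proof (intro sum.cong refl)
    fix x assume "x \<in> dg.K"
    obtain p q where x: "x = (p, q)" by force
    let ?u = "dg.P x *v u" and ?v = "dg.P x *v v"
    have W: "?u \<in> W_C W (p + q)" "?v \<in> W_C W (p + q)" using P_W by (auto simp: x)
    have "cnj (\<i> powi (p - q) * Q_C Q (p + q) ?u (cnj_vec ?v)) = cnj (\<i> powi (p - q)) * Q_C Q (p + q) (cnj_vec ?u) ?v"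
      using QC_cnj[of ?u "p + q" "cnj_vec ?v"] W by simp
    also have "\<dots> = cnj (\<i> powi (p - q)) * (- 1) powi (p + q) * Q_C Q (p + q) ?v (cnj_vec ?u)"
      using QC_sym[of ?v "p + q" "cnj_vec ?u"] W by simp
    also have "\<dots> = \<i> powi (p - q) * Q_C Q (p + q) ?v (cnj_vec ?u)" by (simp only: i_powi_cnj)
    finally show "(case x of (p, q) \<Rightarrow> \<i> powi (p - q) * Q_C Q (p + q) (dg.P (p, q) *v v) (cnj_vec (dg.P (p, q) *v u))) =
      cnj (case x of (p, q) \<Rightarrow> \<i> powi (p - q) * Q_C Q (p + q) (dg.P (p, q) *v u) (cnj_vec (dg.P (p, q) *v v)))"
      by (simp add: x)
  qed
  assume u: "u \<noteq> 0"
  have ge: "0 \<le> Re (case x of (p, q) \<Rightarrow> \<i> powi (p - q) * Q_C Q (p + q) (dg.P (p, q) *v u) (cnj_vec (dg.P (p, q) *v u)))" for x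
    using dg_pos[of "dg.P x *v u" "fst x" "snd x"] P_W[of "fst x" "snd x" u] dg.P_mem'[of x u]
    by (cases x; cases "dg.P x *v u = 0") (auto simp: less_imp_le vec.subspace_0)
  obtain x where x: "x \<in> dg.K" "dg.P x *v u \<noteq> 0"
    using u dg.P_sum[of u] by (metis sum.neutral)
  show "0 < Re (mh u u)"
    unfolding mh_eq Re_sum
    by (rule sum_pos2[OF _ x(1)]) (use dg_pos[of "dg.P x *v u" "fst x" "snd x"] x dg.P_mem'[of x u] ge in \<open>auto simp: case_prod_unfold\<close>)
qed

lemma mh_adjoint_eq: "mh_adjoint W Q F = h.hadj"
  by (intro ext) (simp add: mh_adjoint_def h.hadj_def)

lemma mh_metric_End_eq: "mh_metric_End W Q F = h.hE"
  by (intro ext) (simp add: mh_metric_End_def h.hE_def mh_adjoint_eq)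

lemma orth_proj_eq: "orth_proj W Q F = h.hproj"
  by (intro ext) (simp add: orth_proj_def h.hproj_def mh_metric_End_eq)

end

section \<open>Calculus of matrices and the Cayley transform\<close>

lemma bounded_linear_entry: "bounded_linear (\<lambda>X :: complex ^ 'n::finite ^ 'n. X $ i $ j)"
  by (intro bounded_linear_compose[OF bounded_linear_vec_nth] bounded_linear_vec_nth)

lemma differentiable_matI:
  fixes f :: "'a::real_normed_vector \<Rightarrow> complex ^ 'n::finite ^ 'n"
  assumes "\<And>i j. (\<lambda>x. f x $ i $ j) differentiable F" shows "f differentiable F"
proof -
  define u :: "'n \<Rightarrow> 'n \<Rightarrow> complex ^ 'n ^ 'n" where "u i j = (\<chi> a b. if a = i \<and> b = j then 1 else 0)" for i j
  have bl: "bounded_linear (\<lambda>c. cscale c (u i j))" for i j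
    by (intro linear_conv_bounded_linear[THEN iffD1] linearI) (simp_all add: vec_eq_iff algebra_simps)
  have eq: "f x = (\<Sum>i\<in>UNIV. \<Sum>j\<in>UNIV. cscale (f x $ i $ j) (u i j))" for x
  proof -
    have "(\<Sum>i\<in>UNIV. \<Sum>j\<in>UNIV. cscale (f x $ i $ j) (u i j)) $ a $ b = f x $ a $ b" for a b
    proof -
      have "(\<Sum>i\<in>UNIV. \<Sum>j\<in>UNIV. cscale (f x $ i $ j) (u i j)) $ a $ b
         = (\<Sum>i\<in>UNIV. \<Sum>j\<in>UNIV. f x $ i $ j * (if a = i \<and> b = j then 1 else 0))"
        by (simp add: u_def)
      also have "\<dots> = (\<Sum>i\<in>UNIV. \<Sum>j\<in>UNIV. if j = b then (if i = a then f x $ i $ j else 0) else 0)"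
        by (intro sum.cong refl) auto
      finally show ?thesis by (simp add: sum.delta)
    qed
    then show ?thesis by (simp add: vec_eq_iff)
  qed
  have "(\<lambda>x. cscale (f x $ i $ j) (u i j)) differentiable F" for i j
    using assms[of i j] bounded_linear.has_derivative[OF bl[of i j]] unfolding differentiable_def by blast
  then have "(\<lambda>x. \<Sum>i\<in>UNIV. \<Sum>j\<in>UNIV. cscale (f x $ i $ j) (u i j)) differentiable F"
    by (intro differentiable_sum) auto
  then show ?thesis by (subst ext[OF eq])
qed

lemma differentiable_det:
  fixes f :: "'a::real_normed_vector \<Rightarrow> complex ^ 'n::finite ^ 'n"
  assumes "\<And>i j. (\<lambda>x. f x $ i $ j) differentiable (at x within S)"
  shows "(\<lambda>x. det (f x)) differentiable (at x within S)"
proof -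
  have "(\<lambda>x. \<Prod>i\<in>A. f x $ i $ p i) differentiable (at x within S)" if "finite A" for A and p :: "'n \<Rightarrow> 'n"
    using that by (induction A rule: finite_induct) (auto intro: assms differentiable_mult)
  then show ?thesis
    unfolding det_def by (intro differentiable_sum differentiable_mult differentiable_const) auto
qed

text \<open>The matrix of Cramer's rule, with column \<open>i\<close> replaced by the basis vector
  \<open>j\<close>. It exhibits the entries of the inverse as rational functions, hence as
  differentiable and later as holomorphic ones.\<close>

definition cof :: "'n \<Rightarrow> 'n \<Rightarrow> complex ^ 'n::finite ^ 'n \<Rightarrow> complex ^ 'n ^ 'n" where
  "cof i j A = (\<chi> a b. if b = i then (if a = j then 1 else 0) else A $ a $ b)"

lemma matrix_inv_entry:
  assumes "invertible A" shows "matrix_inv A $ i $ j = det (cof i j A) / det A"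
proof -
  have "A *v (\<chi> i. matrix_inv A $ i $ j) = (\<chi> a. if a = j then 1 else 0)"
    using matrix_inv(1)[OF assms]
    by (simp add: vec_eq_iff matrix_matrix_mult_def matrix_vector_mult_def mat_def)
  then have "(\<chi> i. matrix_inv A $ i $ j) = (\<chi> k. det (\<chi> a b. if b = k then (\<chi> a. if a = j then 1 else 0) $ a else A $ a $ b) / det A)"
    using cramer[of A] assms invertible_det_nz[of A] by blast
  then show ?thesis by (simp add: vec_eq_iff cof_def cong: if_cong)
qed

lemma open_invertible: "open {A :: complex ^ 'n::finite ^ 'n. invertible A}"
proof -
  have "continuous_on UNIV (\<lambda>A :: complex ^ 'n ^ 'n. det A)"
    by (intro differentiable_imp_continuous_on)
      (auto simp: differentiable_on_def intro!: differentiable_det bounded_linear_imp_differentiable[OF bounded_linear_entry])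
  then have "open {A :: complex ^ 'n ^ 'n. det A \<noteq> 0}"
    by (intro open_Collect_neq continuous_intros)
  then show ?thesis by (simp add: invertible_det_nz)
qed

lemma differentiable_matrix_inv:
  assumes "invertible (A :: complex ^ 'n::finite ^ 'n)" shows "matrix_inv differentiable (at A)"
proof (rule differentiable_matI)
  fix i j
  have entry: "(\<lambda>A :: complex ^ 'n ^ 'n. A $ a $ b) differentiable (at A)" for a b
    by (rule bounded_linear_imp_differentiable[OF bounded_linear_entry])
  have "(\<lambda>A :: complex ^ 'n ^ 'n. cof i j A $ a $ b) differentiable (at A)" for a b
    by (cases "b = i") (auto simp: cof_def entry)
  then have "(\<lambda>A :: complex ^ 'n ^ 'n. det (cof i j A) / det A) differentiable (at A)"
    by (intro differentiable_divide differentiable_det entry) (use assms in \<open>auto simp: invertible_det_nz\<close>)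
  then obtain D where D: "((\<lambda>A :: complex ^ 'n ^ 'n. det (cof i j A) / det A) has_derivative D) (at A)"
    by (auto simp: differentiable_def)
  have "((\<lambda>A. matrix_inv A $ i $ j) has_derivative D) (at A)"
    by (rule has_derivative_transform_within_open[OF D open_invertible]) (use assms in \<open>auto simp: matrix_inv_entry\<close>)
  then show "(\<lambda>A. matrix_inv A $ i $ j) differentiable (at A)" by (auto simp: differentiable_def)
qed

lemmas has_derivative_matrix_mult = bounded_bilinear.FDERIV[OF bounded_bilinear_matrix_mult]
lemmas continuous_on_matrix_mult = bounded_bilinear.continuous_on[OF bounded_bilinear_matrix_mult]

text \<open>Differentiability is known from Cramer's rule; the value of the derivative follows by
  differentiating the identity between a matrix times its inverse and 1.\<close>

lemma has_derivative_matrix_inv_at: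
  assumes A: "invertible (A :: complex ^ 'n::finite ^ 'n)"
  shows "(matrix_inv has_derivative (\<lambda>H. - (matrix_inv A ** H ** matrix_inv A))) (at A)"
proof -
  obtain D where D: "(matrix_inv has_derivative D) (at A)"
    using differentiable_matrix_inv[OF A] by (auto simp: differentiable_def)
  have "((\<lambda>X. X ** matrix_inv X) has_derivative (\<lambda>H. A ** D H + H ** matrix_inv A)) (at A)"
    by (rule has_derivative_matrix_mult[OF has_derivative_ident D])
  then have "((\<lambda>X. mat 1) has_derivative (\<lambda>H. A ** D H + H ** matrix_inv A)) (at A)"
    by (rule has_derivative_transform_within_open[OF _ open_invertible]) (use A in \<open>auto simp: matrix_inv\<close>)
  then have "(\<lambda>H. A ** D H + H ** matrix_inv A) = (\<lambda>H. 0)"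
    using has_derivative_unique[OF _ has_derivative_const] by blast
  then have "A ** D H + H ** matrix_inv A = 0" for H by metis
  then have "matrix_inv A ** (A ** D H + H ** matrix_inv A) = 0" for H by simp
  then have "D H = - (matrix_inv A ** H ** matrix_inv A)" for H
    by (simp add: matrix_add_ldistrib matrix_inv_cancel[OF A] matrix_mul_assoc[symmetric] eq_neg_iff_add_eq_0)
  then show ?thesis using D by presburger
qed

lemma has_derivative_matrix_inv:
  assumes "(f has_derivative f') (at x within S)" "invertible (f x :: complex ^ 'n::finite ^ 'n)"
  shows "((\<lambda>y. matrix_inv (f y)) has_derivative (\<lambda>h. - (matrix_inv (f x) ** f' h ** matrix_inv (f x)))) (at x within S)"
  using has_derivative_compose[OF assms(1) has_derivative_matrix_inv_at[OF assms(2)]] by simp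

lemma continuous_on_matrix_inv:
  "continuous_on {A :: complex ^ 'n::finite ^ 'n. invertible A} matrix_inv"
  by (intro continuous_at_imp_continuous_on ballI has_derivative_continuous[OF has_derivative_matrix_inv_at]) auto

text \<open>
  The Cayley transform serves as the exponential map: it carries the Lie algebra of a group that is
  defined by invariant subspaces and bilinear forms into the group, and it is rational.
\<close>

definition cay :: "complex ^ 'n ^ 'n \<Rightarrow> complex ^ 'n::finite ^ 'n" where
  "cay X = matrix_inv (mat 1 - X) ** (mat 1 + X)"

definition regular :: "complex ^ 'n ^ 'n \<Rightarrow> bool" where
  "regular (X :: complex ^ 'n::finite ^ 'n) \<longleftrightarrow> invertible (mat 1 - X) \<and> invertible (mat 1 + X)"

lemma invertible_one [simp]: "invertible (mat 1 :: complex ^ 'n::finite ^ 'n)"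
  unfolding invertible_def by (metis matrix_mul_lid)

lemma regular_0 [simp]: "regular 0"
  by (simp add: regular_def)

lemma open_regular: "open {X :: complex ^ 'n::finite ^ 'n. regular X}"
proof -
  have "open ((\<lambda>X. mat 1 - X) -` {A. invertible A} \<inter> (\<lambda>X :: complex ^ 'n ^ 'n. mat 1 + X) -` {A. invertible A})"
    by (intro open_Int open_vimage open_invertible continuous_intros)
  moreover have "(\<lambda>X. mat 1 - X) -` {A. invertible A} \<inter> (\<lambda>X :: complex ^ 'n ^ 'n. mat 1 + X) -` {A. invertible A} = {X. regular X}"
    by (auto simp: regular_def)
  ultimately show ?thesis by metis
qed

lemma cay_0 [simp]: "cay 0 = mat 1"
  by (simp add: cay_def matrix_inv_unique)

lemma one_commute: "(mat 1 - X) ** (mat 1 + X) = (mat 1 + X) ** (mat 1 - X :: complex ^ 'n::finite ^ 'n)"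
  by (simp add: matrix_diff_distrib matrix_add_ldistrib matrix_add_rdistrib')

lemma cay_alt:
  assumes "regular X" shows "cay X = (mat 1 + X) ** matrix_inv (mat 1 - X)"
proof -
  have i: "invertible (mat 1 - X)" using assms by (simp add: regular_def)
  have "cay X = matrix_inv (mat 1 - X) ** ((mat 1 + X) ** (mat 1 - X)) ** matrix_inv (mat 1 - X)"
    by (simp add: cay_def matrix_mul_assoc matrix_inv_cancel[OF i])
  also have "\<dots> = (mat 1 + X) ** matrix_inv (mat 1 - X)"
    by (simp add: one_commute[symmetric] matrix_mul_assoc matrix_inv[OF i])
  finally show ?thesis .
qed

lemma cay_minus: assumes "regular X" shows "cay X ** cay (- X) = mat 1"
proof -
  have i: "invertible (mat 1 - X)" "invertible (mat 1 + X)" using assms by (auto simp: regular_def)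
  have "cay X ** cay (- X) = matrix_inv (mat 1 - X) ** ((mat 1 + X) ** (matrix_inv (mat 1 + X) ** (mat 1 - X)))"
    by (simp add: cay_def matrix_mul_assoc)
  then show ?thesis by (simp add: matrix_inv_cancel[OF i(2)] matrix_inv[OF i(1)])
qed

lemma cay_invertible: "regular X \<Longrightarrow> invertible (cay X)"
  using cay_minus by (meson invertible_right_inverse)

lemma matrix_inv_cnj:
  assumes "invertible X" shows "matrix_inv (cnj_mat X) = cnj_mat (matrix_inv X)"
  by (rule matrix_inv_unique) (simp add: cnj_mat_mult[symmetric] matrix_inv[OF assms])

lemma cay_cnj: "regular X \<Longrightarrow> cnj_mat (cay X) = cay (cnj_mat X)"
  using matrix_inv_cnj[of "mat 1 - X"] by (simp add: cay_def cnj_mat_mult regular_def)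

definition cayD :: "complex ^ 'n ^ 'n \<Rightarrow> complex ^ 'n ^ 'n \<Rightarrow> complex ^ 'n::finite ^ 'n" where
  "cayD X H = matrix_inv (mat 1 - X) ** H + matrix_inv (mat 1 - X) ** H ** matrix_inv (mat 1 - X) ** (mat 1 + X)"

lemma cay_has_derivative: "regular X \<Longrightarrow> (cay has_derivative cayD X) (at X)"
proof -
  assume "regular X"
  then have i: "invertible (mat 1 - X)" by (simp add: regular_def)
  have d: "((\<lambda>X. mat 1 - X) has_derivative (\<lambda>H. - H)) (at X)"
    and d': "((\<lambda>X. mat 1 + X) has_derivative (\<lambda>H. H)) (at X)"
    by (auto intro!: derivative_eq_intros)
  show ?thesis
    unfolding cay_def[abs_def] cayD_def[abs_def]
    using has_derivative_matrix_mult[OF has_derivative_matrix_inv[OF d i] d'] by (simp add: matrix_neg)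
qed

lemma cayD_0: "cayD 0 H = 2 *\<^sub>R H"
  by (simp add: cayD_def matrix_inv_unique scaleR_2)

lemma continuous_on_cay: "continuous_on {X. regular X} cay"
  by (intro continuous_at_imp_continuous_on ballI has_derivative_continuous[OF cay_has_derivative]) auto

lemma continuous_on_cayD:
  assumes f: "continuous_on S f" and g: "continuous_on S g" and "\<And>x. x \<in> S \<Longrightarrow> regular (f x)"
  shows "continuous_on S (\<lambda>x. cayD (f x) (g x))"
proof -
  have "continuous_on S (\<lambda>x. matrix_inv (mat 1 - f x))"
    by (rule continuous_on_compose2[OF continuous_on_matrix_inv])
      (use assms in \<open>auto simp: regular_def intro!: continuous_intros\<close>)
  then show ?thesis
    unfolding cayD_def by (intro continuous_intros continuous_on_matrix_mult f g) 
qed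

text \<open>The inverse function theorem for a product of Cayley transforms whose directions add up
  to the identity. The fourth factor lets the product fill an open set of all matrices, so no
  submanifold structure on the group is required; that it is trivial on the group is shown where the
  factorization is used.\<close>

theorem cay_factorization:
  fixes L1 L2 L3 L4 :: "complex ^ 'n::finite ^ 'n \<Rightarrow> complex ^ 'n ^ 'n"
  assumes lin: "linear L1" "linear L2" "linear L3" "linear L4"
    and sum: "\<And>X. L1 X + L2 X + L3 X + L4 X = X"
  obtains V \<Phi> where "open V" "mat 1 \<in> V" "\<Phi> (mat 1) = 0"
    "\<And>g. g \<in> V \<Longrightarrow> g = cay (L1 (\<Phi> g)) ** cay (L2 (\<Phi> g)) ** cay (L3 (\<Phi> g)) ** cay (L4 (\<Phi> g))"
    "\<And>g. g \<in> V \<Longrightarrow> regular (L1 (\<Phi> g)) \<and> regular (L2 (\<Phi> g)) \<and> regular (L3 (\<Phi> g)) \<and> regular (L4 (\<Phi> g))"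
    "\<And>g. g \<in> V \<Longrightarrow> \<Phi> differentiable (at g)"
    "(\<Phi> has_derivative (\<lambda>H. (1/2) *\<^sub>R H)) (at (mat 1))"
proof -
  have bl: "bounded_linear L1" "bounded_linear L2" "bounded_linear L3" "bounded_linear L4"
    using lin by (auto simp: linear_conv_bounded_linear)
  have cL: "continuous_on S L1" "continuous_on S L2" "continuous_on S L3" "continuous_on S L4" for S
    using bl by (auto intro: linear_continuous_on)
  define U where "U = {X. regular (L1 X) \<and> regular (L2 X) \<and> regular (L3 X) \<and> regular (L4 X)}"
  have "open (L1 -` {X. regular X} \<inter> L2 -` {X. regular X} \<inter> L3 -` {X. regular X} \<inter> L4 -` {X. regular X})"
    by (intro open_Int open_vimage open_regular cL)
  moreover have "L1 -` {X. regular X} \<inter> L2 -` {X. regular X} \<inter> L3 -` {X. regular X} \<inter> L4 -` {X. regular X} = U"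
    by (auto simp: U_def)
  ultimately have U: "open U" by metis
  have L0: "L1 0 = 0" "L2 0 = 0" "L3 0 = 0" "L4 0 = 0" using lin by (auto simp: linear_0)
  then have U0: "0 \<in> U" by (simp add: U_def)
  define \<Theta> where "\<Theta> X = cay (L1 X) ** cay (L2 X) ** cay (L3 X) ** cay (L4 X)" for X
  define D where "D X H = cay (L1 X) ** cay (L2 X) ** cay (L3 X) ** cayD (L4 X) (L4 H) +
     (cay (L1 X) ** cay (L2 X) ** cayD (L3 X) (L3 H) +
       (cay (L1 X) ** cayD (L2 X) (L2 H) + cayD (L1 X) (L1 H) ** cay (L2 X)) ** cay (L3 X)) ** cay (L4 X)" for X H
  have der: "(\<Theta> has_derivative D X) (at X)" if "X \<in> U" for X
  proof -
    have 1: "((\<lambda>X. cay (L1 X)) has_derivative (\<lambda>H. cayD (L1 X) (L1 H))) (at X)"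
      "((\<lambda>X. cay (L2 X)) has_derivative (\<lambda>H. cayD (L2 X) (L2 H))) (at X)"
      "((\<lambda>X. cay (L3 X)) has_derivative (\<lambda>H. cayD (L3 X) (L3 H))) (at X)"
      "((\<lambda>X. cay (L4 X)) has_derivative (\<lambda>H. cayD (L4 X) (L4 H))) (at X)"
      using that unfolding U_def
      by (auto intro!: has_derivative_compose[OF bounded_linear_imp_has_derivative cay_has_derivative] bl)
    show ?thesis
      unfolding \<Theta>_def[abs_def] D_def[abs_def]
      by (intro has_derivative_matrix_mult 1)
  qed
  define f' where "f' X = Blinfun (D X)" for X
  have app: "blinfun_apply (f' X) = D X" if "X \<in> U" for X
    using der[OF that] unfolding f'_def by (intro bounded_linear_Blinfun_apply has_derivative_bounded_linear)
  have cont: "continuous_on U f'"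
  proof (rule continuous_on_blinfun_componentwise)
    fix i :: "complex ^ 'n ^ 'n"
    have cc: "continuous_on U (\<lambda>X. cay (L1 X))" "continuous_on U (\<lambda>X. cay (L2 X))"
      "continuous_on U (\<lambda>X. cay (L3 X))" "continuous_on U (\<lambda>X. cay (L4 X))"
      by (auto intro!: continuous_on_compose2[OF continuous_on_cay cL(1)] continuous_on_compose2[OF continuous_on_cay cL(2)]
        continuous_on_compose2[OF continuous_on_cay cL(3)] continuous_on_compose2[OF continuous_on_cay cL(4)] simp: U_def)
    have "continuous_on U (\<lambda>X. D X i)"
      unfolding D_def
      by (intro continuous_intros continuous_on_matrix_mult cc continuous_on_cayD cL) (auto simp: U_def)
    then show "continuous_on U (\<lambda>X. blinfun_apply (f' X) i)"
      by (rule continuous_on_eq) (simp add: app)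
  qed
  \<comment> \<open>Each Cayley factor doubles its direction at 0, and the four directions add up to
    \<open>H\<close>; the derivative of the inverse is therefore halving.\<close>
  have D0: "D 0 H = 2 *\<^sub>R H" for H
  proof -
    have "D 0 H = 2 *\<^sub>R (L1 H + L2 H + L3 H + L4 H)"
      by (simp add: D_def L0 cayD_0 scaleR_add_right)
    then show ?thesis by (simp add: sum)
  qed
  define i' where "i' = (Blinfun (\<lambda>H. (1/2) *\<^sub>R H) :: (complex ^ 'n ^ 'n) \<Rightarrow>\<^sub>L (complex ^ 'n ^ 'n))"
  have i': "blinfun_apply i' = (\<lambda>H. (1/2) *\<^sub>R H)"
    unfolding i'_def by (intro bounded_linear_Blinfun_apply bounded_linear_intros)
  have inv: "i' o\<^sub>L f' 0 = id_blinfun"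
    by (rule blinfun_eqI) (simp add: i' app U0 D0)
  obtain U' V \<Phi> g' where *: "open U'" "U' \<subseteq> U" "0 \<in> U'" "open V" "\<Theta> 0 \<in> V" "homeomorphism U' V \<Theta> \<Phi>"
    "\<And>y. y \<in> V \<Longrightarrow> (\<Phi> has_derivative (g' y)) (at y)"
    "\<And>y. y \<in> V \<Longrightarrow> g' y = inv (blinfun_apply (f' (\<Phi> y)))"
    using inverse_function_theorem[OF U _ cont U0 inv, of \<Theta>] der app by metis
  have T0: "\<Theta> 0 = mat 1" by (simp add: \<Theta>_def L0)
  have P0: "\<Phi> (mat 1) = 0" using homeomorphism_apply1[OF *(6) *(3)] by (simp add: T0)
  have PU: "\<Phi> y \<in> U" if "y \<in> V" for y
    using that *(2) homeomorphism_image2[OF *(6)] by blast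
  show thesis
  proof (rule that)
    show "open V" by fact
    show "mat 1 \<in> V" using *(5) by (simp add: T0)
    show "\<Phi> (mat 1) = 0" by fact
    show "g = cay (L1 (\<Phi> g)) ** cay (L2 (\<Phi> g)) ** cay (L3 (\<Phi> g)) ** cay (L4 (\<Phi> g))" if "g \<in> V" for g
      using homeomorphism_apply2[OF *(6) that] by (simp add: \<Theta>_def)
    show "regular (L1 (\<Phi> g)) \<and> regular (L2 (\<Phi> g)) \<and> regular (L3 (\<Phi> g)) \<and> regular (L4 (\<Phi> g))" if "g \<in> V" for g
      using PU[OF that] by (simp add: U_def)
    show "\<Phi> differentiable (at g)" if "g \<in> V" for g
      using *(7)[OF that] by (auto simp: differentiable_def)
    have "g' (mat 1) = (\<lambda>H. (1/2) *\<^sub>R H)"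
    proof -
      have "g' (mat 1) = inv (\<lambda>H. 2 *\<^sub>R H)"
        using *(8)[of "mat 1"] *(5) T0 P0 app[OF U0] by (simp add: D0 fun_eq_iff[symmetric] ext[of "D 0"])
      also have "\<dots> = (\<lambda>H. (1/2) *\<^sub>R H)" by (rule inv_unique_comp) (auto simp: fun_eq_iff)
      finally show ?thesis .
    qed
    then show "(\<Phi> has_derivative (\<lambda>H. (1/2) *\<^sub>R H)) (at (mat 1))"
      using *(7)[of "mat 1"] *(5) T0 by simp
  qed
qed

section \<open>The group and its Lie algebra\<close>

lemma scaleR_vec: "r *\<^sub>R v = complex_of_real r *s (v :: complex ^ 'n)"
  by (simp add: vec_eq_iff complex_eq_iff)

lemma vec_subspace_imp_subspace:
  fixes S :: "(complex ^ 'n) set"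
  assumes "vec.subspace S" shows "subspace S"
  unfolding subspace_def
proof (intro conjI ballI allI)
  show "0 \<in> S" "\<And>x y. x \<in> S \<Longrightarrow> y \<in> S \<Longrightarrow> x + y \<in> S"
    using assms by (auto simp: vec.subspace_def)
  fix c x assume "x \<in> S"
  then have "complex_of_real c *s x \<in> S" using assms by (auto simp: vec.subspace_def)
  moreover have "complex_of_real c *s x = c *\<^sub>R x" by (simp add: scaleR_vec)
  ultimately show "c *\<^sub>R x \<in> S" by simp
qed

lemma has_vector_derivative_cong_nhds:
  assumes "eventually (\<lambda>s. f s = g s) (nhds t)"
  shows "(f has_vector_derivative D) (at t) \<longleftrightarrow> (g has_vector_derivative D) (at t)"
  by (rule has_vector_derivative_cong_ev)
    (use assms eventually_nhds_x_imp_x[OF assms] in \<open>auto elim: eventually_mono\<close>)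

text \<open>The inner product with any vector orthogonal to \<open>S\<close> vanishes along the
  curve, hence so does its derivative, and \<open>S\<close> is the orthogonal complement of its
  orthogonal complement.\<close>

lemma has_vector_derivative_in_subspace:
  fixes f :: "real \<Rightarrow> 'a::euclidean_space"
  assumes S: "subspace S" and f: "(f has_vector_derivative D) (at t)" and ev: "eventually (\<lambda>s. f s \<in> S) (nhds t)"
  shows "D \<in> S"
proof -
  have "inner w D = 0" if w: "w \<in> orthogonal_comp S" for w
  proof -
    have "((\<lambda>s. inner w (f s)) has_vector_derivative inner w D) (at t)"
      using bounded_linear.has_vector_derivative[OF bounded_linear_inner_right f] by simp
    moreover have "((\<lambda>s. inner w (f s)) has_vector_derivative 0) (at t)"
    proof -
      have "eventually (\<lambda>s. inner w (f s) = 0) (nhds t)"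
        using ev by eventually_elim (use w in \<open>auto simp: orthogonal_comp_def orthogonal_def inner_commute\<close>)
      then show ?thesis by (subst has_vector_derivative_cong_nhds) auto
    qed
    ultimately show ?thesis by (rule vector_derivative_unique_at)
  qed
  then have "D \<in> orthogonal_comp (orthogonal_comp S)"
    by (auto simp: orthogonal_comp_def orthogonal_def)
  then show ?thesis using orthogonal_comp_self[OF S] by simp
qed

text \<open>\<open>lie_algebra\<close> asks for a curve that stays in the group at all times. A
  curve that does so only near 0 is redefined as the identity elsewhere, which leaves the derivative
  alone.\<close>

lemma lie_algebraI:
  assumes "\<gamma> 0 = mat 1" "(\<gamma> has_vector_derivative X) (at 0)" "eventually (\<lambda>t. \<gamma> t \<in> G) (nhds 0)" "mat 1 \<in> G"
  shows "X \<in> lie_algebra G"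
proof -
  define \<delta> where "\<delta> t = (if \<gamma> t \<in> G then \<gamma> t else mat 1)" for t
  have "eventually (\<lambda>t. \<gamma> t = \<delta> t) (nhds 0)"
    using assms(3) by eventually_elim (simp add: \<delta>_def)
  then have "(\<delta> has_vector_derivative X) (at 0)"
    using has_vector_derivative_cong_nhds assms(2) by blast
  then show ?thesis unfolding lie_algebra_def using assms(1,4)
    by (intro CollectI exI[of _ \<delta>]) (auto simp: \<delta>_def)
qed

lemma invertible_image_subspace:
  fixes A :: "complex ^ 'n::finite ^ 'n"
  assumes S: "vec.subspace S" and A: "invertible A" and inv: "\<And>v. v \<in> S \<Longrightarrow> A *v v \<in> S"
  shows "(*v) A ` S = S"
proof (rule vec.subspace_dim_equal)
  show "vec.subspace ((*v) A ` S)" by (rule vec.linear_subspace_image[OF matrix_vector_mul_linear_gen S])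
  have "inj ((*v) A)" by (rule inj_on_inverseI[of _ "(*v) (matrix_inv A)"]) (simp add: matrix_inv_cancel[OF A])
  then have "vec.dim ((*v) A ` S) = vec.dim S"
    by (intro vec.dim_image_eq) (auto intro: inj_on_subset)
  then show "vec.dim S \<le> vec.dim ((*v) A ` S)" by simp
qed (use S inv in auto)

lemma image_eq_inv:
  fixes A :: "complex ^ 'n::finite ^ 'n"
  assumes A: "invertible A" and "(*v) A ` S = T" shows "(*v) (matrix_inv A) ` T = S"
  using assms(2) by (auto simp: image_image matrix_inv_cancel[OF A])

text \<open>\<open>X\<close> and \<open>cay X\<close> determine each other rationally:
  \<open>cay X + mat 1\<close> is twice the inverse of \<open>mat 1 - X\<close>. An invertible
  matrix mapping a finite-dimensional subspace into itself maps it onto itself, so invariance passes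
  both ways.\<close>

lemma cay_preserves:
  assumes X: "regular X" and S: "vec.subspace S"
  shows "(*v) (cay X) ` S = S \<longleftrightarrow> (\<forall>v\<in>S. X *v v \<in> S)"
proof
  have i: "invertible (mat 1 - X)" "invertible (mat 1 + X)" using X by (auto simp: regular_def)
  assume c: "(*v) (cay X) ` S = S"
  have e: "cay X + mat 1 = cscale 2 (matrix_inv (mat 1 - X))"
  proof -
    have "cay X + mat 1 = (mat 1 + X) ** matrix_inv (mat 1 - X) + (mat 1 - X) ** matrix_inv (mat 1 - X)"
      by (simp add: cay_alt[OF X] matrix_inv[OF i(1)])
    also have "\<dots> = ((mat 1 + X) + (mat 1 - X)) ** matrix_inv (mat 1 - X)"
      by (simp only: matrix_add_rdistrib')
    also have "(mat 1 + X) + (mat 1 - X) = cscale 2 (mat 1)"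
      by (simp add: vec_eq_iff)
    finally show ?thesis by (simp add: cscale_mult)
  qed
  have "matrix_inv (mat 1 - X) *v v \<in> S" if v: "v \<in> S" for v
  proof -
    have "(cay X + mat 1) *v v \<in> S"
      using c v S by (auto simp: matrix_vector_mult_add_rdistrib intro!: vec.subspace_add)
    then have "(1/2) *s ((cay X + mat 1) *v v) \<in> S" using S by (simp add: vec.subspace_scale)
    then show ?thesis by (simp add: e cscale_vec)
  qed
  then have "(*v) (matrix_inv (mat 1 - X)) ` S = S"
    by (intro invertible_image_subspace S invertible_inv[OF i(1)])
  then have im: "(*v) (mat 1 - X) ` S = S" using image_eq_inv[OF invertible_inv(1)[OF i(1)]] invertible_inv[OF i(1)] by metis
  show "\<forall>v\<in>S. X *v v \<in> S"
  proof
    fix v assume v: "v \<in> S"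
    then have "v - (mat 1 - X) *v v \<in> S" using im S by (intro vec.subspace_diff) auto
    then show "X *v v \<in> S" by (simp add: matrix_vector_mult_diff_rdistrib)
  qed
next
  have i: "invertible (mat 1 - X)" "invertible (mat 1 + X)" using X by (auto simp: regular_def)
  assume *: "\<forall>v\<in>S. X *v v \<in> S"
  have 1: "(*v) (mat 1 - X) ` S = S"
    using * S by (intro invertible_image_subspace i) (auto simp: matrix_vector_mult_diff_rdistrib vec.subspace_diff)
  have 2: "(*v) (mat 1 + X) ` S = S"
    using * S by (intro invertible_image_subspace i) (auto simp: matrix_vector_mult_add_rdistrib vec.subspace_add)
  have "(*v) (cay X) ` S = (*v) (matrix_inv (mat 1 - X)) ` ((*v) (mat 1 + X) ` S)"
    by (simp add: image_image cay_def matrix_vector_mul_assoc)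
  then show "(*v) (cay X) ` S = S" using 1 2 image_eq_inv[OF i(1)] by metis
qed

text \<open>The linearized equations of \<open>G_C\<close>; they are shown to be the Lie algebra
  \<open>g_C\<close> in \<open>g_C_eq\<close>.\<close>

definition glie :: "'n::finite weight \<Rightarrow> 'n forms \<Rightarrow> (complex ^ 'n ^ 'n) set" where
  "glie W Q = {X. (\<forall>k. \<forall>v\<in>W_C W k. X *v v \<in> W_C W k) \<and>
     (\<forall>k. \<forall>u\<in>W_C W k. \<forall>v\<in>W_C W k. Q_C Q k (X *v u) v + Q_C Q k u (X *v v) = 0)}"

lemma G_C_invertible: "g \<in> G_C W Q \<Longrightarrow> invertible g"
  and G_C_W: "g \<in> G_C W Q \<Longrightarrow> (*v) g ` W_C W k = W_C W k"
  and G_C_Q: "g \<in> G_C W Q \<Longrightarrow> u \<in> W_C W k \<Longrightarrow> v \<in> W_C W k \<Longrightarrow> Q_C Q k (g *v u) (g *v v) = Q_C Q k u v"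
  by (auto simp: G_C_def)

lemma G_C_W_mem: "g \<in> G_C W Q \<Longrightarrow> v \<in> W_C W k \<Longrightarrow> g *v v \<in> W_C W k"
  using G_C_W by blast

lemma G_C_one [simp]: "mat 1 \<in> G_C W Q"
  by (auto simp: G_C_def)

lemma G_C_mult:
  assumes "g \<in> G_C W Q" "g' \<in> G_C W Q" shows "g ** g' \<in> G_C W Q"
proof -
  have "(*v) (g ** g') ` W_C W k = W_C W k" for k
    using G_C_W[OF assms(1), of k] G_C_W[OF assms(2), of k]
    by (metis (no_types, lifting) image_cong image_image matrix_vector_mul_assoc)
  then show ?thesis using assms G_C_W_mem[OF assms(2)]
    by (auto simp: G_C_def invertible_mult matrix_vector_mul_assoc[symmetric])
qed

lemma G_C_inv:
  assumes g: "g \<in> G_C W Q" shows "matrix_inv g \<in> G_C W Q"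
proof -
  note i = G_C_invertible[OF g]
  have W: "(*v) (matrix_inv g) ` W_C W k = W_C W k" for k by (rule image_eq_inv[OF i G_C_W[OF g]])
  have Wm: "matrix_inv g *v u \<in> W_C W k" if "u \<in> W_C W k" for k u using W that by blast
  have "Q_C Q k (matrix_inv g *v u) (matrix_inv g *v v) = Q_C Q k u v" if "u \<in> W_C W k" "v \<in> W_C W k" for k u v
    using G_C_Q[OF g Wm[OF that(1)] Wm[OF that(2)]] by (simp add: matrix_inv_cancel[OF i])
  then show ?thesis using W invertible_inv[OF i] by (auto simp: G_C_def)
qed

text \<open>The isotropy group is the case in which \<open>\<S>\<close> consists of the steps of the Hodge filtration.\<close>

definition stab :: "'n::finite weight \<Rightarrow> 'n forms \<Rightarrow> (complex ^ 'n) set set \<Rightarrow> (complex ^ 'n ^ 'n) set" where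
  "stab W Q \<S> = {g \<in> G_C W Q. \<forall>S\<in>\<S>. (*v) g ` S = S}"

lemma isotropy_stab: "isotropy W Q F = stab W Q (range F)"
  by (auto simp: isotropy_def stab_def filt_act_def fun_eq_iff)

lemma G_C_stab: "G_C W Q = stab W Q {}"
  by (simp add: stab_def)

lemma stab_mult:
  assumes "g \<in> stab W Q \<S>" "g' \<in> stab W Q \<S>" shows "g ** g' \<in> stab W Q \<S>"
proof -
  have "(*v) (g ** g') ` S = (*v) g ` ((*v) g' ` S)" for S
    by (simp add: image_image matrix_vector_mul_assoc)
  then show ?thesis using assms by (simp add: stab_def G_C_mult)
qed

lemma stab_inv:
  assumes "g \<in> stab W Q \<S>" shows "matrix_inv g \<in> stab W Q \<S>"
proof -
  have g: "g \<in> G_C W Q" "\<And>S. S \<in> \<S> \<Longrightarrow> (*v) g ` S = S" using assms by (auto simp: stab_def)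
  then show ?thesis using image_eq_inv[OF G_C_invertible[OF g(1)] g(2)] by (simp add: stab_def G_C_inv)
qed

context mixed_hodge begin

lemma mem_W_iff': "v \<in> W_C W k \<longleftrightarrow> (\<Sum>x\<in>{x\<in>dg.K. fst x + snd x \<le> k}. dg.P x) *v v = v"
proof
  assume v: "v \<in> W_C W k"
  have "(\<Sum>x\<in>{x\<in>dg.K. fst x + snd x \<le> k}. dg.P x *v v) = (\<Sum>x\<in>dg.K. dg.P x *v v)"
  proof (rule sum.mono_neutral_left)
    show "\<forall>x\<in>dg.K - {x \<in> dg.K. fst x + snd x \<le> k}. dg.P x *v v = 0"
    proof
      fix x assume "x \<in> dg.K - {x \<in> dg.K. fst x + snd x \<le> k}"
      then show "dg.P x *v v = 0" using v[unfolded mem_W_iff, rule_format, of "fst x" "snd x"]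
        by (auto simp: not_le)
    qed
  qed auto
  then show "(\<Sum>x\<in>{x\<in>dg.K. fst x + snd x \<le> k}. dg.P x) *v v = v"
    by (simp add: dg.sum_matrix_vector dg.P_sum)
next
  assume *: "(\<Sum>x\<in>{x\<in>dg.K. fst x + snd x \<le> k}. dg.P x) *v v = v"
  have "(\<Sum>x\<in>{x\<in>dg.K. fst x + snd x \<le> k}. dg.P x *v v) \<in> W_C W k"
  proof (rule vec.subspace_sum[OF Wc_sub])
    fix x assume "x \<in> {x\<in>dg.K. fst x + snd x \<le> k}"
    then show "dg.P x *v v \<in> W_C W k" using Wc_mono'[OF dg_W[OF dg.P_mem'[of x v]]] by simp
  qed
  then show "v \<in> W_C W k" using * by (simp add: dg.sum_matrix_vector)
qed

text \<open>A projection onto \<open>W_C W k\<close>. The form \<open>Q k\<close> is arbitrary off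
  \<open>W k\<close>; composing with \<open>WP k\<close> yields a form that is bilinear everywhere
  and can be differentiated.\<close>

definition WP where "WP k = (\<Sum>x\<in>{x\<in>dg.K. fst x + snd x \<le> k}. dg.P x)"

lemma WP_id: "v \<in> W_C W k \<Longrightarrow> WP k *v v = v"
  by (simp add: WP_def mem_W_iff')

lemma WP_mem: "WP k *v v \<in> W_C W k"
  unfolding WP_def dg.sum_matrix_vector
proof (rule vec.subspace_sum[OF Wc_sub])
  fix x assume "x \<in> {x\<in>dg.K. fst x + snd x \<le> k}"
  then show "dg.P x *v v \<in> W_C W k" using Wc_mono'[OF dg_W[OF dg.P_mem'[of x v]]] by simp
qed

end

context polarized_hodge begin

lemma QC_diff: "u \<in> W_C W k \<Longrightarrow> v \<in> W_C W k \<Longrightarrow> w \<in> W_C W k \<Longrightarrow> Q_C Q k (u - v) w = Q_C Q k u w - Q_C Q k v w"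
  using QC_add[of "u - v" k v w] vec.subspace_diff[OF Wc_sub] by fastforce

lemma QC_diff_right: "u \<in> W_C W k \<Longrightarrow> v \<in> W_C W k \<Longrightarrow> w \<in> W_C W k \<Longrightarrow> Q_C Q k w (u - v) = Q_C Q k w u - Q_C Q k w v"
  using QC_add_right[of "u - v" k v w] vec.subspace_diff[OF Wc_sub] by fastforce

lemma QC_scale_right: "u \<in> W_C W k \<Longrightarrow> w \<in> W_C W k \<Longrightarrow> Q_C Q k w (c *s u) = c * Q_C Q k w u"
  using QC_sym[of "c *s u" k w] QC_sym[of u k w] QC_scale[of u k w c] vec.subspace_scale[OF Wc_sub] by simp

text \<open>On vectors \<open>(mat 1 - X) *v u\<close> the transform acts as
  \<open>mat 1 + X\<close>. The difference of the two values of the form is then twice the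
  infinitesimal expression, and these vectors exhaust \<open>W_C W k\<close>.\<close>

lemma cay_G_C:
  assumes X: "regular X" shows "cay X \<in> G_C W Q \<longleftrightarrow> X \<in> glie W Q"
proof -
  have i: "invertible (mat 1 - X)" "invertible (mat 1 + X)" using X by (auto simp: regular_def)
  have W: "(\<forall>k. (*v) (cay X) ` W_C W k = W_C W k) \<longleftrightarrow> (\<forall>k. \<forall>v\<in>W_C W k. X *v v \<in> W_C W k)"
    using cay_preserves[OF X] by simp
  have "(\<forall>k. \<forall>u\<in>W_C W k. \<forall>v\<in>W_C W k. Q_C Q k (cay X *v u) (cay X *v v) = Q_C Q k u v) \<longleftrightarrow>
        (\<forall>k. \<forall>u\<in>W_C W k. \<forall>v\<in>W_C W k. Q_C Q k (X *v u) v + Q_C Q k u (X *v v) = 0)"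
    if XW: "\<forall>k. \<forall>v\<in>W_C W k. X *v v \<in> W_C W k"
  proof -
    have key: "Q_C Q k (cay X *v ((mat 1 - X) *v u)) (cay X *v ((mat 1 - X) *v v)) = Q_C Q k ((mat 1 - X) *v u) ((mat 1 - X) *v v)
      \<longleftrightarrow> Q_C Q k (X *v u) v + Q_C Q k u (X *v v) = 0" if "u \<in> W_C W k" "v \<in> W_C W k" for k u v
    proof -
      have "cay X *v ((mat 1 - X) *v w) = (mat 1 + X) *v w" for w
        by (simp add: matrix_vector_mul_assoc cay_alt[OF X] matrix_inv_cancel[OF i(1)])
      then have c: "cay X *v ((mat 1 - X) *v w) = w + X *v w" "(mat 1 - X) *v w = w - X *v w" for w
        by (simp_all add: matrix_vector_mult_add_rdistrib matrix_vector_mult_diff_rdistrib)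
      have Xuv: "X *v u \<in> W_C W k" "X *v v \<in> W_C W k" using XW that by auto
      have "Q_C Q k (u + X *v u) (v + X *v v) - Q_C Q k (u - X *v u) (v - X *v v) =
          2 * (Q_C Q k (X *v u) v + Q_C Q k u (X *v v))"
        using that Xuv vec.subspace_add[OF Wc_sub] vec.subspace_diff[OF Wc_sub]
        by (simp add: QC_add QC_add_right QC_diff QC_diff_right)
      then show ?thesis unfolding c(1) unfolding c(2) eq_iff_diff_eq_0[of "Q_C Q k (u + X *v u) (v + X *v v)"]
        by (simp del: distrib_left_numeral)
    qed
    have im: "(*v) (mat 1 - X) ` W_C W k = W_C W k" for k
      using XW by (intro invertible_image_subspace i Wc_sub) (auto simp: matrix_vector_mult_diff_rdistrib vec.subspace_diff)
    have im': "(mat 1 - X) *v w \<in> W_C W k" if "w \<in> W_C W k" for w k using im that by blast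
    show ?thesis
    proof (intro iffI allI ballI)
      fix k u v assume *: "\<forall>k. \<forall>u\<in>W_C W k. \<forall>v\<in>W_C W k. Q_C Q k (cay X *v u) (cay X *v v) = Q_C Q k u v"
        and uv: "u \<in> W_C W k" "v \<in> W_C W k"
      then show "Q_C Q k (X *v u) v + Q_C Q k u (X *v v) = 0"
        using key[OF uv] im' by blast
    next
      fix k u v assume *: "\<forall>k. \<forall>u\<in>W_C W k. \<forall>v\<in>W_C W k. Q_C Q k (X *v u) v + Q_C Q k u (X *v v) = 0"
        and "u \<in> W_C W k" "v \<in> W_C W k"
      then obtain u' v' where uv: "u = (mat 1 - X) *v u'" "v = (mat 1 - X) *v v'" "u' \<in> W_C W k" "v' \<in> W_C W k"
      proof -
        have "u \<in> (*v) (mat 1 - X) ` W_C W k" "v \<in> (*v) (mat 1 - X) ` W_C W k"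
          using im \<open>u \<in> W_C W k\<close> \<open>v \<in> W_C W k\<close> by simp_all
        then show ?thesis using that by blast
      qed
      show "Q_C Q k (cay X *v u) (cay X *v v) = Q_C Q k u v"
        unfolding uv using key[OF uv(3,4)] * uv(3,4) by blast
    qed
  qed
  then show ?thesis using W cay_invertible[OF X] unfolding G_C_def glie_def by blast
qed

lemma csub_glie: "csub (glie W Q)"
proof (rule csubI)
  show "0 \<in> glie W Q" by (auto simp: glie_def vec.subspace_0)
next
  fix X Y assume XY: "X \<in> glie W Q" "Y \<in> glie W Q"
  show "X + Y \<in> glie W Q"
    unfolding glie_def mem_Collect_eq
  proof (intro conjI allI ballI)
    fix k v assume "v \<in> W_C W k" then show "(X + Y) *v v \<in> W_C W k"
      using XY by (auto simp: glie_def matrix_vector_mult_add_rdistrib vec.subspace_add)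
  next
    fix k u v assume uv: "u \<in> W_C W k" "v \<in> W_C W k"
    then have "X *v u \<in> W_C W k" "Y *v u \<in> W_C W k" "X *v v \<in> W_C W k" "Y *v v \<in> W_C W k"
      "Q_C Q k (X *v u) v + Q_C Q k u (X *v v) = 0" "Q_C Q k (Y *v u) v + Q_C Q k u (Y *v v) = 0"
      using XY by (auto simp: glie_def)
    then show "Q_C Q k ((X + Y) *v u) v + Q_C Q k u ((X + Y) *v v) = 0"
      using uv by (simp add: matrix_vector_mult_add_rdistrib QC_add QC_add_right algebra_simps)
  qed
next
  fix c X assume X: "X \<in> glie W Q"
  show "cscale c X \<in> glie W Q"
    unfolding glie_def mem_Collect_eq
  proof (intro conjI allI ballI)
    fix k v assume "v \<in> W_C W k" then show "cscale c X *v v \<in> W_C W k"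
      using X by (auto simp: glie_def cscale_vec vec.subspace_scale)
  next
    fix k u v assume uv: "u \<in> W_C W k" "v \<in> W_C W k"
    then have "X *v u \<in> W_C W k" "X *v v \<in> W_C W k" "Q_C Q k (X *v u) v + Q_C Q k u (X *v v) = 0"
      using X by (auto simp: glie_def)
    then show "Q_C Q k (cscale c X *v u) v + Q_C Q k u (cscale c X *v v) = 0"
      using uv by (simp add: cscale_vec QC_scale QC_scale_right distrib_left[symmetric])
  qed
qed

text \<open>Differentiating a curve in the group gives the linear conditions. Conversely a Cayley
  curve in the direction \<open>X\<close> stays in the group, because \<open>cay\<close> respects
  both the form and the invariant subspaces.\<close>

lemma lie_algebra_stab:
  assumes sub: "\<And>S. S \<in> \<S> \<Longrightarrow> vec.subspace S"
  shows "lie_algebra (stab W Q \<S>) = {X \<in> glie W Q. \<forall>S\<in>\<S>. \<forall>v\<in>S. X *v v \<in> S}"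
proof (intro equalityI subsetI)
  fix X assume "X \<in> lie_algebra (stab W Q \<S>)"
  then obtain \<gamma> where \<gamma>: "\<gamma> 0 = mat 1" "\<And>t. \<gamma> t \<in> stab W Q \<S>" "(\<gamma> has_vector_derivative X) (at 0)"
    by (auto simp: lie_algebra_def)
  have blv: "bounded_linear (\<lambda>X :: complex ^ 'a ^ 'a. X *v v)" for v
    by (intro linear_conv_bounded_linear[THEN iffD1] linearI matrix_vector_mult_add_rdistrib)
      (simp add: vec_eq_iff matrix_vector_mult_def scaleR_sum_right)
  have dv: "((\<lambda>t. \<gamma> t *v v) has_vector_derivative X *v v) (at 0)" for v
    by (rule bounded_linear.has_vector_derivative[OF blv \<gamma>(3)])
  have pres: "X *v v \<in> S" if "vec.subspace S" "\<And>t. (*v) (\<gamma> t) ` S = S" "v \<in> S" for S v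
  proof (rule has_vector_derivative_in_subspace[OF vec_subspace_imp_subspace dv])
    show "\<forall>\<^sub>F t in nhds 0. \<gamma> t *v v \<in> S" using that by (intro always_eventually) blast
  qed fact
  have G: "\<gamma> t \<in> G_C W Q" for t using \<gamma>(2) by (auto simp: stab_def)
  have "Q_C Q k (X *v u) v + Q_C Q k u (X *v v) = 0" if uv: "u \<in> W_C W k" "v \<in> W_C W k" for k u v
  proof -
    define B where "B a b = Q_C Q k (WP k *v a) (WP k *v b)" for a b
    have "bilinear B"
      unfolding bilinear_def B_def
      by (auto intro!: linearI simp: matrix_vector_right_distrib QC_add QC_add_right WP_mem)
        (simp_all add: scaleR_vec cscale_vec QC_scale QC_scale_right WP_mem scaleR_conv_of_real)
    then have B: "bounded_bilinear B" by (simp add: bilinear_conv_bounded_bilinear)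
    have "((\<lambda>t. B (\<gamma> t *v u) (\<gamma> t *v v)) has_vector_derivative (B (\<gamma> 0 *v u) (X *v v) + B (X *v u) (\<gamma> 0 *v v))) (at 0)"
      by (rule bounded_bilinear.has_vector_derivative[OF B dv dv])
    moreover have "(\<lambda>t. B (\<gamma> t *v u) (\<gamma> t *v v)) = (\<lambda>t. Q_C Q k u v)"
      using uv G_C_W_mem[OF G] G_C_Q[OF G] by (simp add: B_def WP_id)
    ultimately have "((\<lambda>t. Q_C Q k u v) has_vector_derivative (B u (X *v v) + B (X *v u) v)) (at 0)" by (simp add: \<gamma>(1))
    then have "B u (X *v v) + B (X *v u) v = 0"
      using vector_derivative_unique_at[OF _ has_vector_derivative_const] by blast
    moreover have "X *v u \<in> W_C W k" "X *v v \<in> W_C W k" using pres[OF Wc_sub G_C_W[OF G]] uv by auto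
    ultimately show ?thesis using uv by (simp add: B_def WP_id add.commute)
  qed
  then have "X \<in> glie W Q" using pres[OF Wc_sub G_C_W[OF G]] by (auto simp: glie_def)
  moreover have "X *v v \<in> S" if "S \<in> \<S>" "v \<in> S" for S v
    using that \<gamma>(2) by (intro pres sub) (auto simp: stab_def)
  ultimately show "X \<in> {X \<in> glie W Q. \<forall>S\<in>\<S>. \<forall>v\<in>S. X *v v \<in> S}" by blast
next
  fix X assume X: "X \<in> {X \<in> glie W Q. \<forall>S\<in>\<S>. \<forall>v\<in>S. X *v v \<in> S}"
  \<comment> \<open>The factor 1/2 offsets the doubling by \<open>cay\<close>, so that the velocity
    is exactly \<open>X\<close>.\<close>
  define f where "f t = (t / 2) *\<^sub>R X" for t :: real
  have f0: "f 0 = 0" by (simp add: f_def)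
  have df: "(f has_derivative (\<lambda>t. (t / 2) *\<^sub>R X)) (at 0)"
    unfolding f_def by (auto intro!: derivative_eq_intros)
  have "((\<lambda>t. cay (f t)) has_derivative (\<lambda>t. cayD (f 0) ((t / 2) *\<^sub>R X))) (at 0)"
    by (rule has_derivative_compose[OF df]) (simp add: f0 cay_has_derivative)
  then have d: "((\<lambda>t. cay (f t)) has_vector_derivative X) (at 0)"
    by (simp add: f0 cayD_0 has_vector_derivative_def)
  have "(f \<longlongrightarrow> f 0) (nhds 0)"
    using has_derivative_continuous[OF df] unfolding isCont_def tendsto_at_iff_tendsto_nhds .
  then have reg: "\<forall>\<^sub>F t in nhds 0. regular (f t)"
    using topological_tendstoD[of f "f 0" "nhds 0" "{X. regular X}"] open_regular by (simp add: f0)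
  show "X \<in> lie_algebra (stab W Q \<S>)"
  proof (rule lie_algebraI[OF _ d])
    show "\<forall>\<^sub>F t in nhds 0. cay (f t) \<in> stab W Q \<S>"
      using reg
    proof eventually_elim
      fix t assume r: "regular (f t)"
      have ft: "f t = cscale (of_real (t / 2)) X" by (simp only: f_def cscale_of_real)
      then have "f t \<in> glie W Q" using X csub_scale[OF csub_glie] by auto
      moreover have "(*v) (cay (f t)) ` S = S" if "S \<in> \<S>" for S
        using X that sub[OF that] cay_preserves[OF r sub[OF that]]
        by (auto simp: ft cscale_vec vec.subspace_scale)
      ultimately show "cay (f t) \<in> stab W Q \<S>" using cay_G_C[OF r] by (auto simp: stab_def)
    qed
  qed (auto simp: f0 stab_def)
qed

lemma g_C_eq: "g_C W Q = glie W Q"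
  using lie_algebra_stab[of "{}"] by (simp add: g_C_def G_C_stab)

lemma lie_isotropy_eq: "lie_algebra (isotropy W Q F) = {X \<in> glie W Q. \<forall>p. \<forall>v\<in>F p. X *v v \<in> F p}"
  unfolding isotropy_stab using lie_algebra_stab[of "range F"] by auto

end

section \<open>The bigrading of the Lie algebra\<close>

text \<open>
  The shifts of the endomorphisms that preserve \<open>W\<close>, that preserve \<open>F\<close>, and of those in \<open>\<qq>\<close>, \<open>\<Lambda>\<close>,
  \<open>\<nn>\<^sub>+\<close>, \<open>\<nn>\<^sub>-\<close> and \<open>\<gg>\<^sup>0\<^sup>,\<^sup>0\<close>.
\<close>

definition SW :: "(int \<times> int) set" where "SW = {(r, s). r + s \<le> 0}"
definition SF :: "(int \<times> int) set" where "SF = {(r, s). 0 \<le> r}"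
definition SQ :: "(int \<times> int) set" where "SQ = {(r, s). r < 0}"
definition SL :: "(int \<times> int) set" where "SL = {(r, s). r < 0 \<and> s < 0}"
definition SP :: "(int \<times> int) set" where "SP = {(a, b). a \<ge> 0 \<and> b < 0}"
definition SM :: "(int \<times> int) set" where "SM = {(a, b). a < 0 \<and> b \<ge> 0}"
definition S0 :: "(int \<times> int) set" where "S0 = {(0, 0)}"

lemmas S_defs = SW_def SF_def SQ_def SL_def SP_def SM_def S0_def

text \<open>The shifts by which the complex conjugate of an endomorphism with shifts in \<open>S\<close> moves the bigrading.\<close>

definition clo :: "(int \<times> int) set \<Rightarrow> (int \<times> int) set" where
  "clo S = {(a, b). \<exists>(r, s)\<in>S. (a, b) = (s, r) \<or> a < s \<and> b < r}"

text \<open>Conjugation preserves \<Lambda>; modulo \<Lambda> it exchanges \<open>n_plus\<close>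
  with \<open>n_minus\<close> and keeps the shift (0, 0).\<close>

lemma clo_simps: "clo SL \<subseteq> SL" "clo SM \<subseteq> SP \<union> SL" "clo SP \<subseteq> SM \<union> SL" "clo S0 \<subseteq> S0 \<union> SL" "clo SQ \<inter> SW \<subseteq> SP \<union> SL"
  by (auto simp: clo_def S_defs)

context mixed_hodge begin

lemma cnj_dg_P:
  assumes w: "w \<in> dg a b" and y: "dg.P y *v cnj_vec w \<noteq> 0"
  shows "y = (b, a) \<or> fst y < b \<and> snd y < a"
proof (rule ccontr)
  assume n: "\<not> (y = (b, a) \<or> fst y < b \<and> snd y < a)"
  obtain x l where xl: "x \<in> dg b a" "l \<in> bigrading_sum dg {(a', b'). a' < b \<and> b' < a}" "cnj_vec w = x + l"
    using dg_cnj[OF w] by (auto elim!: subspace_sumE)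
  have "y \<notin> {(a', b'). a' < b \<and> b' < a}" using n by (cases y) auto
  then have "dg.P y *v l = 0" using xl(2) unfolding dg.bigrading_sum_iff by blast
  moreover have "dg.P y *v x = 0" using n dg.P_on[OF xl(1)] by simp
  ultimately show False using y by (simp add: xl matrix_vector_right_distrib)
qed

text \<open>The conjugate matrix is conjugation, then \<open>X\<close>, then conjugation. Each
  conjugation swaps the two indices up to components strictly smaller in both of them, and
  \<open>clo\<close> collects the resulting total shifts.\<close>

lemma EE_cnj:
  assumes X: "X \<in> dg.EE S" shows "cnj_mat X \<in> dg.EE (clo S)"
proof (rule dg.EE_I)
  fix x y assume xy: "y - x \<notin> clo S"
  have "(dg.P y ** cnj_mat X ** dg.P x) *v v = 0" for v
  proof -
    define w where "w = dg.P x *v v"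
    have w: "w \<in> dg (fst x) (snd x)" by (simp add: w_def dg.P_mem')
    have z: "dg.P y *v cnj_vec (dg.P y' *v (X *v (dg.P x' *v cnj_vec w))) = 0" for x' y'
    proof (rule ccontr)
      assume n: "dg.P y *v cnj_vec (dg.P y' *v (X *v (dg.P x' *v cnj_vec w))) \<noteq> 0"
      then have 1: "dg.P x' *v cnj_vec w \<noteq> 0" by auto
      have 2: "dg.P y' *v (X *v (dg.P x' *v cnj_vec w)) \<noteq> 0" using n by auto
      have "x' = (snd x, fst x) \<or> fst x' < snd x \<and> snd x' < fst x" using cnj_dg_P[OF w 1] .
      moreover have "y' - x' \<in> S" using dg.EE_vec[OF X dg.P_mem' 2] by simp
      moreover have "y = (snd y', fst y') \<or> fst y < snd y' \<and> snd y < fst y'" using cnj_dg_P[OF dg.P_mem' n] .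
      ultimately have "y - x \<in> clo S"
        unfolding clo_def by (cases x; cases y; cases x'; cases y') (auto intro!: bexI[of _ "y' - x'"])
      then show False using xy by simp
    qed
    have "cnj_mat X *v w = (\<Sum>x'\<in>dg.K. \<Sum>y'\<in>dg.K. cnj_vec (dg.P y' *v (X *v (dg.P x' *v cnj_vec w))))"
    proof -
      have "X *v cnj_vec w = X *v (\<Sum>x'\<in>dg.K. dg.P x' *v cnj_vec w)" by (simp add: dg.P_sum)
      also have "\<dots> = (\<Sum>x'\<in>dg.K. X *v (dg.P x' *v cnj_vec w))" by (simp add: matrix_vector_mult_sum_right)
      also have "\<dots> = (\<Sum>x'\<in>dg.K. \<Sum>y'\<in>dg.K. dg.P y' *v (X *v (dg.P x' *v cnj_vec w)))" by (simp add: dg.P_sum)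
      finally show ?thesis by (simp add: cnj_mat_vec' cnj_vec_sum)
    qed
    then have "dg.P y *v (cnj_mat X *v w) = 0" by (simp add: matrix_vector_mult_sum_right z)
    then show ?thesis by (simp add: w_def matrix_vector_mul_assoc matrix_mul_assoc)
  qed
  then show "dg.P y ** cnj_mat X ** dg.P x = 0" by (simp add: matrix_vec_zero_iff)
qed

lemma pres_W_iff: "(\<forall>k. \<forall>v\<in>W_C W k. X *v v \<in> W_C W k) \<longleftrightarrow> X \<in> dg.EE SW"
proof -
  have "W_C W k = bigrading_sum dg {x. fst x + snd x \<le> k}" for k
    by (subst W_bigrading_sum) (simp add: case_prod_unfold)
  moreover have "{d. fst d + snd d \<le> 0} = SW" by (auto simp: SW_def)
  ultimately show ?thesis using dg.EE_filtration[of "\<lambda>x. fst x + snd x" X] by simp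
qed

lemma pres_F_iff: "(\<forall>p. \<forall>v\<in>F p. X *v v \<in> F p) \<longleftrightarrow> X \<in> dg.EE SF"
proof -
  have F: "F (- k) = bigrading_sum dg {x. - fst x \<le> k}" for k
    by (subst F_bigrading_sum) (rule arg_cong[of _ _ "bigrading_sum dg"], auto)
  have "{d. - fst d \<le> 0} = SF" by (auto simp: SF_def)
  then have "(\<forall>k. \<forall>v\<in>F (- k). X *v v \<in> F (- k)) \<longleftrightarrow> X \<in> dg.EE SF"
    using dg.EE_filtration[of "\<lambda>x. - fst x" X] by (simp add: F)
  moreover have "(\<forall>k. \<forall>v\<in>F (- k). X *v v \<in> F (- k)) \<longleftrightarrow> (\<forall>p. \<forall>v\<in>F p. X *v v \<in> F p)"
    by (metis minus_minus)
  ultimately show ?thesis by blast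
qed

end

context polarized_hodge begin

abbreviation "\<gg> \<equiv> glie W Q"

lemma glie_W: "X \<in> \<gg> \<Longrightarrow> v \<in> W_C W k \<Longrightarrow> X *v v \<in> W_C W k"
  and glie_Q: "X \<in> \<gg> \<Longrightarrow> u \<in> W_C W k \<Longrightarrow> v \<in> W_C W k \<Longrightarrow> Q_C Q k (X *v u) v = - Q_C Q k u (X *v v)"
  by (auto simp: glie_def add_eq_0_iff2)

lemma glie_SW: "X \<in> \<gg> \<Longrightarrow> X \<in> dg.EE SW"
  unfolding pres_W_iff[symmetric] by (auto simp: glie_def)

text \<open>Skewness need only be tested on components of weight exactly \<open>k\<close>: a
  component of lower weight lies in the radical of \<open>Q k\<close>.\<close>

lemma glieI:
  assumes X: "X \<in> dg.EE SW" and Qs: "\<And>k a b c d u v. u \<in> dg a b \<Longrightarrow> v \<in> dg c d \<Longrightarrow> a + b = k \<Longrightarrow> c + d = k \<Longrightarrow>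
      Q_C Q k (X *v u) v + Q_C Q k u (X *v v) = 0"
  shows "X \<in> \<gg>"
proof -
  have W: "X *v v \<in> W_C W k" if "v \<in> W_C W k" for k v using X that unfolding pres_W_iff[symmetric] by blast
  have 1: "Q_C Q k (X *v u) v + Q_C Q k u (X *v v) = 0"
    if uv: "u \<in> dg a b" "v \<in> dg c d" "u \<in> W_C W k" "v \<in> W_C W k" for u v a b c d k
  proof -
    have le: "a + b \<le> k \<or> u = 0" "c + d \<le> k \<or> v = 0"
      using uv(3)[unfolded mem_W_iff, rule_format, of a b] uv(4)[unfolded mem_W_iff, rule_format, of c d]
        dg.P_on[OF uv(1), of "(a, b)"] dg.P_on[OF uv(2), of "(c, d)"] by force+
    consider "u \<in> W_C W (k - 1)" | "v \<in> W_C W (k - 1)" | "a + b = k" "c + d = k"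
      using le Wc_mono'[OF dg_W[OF uv(1)], of "k - 1"] Wc_mono'[OF dg_W[OF uv(2)], of "k - 1"]
      by (cases "a + b = k"; cases "c + d = k") (auto simp: vec.subspace_0)
    then show ?thesis
    proof cases
      case 1 then show ?thesis using uv W by (simp add: QC_rad)
    next
      case 2 then show ?thesis using uv W by (simp add: QC_rad_right)
    next
      case 3 then show ?thesis using Qs uv by blast
    qed
  qed
  have "Q_C Q k (X *v u) v + Q_C Q k u (X *v v) = 0" if uv: "u \<in> W_C W k" "v \<in> W_C W k" for k u v
  proof -
    have PW: "dg.P x *v u \<in> W_C W k" "dg.P x *v v \<in> W_C W k" for x
    proof -
      have "dg.P x *v w \<in> W_C W k" if w: "w \<in> W_C W k" for w
      proof (cases "fst x + snd x \<le> k")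
        case True then show ?thesis by (rule Wc_mono'[OF dg_W[OF dg.P_mem']])
      next
        case False then show ?thesis using w[unfolded mem_W_iff, rule_format, of "fst x" "snd x"] by (simp add: vec.subspace_0)
      qed
      then show "dg.P x *v u \<in> W_C W k" "dg.P x *v v \<in> W_C W k" using uv by auto
    qed
    have u: "u = (\<Sum>x\<in>dg.K. dg.P x *v u)" and v: "v = (\<Sum>x\<in>dg.K. dg.P x *v v)" by (simp_all add: dg.P_sum)
    have "Q_C Q k (X *v u) v = Q_C Q k (\<Sum>x\<in>dg.K. X *v (dg.P x *v u)) (\<Sum>y\<in>dg.K. dg.P y *v v)"
      by (simp only: matrix_vector_mult_sum_right[symmetric] dg.P_sum)
    also have "\<dots> = (\<Sum>x\<in>dg.K. \<Sum>y\<in>dg.K. Q_C Q k (X *v (dg.P x *v u)) (dg.P y *v v))"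
      using PW W by (simp add: QC_sum QC_sum_right vec.subspace_sum) (rule sum.swap)
    finally have e1: "Q_C Q k (X *v u) v = (\<Sum>x\<in>dg.K. \<Sum>y\<in>dg.K. Q_C Q k (X *v (dg.P x *v u)) (dg.P y *v v))" .
    have "Q_C Q k u (X *v v) = Q_C Q k (\<Sum>x\<in>dg.K. dg.P x *v u) (\<Sum>y\<in>dg.K. X *v (dg.P y *v v))"
      by (simp only: matrix_vector_mult_sum_right[symmetric] dg.P_sum)
    also have "\<dots> = (\<Sum>x\<in>dg.K. \<Sum>y\<in>dg.K. Q_C Q k (dg.P x *v u) (X *v (dg.P y *v v)))"
      using PW W by (simp add: QC_sum QC_sum_right vec.subspace_sum) (rule sum.swap)
    finally have e2: "Q_C Q k u (X *v v) = (\<Sum>x\<in>dg.K. \<Sum>y\<in>dg.K. Q_C Q k (dg.P x *v u) (X *v (dg.P y *v v)))" .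
    show ?thesis unfolding e1 e2 sum.distrib[symmetric]
      by (intro sum.neutral ballI 1[OF dg.P_mem' dg.P_mem'] PW)
  qed
  then show ?thesis using W by (auto simp: glie_def)
qed

text \<open>Components of weight below \<open>k\<close> are in the radical, and those of weight
  \<open>k\<close> pair to zero with \<open>dg c d\<close> unless their index is transposed.\<close>

lemma Q_pick:
  assumes w: "w \<in> W_C W k" and v: "v \<in> dg c d" and k: "c + d = k"
  shows "Q_C Q k w v = Q_C Q k (dg.P (d, c) *v w) v"
proof -
  have vW: "v \<in> W_C W k" using dg_W[OF v] k by simp
  have PW: "dg.P x *v w \<in> W_C W k" for x
  proof (cases "fst x + snd x \<le> k")
    case True then show ?thesis by (rule Wc_mono'[OF dg_W[OF dg.P_mem']])
  next
    case False then show ?thesis using w[unfolded mem_W_iff, rule_format, of "fst x" "snd x"] by (simp add: vec.subspace_0)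
  qed
  have z: "Q_C Q k (dg.P x *v w) v = 0" if x: "x \<noteq> (d, c)" for x
  proof (cases "fst x + snd x = k")
    case True
    then show ?thesis using QC_dg[OF dg.P_mem'[of x w] v] x k by (cases x) auto
  next
    case False
    show ?thesis
    proof (cases "fst x + snd x < k")
      case True
      then have "dg.P x *v w \<in> W_C W (k - 1)" by (intro Wc_mono'[OF dg_W[OF dg.P_mem']]) simp
      then show ?thesis using vW by (rule QC_rad)
    next
      case False
      then have "dg.P x *v w = 0" using w[unfolded mem_W_iff, rule_format, of "fst x" "snd x"] \<open>fst x + snd x \<noteq> k\<close> by simp
      then show ?thesis using vW by simp
    qed
  qed
  have "Q_C Q k w v = Q_C Q k (\<Sum>x\<in>dg.K. dg.P x *v w) v" by (simp add: dg.P_sum)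
  also have "\<dots> = (\<Sum>x\<in>dg.K. Q_C Q k (dg.P x *v w) v)" using PW vW by (intro QC_sum)
  also have "\<dots> = (\<Sum>x\<in>dg.K. if x = (d, c) then Q_C Q k (dg.P (d, c) *v w) v else 0)"
    by (intro sum.cong refl) (simp add: z)
  also have "\<dots> = Q_C Q k (dg.P (d, c) *v w) v"
    using dg.P_out[of "(d, c)"] vW by (auto simp: sum.delta)
  finally show ?thesis .
qed

lemma Q_pick': 
  assumes w: "w \<in> W_C W k" and v: "v \<in> dg c d" and k: "c + d = k"
  shows "Q_C Q k v w = Q_C Q k v (dg.P (d, c) *v w)"
proof -
  have vW: "v \<in> W_C W k" using dg_W[OF v] k by simp
  have "dg.P (d, c) *v w \<in> W_C W k" using dg_W[OF dg.P_mem, of d c w] k by (simp add: add.commute)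
  then show ?thesis using Q_pick[OF assms] QC_sym[OF w vW] QC_sym[OF _ vW] by simp
qed

lemma P_epart_vec: "u \<in> dg a b \<Longrightarrow> dg.P y *v (dg.epart S X *v u) = (if y - (a, b) \<in> S then dg.P y *v (X *v u) else 0)"
proof -
  assume u: "u \<in> dg a b"
  then have u': "u = dg.P (a, b) *v u" by (simp add: dg.mem_I_iff)
  have "dg.P y *v (dg.epart S X *v u) = (dg.P y ** dg.epart S X ** dg.P (a, b)) *v u"
    by (subst u') (simp add: matrix_vector_mul_assoc matrix_mul_assoc)
  also have "\<dots> = (if y - (a, b) \<in> S then (dg.P y ** X ** dg.P (a, b)) *v u else 0)" by (simp only: dg.P_epart) simp
  also have "(dg.P y ** X ** dg.P (a, b)) *v u = dg.P y *v (X *v u)"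
    by (subst (2) u') (simp add: matrix_vector_mul_assoc matrix_mul_assoc)
  finally show ?thesis .
qed

lemma glie_epart:
  assumes X: "X \<in> \<gg>" shows "dg.epart S X \<in> \<gg>"
proof (rule glieI)
  show SW': "dg.epart S X \<in> dg.EE SW" by (rule dg.epart_EE[OF glie_SW[OF X]])
  fix k a b c d u v assume uv: "u \<in> dg a b" "v \<in> dg c d" "a + b = k" "c + d = k"
  have W: "u \<in> W_C W k" "v \<in> W_C W k" using dg_W[OF uv(1)] dg_W[OF uv(2)] uv by auto
  have EW: "dg.epart S X *v u \<in> W_C W k" "dg.epart S X *v v \<in> W_C W k"
    using SW' W unfolding pres_W_iff[symmetric] by blast+
  \<comment> \<open>Equality of the weights makes the shift seen on the left factor equal to the one
    seen on the right factor, so truncating to \<open>S\<close> keeps or kills both terms of the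
    skewness relation together.\<close>
  have eq: "(b, a) - (c, d) = (d, c) - (a, b)" using uv by auto
  have "Q_C Q k (dg.epart S X *v u) v = (if (d, c) - (a, b) \<in> S then Q_C Q k (X *v u) v else 0)"
    using Q_pick[OF EW(1) uv(2,4)] Q_pick[OF glie_W[OF X W(1)] uv(2,4)] W by (simp add: P_epart_vec[OF uv(1)])
  moreover have "Q_C Q k u (dg.epart S X *v v) = (if (d, c) - (a, b) \<in> S then Q_C Q k u (X *v v) else 0)"
    using Q_pick'[OF EW(2) uv(1,3)] Q_pick'[OF glie_W[OF X W(2)] uv(1,3)] W by (simp only: P_epart_vec[OF uv(2)] eq) simp
  ultimately show "Q_C Q k (dg.epart S X *v u) v + Q_C Q k u (dg.epart S X *v v) = 0"
    using glie_Q[OF X W] by simp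
qed

lemma SL_lowers: "X \<in> dg.EE SL \<Longrightarrow> v \<in> W_C W k \<Longrightarrow> X *v v \<in> W_C W (k - 1)"
proof (rule mem_W_iff[THEN iffD2, rule_format])
  fix a b assume X: "X \<in> dg.EE SL" and v: "v \<in> W_C W k" and ab: "k - 1 < a + b"
  show "dg.P (a, b) *v (X *v v) = 0"
    unfolding dg.P_Y_decomp
  proof (intro sum.neutral ballI)
    fix x
    show "(dg.P (a, b) ** X ** dg.P x) *v (dg.P x *v v) = 0"
    proof (cases "fst x + snd x \<le> k")
      case True
      then have "(a, b) - x \<notin> SL" using ab by (cases x) (auto simp: SL_def)
      then show ?thesis using dg.EE_D[OF X] by simp
    next
      case False
      then show ?thesis using v[unfolded mem_W_iff, rule_format, of "fst x" "snd x"] by simp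
    qed
  qed
qed

lemma glie_cnj: assumes X: "X \<in> \<gg>" shows "cnj_mat X \<in> \<gg>"
proof -
  have "Q_C Q k (cnj_mat X *v u) v + Q_C Q k u (cnj_mat X *v v) = 0" if uv: "u \<in> W_C W k" "v \<in> W_C W k" for k u v
  proof -
    have c: "cnj_vec u \<in> W_C W k" "cnj_vec v \<in> W_C W k" using uv by auto
    have "cnj (Q_C Q k (X *v cnj_vec u) (cnj_vec v)) = - cnj (Q_C Q k (cnj_vec u) (X *v cnj_vec v))"
      using glie_Q[OF X c] by simp
    then show ?thesis
      using QC_cnj[OF glie_W[OF X c(1)] c(2)] QC_cnj[OF c(1) glie_W[OF X c(2)]] by (simp add: cnj_mat_vec')
  qed
  then show ?thesis using glie_W[OF X] by (auto simp: glie_def cnj_mat_vec')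
qed

lemma glie_ad: assumes X: "X \<in> \<gg>" and Y: "Y \<in> \<gg>" shows "ad X Y \<in> \<gg>"
proof -
  have "Q_C Q k (ad X Y *v u) v + Q_C Q k u (ad X Y *v v) = 0" if uv: "u \<in> W_C W k" "v \<in> W_C W k" for k u v
    using uv glie_W[OF X] glie_W[OF Y] glie_Q[OF X] glie_Q[OF Y]
    by (simp add: ad_def matrix_vector_mult_diff_rdistrib matrix_vector_mul_assoc[symmetric] QC_diff QC_diff_right)
  then show ?thesis using glie_W[OF X] glie_W[OF Y]
    by (auto simp: glie_def ad_def matrix_vector_mult_diff_rdistrib matrix_vector_mul_assoc[symmetric] vec.subspace_diff)
qed

lemma glie_Ad: assumes g: "g \<in> G_C W Q" and X: "X \<in> \<gg>" shows "g ** X ** matrix_inv g \<in> \<gg>"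
proof -
  note i = G_C_invertible[OF g] and gi = G_C_inv[OF g]
  have "Q_C Q k ((g ** X ** matrix_inv g) *v u) v + Q_C Q k u ((g ** X ** matrix_inv g) *v v) = 0"
    if uv: "u \<in> W_C W k" "v \<in> W_C W k" for k u v
  proof -
    define u' v' where "u' = matrix_inv g *v u" and "v' = matrix_inv g *v v"
    have uv': "u' \<in> W_C W k" "v' \<in> W_C W k" "u = g *v u'" "v = g *v v'"
      using G_C_W_mem[OF gi] uv by (auto simp: u'_def v'_def matrix_inv_cancel[OF i])
    have e: "(g ** X ** matrix_inv g) *v (g *v w) = g *v (X *v w)" for w
      by (simp add: matrix_vector_mul_assoc[symmetric] matrix_inv_cancel[OF i])
    show ?thesis unfolding uv'(3,4) e
      using glie_Q[OF X uv'(1,2)] G_C_Q[OF g] glie_W[OF X] uv'(1,2) by simp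
  qed
  then show ?thesis using glie_W[OF X] G_C_W_mem[OF g] G_C_W_mem[OF gi]
    by (auto simp: glie_def matrix_vector_mul_assoc[symmetric])
qed

text \<open>Preserving the weight excludes all shifts with both entries nonnegative except (0, 0),
  so the four sets cover \<open>SW\<close>.\<close>

lemma glie_parts:
  assumes "X \<in> \<gg>" shows "X = dg.epart SP X + dg.epart S0 X + dg.epart SM X + dg.epart SL X"
proof -
  have "X = dg.epart SW X" using glie_SW[OF assms] by (simp add: dg.epart_id)
  also have "\<dots> = dg.epart (SW \<inter> SP) X + dg.epart (SW \<inter> S0) X + dg.epart (SW \<inter> SM) X + dg.epart (SW \<inter> SL) X"
  proof -
    have "SW = (((SW \<inter> SP) \<union> (SW \<inter> S0)) \<union> (SW \<inter> SM)) \<union> (SW \<inter> SL)" by (auto simp: S_defs)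
    then have "dg.epart SW X = dg.epart ((((SW \<inter> SP) \<union> (SW \<inter> S0)) \<union> (SW \<inter> SM)) \<union> (SW \<inter> SL)) X" by simp
    also have "\<dots> = dg.epart (SW \<inter> SP) X + dg.epart (SW \<inter> S0) X + dg.epart (SW \<inter> SM) X + dg.epart (SW \<inter> SL) X"
      by (subst dg.epart_Un, force simp: S_defs)+ simp
    finally show ?thesis .
  qed
  also have "\<dots> = dg.epart SP X + dg.epart S0 X + dg.epart SM X + dg.epart SL X"
    using dg.epart_EE'[OF glie_SW[OF assms]] by metis
  finally show ?thesis .
qed

lemma g_comp_eq: "g_comp W Q F r s = \<gg> \<inter> dg.EE {(r, s)}"
  by (auto simp: g_comp_def g_C_eq deligne_eq dg.EE_single_iff)

lemma csub_Int: "csub (\<gg> \<inter> dg.EE S)"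
  using csub_glie dg.csub_EE[of S] by (simp add: csub_def)

text \<open>An element with shifts in \<open>S\<close> is the finite sum of its parts of a single
  shift, and each of these is again in the Lie algebra by \<open>glie_epart\<close>.\<close>

lemma g_sum_eq: "g_sum W Q F S = \<gg> \<inter> dg.EE S"
proof
  have "(\<Union>(r, s)\<in>S. g_comp W Q F r s) \<subseteq> \<gg> \<inter> dg.EE S"
    by (auto simp: g_comp_eq intro: dg.EE_mono)
  then show "g_sum W Q F S \<subseteq> \<gg> \<inter> dg.EE S"
    unfolding g_sum_def by (intro span_minimal csub_subspace csub_Int)
next
  show "\<gg> \<inter> dg.EE S \<subseteq> g_sum W Q F S"
  proof
    fix X assume X: "X \<in> \<gg> \<inter> dg.EE S"
    define D where "D = (\<lambda>(x, y). y - x) ` (dg.K \<times> dg.K)"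
    have D: "finite D" by (simp add: D_def)
    have "X = (\<Sum>d\<in>D. dg.epart {d} X)"
    proof (rule dg.EE_ext)
      fix x y
      show "dg.P y ** X ** dg.P x = dg.P y ** (\<Sum>d\<in>D. dg.epart {d} X) ** dg.P x"
      proof (cases "x \<in> dg.K \<and> y \<in> dg.K")
        case True
        then have "y - x \<in> D" by (force simp: D_def)
        moreover have "dg.P y ** (\<Sum>d\<in>D. dg.epart {d} X) ** dg.P x = (\<Sum>d\<in>D. if d = y - x then dg.P y ** X ** dg.P x else 0)"
          by (simp add: matrix_sum dg.P_epart eq_commute)
        ultimately show ?thesis using D by (simp add: sum.delta)
      next
        case False then show ?thesis using dg.P_out[of x] dg.P_out[of y] by auto
      qed
    qed
    moreover have "dg.epart {d} X \<in> g_sum W Q F S" for d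
    proof (cases "d \<in> S")
      case True
      have "dg.epart {d} X \<in> g_comp W Q F (fst d) (snd d)" using X by (simp add: g_comp_eq glie_epart)
      then show ?thesis unfolding g_sum_def using True by (intro span_base) (auto intro!: bexI[of _ d])
    next
      case False
      then have "dg.epart {d} X = 0" using X by (intro dg.epart_disjoint[of X S]) auto
      then show ?thesis by (simp add: g_sum_def span_zero)
    qed
    ultimately show "X \<in> g_sum W Q F S" unfolding g_sum_def using span_sum by metis
  qed
qed

lemma q_alg_eq: "q_alg W Q F = \<gg> \<inter> dg.EE SQ"
  and Lambda_alg_eq: "Lambda_alg W Q F = \<gg> \<inter> dg.EE SL"
  and n_plus_eq: "n_plus W Q F = \<gg> \<inter> dg.EE SP"
  and n_minus_eq: "n_minus W Q F = \<gg> \<inter> dg.EE SM"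
  by (simp_all add: q_alg_def Lambda_alg_def n_plus_def n_minus_def g_sum_eq S_defs)

lemma isotropy_alg_eq: "lie_algebra (isotropy W Q F) = \<gg> \<inter> dg.EE SF"
  unfolding lie_isotropy_eq pres_F_iff by auto

lemma proj_along_epart:
  assumes X: "X \<in> \<gg>" and A: "A = \<gg> \<inter> dg.EE S" and B: "B = \<gg> \<inter> dg.EE T" and S: "S \<inter> T = {}" "SW \<subseteq> S \<union> T"
  shows "proj_along A B X = dg.epart S X"
  unfolding proj_along_def
proof (rule the_equality)
  have "X = dg.epart SW X" using glie_SW[OF X] by (simp add: dg.epart_id)
  also have "SW = (SW \<inter> S) \<union> (SW \<inter> T)" using S by auto
  also have "dg.epart ((SW \<inter> S) \<union> (SW \<inter> T)) X = dg.epart (SW \<inter> S) X + dg.epart (SW \<inter> T) X"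
    using S by (intro dg.epart_Un) auto
  also have "\<dots> = dg.epart S X + dg.epart T X" using dg.epart_EE'[OF glie_SW[OF X]] by metis
  finally have "X - dg.epart S X = dg.epart T X" by (simp add: algebra_simps)
  then show "dg.epart S X \<in> A \<and> X - dg.epart S X \<in> B" by (simp add: A B glie_epart[OF X])
  fix Y assume "Y \<in> A \<and> X - Y \<in> B"
  then have "Y \<in> dg.EE S" "X - Y \<in> dg.EE T" by (auto simp: A B)
  then have "dg.epart S Y = Y" "dg.epart S (X - Y) = 0"
    using S by (auto simp: dg.epart_id intro!: dg.epart_disjoint[of _ T])
  then show "Y = dg.epart S X" by (simp add: dg.epart_diff)
qed

lemma subspace_sum_EE:
  assumes "S \<inter> T = {}"
  shows "subspace_sum (\<gg> \<inter> dg.EE S) (\<gg> \<inter> dg.EE T) = \<gg> \<inter> dg.EE (S \<union> T)"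
proof (intro equalityI subsetI)
  fix X assume "X \<in> subspace_sum (\<gg> \<inter> dg.EE S) (\<gg> \<inter> dg.EE T)"
  then obtain Y Z where "Y \<in> \<gg>" "Y \<in> dg.EE S" "Z \<in> \<gg>" "Z \<in> dg.EE T" "X = Y + Z" by (auto elim!: subspace_sumE)
  then show "X \<in> \<gg> \<inter> dg.EE (S \<union> T)"
    by (auto intro!: csub_add[OF csub_glie] csub_add[OF dg.csub_EE] intro: dg.EE_mono)
next
  fix X assume X: "X \<in> \<gg> \<inter> dg.EE (S \<union> T)"
  then have "X = dg.epart S X + dg.epart T X" using dg.epart_Un[OF assms, of X] by (simp add: dg.epart_id)
  then show "X \<in> subspace_sum (\<gg> \<inter> dg.EE S) (\<gg> \<inter> dg.EE T)"
    using subspace_sumI[of "dg.epart S X" "\<gg> \<inter> dg.EE S" "dg.epart T X" "\<gg> \<inter> dg.EE T"] X by (simp add: glie_epart)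
qed

lemma orth_proj_g: "X \<in> \<gg> \<Longrightarrow> orth_proj W Q F (g_C W Q) X = X"
  by (simp add: orth_proj_eq g_C_eq h.hproj_id csub_glie)

lemma plus_part_eq: "X \<in> \<gg> \<Longrightarrow> plus_part W Q F X = dg.epart SP X"
proof -
  assume X: "X \<in> \<gg>"
  have "subspace_sum (g_comp W Q F 0 0) (subspace_sum (n_minus W Q F) (Lambda_alg W Q F)) = \<gg> \<inter> dg.EE (S0 \<union> (SM \<union> SL))"
    unfolding g_comp_eq n_minus_eq Lambda_alg_eq S0_def[symmetric]
    by (subst subspace_sum_EE, force simp: S_defs)+ simp
  then show ?thesis unfolding plus_part_def orth_proj_g[OF X] n_plus_eq
    by (intro proj_along_epart[OF X refl]) (auto simp: S_defs)
qed

lemma zero_part_eq: "X \<in> \<gg> \<Longrightarrow> zero_part W Q F X = dg.epart S0 X"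
proof -
  assume X: "X \<in> \<gg>"
  have "subspace_sum (n_plus W Q F) (subspace_sum (n_minus W Q F) (Lambda_alg W Q F)) = \<gg> \<inter> dg.EE (SP \<union> (SM \<union> SL))"
    unfolding n_plus_eq n_minus_eq Lambda_alg_eq
    by (subst subspace_sum_EE, force simp: S_defs)+ simp
  then show ?thesis unfolding zero_part_def orth_proj_g[OF X] g_comp_eq S0_def[symmetric]
    by (intro proj_along_epart[OF X refl]) (auto simp: S_defs)
qed

lemma proj_q_isotropy: "X \<in> \<gg> \<Longrightarrow> proj_along (q_alg W Q F) (lie_algebra (isotropy W Q F)) X = dg.epart SQ X"
  unfolding q_alg_eq isotropy_alg_eq by (intro proj_along_epart) (auto simp: S_defs)

lemma h_P: "mh (dg.P x *v u) v = mh u (dg.P x *v v)"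
proof -
  have "mh (dg.P x *v u) v = (\<Sum>(p, q)\<in>dg.K. \<i> powi (p - q) * Q_C Q (p + q) (dg.P x *v (dg.P (p, q) *v u)) (cnj_vec (dg.P (p, q) *v v)))"
    unfolding mh_eq by (intro sum.cong refl) (auto simp: matrix_vector_mul_assoc dg.P_mult)
  also have "\<dots> = (\<Sum>(p, q)\<in>dg.K. \<i> powi (p - q) * Q_C Q (p + q) (dg.P (p, q) *v u) (cnj_vec (dg.P x *v (dg.P (p, q) *v v))))"
    by (intro sum.cong refl) (auto simp: matrix_vector_mul_assoc dg.P_mult P_W)
  also have "\<dots> = mh u (dg.P x *v v)"
    unfolding mh_eq by (intro sum.cong refl) (auto simp: matrix_vector_mul_assoc dg.P_mult)
  finally show ?thesis .
qed

lemma hadj_P: "h.hadj (dg.P x) = dg.P x"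
  by (rule h.hadj_unique) (rule h_P)

lemma hadj_EE: "X \<in> dg.EE S \<Longrightarrow> h.hadj X \<in> dg.EE (uminus ` S)"
proof (rule dg.EE_I)
  fix x y assume X: "X \<in> dg.EE S" and xy: "y - x \<notin> uminus ` S"
  have "dg.P y ** h.hadj X ** dg.P x = h.hadj (dg.P x ** X ** dg.P y)"
    by (simp add: h.hadj_mult hadj_P matrix_mul_assoc)
  moreover have "x - y \<notin> S" using xy by (metis image_eqI minus_diff_eq)
  ultimately show "dg.P y ** h.hadj X ** dg.P x = 0" using dg.EE_D[OF X] by simp
qed

lemma trace_EE: assumes "X \<in> dg.EE S" "0 \<notin> S" shows "trace X = 0"
proof -
  have "trace X = trace (X ** (\<Sum>x\<in>dg.K. dg.P x))" by (simp add: dg.P_sum_mat)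
  also have "\<dots> = (\<Sum>x\<in>dg.K. trace (X ** dg.P x))" by (simp add: matrix_sum linear_sum[OF linear_trace])
  also have "\<dots> = (\<Sum>x\<in>dg.K. trace (dg.P x ** X ** dg.P x))"
  proof (intro sum.cong refl)
    fix x
    have "trace (dg.P x ** X ** dg.P x) = trace (X ** dg.P x ** dg.P x)"
      by (metis matrix_mul_assoc trace_commute)
    then show "trace (X ** dg.P x) = trace (dg.P x ** X ** dg.P x)"
      by (simp add: matrix_mul_assoc[symmetric] dg.P_mult)
  qed
  also have "\<dots> = 0" using dg.EE_D[OF assms(1)] assms(2) by (simp add: trace_def)
  finally show ?thesis .
qed

text \<open>\<open>X\<close> times the adjoint of \<open>Y\<close> has only shifts
  \<open>s - t\<close> with \<open>s\<close> in \<open>S\<close> and \<open>t\<close> in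
  \<open>T\<close>. None of them is 0, so no diagonal block contributes to the trace.\<close>

lemma hE_orth: assumes X: "X \<in> dg.EE S" and Y: "Y \<in> dg.EE T" and "S \<inter> T = {}" shows "h.hE X Y = 0"
proof -
  have "X ** h.hadj Y \<in> dg.EE (UNIV - {0})"
    by (rule dg.EE_mult[OF X hadj_EE[OF Y]]) (use assms(3) in \<open>auto simp: zero_prod_def\<close>)
  then show ?thesis unfolding h.hE_def by (rule trace_EE) simp
qed

lemma hproj_q: "X \<in> \<gg> \<Longrightarrow> h.hproj (\<gg> \<inter> dg.EE SQ) X = dg.epart SQ X"
proof (rule h.hproj_unique[OF csub_Int])
  assume X: "X \<in> \<gg>"
  then show "dg.epart SQ X \<in> \<gg> \<inter> dg.EE SQ" by (simp add: glie_epart)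
  fix Z assume Z: "Z \<in> \<gg> \<inter> dg.EE SQ"
  have "X - dg.epart SQ X = dg.epart (- SQ) X"
  proof -
    have "dg.epart (SQ \<union> - SQ) X = dg.epart SQ X + dg.epart (- SQ) X" by (rule dg.epart_Un) auto
    moreover have "dg.epart (SQ \<union> - SQ) X = X" by (simp add: dg.epart_id_iff dg.EE_def)
    ultimately show ?thesis by (simp add: algebra_simps)
  qed
  then show "h.hE (X - dg.epart SQ X) Z = 0" using hE_orth[of "dg.epart (- SQ) X" "- SQ" Z SQ] Z by simp
qed

text \<open>\<open>X\<close> acts on each \<open>dg p q\<close> separately and is skew for the form;
  moving it across the conjugation in the metric replaces it by its conjugate. The part of that
  conjugate in \<Lambda> lowers the weight into the radical and drops out.\<close>

lemma hadj_S0: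
  assumes X: "X \<in> \<gg>" "X \<in> dg.EE S0" shows "h.hadj X = - dg.epart S0 (cnj_mat X)"
proof (rule h.hadj_unique)
  fix u v
  define Y where "Y = dg.epart S0 (cnj_mat X)"
  have PX: "dg.P x ** Z = Z ** dg.P x" if "Z \<in> dg.EE S0" for Z x
  proof (rule dg.EE_ext)
    fix a b
    have "dg.P b ** Z ** dg.P a = 0" if "a \<noteq> b"
      using dg.EE_D[OF \<open>Z \<in> dg.EE S0\<close>, of b a] that by (cases a; cases b) (auto simp: S0_def)
    moreover have "dg.P b ** (dg.P x ** Z) ** dg.P a = (if b = x then dg.P b ** Z ** dg.P a else 0)"
      by (simp add: matrix_mul_assoc dg.P_mult)
    moreover have "dg.P b ** (Z ** dg.P x) ** dg.P a = (if a = x then dg.P b ** Z ** dg.P a else 0)"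
      using dg.P_mult[of x a] by (simp add: matrix_mul_assoc[symmetric])
    ultimately show "dg.P b ** (dg.P x ** Z) ** dg.P a = dg.P b ** (Z ** dg.P x) ** dg.P a" by auto
  qed
  have cX: "cnj_mat X \<in> \<gg>" by (rule glie_cnj[OF X(1)])
  have low: "cnj_mat X - Y \<in> dg.EE SL"
  proof -
    have c: "cnj_mat X \<in> dg.EE (S0 \<union> SL)" by (rule dg.EE_mono[OF EE_cnj[OF X(2)] clo_simps(4)])
    have "dg.epart (S0 \<union> SL) (cnj_mat X) = Y + dg.epart SL (cnj_mat X)"
      unfolding Y_def by (rule dg.epart_Un) (auto simp: S_defs)
    then have "cnj_mat X - Y = dg.epart SL (cnj_mat X)" using dg.epart_id[OF c] by (simp add: algebra_simps)
    then show ?thesis by simp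
  qed
  have Yg: "Y \<in> \<gg>" "Y \<in> dg.EE S0" by (simp_all add: Y_def glie_epart cX)
  have "Q_C Q (p + q) (dg.P (p, q) *v (X *v u)) (cnj_vec (dg.P (p, q) *v v)) =
        - Q_C Q (p + q) (dg.P (p, q) *v u) (cnj_vec (dg.P (p, q) *v (Y *v v)))" for p q
  proof -
    define u' v' where "u' = dg.P (p, q) *v u" and "v' = dg.P (p, q) *v v"
    have W: "u' \<in> W_C W (p + q)" "v' \<in> W_C W (p + q)" by (simp_all add: u'_def v'_def P_W)
    have "cnj_mat X *v v' = Y *v v' + (cnj_mat X - Y) *v v'" by (simp add: matrix_vector_mult_diff_rdistrib)
    then have "cnj_vec (cnj_mat X *v v') = cnj_vec (Y *v v') + cnj_vec ((cnj_mat X - Y) *v v')" by simp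
    moreover have "cnj_vec (cnj_mat X *v v') = X *v cnj_vec v'" by (simp add: cnj_mat_vec)
    moreover have "cnj_vec ((cnj_mat X - Y) *v v') \<in> W_C W (p + q - 1)" using SL_lowers[OF low W(2)] by simp
    moreover have "cnj_vec (Y *v v') \<in> W_C W (p + q)" using glie_W[OF Yg(1) W(2)] by simp
    ultimately have "Q_C Q (p + q) u' (X *v cnj_vec v') = Q_C Q (p + q) u' (cnj_vec (Y *v v'))"
      using W QC_rad_right[OF W(1)] Wc_mono'[of "cnj_vec ((cnj_mat X - Y) *v v')" "p + q - 1" "p + q"]
      by (simp add: QC_add_right)
    moreover have "Q_C Q (p + q) (X *v u') (cnj_vec v') = - Q_C Q (p + q) u' (X *v cnj_vec v')"
      using glie_Q[OF X(1) W(1)] W by simp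
    moreover have "dg.P (p, q) *v (X *v u) = X *v u'" "dg.P (p, q) *v (Y *v v) = Y *v v'"
      using PX[OF X(2)] PX[OF Yg(2)] by (simp_all add: u'_def v'_def matrix_vector_mul_assoc)
    ultimately show ?thesis by (simp add: u'_def v'_def)
  qed
  then have "mh (X *v u) v = - mh u (Y *v v)"
    unfolding mh_eq by (simp add: sum_negf[symmetric] case_prod_unfold)
  then show "mh (X *v u) v = mh u ((- dg.epart S0 (cnj_mat X)) *v v)"
    using h.h_scale_right[of u "-1" "Y *v v"]
      matrix_vector_mult_diff_rdistrib[of 0 Y v] by (simp add: Y_def[symmetric])
qed

end

section \<open>Moving the base point\<close>

lemma image_matrix_mult: "(*v) (A ** B) ` S = (*v) A ` ((*v) B ` S)"
  by (simp add: image_image matrix_vector_mul_assoc)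

lemma filt_act_mult: "filt_act (A ** B) F = filt_act A (filt_act B F)"
  by (simp add: filt_act_def image_matrix_mult)

lemma filt_act_one [simp]: "filt_act (mat 1) F = F"
  by (simp add: filt_act_def)

lemma filt_act_inv: "invertible A \<Longrightarrow> filt_act (matrix_inv A) (filt_act A F) = F"
  by (simp add: filt_act_mult[symmetric] matrix_inv)

lemma mem_image_matrix:
  fixes A :: "complex ^ 'n::finite ^ 'n"
  assumes A: "invertible A" shows "v \<in> (*v) A ` S \<longleftrightarrow> matrix_inv A *v v \<in> S"
proof
  assume "matrix_inv A *v v \<in> S"
  then have "A *v (matrix_inv A *v v) \<in> (*v) A ` S" by (rule imageI)
  then show "v \<in> (*v) A ` S" by (simp add: matrix_inv_cancel[OF A])
qed (auto simp: matrix_inv_cancel[OF A])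

lemma bigrading_sum_image:
  "bigrading_sum (\<lambda>p q. (*v) g ` I p q) S = (*v) g ` bigrading_sum I S"
  for g :: "complex ^ 'n::finite ^ 'n"
proof -
  have "(\<Union>(a, b)\<in>S. (*v) g ` I a b) = (*v) g ` (\<Union>(a, b)\<in>S. I a b)" by auto
  then show ?thesis unfolding bigrading_sum_def
    using vec.linear_span_image[OF matrix_vector_mul_linear_gen[of g], of "\<Union>(a, b)\<in>S. I a b"] by simp
qed

context bigraded begin

lemma image_supp: fixes g :: "complex ^ 'n ^ 'n" assumes "invertible g" shows "bg_supp (\<lambda>p q. (*v) g ` I p q) = K"
proof -
  have "(*v) g ` I p q = {0} \<longleftrightarrow> I p q = {0}" for p q
  proof
    assume "(*v) g ` I p q = {0}"
    then have "(*v) (matrix_inv g) ` {0} = I p q" using image_eq_inv[OF assms] by blast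
    then show "I p q = {0}" by simp
  qed simp
  then show ?thesis by (simp add: bg_supp_def)
qed

lemma bigrading_image:
  fixes g :: "complex ^ 'n ^ 'n"
  assumes g: "invertible g" shows "bigrading (\<lambda>p q. (*v) g ` I p q)"
  unfolding bigrading_def
proof (intro conjI allI)
  show "vec.subspace ((*v) g ` I p q)" for p q
    by (rule vec.linear_subspace_image[OF matrix_vector_mul_linear_gen]) simp
  have K: "{(p, q). (*v) g ` I p q \<noteq> {0}} = K" using image_supp[OF g] by (simp add: bg_supp_def)
  show "finite {(p, q). (*v) g ` I p q \<noteq> {0}}" by (simp add: K)
  fix v
  show "\<exists>!c. (\<forall>p q. c p q \<in> (*v) g ` I p q) \<and> (\<Sum>(p, q)\<in>{(p, q). (*v) g ` I p q \<noteq> {0}}. c p q) = v"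
    unfolding K
  proof (rule ex1I[of _ "\<lambda>p q. g *v bg_comp I (matrix_inv g *v v) p q"])
    have "(\<Sum>(p, q)\<in>K. g *v bg_comp I (matrix_inv g *v v) p q) = g *v (\<Sum>(p, q)\<in>K. bg_comp I (matrix_inv g *v v) p q)"
      by (simp add: matrix_vector_mult_sum_right case_prod_unfold)
    then show "(\<forall>p q. g *v bg_comp I (matrix_inv g *v v) p q \<in> (*v) g ` I p q) \<and>
        (\<Sum>(p, q)\<in>K. g *v bg_comp I (matrix_inv g *v v) p q) = v"
      by (simp add: comp_mem comp_sum matrix_inv_cancel[OF g])
  next
    fix d assume d: "(\<forall>p q. d p q \<in> (*v) g ` I p q) \<and> (\<Sum>(p, q)\<in>K. d p q) = v"
    have "bg_comp I (matrix_inv g *v v) = (\<lambda>p q. matrix_inv g *v d p q)"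
    proof (rule comp_unique)
      show "matrix_inv g *v d p q \<in> I p q" for p q using d mem_image_matrix[OF g] by blast
      have "(\<Sum>(p, q)\<in>K. matrix_inv g *v d p q) = matrix_inv g *v (\<Sum>(p, q)\<in>K. d p q)"
        by (simp add: matrix_vector_mult_sum_right case_prod_unfold)
      then show "(\<Sum>(p, q)\<in>K. matrix_inv g *v d p q) = matrix_inv g *v v" using d by simp
    qed
    then show "d = (\<lambda>p q. g *v bg_comp I (matrix_inv g *v v) p q)" by (simp add: matrix_inv_cancel[OF g])
  qed
qed

lemma bg_proj_image:
  fixes g :: "complex ^ 'n ^ 'n"
  assumes g: "invertible g" shows "bg_proj (\<lambda>p q. (*v) g ` I p q) x = g ** P x ** matrix_inv g"
proof -
  interpret g: bigraded "\<lambda>p q. (*v) g ` I p q" by unfold_locales (rule bigrading_image[OF g])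
  have "g.P x *v v = (g ** P x ** matrix_inv g) *v v" for v
  proof -
    have "bg_comp (\<lambda>p q. (*v) g ` I p q) v = (\<lambda>p q. g *v (P (p, q) *v (matrix_inv g *v v)))"
    proof (rule g.comp_unique)
      have "(\<Sum>(p, q)\<in>g.K. g *v (P (p, q) *v (matrix_inv g *v v))) = g *v (\<Sum>x\<in>K. P x *v (matrix_inv g *v v))"
        by (simp add: image_supp[OF g] matrix_vector_mult_sum_right case_prod_unfold)
      then show "(\<Sum>(p, q)\<in>g.K. g *v (P (p, q) *v (matrix_inv g *v v))) = v"
        by (simp add: P_sum matrix_inv_cancel[OF g])
    qed auto
    then show ?thesis by (simp add: g.P_eq matrix_vector_mul_assoc matrix_mul_assoc)
  qed
  then show ?thesis by (simp add: matrix_eq)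
qed

end

text \<open>A real element commutes with conjugation and maps sums to sums, so each defining clause
  is carried over literally.\<close>

lemma real_transport:
  assumes J: "is_deligne_bigrading W F J" and k: "k \<in> G_C W Q" "cnj_mat k = k"
  shows "is_deligne_bigrading W (filt_act k F) (\<lambda>p q. (*v) k ` J p q)"
proof -
  interpret bigraded J using J by unfold_locales (simp add: is_deligne_bigrading_def)
  note i = G_C_invertible[OF k(1)]
  have c: "cnj_vec ` ((*v) k ` S) = (*v) k ` (cnj_vec ` S)" for S
    using k(2) by (simp add: image_image cnj_mat_vec)
  have s: "subspace_sum ((*v) k ` S) ((*v) k ` T) = (*v) k ` subspace_sum S T" for S T
  proof (rule set_eqI)
    fix x
    have "x \<in> subspace_sum ((*v) k ` S) ((*v) k ` T) \<longleftrightarrow> (\<exists>a\<in>S. \<exists>b\<in>T. x = k *v a + k *v b)"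
      by (auto simp: subspace_sum_def)
    also have "\<dots> \<longleftrightarrow> (\<exists>a\<in>S. \<exists>b\<in>T. x = k *v (a + b))" by (simp add: matrix_vector_right_distrib)
    also have "\<dots> \<longleftrightarrow> x \<in> (*v) k ` subspace_sum S T" by (auto simp: subspace_sum_def image_iff)
    finally show "x \<in> subspace_sum ((*v) k ` S) ((*v) k ` T) \<longleftrightarrow> x \<in> (*v) k ` subspace_sum S T" .
  qed
  show ?thesis unfolding is_deligne_bigrading_def
  proof (intro conjI allI)
    show "bigrading (\<lambda>p q. (*v) k ` J p q)" by (rule bigrading_image[OF i])
    show "filt_act k F p = bigrading_sum (\<lambda>p q. (*v) k ` J p q) {(a, b). p \<le> a}" for p
      using J unfolding is_deligne_bigrading_def bigrading_sum_image filt_act_def by metis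
    show "W_C W l = bigrading_sum (\<lambda>p q. (*v) k ` J p q) {(a, b). a + b \<le> l}" for l
      using J G_C_W[OF k(1), of l] unfolding is_deligne_bigrading_def bigrading_sum_image by metis
    show "subspace_sum (cnj_vec ` (*v) k ` J p q) (bigrading_sum (\<lambda>p q. (*v) k ` J p q) {(a, b). a < q \<and> b < p}) =
       subspace_sum ((*v) k ` J q p) (bigrading_sum (\<lambda>p q. (*v) k ` J p q) {(a, b). a < q \<and> b < p})" for p q
      using J unfolding is_deligne_bigrading_def bigrading_sum_image c s by metis
  qed
qed

lemma polarized_hodgeI:
  assumes "weight_filtration W" "graded_forms W Q" "F \<in> classifying_space W Q h"
  shows "polarized_hodge W F Q"
  using assms by unfold_locales (auto simp: classifying_space_def)

context polarized_hodge begin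

text \<open>Such an \<open>l\<close> acts as the identity on the graded pieces, because
  \<open>l - mat 1\<close> lowers the weight; the forms live on those pieces.\<close>

lemma G_C_SL: assumes l: "l - mat 1 \<in> dg.EE SL" "invertible l" shows "l \<in> G_C W Q"
proof -
  define N where "N = l - mat 1"
  have lv: "l *v v = v + N *v v" for v by (simp add: N_def matrix_vector_mult_diff_rdistrib)
  have low: "N *v v \<in> W_C W (k - 1)" if "v \<in> W_C W k" for v k using SL_lowers[OF l(1) that] by (simp add: N_def)
  have low': "N *v v \<in> W_C W k" if "v \<in> W_C W k" for v k by (rule Wc_mono'[OF low[OF that]]) simp
  have "(*v) l ` W_C W k = W_C W k" for k
    by (rule invertible_image_subspace[OF Wc_sub l(2)]) (simp add: lv vec.subspace_add low')
  moreover have "Q_C Q k (l *v u) (l *v v) = Q_C Q k u v" if uv: "u \<in> W_C W k" "v \<in> W_C W k" for u v k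
    using low'[OF uv(1)] low'[OF uv(2)] low[OF uv(1)] low[OF uv(2)] uv
    by (simp add: lv QC_add QC_add_right vec.subspace_add QC_rad QC_rad_right)
  ultimately show ?thesis using l(2) by (auto simp: G_C_def)
qed

lemma SL_lowers_bigrading:
  assumes X: "X \<in> dg.EE SL" and v: "v \<in> dg p q" shows "X *v v \<in> bigrading_sum dg {(a, b). a < p \<and> b < q}"
  unfolding dg.bigrading_sum_iff
proof (intro allI impI)
  fix y assume y: "y \<notin> {(a, b). a < p \<and> b < q}"
  show "dg.P y *v (X *v v) = 0"
    using dg.EE_vec[OF X v, of y] y by (cases y) (auto simp: SL_def)
qed

lemma SL_lowers_bigrading':
  assumes X: "X \<in> dg.EE SL" and v: "v \<in> bigrading_sum dg {(a, b). a < p \<and> b < q}"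
  shows "X *v v \<in> bigrading_sum dg {(a, b). a < p \<and> b < q}"
proof (rule dg.bigrading_sum_induct[OF v, where f = "(*v) X"])
  fix a b w assume ab: "(a, b) \<in> {(a, b). a < p \<and> b < q}" and w: "w \<in> dg a b"
  show "X *v w \<in> bigrading_sum dg {(a, b). a < p \<and> b < q}"
    by (rule dg.bigrading_sum_mono[OF SL_lowers_bigrading[OF X w]]) (use ab in auto)
qed (auto simp: matrix_vector_right_distrib)

text \<open>\<open>l\<close> moves \<open>dg p q\<close> only by vectors strictly lower in both
  indices. The conjugation clause of the bigrading is a congruence modulo exactly such vectors,
  hence does not notice \<open>l\<close>.\<close>

lemma SL_transport:
  assumes l: "l - mat 1 \<in> dg.EE SL" "invertible l"
  shows "is_deligne_bigrading W (filt_act l F) (\<lambda>p q. (*v) l ` dg p q)"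
proof -
  define N where "N = l - mat 1"
  have N: "N \<in> dg.EE SL" using l by (simp add: N_def)
  have lv: "l *v v = v + N *v v" for v by (simp add: N_def matrix_vector_mult_diff_rdistrib)
  have L: "(*v) l ` bigrading_sum dg {(a, b). a < q \<and> b < p} = bigrading_sum dg {(a, b). a < q \<and> b < p}" for p q
    by (rule invertible_image_subspace[OF dg.bigrading_sum_sub l(2)])
      (unfold lv, intro vec.subspace_add[OF dg.bigrading_sum_sub] SL_lowers_bigrading'[OF N])
  have sum_eq: "subspace_sum ((\<lambda>v. f v + n v) ` S) T = subspace_sum (f ` S) T"
    if T: "vec.subspace T" and n: "\<And>v. v \<in> S \<Longrightarrow> n v \<in> T" for f n :: "complex ^ 'a \<Rightarrow> complex ^ 'a" and S T
  proof (intro equalityI subsetI)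
    fix x assume "x \<in> subspace_sum ((\<lambda>v. f v + n v) ` S) T"
    then obtain v t where "v \<in> S" "t \<in> T" "x = f v + (n v + t)" by (auto elim!: subspace_sumE simp: add.assoc)
    then show "x \<in> subspace_sum (f ` S) T" using n vec.subspace_add[OF T] by (auto intro!: subspace_sumI)
  next
    fix x assume "x \<in> subspace_sum (f ` S) T"
    then obtain v t where "v \<in> S" "t \<in> T" "x = (f v + n v) + (t - n v)" by (auto elim!: subspace_sumE)
    then show "x \<in> subspace_sum ((\<lambda>v. f v + n v) ` S) T" using n vec.subspace_diff[OF T]
      by (metis (no_types, lifting) image_eqI subspace_sumI)
  qed
  show ?thesis unfolding is_deligne_bigrading_def
  proof (intro conjI allI)
    show "bigrading (\<lambda>p q. (*v) l ` dg p q)" by (rule dg.bigrading_image[OF l(2)])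
    show "filt_act l F p = bigrading_sum (\<lambda>p q. (*v) l ` dg p q) {(a, b). p \<le> a}" for p
      unfolding bigrading_sum_image filt_act_def by (subst F_bigrading_sum) simp
    show "W_C W k = bigrading_sum (\<lambda>p q. (*v) l ` dg p q) {(a, b). a + b \<le> k}" for k
      using G_C_W[OF G_C_SL[OF l], of k] unfolding bigrading_sum_image by (subst W_bigrading_sum[symmetric]) simp
    fix p q
    let ?L = "bigrading_sum dg {(a, b). a < q \<and> b < p}"
    have c1: "cnj_vec ` (*v) l ` dg p q = (\<lambda>v. cnj_vec v + cnj_vec (N *v v)) ` dg p q"
      by (simp add: image_image lv)
    have c2: "(*v) l ` dg q p = (\<lambda>v. v + N *v v) ` dg q p" by (simp add: lv)
    have "subspace_sum (cnj_vec ` (*v) l ` dg p q) ?L = subspace_sum (cnj_vec ` dg p q) ?L"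
      unfolding c1 by (rule sum_eq, rule dg.bigrading_sum_sub, rule bigrading_sum_cnj, erule SL_lowers_bigrading[OF N])
    also have "\<dots> = subspace_sum ((\<lambda>v. v) ` dg q p) ?L" using dg_deligne unfolding is_deligne_bigrading_def by simp
    also have "\<dots> = subspace_sum ((*v) l ` dg q p) ?L"
      unfolding c2 by (rule sum_eq[symmetric], rule dg.bigrading_sum_sub, erule SL_lowers_bigrading[OF N])
    finally show "subspace_sum (cnj_vec ` (*v) l ` dg p q) (bigrading_sum (\<lambda>p q. (*v) l ` dg p q) {(a, b). a < q \<and> b < p}) =
       subspace_sum ((*v) l ` dg q p) (bigrading_sum (\<lambda>p q. (*v) l ` dg p q) {(a, b). a < q \<and> b < p})"
      unfolding bigrading_sum_image L .
  qed
qed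

end

text \<open>A base point \<open>F\<close> and an element \<open>k l\<close> with \<open>k\<close> real and \<open>l\<close> in the group of \<open>\<Lambda>\<close>: it moves all the
  structure at \<open>F\<close> isometrically.\<close>

locale moved_hodge = polarized_hodge W F Q
  for W :: "'n::finite weight" and F :: "'n filt" and Q :: "'n forms" +
  fixes k l :: "complex ^ 'n ^ 'n"
  assumes k: "k \<in> G_C W Q" "cnj_mat k = k" and l: "l - mat 1 \<in> dg.EE SL" "invertible l"
    and moved: "polarized_hodge W (filt_act (k ** l) F) Q"
begin

definition "\<gamma> = k ** l"

lemma \<gamma>_G: "\<gamma> \<in> G_C W Q"
  by (simp add: \<gamma>_def G_C_mult k G_C_SL[OF l])

lemma \<gamma>_inv: "invertible \<gamma>"
  by (rule G_C_invertible[OF \<gamma>_G])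

text \<open>This does not follow from membership in \<open>G_C\<close>, since \<gamma> is not real
  and the second argument is conjugated. It holds because \<open>k\<close> commutes with conjugation
  and \<open>l\<close> changes both arguments only within the radical.\<close>

lemma \<gamma>_Q:
  assumes "u \<in> W_C W j" "v \<in> W_C W j"
  shows "Q_C Q j (\<gamma> *v u) (cnj_vec (\<gamma> *v v)) = Q_C Q j u (cnj_vec v)"
proof -
  define N where "N = l - mat 1"
  have lv: "l *v v = v + N *v v" for v by (simp add: N_def matrix_vector_mult_diff_rdistrib)
  have low: "N *v v \<in> W_C W (j - 1)" if "v \<in> W_C W j" for v using SL_lowers[OF l(1) that] by (simp add: N_def)
  have low': "N *v v \<in> W_C W j" if "v \<in> W_C W j" for v by (rule Wc_mono'[OF low[OF that]]) simp
  have lW: "l *v v \<in> W_C W j" if "v \<in> W_C W j" for v by (rule G_C_W_mem[OF G_C_SL[OF l] that])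
  have "Q_C Q j (\<gamma> *v u) (cnj_vec (\<gamma> *v v)) = Q_C Q j (k *v (l *v u)) (k *v cnj_vec (l *v v))"
    using k(2) by (simp add: \<gamma>_def matrix_vector_mul_assoc[symmetric] cnj_mat_vec)
  also have "\<dots> = Q_C Q j (l *v u) (cnj_vec (l *v v))" using lW assms by (intro G_C_Q[OF k(1)]) simp_all
  also have "\<dots> = Q_C Q j u (cnj_vec v)"
    using low'[OF assms(1)] low'[OF assms(2)] low[OF assms(1)] low[OF assms(2)] assms
    by (simp add: lv QC_add QC_add_right vec.subspace_add QC_rad QC_rad_right)
  finally show ?thesis .
qed

sublocale m: polarized_hodge W "filt_act \<gamma> F" Q
  using moved by (simp add: \<gamma>_def)

text \<open>Transport by \<open>l\<close> and then by \<open>k\<close> yields a Deligne bigrading of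
  the moved filtration, and there is only one.\<close>

lemma m_dg: "m.dg = (\<lambda>p q. (*v) \<gamma> ` dg p q)"
proof -
  have "is_deligne_bigrading W (filt_act k (filt_act l F)) (\<lambda>p q. (*v) k ` ((*v) l ` dg p q))"
    by (rule real_transport[OF SL_transport[OF l] k])
  then have "is_deligne_bigrading W (filt_act \<gamma> F) (\<lambda>p q. (*v) \<gamma> ` dg p q)"
    by (simp add: \<gamma>_def filt_act_mult image_matrix_mult)
  then show ?thesis by (rule m.deligne_unique[symmetric])
qed

abbreviation Ad where "Ad X \<equiv> \<gamma> ** X ** matrix_inv \<gamma>"

lemma m_P: "m.dg.P x = Ad (dg.P x)"
  unfolding m_dg by (rule dg.bg_proj_image[OF \<gamma>_inv])

lemma m_K: "m.dg.K = dg.K"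
  unfolding m_dg by (rule dg.image_supp[OF \<gamma>_inv])

lemma m_mh: "mh_metric W Q (filt_act \<gamma> F) (\<gamma> *v u) (\<gamma> *v v) = mh u v"
proof -
  have "m.dg.P x *v (\<gamma> *v w) = \<gamma> *v (dg.P x *v w)" for x w
    by (simp add: m_P matrix_vector_mul_assoc[symmetric] matrix_inv_cancel[OF \<gamma>_inv])
  then show ?thesis unfolding mh_eq m.mh_eq m_K by (intro sum.cong refl) (auto simp: \<gamma>_Q P_W)
qed

lemma Ad_mult: "Ad X ** Ad Y = Ad (X ** Y)"
proof -
  have "Ad X ** Ad Y = \<gamma> ** X ** (matrix_inv \<gamma> ** \<gamma>) ** Y ** matrix_inv \<gamma>" by (simp add: matrix_mul_assoc)
  then show ?thesis by (simp add: matrix_inv[OF \<gamma>_inv] matrix_mul_assoc)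
qed

lemma m_hadj: "m.h.hadj (Ad X) = Ad (h.hadj X)"
proof (rule m.h.hadj_unique)
  fix u v
  define u' v' where "u' = matrix_inv \<gamma> *v u" and "v' = matrix_inv \<gamma> *v v"
  have uv: "u = \<gamma> *v u'" "v = \<gamma> *v v'" by (simp_all add: u'_def v'_def matrix_inv_cancel[OF \<gamma>_inv])
  have e: "Ad Y *v (\<gamma> *v w) = \<gamma> *v (Y *v w)" for Y w
    by (simp add: matrix_vector_mul_assoc[symmetric] matrix_inv_cancel[OF \<gamma>_inv])
  show "mh_metric W Q (filt_act \<gamma> F) (Ad X *v u) v = mh_metric W Q (filt_act \<gamma> F) u (Ad (h.hadj X) *v v)"
    unfolding uv e m_mh by (rule h.hadj)
qed

lemma m_hE: "m.h.hE (Ad X) (Ad Y) = h.hE X Y"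
proof -
  have "m.h.hE (Ad X) (Ad Y) = trace (Ad (X ** h.hadj Y))" by (simp add: m.h.hE_def m_hadj Ad_mult)
  also have "\<dots> = trace (matrix_inv \<gamma> ** (\<gamma> ** (X ** h.hadj Y)))"
    by (subst trace_commute) (simp add: matrix_mul_assoc)
  also have "\<dots> = h.hE X Y" by (simp add: matrix_inv_cancel[OF \<gamma>_inv] h.hE_def)
  finally show ?thesis .
qed

lemma m_epart: "m.dg.epart S (Ad X) = Ad (dg.epart S X)"
proof (rule m.dg.EE_ext)
  fix x y
  have "m.dg.P y ** m.dg.epart S (Ad X) ** m.dg.P x = (if y - x \<in> S then Ad (dg.P y ** X ** dg.P x) else 0)"
    unfolding m.dg.P_epart by (simp only: m_P Ad_mult)
  moreover have "m.dg.P y ** Ad (dg.epart S X) ** m.dg.P x = Ad (dg.P y ** dg.epart S X ** dg.P x)"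
    by (simp only: m_P Ad_mult)
  ultimately show "m.dg.P y ** m.dg.epart S (Ad X) ** m.dg.P x = m.dg.P y ** Ad (dg.epart S X) ** m.dg.P x"
    by (simp add: dg.P_epart)
qed

end

section \<open>Tangent vectors\<close>

lemma has_vector_derivative_matrix_mult:
  fixes f g :: "real \<Rightarrow> complex ^ 'n::finite ^ 'n"
  assumes "(f has_vector_derivative f') (at t)" "(g has_vector_derivative g') (at t)"
  shows "((\<lambda>t. f t ** g t) has_vector_derivative (f t ** g' + f' ** g t)) (at t)"
  by (rule bounded_bilinear.has_vector_derivative[OF bounded_bilinear_matrix_mult assms])

lemma has_vector_derivative_matrix_inv:
  fixes f :: "real \<Rightarrow> complex ^ 'n::finite ^ 'n"
  assumes "(f has_vector_derivative f') (at t)" "invertible (f t)"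
  shows "((\<lambda>t. matrix_inv (f t)) has_vector_derivative - (matrix_inv (f t) ** f' ** matrix_inv (f t))) (at t)"
proof -
  have "((\<lambda>t. matrix_inv (f t)) has_derivative (\<lambda>h. - (matrix_inv (f t) ** (h *\<^sub>R f') ** matrix_inv (f t)))) (at t)"
    using has_derivative_matrix_inv[of f "\<lambda>h. h *\<^sub>R f'" t UNIV, OF _ assms(2)] assms(1) by (simp add: has_vector_derivative_def)
  then show ?thesis
    by (simp add: has_vector_derivative_def cscale_of_real[symmetric] cscale_mult cscale_distrib)
qed

context polarized_hodge begin

text \<open>The definite description is meaningful: two lifts of the same curve differ by a curve in
  the isotropy group, so their velocities differ by an element of the isotropy algebra, which has no
  part in \<open>q_alg\<close>.\<close>

lemma curve_velocity_eq:
  assumes \<gamma>: "\<gamma> 0 = mat 1" "(\<gamma> has_vector_derivative X) (at 0)"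
    and ev: "\<forall>\<^sub>F t in nhds 0. \<gamma> t \<in> G_C W Q \<and> c t = filt_act (\<gamma> t) F" and c: "c 0 = F"
  shows "X \<in> \<gg>" "curve_velocity W Q c = dg.epart SQ X"
proof -
  have mem: "X \<in> \<gg>" if "\<gamma> 0 = mat 1" "(\<gamma> has_vector_derivative X) (at 0)" "\<forall>\<^sub>F t in nhds 0. \<gamma> t \<in> G_C W Q \<and> c t = filt_act (\<gamma> t) F" for \<gamma> X
    unfolding g_C_eq[symmetric] g_C_def
    by (rule lie_algebraI[of \<gamma>]) (use that in \<open>auto elim: eventually_mono\<close>)
  show Xg: "X \<in> \<gg>" by (rule mem[OF \<gamma> ev])
  show "curve_velocity W Q c = dg.epart SQ X"
    unfolding curve_velocity_def
  proof (rule the_equality)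
    show "\<exists>\<gamma> Y. \<gamma> 0 = mat 1 \<and> (\<gamma> has_vector_derivative Y) (at 0) \<and>
       (\<forall>\<^sub>F t in nhds 0. \<gamma> t \<in> G_C W Q \<and> c t = filt_act (\<gamma> t) (c 0)) \<and>
       dg.epart SQ X = proj_along (q_alg W Q (c 0)) (lie_algebra (isotropy W Q (c 0))) Y"
      using \<gamma> ev c proj_q_isotropy[OF Xg] by (intro exI[of _ \<gamma>] exI[of _ X]) simp
  next
    fix w assume "\<exists>\<gamma> Y. \<gamma> 0 = mat 1 \<and> (\<gamma> has_vector_derivative Y) (at 0) \<and>
       (\<forall>\<^sub>F t in nhds 0. \<gamma> t \<in> G_C W Q \<and> c t = filt_act (\<gamma> t) (c 0)) \<and>
       w = proj_along (q_alg W Q (c 0)) (lie_algebra (isotropy W Q (c 0))) Y"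
    then obtain \<delta> Y where \<delta>: "\<delta> 0 = mat 1" "(\<delta> has_vector_derivative Y) (at 0)"
      "\<forall>\<^sub>F t in nhds 0. \<delta> t \<in> G_C W Q \<and> c t = filt_act (\<delta> t) F"
      "w = proj_along (q_alg W Q F) (lie_algebra (isotropy W Q F)) Y" by (auto simp: c)
    have Yg: "Y \<in> \<gg>" by (rule mem[OF \<delta>(1-3)])
    have "((\<lambda>t. matrix_inv (\<gamma> t) ** \<delta> t) has_vector_derivative
        (matrix_inv (\<gamma> 0) ** Y + - (matrix_inv (\<gamma> 0) ** X ** matrix_inv (\<gamma> 0)) ** \<delta> 0)) (at 0)"
      by (intro has_vector_derivative_matrix_mult has_vector_derivative_matrix_inv \<gamma> \<delta>) (simp add: \<gamma>)
    moreover have "matrix_inv (mat 1 :: complex ^ 'a ^ 'a) = mat 1" by (rule matrix_inv_unique) simp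
    ultimately have d: "((\<lambda>t. matrix_inv (\<gamma> t) ** \<delta> t) has_vector_derivative (Y - X)) (at 0)"
      by (simp add: \<gamma> \<delta> matrix_neg)
    have "Y - X \<in> lie_algebra (isotropy W Q F)"
    proof (rule lie_algebraI[OF _ d])
      show "\<forall>\<^sub>F t in nhds 0. matrix_inv (\<gamma> t) ** \<delta> t \<in> isotropy W Q F"
        using ev \<delta>(3)
      proof eventually_elim
        fix t assume 1: "\<gamma> t \<in> G_C W Q \<and> c t = filt_act (\<gamma> t) F" and 2: "\<delta> t \<in> G_C W Q \<and> c t = filt_act (\<delta> t) F"
        then have "filt_act (matrix_inv (\<gamma> t) ** \<delta> t) F = filt_act (matrix_inv (\<gamma> t)) (filt_act (\<gamma> t) F)"
          by (simp add: filt_act_mult)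
        then have "filt_act (matrix_inv (\<gamma> t) ** \<delta> t) F = F"
          using 1 filt_act_inv G_C_invertible by metis
        then show "matrix_inv (\<gamma> t) ** \<delta> t \<in> isotropy W Q F"
          using 1 2 by (simp add: isotropy_def G_C_mult G_C_inv)
      qed
      show "matrix_inv (\<gamma> 0) ** \<delta> 0 = mat 1" by (simp add: \<gamma> \<delta> matrix_inv_unique)
      show "mat 1 \<in> isotropy W Q F" by (simp add: isotropy_def)
    qed
    then have "dg.epart SQ (Y - X) = 0"
      unfolding isotropy_alg_eq by (intro dg.epart_disjoint[of _ SF]) (auto simp: S_defs)
    then show "w = dg.epart SQ X" using \<delta>(4) proj_q_isotropy[OF Yg] by (simp add: dg.epart_diff)
  qed
qed

lemma cay_isotropy: assumes Y: "Y \<in> \<gg>" "Y \<in> dg.EE SF" "regular Y" shows "cay Y \<in> isotropy W Q F"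
  using cay_G_C[OF Y(3)] cay_preserves[OF Y(3) F_sub] Y(1) pres_F_iff[of Y] Y(2)
  by (simp add: isotropy_def filt_act_def fun_eq_iff)

lemma SQ_compl: "X - dg.epart SQ X \<in> dg.EE SF"
proof -
  have "dg.epart (SQ \<union> SF) X = dg.epart SQ X + dg.epart SF X" by (rule dg.epart_Un) (auto simp: S_defs)
  moreover have "dg.epart (SQ \<union> SF) X = X"
  proof -
    have "SQ \<union> SF = UNIV" by (auto simp: S_defs)
    then show ?thesis by (simp add: dg.epart_id_iff dg.EE_def)
  qed
  ultimately show ?thesis by (metis add_diff_cancel_left' dg.EE_mem)
qed

end

section \<open>Wirtinger derivatives\<close>

text \<open>\<open>C\<close> and \<open>C'\<close> are the derivatives of \<open>f\<close> with respect to the variable and to its conjugate.\<close>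

definition wd :: "(complex \<Rightarrow> complex ^ 'n::finite ^ 'n) \<Rightarrow> complex \<Rightarrow> complex ^ 'n ^ 'n \<Rightarrow> complex ^ 'n ^ 'n \<Rightarrow> bool" where
  "wd f s C C' \<longleftrightarrow> (f has_derivative (\<lambda>\<tau>. cscale \<tau> C + cscale (cnj \<tau>) C')) (at s)"

definition cwd :: "(complex \<Rightarrow> complex) \<Rightarrow> complex \<Rightarrow> complex \<Rightarrow> complex \<Rightarrow> bool" where
  "cwd f s c c' \<longleftrightarrow> (f has_derivative (\<lambda>\<tau>. \<tau> * c + cnj \<tau> * c')) (at s)"

lemma wd_ex:
  fixes f :: "complex \<Rightarrow> complex ^ 'n::finite ^ 'n"
  assumes "f differentiable (at s)" shows "\<exists>C C'. wd f s C C'"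
proof -
  obtain D where D: "(f has_derivative D) (at s)" using assms by (auto simp: differentiable_def)
  then interpret D: bounded_linear D by (rule has_derivative_bounded_linear)
  define C C' where "C = cscale (1/2) (D 1 - cscale \<i> (D \<i>))" and "C' = cscale (1/2) (D 1 + cscale \<i> (D \<i>))"
  have "D \<tau> = cscale \<tau> C + cscale (cnj \<tau>) C'" for \<tau>
  proof -
    have "D \<tau> = D (Re \<tau> *\<^sub>R 1 + Im \<tau> *\<^sub>R \<i>)" by (rule arg_cong[of _ _ D]) (simp add: complex_eq_iff)
    also have "\<dots> = Re \<tau> *\<^sub>R D 1 + Im \<tau> *\<^sub>R D \<i>" by (simp only: D.add D.scaleR)
    also have "\<dots> = cscale \<tau> C + cscale (cnj \<tau>) C'"
      by (auto simp: C_def C'_def vec_eq_iff complex_eq_iff field_simps)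
    finally show ?thesis .
  qed
  then have "D = (\<lambda>\<tau>. cscale \<tau> C + cscale (cnj \<tau>) C')" by blast
  then show ?thesis using D unfolding wd_def by metis
qed

lemma wd_mult: "wd f s C C' \<Longrightarrow> wd g s E E' \<Longrightarrow> wd (\<lambda>x. f x ** g x) s (f s ** E + C ** g s) (f s ** E' + C' ** g s)"
  unfolding wd_def
  by (drule (1) has_derivative_matrix_mult, erule has_derivative_eq_rhs)
    (simp add: fun_eq_iff matrix_add_ldistrib matrix_add_rdistrib' cscale_mult cscale_distrib algebra_simps)

lemma wd_add: "wd f s C C' \<Longrightarrow> wd g s E E' \<Longrightarrow> wd (\<lambda>x. f x + g x) s (C + E) (C' + E')"
  unfolding wd_def
  by (drule (1) has_derivative_add, erule has_derivative_eq_rhs) (simp add: fun_eq_iff cscale_distrib algebra_simps)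

lemma wd_diff: "wd f s C C' \<Longrightarrow> wd g s E E' \<Longrightarrow> wd (\<lambda>x. f x - g x) s (C - E) (C' - E')"
  unfolding wd_def
  by (drule (1) has_derivative_diff, erule has_derivative_eq_rhs) (simp add: fun_eq_iff cscale_distrib algebra_simps)

lemma wd_const: "wd (\<lambda>x. c) s 0 0"
  by (simp add: wd_def)

lemma wd_inv:
  "wd f s C C' \<Longrightarrow> invertible (f s) \<Longrightarrow>
   wd (\<lambda>x. matrix_inv (f x)) s (- (matrix_inv (f s) ** C ** matrix_inv (f s))) (- (matrix_inv (f s) ** C' ** matrix_inv (f s)))"
  unfolding wd_def
  by (drule (1) has_derivative_matrix_inv, erule has_derivative_eq_rhs)
    (simp add: fun_eq_iff matrix_add_ldistrib matrix_add_rdistrib' cscale_mult cscale_distrib)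

definition clinear :: "(complex ^ 'n::finite ^ 'n \<Rightarrow> complex ^ 'n ^ 'n) \<Rightarrow> bool" where
  "clinear T \<longleftrightarrow> (\<forall>X Y. T (X + Y) = T X + T Y) \<and> (\<forall>c X. T (cscale c X) = cscale c (T X))"

definition antilinear :: "(complex ^ 'n::finite ^ 'n \<Rightarrow> complex ^ 'n ^ 'n) \<Rightarrow> bool" where
  "antilinear T \<longleftrightarrow> (\<forall>X Y. T (X + Y) = T X + T Y) \<and> (\<forall>c X. T (cscale c X) = cscale (cnj c) (T X))"

lemma clinear_bounded: "clinear T \<Longrightarrow> bounded_linear T"
  unfolding clinear_def by (intro linear_conv_bounded_linear[THEN iffD1] linearI) (auto simp flip: cscale_of_real)

lemma antilinear_bounded: "antilinear T \<Longrightarrow> bounded_linear T"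
  unfolding antilinear_def by (intro linear_conv_bounded_linear[THEN iffD1] linearI) (auto simp flip: cscale_of_real)

lemma wd_clinear: "clinear T \<Longrightarrow> wd f s C C' \<Longrightarrow> wd (\<lambda>x. T (f x)) s (T C) (T C')"
  unfolding wd_def
  by (frule clinear_bounded, drule (1) bounded_linear.has_derivative, erule has_derivative_eq_rhs)
    (simp add: fun_eq_iff clinear_def)

lemma wd_antilinear: "antilinear T \<Longrightarrow> wd f s C C' \<Longrightarrow> wd (\<lambda>x. T (f x)) s (T C') (T C)"
  unfolding wd_def
  by (frule antilinear_bounded, drule (1) bounded_linear.has_derivative, erule has_derivative_eq_rhs)
    (simp add: fun_eq_iff antilinear_def add.commute)

lemma antilinear_cnj: "antilinear cnj_mat"
  by (simp add: antilinear_def)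

lemma wd_unique: assumes "wd f s C C'" "wd f s E E'" shows "C = E" "C' = E'"
proof -
  have *: "(\<lambda>\<tau>. cscale \<tau> C + cscale (cnj \<tau>) C') = (\<lambda>\<tau>. cscale \<tau> E + cscale (cnj \<tau>) E')"
    using assms unfolding wd_def by (rule has_derivative_unique)
  have 1: "C + C' = E + E'" using fun_cong[OF *, of 1] by simp
  have "cscale (- \<i>) (cscale \<i> C + cscale (cnj \<i>) C') = cscale (- \<i>) (cscale \<i> E + cscale (cnj \<i>) E')"
    using fun_cong[OF *, of \<i>] by simp
  then have 2: "C - C' = E - E'" by (simp add: cscale_distrib)
  have "cscale 2 C = cscale 2 E" using arg_cong2[OF 1 2, of "(+)"] by (simp add: vec_eq_iff)
  then show "C = E" by (simp add: vec_eq_iff)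
  then show "C' = E'" using 1 by simp
qed

lemma wd_cong:
  assumes "wd f s C C'" "open S" "s \<in> S" "\<And>x. x \<in> S \<Longrightarrow> f x = g x" shows "wd g s C C'"
  unfolding wd_def by (rule has_derivative_transform_within_open[OF assms(1)[unfolded wd_def] assms(2-4)])

lemma cwd_cong:
  assumes "cwd f s C C'" "open S" "s \<in> S" "\<And>x. x \<in> S \<Longrightarrow> f x = g x" shows "cwd g s C C'"
  unfolding cwd_def by (rule has_derivative_transform_within_open[OF assms(1)[unfolded cwd_def] assms(2-4)])

lemma line_tendsto: "filterlim (\<lambda>t::real. s + of_real t * \<tau>) (nhds s) (nhds 0)" for \<tau> :: complex
proof -
  have "isCont (\<lambda>t::real. s + of_real t * \<tau>) 0" by (intro continuous_intros)
  then show ?thesis using tendsto_at_iff_tendsto_nhds[of "\<lambda>t::real. s + of_real t * \<tau>" 0]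
    by (simp add: isCont_def)
qed

lemma wd_curve:
  assumes "wd f s C C'"
  shows "((\<lambda>t. f (s + of_real t * \<tau>)) has_vector_derivative (cscale \<tau> C + cscale (cnj \<tau>) C')) (at 0)"
proof -
  have d: "((\<lambda>t. s + of_real t * \<tau>) has_derivative (\<lambda>t. of_real t * \<tau>)) (at 0)"
    by (auto intro!: derivative_eq_intros)
  have "((\<lambda>t. f (s + of_real t * \<tau>)) has_derivative (\<lambda>t. cscale (of_real t * \<tau>) C + cscale (cnj (of_real t * \<tau>)) C')) (at 0)"
    by (rule has_derivative_compose[OF d]) (use assms in \<open>simp add: wd_def\<close>)
  then show ?thesis unfolding has_vector_derivative_def
    by (rule has_derivative_eq_rhs) (simp add: fun_eq_iff vec_eq_iff complex_eq_iff algebra_simps)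
qed

text \<open>Every real direction yields an element of the Lie algebra; combining the directions 1
  and \<open>\<i>\<close> with complex coefficients isolates the two Wirtinger derivatives, which is
  why a complex Lie algebra is assumed.\<close>

lemma wd_group:
  assumes g: "wd g s C C'" "g s = mat 1" and ev: "\<forall>\<^sub>F x in nhds s. g x \<in> Gp" and "mat 1 \<in> Gp" "csub (lie_algebra Gp)"
  shows "C \<in> lie_algebra Gp" "C' \<in> lie_algebra Gp"
proof -
  have D: "cscale \<tau> C + cscale (cnj \<tau>) C' \<in> lie_algebra Gp" for \<tau>
  proof (rule lie_algebraI[OF _ wd_curve[OF g(1)]])
    show "\<forall>\<^sub>F t in nhds 0. g (s + of_real t * \<tau>) \<in> Gp"
      by (rule eventually_compose_filterlim[OF ev line_tendsto])
  qed (use assms in auto)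
  have "cscale (1/2) ((cscale 1 C + cscale (cnj 1) C') + cscale (- \<i>) (cscale \<i> C + cscale (cnj \<i>) C')) = C"
    "cscale (1/2) ((cscale 1 C + cscale (cnj 1) C') + cscale \<i> (cscale \<i> C + cscale (cnj \<i>) C')) = C'"
    by (simp_all add: vec_eq_iff algebra_simps)
  then show "C \<in> lie_algebra Gp" "C' \<in> lie_algebra Gp"
    using csub_scale[OF assms(5) csub_add[OF assms(5) D csub_scale[OF assms(5) D]]] by metis+
qed

lemma wd_csub:
  assumes g: "wd g s C C'" and ev: "\<forall>\<^sub>F x in nhds s. g x \<in> S" and S: "csub S"
  shows "C \<in> S" "C' \<in> S"
proof -
  have D: "cscale \<tau> C + cscale (cnj \<tau>) C' \<in> S" for \<tau>
  proof (rule has_vector_derivative_in_subspace[OF csub_subspace[OF S] wd_curve[OF g]])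
    show "\<forall>\<^sub>F t in nhds 0. g (s + of_real t * \<tau>) \<in> S"
      by (rule eventually_compose_filterlim[OF ev line_tendsto])
  qed
  have "cscale (1/2) ((cscale 1 C + cscale (cnj 1) C') + cscale (- \<i>) (cscale \<i> C + cscale (cnj \<i>) C')) = C"
    "cscale (1/2) ((cscale 1 C + cscale (cnj 1) C') + cscale \<i> (cscale \<i> C + cscale (cnj \<i>) C')) = C'"
    by (simp_all add: vec_eq_iff algebra_simps)
  then show "C \<in> S" "C' \<in> S"
    using csub_scale[OF S csub_add[OF S D csub_scale[OF S D]]] by metis+
qed

text \<open>Conjugate linearity in the second argument makes the antiholomorphic derivative of
  \<open>g\<close> contribute to the holomorphic derivative of the pairing; this is how the
  antiholomorphic part of the form of \<open>f\<close> reaches the connection.\<close>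

lemma (in hermitian) cwd_hE:
  assumes f: "wd f s C C'" and g: "wd g s E E'"
  shows "cwd (\<lambda>x. hE (f x) (g x)) s (hE C (g s) + hE (f s) E') (hE C' (g s) + hE (f s) E)"
  using bounded_bilinear.FDERIV[OF bounded_bilinear_hE f[unfolded wd_def] g[unfolded wd_def]]
  unfolding cwd_def
  by (rule has_derivative_eq_rhs) (simp add: fun_eq_iff hE_add hE_scale algebra_simps)

text \<open>A dimension count. It shows that multiplication by a matrix such as
  \<open>mat 1 - Y\<close> is onto \<open>dg.EE SL\<close>, so that inverses stay in that space
  without any series expansion.\<close>

lemma linear_inj_image_subspace:
  fixes T :: "'a::euclidean_space \<Rightarrow> 'a"
  assumes T: "linear T" "inj T" and S: "subspace S" "\<And>x. x \<in> S \<Longrightarrow> T x \<in> S"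
  shows "T ` S = S"
proof (rule subspace_dim_equal)
  show "subspace (T ` S)" by (rule linear_subspace_image[OF T(1) S(1)])
  show "dim S \<le> dim (T ` S)" using dim_image_eq[OF T(1), of S] T(2) by (simp add: inj_on_subset)
qed (use S in auto)

section \<open>Factorization along a holomorphic curve\<close>

text \<open>The vanishing second entry of \<open>wd\<close> expresses holomorphy of \<open>G\<close>
  and of its derivative \<open>G1\<close>. \<open>G_pol\<close> supplies a polarized structure at
  each point of the line, as required to compare metrics there with the one at
  \<open>F\<close>.\<close>

locale hodge_line = polarized_hodge W F Q
  for W :: "'n::finite weight" and F :: "'n filt" and Q :: "'n forms" +
  fixes G G1 :: "complex \<Rightarrow> complex ^ 'n ^ 'n" and r :: real and u :: "complex ^ 'n ^ 'n"
  assumes r: "0 < r" and G0: "G 0 = mat 1"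
    and G_mem: "\<And>s. s \<in> ball 0 r \<Longrightarrow> G s \<in> G_C W Q"
    and G_pol: "\<And>s. s \<in> ball 0 r \<Longrightarrow> polarized_hodge W (filt_act (G s) F) Q"
    and G_wd: "\<And>s. s \<in> ball 0 r \<Longrightarrow> wd G s (G1 s) 0"
    and G1_wd: "\<And>s. s \<in> ball 0 r \<Longrightarrow> \<exists>C. wd G1 s C 0"
    and G1_0: "G1 0 = u" and u: "u \<in> \<gg>" "u \<in> dg.EE SQ"
begin

definition "ub = cnj_mat u"
definition "up = dg.epart SP ub"

lemma ub_g: "ub \<in> \<gg>"
  by (simp add: ub_def glie_cnj u)

lemma up_g: "up \<in> \<gg>"
  by (simp add: up_def glie_epart ub_g)

lemma ub_low: "ub - up \<in> dg.EE SL"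
proof -
  have "ub \<in> dg.EE (clo SQ \<inter> SW)" unfolding ub_def
    by (intro dg.EE_Int EE_cnj u glie_SW glie_cnj)
  then have ub: "ub \<in> dg.EE (SP \<union> SL)" by (rule dg.EE_mono) (rule clo_simps)
  have "dg.epart (SP \<union> SL) ub = up + dg.epart SL ub" unfolding up_def by (rule dg.epart_Un) (auto simp: S_defs)
  then have "ub - up = dg.epart SL ub" using dg.epart_id[OF ub] by (simp add: algebra_simps)
  then show ?thesis by simp
qed

text \<open>
  The sum of the four maps is the identity; they are the directions of the real factor, of the factor in
  the group of \<open>\<Lambda>\<close>, of the factor in the isotropy group, and of a complement of \<open>\<gg>\<close>.
\<close>

definition "pg = h.hproj \<gg>"
definition "L1 X = dg.epart SM (pg X) + cnj_mat (dg.epart SM (pg X)) + cscale (1/2) (dg.epart S0 (pg X) + cnj_mat (dg.epart S0 (pg X)))"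
definition "L3 X = dg.epart SP (pg X) - dg.epart SP (cnj_mat (dg.epart SM (pg X))) +
   cscale (1/2) (dg.epart S0 (pg X) - dg.epart S0 (cnj_mat (dg.epart S0 (pg X))))"
definition "L2 X = pg X - L1 X - L3 X"
definition "L4 X = X - pg X"

lemma pg_g: "pg X \<in> \<gg>" and pg_id: "X \<in> \<gg> \<Longrightarrow> pg X = X"
  by (simp_all add: pg_def h.hproj_mem h.hproj_id csub_glie)

lemma pg_add: "pg (X + Y) = pg X + pg Y" and pg_scale: "pg (cscale c X) = cscale c (pg X)"
  by (simp_all add: pg_def h.hproj_add h.hproj_cscale csub_glie)

lemma L_linear: "linear L1" "linear L2" "linear L3" "linear L4"
proof -
  have R: "c *\<^sub>R X = cscale (of_real c) X" for c and X :: "complex ^ 'n ^ 'n" by (simp add: cscale_of_real)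
  show 1: "linear L1" unfolding L1_def
    by (rule linearI) (simp_all add: R pg_add pg_scale dg.epart_add dg.epart_cscale cscale_distrib mult.commute)
  show 3: "linear L3" unfolding L3_def
    by (rule linearI) (simp_all add: R pg_add pg_scale dg.epart_add dg.epart_cscale cscale_distrib mult.commute)
  show "linear L2" unfolding L2_def
    by (rule linearI) (simp_all add: R pg_add pg_scale linear_add[OF 1] linear_add[OF 3]
        linear_scale[OF 1, unfolded R] linear_scale[OF 3, unfolded R] cscale_distrib)
  show "linear L4" unfolding L4_def
    by (rule linearI) (simp_all add: R pg_add pg_scale cscale_distrib)
qed

lemma L1_g: "L1 X \<in> \<gg>" "cnj_mat (L1 X) = L1 X"
  by (simp_all add: L1_def csub_add[OF csub_glie] csub_scale[OF csub_glie] glie_cnj glie_epart pg_g add.commute)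

lemma L3_g: "L3 X \<in> \<gg>" "L3 X \<in> dg.EE SF"
proof -
  show "L3 X \<in> \<gg>"
    unfolding L3_def by (intro csub_add[OF csub_glie] csub_diff[OF csub_glie] csub_scale[OF csub_glie] glie_cnj glie_epart pg_g)
  have e: "dg.epart S Y \<in> dg.EE SF" if "S \<subseteq> SF" for S Y by (rule dg.EE_mono[OF dg.EE_mem that])
  show "L3 X \<in> dg.EE SF"
    unfolding L3_def by (intro csub_add[OF dg.csub_EE] csub_diff[OF dg.csub_EE] csub_scale[OF dg.csub_EE] e) (auto simp: S_defs)
qed

lemma cnj_SM_low: "cnj_mat (dg.epart SM Y) - dg.epart SP (cnj_mat (dg.epart SM Y)) \<in> dg.EE SL"
proof -
  let ?Z = "cnj_mat (dg.epart SM Y)"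
  have Z: "?Z \<in> dg.EE (SP \<union> SL)" by (rule dg.EE_mono[OF EE_cnj[OF dg.EE_mem] clo_simps(2)])
  have "dg.epart (SP \<union> SL) ?Z = dg.epart SP ?Z + dg.epart SL ?Z" by (rule dg.epart_Un) (auto simp: S_defs)
  then have "?Z - dg.epart SP ?Z = dg.epart SL ?Z" using dg.epart_id[OF Z] by (simp add: algebra_simps)
  then show ?thesis by simp
qed

lemma cnj_S0_low: "cnj_mat (dg.epart S0 Y) - dg.epart S0 (cnj_mat (dg.epart S0 Y)) \<in> dg.EE SL"
proof -
  let ?Z = "cnj_mat (dg.epart S0 Y)"
  have Z: "?Z \<in> dg.EE (S0 \<union> SL)" by (rule dg.EE_mono[OF EE_cnj[OF dg.EE_mem] clo_simps(4)])
  have "dg.epart (S0 \<union> SL) ?Z = dg.epart S0 ?Z + dg.epart SL ?Z" by (rule dg.epart_Un) (auto simp: S_defs)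
  then have "?Z - dg.epart S0 ?Z = dg.epart SL ?Z" using dg.epart_id[OF Z] by (simp add: algebra_simps)
  then show ?thesis by simp
qed

text \<open>\<open>L1\<close> completes the \<open>n_minus\<close> part to a real element, and
  splits the part of shift (0, 0) into half a real element and a rest. \<open>L3\<close> subtracts
  what this adds to \<open>n_plus\<close> and to the shift (0, 0). Conjugation exchanges or
  preserves these spaces modulo \<Lambda>, so the remainder lies in \<Lambda>.\<close>

lemma L2_SL: "L2 X \<in> dg.EE SL"
proof -
  let ?x = "pg X"
  have half: "cscale (1/2) Y + cscale (1/2) Y = Y" for Y :: "complex ^ 'n ^ 'n" by (simp add: vec_eq_iff)
  have "L2 X = dg.epart SL ?x
      - (cnj_mat (dg.epart SM ?x) - dg.epart SP (cnj_mat (dg.epart SM ?x)))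
      - cscale (1/2) (cnj_mat (dg.epart S0 ?x) - dg.epart S0 (cnj_mat (dg.epart S0 ?x)))"
    unfolding L2_def L1_def L3_def cscale_distrib
    using glie_parts[OF pg_g, of X] half[of "dg.epart S0 ?x"] by (simp add: algebra_simps)
  then show ?thesis
    using dg.EE_mem cnj_SM_low cnj_S0_low by (simp add: csub_diff[OF dg.csub_EE] csub_scale[OF dg.csub_EE])
qed

text \<open>\<open>L4 X\<close> is in the kernel of the projection \<open>pg\<close>, which is the
  identity on the Lie algebra.\<close>

lemma L4_zero: assumes "L4 X \<in> \<gg>" shows "L4 X = 0"
proof -
  have "L4 X = pg (L4 X)" by (simp add: pg_id assms)
  also have "\<dots> = pg X - pg (pg X)" unfolding L4_def using pg_add[of "X - pg X" "pg X"] by (simp add: algebra_simps)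
  also have "\<dots> = 0" by (simp add: pg_id pg_g)
  finally show ?thesis .
qed

lemma L_sum: "L1 X + L2 X + L3 X + L4 X = X"
  by (simp add: L2_def L4_def)

text \<open>\<open>cay Y - mat 1\<close> solves the equation
  \<open>(mat 1 - Y) ** Z = cscale 2 Y\<close>, and multiplication by \<open>mat 1 - Y\<close> maps
  \<open>dg.EE SL\<close> bijectively to itself.\<close>

lemma cay_SL: assumes Y: "Y \<in> dg.EE SL" "regular Y" shows "cay Y - mat 1 \<in> dg.EE SL"
proof -
  have i: "invertible (mat 1 - Y)" using Y by (simp add: regular_def)
  let ?T = "\<lambda>Z :: complex ^ 'n ^ 'n. (mat 1 - Y) ** Z"
  have "?T ` dg.EE SL = dg.EE SL"
  proof (rule linear_inj_image_subspace)
    show "linear ?T"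
      by (rule linearI) (simp_all add: matrix_add_ldistrib cscale_of_real[symmetric] cscale_mult)
    show "inj ?T" by (rule inj_on_inverseI[of _ "\<lambda>Z. matrix_inv (mat 1 - Y) ** Z"]) (simp add: matrix_inv_cancel[OF i])
    show "subspace (dg.EE SL)" by (rule csub_subspace[OF dg.csub_EE])
    fix Z assume Z: "Z \<in> dg.EE SL"
    have "Y ** Z \<in> dg.EE SL" by (rule dg.EE_mult[OF Y(1) Z]) (auto simp: S_defs)
    then show "(mat 1 - Y) ** Z \<in> dg.EE SL" using Z by (simp add: matrix_diff_distrib csub_diff[OF dg.csub_EE])
  qed
  moreover have "cscale 2 Y \<in> dg.EE SL" using Y by (simp add: csub_scale[OF dg.csub_EE])
  ultimately obtain Z where Z: "Z \<in> dg.EE SL" "(mat 1 - Y) ** Z = cscale 2 Y" by (metis imageE)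
  have "cay Y - mat 1 = matrix_inv (mat 1 - Y) ** ((mat 1 + Y) - (mat 1 - Y))"
    by (simp only: cay_def matrix_diff_distrib(2)[where A = "mat 1 + Y" and B = "mat 1 - Y"] matrix_inv[OF i])
  also have "(mat 1 + Y) - (mat 1 - Y) = cscale 2 Y" by (simp add: vec_eq_iff)
  also have "matrix_inv (mat 1 - Y) ** cscale 2 Y = Z" unfolding Z(2)[symmetric] by (simp add: matrix_inv_cancel[OF i])
  finally show ?thesis using Z by simp
qed

lemma isotropy_SF: assumes f: "f \<in> isotropy W Q F" shows "f \<in> dg.EE SF" "matrix_inv f \<in> dg.EE SF" "f \<in> G_C W Q" "invertible f"
proof -
  have *: "f \<in> dg.EE SF" if "f \<in> isotropy W Q F" for f
    using that pres_F_iff[of f] by (auto simp: isotropy_def filt_act_def fun_eq_iff)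
  then show "f \<in> dg.EE SF" "matrix_inv f \<in> dg.EE SF" using f stab_inv[of f W Q "range F"] by (auto simp: isotropy_stab)
  show "f \<in> G_C W Q" using f by (simp add: isotropy_def)
  then show "invertible f" by (rule G_C_invertible)
qed

definition fact_at :: "(complex \<Rightarrow> complex ^ 'n ^ 'n) \<Rightarrow> (complex \<Rightarrow> complex ^ 'n ^ 'n) \<Rightarrow> (complex \<Rightarrow> complex ^ 'n ^ 'n) \<Rightarrow> complex \<Rightarrow> bool" where
  "fact_at k l f s \<longleftrightarrow> G s = k s ** l s ** f s \<and> k s \<in> G_C W Q \<and> cnj_mat (k s) = k s \<and>
     l s - mat 1 \<in> dg.EE SL \<and> invertible (l s) \<and> f s \<in> isotropy W Q F \<and>
     k differentiable (at s) \<and> l differentiable (at s) \<and> f differentiable (at s)"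

lemma factorization:
  obtains e k l f where "0 < e" "e \<le> r" "\<And>s. s \<in> ball 0 e \<Longrightarrow> fact_at k l f s"
    "k 0 = mat 1" "l 0 = mat 1" "f 0 = mat 1"
    "wd k 0 (dg.epart SM u) (cnj_mat (dg.epart SM u))"
    "wd l 0 (u - dg.epart SM u) (up - cnj_mat (dg.epart SM u))" "wd f 0 0 (- up)"
proof -
  obtain V \<Phi> where V: "open V" "mat 1 \<in> V" "\<Phi> (mat 1) = 0"
    and fac: "\<And>g. g \<in> V \<Longrightarrow> g = cay (L1 (\<Phi> g)) ** cay (L2 (\<Phi> g)) ** cay (L3 (\<Phi> g)) ** cay (L4 (\<Phi> g))"
    and reg: "\<And>g. g \<in> V \<Longrightarrow> regular (L1 (\<Phi> g)) \<and> regular (L2 (\<Phi> g)) \<and> regular (L3 (\<Phi> g)) \<and> regular (L4 (\<Phi> g))"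
    and dif: "\<And>g. g \<in> V \<Longrightarrow> \<Phi> differentiable (at g)"
    and d1: "(\<Phi> has_derivative (\<lambda>H. (1/2) *\<^sub>R H)) (at (mat 1))"
    using cay_factorization[OF L_linear L_sum] by metis
  have "isCont G 0" using G_wd[of 0] r unfolding wd_def by (auto dest: has_derivative_continuous)
  then have "\<forall>\<^sub>F s in nhds 0. G s \<in> V"
    using V G0 unfolding isCont_def tendsto_at_iff_tendsto_nhds by (auto dest: topological_tendstoD)
  then obtain e0 where e0: "0 < e0" "\<And>s. dist s 0 < e0 \<Longrightarrow> G s \<in> V" by (auto simp: eventually_nhds_metric)
  define e where "e = min e0 r"
  have e: "0 < e" "e \<le> r" using e0 r by (auto simp: e_def)
  have GV: "G s \<in> V" if "s \<in> ball 0 e" for s using that e0(2)[of s] by (simp add: e_def dist_commute)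
  define k l f where "k s = cay (L1 (\<Phi> (G s)))" and "l s = cay (L2 (\<Phi> (G s)))" and "f s = cay (L3 (\<Phi> (G s)))" for s
  have bl: "bounded_linear L1" "bounded_linear L2" "bounded_linear L3"
    using L_linear by (auto simp: linear_conv_bounded_linear)
  have fa: "fact_at k l f s" if s: "s \<in> ball 0 e" for s
  proof -
    let ?X = "\<Phi> (G s)"
    have sr: "s \<in> ball 0 r" using s e by auto
    note R = reg[OF GV[OF s]]
    have kG: "k s \<in> G_C W Q" using cay_G_C[of "L1 ?X"] R L1_g by (simp add: k_def)
    have kr: "cnj_mat (k s) = k s" using R by (simp add: k_def cay_cnj L1_g)
    have lS: "l s - mat 1 \<in> dg.EE SL" using cay_SL[OF L2_SL] R by (simp add: l_def)
    have li: "invertible (l s)" using R by (simp add: l_def cay_invertible)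
    have lG: "l s \<in> G_C W Q" by (rule G_C_SL[OF lS li])
    have fI: "f s \<in> isotropy W Q F" using cay_isotropy[OF L3_g] R by (simp add: f_def)
    have fG: "f s \<in> G_C W Q" using fI by (rule isotropy_SF)
    have Gs: "G s = k s ** l s ** f s ** cay (L4 ?X)" using fac[OF GV[OF s]] by (simp add: k_def l_def f_def)
    have klf: "k s ** l s ** f s \<in> G_C W Q" by (intro G_C_mult kG lG fG)
    have "cay (L4 ?X) = matrix_inv (k s ** l s ** f s) ** ((k s ** l s ** f s) ** cay (L4 ?X))"
      by (rule matrix_inv_cancel(2)[OF G_C_invertible[OF klf], symmetric])
    also have "(k s ** l s ** f s) ** cay (L4 ?X) = G s" by (rule Gs[symmetric])
    finally have "cay (L4 ?X) = matrix_inv (k s ** l s ** f s) ** G s" .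
    \<comment> \<open>The fourth factor is a quotient of group elements, so its direction lies in
      the Lie algebra; being in a complement of it, that direction is 0.\<close>
    then have "cay (L4 ?X) \<in> G_C W Q" using G_mem[OF sr] klf by (simp add: G_C_mult G_C_inv)
    then have "L4 ?X = 0" using L4_zero cay_G_C R by blast
    then have Gs': "G s = k s ** l s ** f s" using Gs by simp
    have "G differentiable (at s)" using G_wd[OF sr] by (auto simp: wd_def differentiable_def)
    then obtain D where D: "((\<lambda>s. \<Phi> (G s)) has_derivative D) (at s)"
      using dif[OF GV[OF s]] has_derivative_compose by (metis differentiable_def)
    have "k differentiable (at s)" "l differentiable (at s)" "f differentiable (at s)"
      unfolding k_def[abs_def] l_def[abs_def] f_def[abs_def] differentiable_def
      using has_derivative_compose[OF bounded_linear.has_derivative[OF bl(1) D] cay_has_derivative]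
        has_derivative_compose[OF bounded_linear.has_derivative[OF bl(2) D] cay_has_derivative]
        has_derivative_compose[OF bounded_linear.has_derivative[OF bl(3) D] cay_has_derivative] R by blast+
    then show ?thesis using Gs' kG kr lS li fI by (simp add: fact_at_def)
  qed
  have zero: "L1 0 = 0" "L2 0 = 0" "L3 0 = 0" using L_linear by (auto simp: linear_0)
  have dG: "((\<lambda>s. \<Phi> (G s)) has_derivative (\<lambda>\<tau>. (1/2) *\<^sub>R (cscale \<tau> u))) (at 0)"
  proof -
    have 1: "(G has_derivative (\<lambda>\<tau>. cscale \<tau> u)) (at 0)" using G_wd[of 0] r G1_0 by (simp add: wd_def)
    have 2: "(\<Phi> has_derivative (\<lambda>H. (1/2) *\<^sub>R H)) (at (G 0))" using d1 G0 by simp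
    show ?thesis using has_derivative_compose[OF 1 2] .
  qed
  \<comment> \<open>The halving in the derivative of \<Phi> cancels the doubling by
    \<open>cayD\<close>.\<close>
  have dcay: "((\<lambda>s. cay (L (\<Phi> (G s)))) has_derivative (\<lambda>\<tau>. L (cscale \<tau> u))) (at 0)"
    if "bounded_linear L" "L 0 = 0" for L
  proof -
    interpret L: bounded_linear L by fact
    have "((\<lambda>s. cay (L (\<Phi> (G s)))) has_derivative (\<lambda>\<tau>. cayD (L (\<Phi> (G 0))) (L ((1/2) *\<^sub>R (cscale \<tau> u))))) (at 0)"
      by (rule has_derivative_compose[OF L.has_derivative[OF dG] cay_has_derivative]) (simp add: G0 V that)
    then show ?thesis by (simp add: G0 V that cayD_0 L.scaleR)
  qed
  have uS: "dg.epart SP u = 0" "dg.epart S0 u = 0"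
    by (rule dg.epart_disjoint[OF u(2)], force simp: S_defs)+
  have upM: "dg.epart SP (cnj_mat (dg.epart SM u)) = up"
  proof -
    have "u = dg.epart SM u + dg.epart SL u" using glie_parts[OF u(1)] uS by simp
    then have "up = dg.epart SP (cnj_mat (dg.epart SM u + dg.epart SL u))" by (simp add: up_def ub_def)
    moreover have "dg.epart SP (cnj_mat (dg.epart SL u)) = 0"
      by (rule dg.epart_disjoint[OF dg.EE_mono[OF EE_cnj[OF dg.EE_mem] clo_simps(1)]]) (auto simp: S_defs)
    ultimately show ?thesis by (simp add: dg.epart_add)
  qed
  have tu: "pg (cscale \<tau> u) = cscale \<tau> u" for \<tau> by (simp add: pg_id csub_scale[OF csub_glie] u)
  have L1u: "L1 (cscale \<tau> u) = cscale \<tau> (dg.epart SM u) + cscale (cnj \<tau>) (cnj_mat (dg.epart SM u))" for \<tau>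
    by (simp add: L1_def tu dg.epart_cscale uS)
  \<comment> \<open>As \<open>u\<close> has no part in \<open>n_plus\<close> or of shift (0, 0),
    only the conjugate of its \<open>n_minus\<close> part enters \<open>L3\<close>; hence
    \<open>f\<close> moves purely antiholomorphically at 0.\<close>
  have L3u: "L3 (cscale \<tau> u) = cscale (cnj \<tau>) (- up)" for \<tau>
    by (simp add: L3_def tu dg.epart_cscale uS upM cscale_distrib)
  have L2u: "L2 (cscale \<tau> u) = cscale \<tau> (u - dg.epart SM u) + cscale (cnj \<tau>) (up - cnj_mat (dg.epart SM u))" for \<tau>
    by (simp add: L2_def L1u L3u tu cscale_distrib)
  show thesis
  proof (rule that[OF e fa])
    show "k 0 = mat 1" "l 0 = mat 1" "f 0 = mat 1" by (simp_all add: k_def l_def f_def G0 V zero)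
    show "wd k 0 (dg.epart SM u) (cnj_mat (dg.epart SM u))"
      using dcay[OF bl(1) zero(1)] by (simp add: wd_def k_def[abs_def] L1u)
    show "wd l 0 (u - dg.epart SM u) (up - cnj_mat (dg.epart SM u))"
      using dcay[OF bl(2) zero(2)] by (simp add: wd_def l_def[abs_def] L2u)
    show "wd f 0 0 (- up)"
      using dcay[OF bl(3) zero(3)] by (simp add: wd_def f_def[abs_def] L3u)
  qed
qed

end

section \<open>The Maurer-Cartan equation of the factorization\<close>

context polarized_hodge begin

lemma inv_SL:
  assumes l: "l - mat 1 \<in> dg.EE SL" "invertible l" shows "matrix_inv l - mat 1 \<in> dg.EE SL"
proof -
  let ?T = "\<lambda>Z :: complex ^ 'a ^ 'a. l ** Z"
  have e: "l ** Z = Z + (l - mat 1) ** Z" for Z :: "complex ^ 'a ^ 'a" by (simp add: matrix_diff_distrib)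
  have "?T ` dg.EE SL = dg.EE SL"
  proof (rule linear_inj_image_subspace)
    show "linear ?T"
      by (rule linearI) (simp_all add: matrix_add_ldistrib cscale_of_real[symmetric] cscale_mult)
    show "inj ?T" by (rule inj_on_inverseI[of _ "\<lambda>Z. matrix_inv l ** Z"]) (simp add: matrix_inv_cancel[OF l(2)])
    show "subspace (dg.EE SL)" by (rule csub_subspace[OF dg.csub_EE])
    fix Z assume Z: "Z \<in> dg.EE SL"
    have "(l - mat 1) ** Z \<in> dg.EE SL" by (rule dg.EE_mult[OF l(1) Z]) (auto simp: S_defs)
    then show "l ** Z \<in> dg.EE SL" unfolding e using Z by (simp add: csub_add[OF dg.csub_EE])
  qed
  moreover have "- (l - mat 1) \<in> dg.EE SL" using l csub_neg[OF dg.csub_EE] by blast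
  ultimately obtain Z where Z: "Z \<in> dg.EE SL" "l ** Z = - (l - mat 1)" by (metis imageE)
  have "matrix_inv l - mat 1 = matrix_inv l ** (- (l - mat 1))"
    by (simp add: matrix_diff_distrib matrix_inv[OF l(2)])
  also have "\<dots> = Z" unfolding Z(2)[symmetric] by (simp add: matrix_inv_cancel[OF l(2)])
  finally show ?thesis using Z by simp
qed

text \<open>Conjugation transported by \<open>l\<close>: if the two parts of the form of
  \<open>k\<close> are conjugate to each other, \<open>twist l\<close> carries one of them,
  conjugated by the inverse of \<open>l\<close>, to the other.\<close>

definition twist :: "complex ^ 'a ^ 'a \<Rightarrow> complex ^ 'a ^ 'a \<Rightarrow> complex ^ 'a ^ 'a" where
  "twist l X = matrix_inv l ** cnj_mat (l ** X ** matrix_inv l) ** l"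

lemma twist_simps: "twist l (X + Y) = twist l X + twist l Y" "twist l (X - Y) = twist l X - twist l Y"
  by (simp_all add: twist_def matrix_add_ldistrib matrix_add_rdistrib' matrix_diff_distrib)

lemma SF_parts: "X \<in> \<gg> \<Longrightarrow> X \<in> dg.EE SF \<Longrightarrow> X = dg.epart SP X + dg.epart S0 X"
proof -
  assume X: "X \<in> \<gg>" "X \<in> dg.EE SF"
  have "SF \<inter> SM = {}" "SF \<inter> SL = {}" by (auto simp: S_defs)
  then show ?thesis using glie_parts[OF X(1)] dg.epart_disjoint[OF X(2)] by simp
qed

text \<open>The shifts of \<open>N + X\<close> are (0, 0) or have negative second entry, so after
  conjugation they are (0, 0) or have negative first entry, and \<open>l\<close> adds only further
  shifts of \<Lambda>. Thus nothing reaches \<open>n_plus\<close>, and the shift (0, 0) sees only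
  the conjugate of the corresponding part of \<open>X\<close>, which \<open>hadj_S0\<close>
  evaluates.\<close>

lemma twist_parts:
  assumes l: "l - mat 1 \<in> dg.EE SL" "invertible l" and N: "N \<in> dg.EE SL" and X: "X \<in> \<gg>" "X \<in> dg.EE SF"
  shows "dg.epart SP (twist l (N + X)) = 0" "dg.epart S0 (twist l (N + X)) = - h.hadj (dg.epart S0 X)"
proof -
  define R1 R2 R3 :: "(int \<times> int) set" where "R1 = {(a, b). b < 0} \<union> S0" and "R2 = SQ \<union> S0" and "R3 = {(a, b). b < 0}"
  note R_defs = R1_def R2_def R3_def S_defs
  define m where "m = matrix_inv l"
  have m: "m - mat 1 \<in> dg.EE SL" unfolding m_def by (rule inv_SL[OF l])
  have one: "mat 1 \<in> dg.EE (S0 \<union> SL)" by (rule dg.EE_mono[OF dg.EE_one]) (auto simp: S_defs zero_prod_def)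
  have lB: "l \<in> dg.EE (S0 \<union> SL)"
    using csub_add[OF dg.csub_EE one dg.EE_mono[OF l(1), of "S0 \<union> SL"]] by simp
  have mB: "m \<in> dg.EE (S0 \<union> SL)"
    using csub_add[OF dg.csub_EE one dg.EE_mono[OF m, of "S0 \<union> SL"]] by simp
  define Z where "Z = N + X"
  have "X \<in> dg.EE (SF \<inter> SW)" by (rule dg.EE_Int[OF X(2) glie_SW[OF X(1)]])
  then have "X \<in> dg.EE R1" by (rule dg.EE_mono) (auto simp: R_defs)
  moreover have "N \<in> dg.EE R1" by (rule dg.EE_mono[OF N]) (auto simp: R_defs)
  ultimately have Z: "Z \<in> dg.EE R1" unfolding Z_def by (rule csub_add[OF dg.csub_EE, rotated])
  have D1: "l ** Z ** m - Z \<in> dg.EE R3"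
  proof -
    have "(l - mat 1) ** Z \<in> dg.EE R3" by (rule dg.EE_mult[OF l(1) Z]) (auto simp: R_defs)
    then have a: "(l - mat 1) ** Z ** m \<in> dg.EE R3" by (rule dg.EE_mult[OF _ mB]) (auto simp: R_defs)
    have b: "Z ** (m - mat 1) \<in> dg.EE R3" by (rule dg.EE_mult[OF Z m]) (auto simp: R_defs)
    have "l ** Z ** m - Z = (l - mat 1) ** Z ** m + Z ** (m - mat 1)" by (simp add: matrix_diff_distrib)
    then show ?thesis using csub_add[OF dg.csub_EE a b] by simp
  qed
  have cR3: "clo R3 \<subseteq> SQ" and cR1: "clo R1 \<subseteq> R2" by (auto simp: clo_def R_defs)
  have cD1: "cnj_mat (l ** Z ** m - Z) \<in> dg.EE SQ" by (rule dg.EE_mono[OF EE_cnj[OF D1] cR3])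
  have cZ: "cnj_mat Z \<in> dg.EE R2" by (rule dg.EE_mono[OF EE_cnj[OF Z] cR1])
  define V where "V = cnj_mat (l ** Z ** m)"
  have "V = cnj_mat Z + cnj_mat (l ** Z ** m - Z)" by (simp add: V_def)
  then have V: "V \<in> dg.EE R2" using csub_add[OF dg.csub_EE cZ dg.EE_mono[OF cD1, of R2]] by (auto simp: R2_def)
  have D2: "m ** V ** l - V \<in> dg.EE SQ"
  proof -
    have "(m - mat 1) ** V \<in> dg.EE SQ" by (rule dg.EE_mult[OF m V]) (auto simp: R_defs)
    then have a: "(m - mat 1) ** V ** l \<in> dg.EE SQ" by (rule dg.EE_mult[OF _ lB]) (auto simp: R_defs)
    have b: "V ** (l - mat 1) \<in> dg.EE SQ" by (rule dg.EE_mult[OF V l(1)]) (auto simp: R_defs)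
    have "m ** V ** l - V = (m - mat 1) ** V ** l + V ** (l - mat 1)" by (simp add: matrix_diff_distrib)
    then show ?thesis using csub_add[OF dg.csub_EE a b] by simp
  qed
  have T: "twist l (N + X) = cnj_mat Z + (cnj_mat (l ** Z ** m - Z) + (m ** V ** l - V))"
    by (simp add: twist_def V_def m_def Z_def[symmetric])
  have T': "cnj_mat (l ** Z ** m - Z) + (m ** V ** l - V) \<in> dg.EE SQ" by (rule csub_add[OF dg.csub_EE cD1 D2])
  have "twist l (N + X) \<in> dg.EE R2" unfolding T
    by (rule csub_add[OF dg.csub_EE cZ dg.EE_mono[OF T']]) (auto simp: R2_def)
  then show "dg.epart SP (twist l (N + X)) = 0" by (rule dg.epart_disjoint) (auto simp: R_defs)
  have "dg.epart S0 (twist l (N + X)) = dg.epart S0 (cnj_mat Z)"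
    unfolding T dg.epart_add[of S0 "cnj_mat Z"] using dg.epart_disjoint[OF T', of S0] by (simp add: S_defs)
  also have "\<dots> = dg.epart S0 (cnj_mat N + (cnj_mat (dg.epart SP X) + cnj_mat (dg.epart S0 X)))"
    using SF_parts[OF X] by (simp add: Z_def flip: cnj_mat_simps(2))
  also have "\<dots> = dg.epart S0 (cnj_mat (dg.epart S0 X))"
  proof -
    have "dg.epart S0 (cnj_mat N) = 0"
      by (rule dg.epart_disjoint[OF dg.EE_mono[OF EE_cnj[OF N] clo_simps(1)]]) (auto simp: S_defs)
    moreover have "dg.epart S0 (cnj_mat (dg.epart SP X)) = 0"
      by (rule dg.epart_disjoint[OF dg.EE_mono[OF EE_cnj[OF dg.EE_mem] clo_simps(3)]]) (auto simp: S_defs)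
    ultimately show ?thesis by (simp add: dg.epart_add)
  qed
  also have "\<dots> = - h.hadj (dg.epart S0 X)" by (simp add: hadj_S0 glie_epart X)
  finally show "dg.epart S0 (twist l (N + X)) = - h.hadj (dg.epart S0 X)" .
qed

end

context hodge_line begin

definition "\<eta> s = matrix_inv (G s) ** G1 s"

lemma lie_G_C: "lie_algebra (G_C W Q) = \<gg>"
  using g_C_eq by (simp add: g_C_def)

lemma wd_left_mult: "wd f s C C' \<Longrightarrow> wd (\<lambda>x. A ** f x) s (A ** C) (A ** C')"
  using wd_mult[OF wd_const[of A s]] by (simp add: matrix_zero)

lemma wd_right_mult: "wd f s C C' \<Longrightarrow> wd (\<lambda>x. f x ** A) s (C ** A) (C' ** A)"
  using wd_mult[OF _ wd_const[of A s]] by (simp add: matrix_zero)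

lemma eventually_ball: "s \<in> ball 0 e \<Longrightarrow> (\<And>x. x \<in> ball (0::complex) e \<Longrightarrow> A x) \<Longrightarrow> eventually A (nhds s)"
  using eventually_nhds open_ball by blast

lemma \<eta>_g: assumes s: "s \<in> ball 0 r" shows "\<eta> s \<in> \<gg>"
proof -
  have i: "invertible (G s)" by (rule G_C_invertible[OF G_mem[OF s]])
  have "wd (\<lambda>x. matrix_inv (G s) ** G x) s (matrix_inv (G s) ** G1 s) (matrix_inv (G s) ** 0)"
    by (rule wd_left_mult[OF G_wd[OF s]])
  then have "matrix_inv (G s) ** G1 s \<in> lie_algebra (G_C W Q)"
  proof (rule wd_group(1))
    show "\<forall>\<^sub>F x in nhds s. matrix_inv (G s) ** G x \<in> G_C W Q"
      by (rule eventually_ball[OF s]) (intro G_C_mult G_C_inv G_mem s)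
  qed (auto simp: matrix_inv[OF i] lie_G_C csub_glie)
  then show ?thesis by (simp add: \<eta>_def lie_G_C)
qed

definition "alpha f s = f s ** \<eta> s ** matrix_inv (f s)"

text \<open>The right-hand side of the equation for \<open>\<psi> + \<psi>'\<^sup>*\<close>.\<close>

definition "Zc l f s = dg.epart SP (alpha f s) + dg.epart S0 (alpha f s) - h.hadj (dg.epart SP (twist (l s) (alpha f s)))"

text \<open>Differentiating \<open>G = k l f\<close> and removing \<open>k l\<close> on the left and
  \<open>f\<close> on the right writes \<open>alpha\<close> as an isotropy part \<psi>, a \<Lambda>
  part \<mu> and a transported form of \<open>k\<close>. The antiholomorphic derivative gives the
  same with 0 on the left. Reality of \<open>k\<close> links the two forms of \<open>k\<close> by
  \<open>twist\<close>, so both can be eliminated.\<close>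

lemma maurer_cartan:
  assumes e: "e \<le> r" and fac: "\<And>s. s \<in> ball 0 e \<Longrightarrow> fact_at k l f s" and s: "s \<in> ball 0 e" and f: "wd f s C C'"
  shows "C ** matrix_inv (f s) \<in> \<gg> \<inter> dg.EE SF" "C' ** matrix_inv (f s) \<in> \<gg> \<inter> dg.EE SF"
    "C ** matrix_inv (f s) + h.hadj (C' ** matrix_inv (f s)) = Zc l f s" "alpha f s \<in> \<gg>"
proof -
  note F = fac[OF s, unfolded fact_at_def]
  have sr: "s \<in> ball 0 r" using s e by auto
  obtain K K' where K: "wd k s K K'" using F wd_ex by blast
  obtain L L' where L: "wd l s L L'" using F wd_ex by blast
  have ki: "invertible (k s)" and li: "invertible (l s)" and fi: "invertible (f s)" and fG: "f s \<in> G_C W Q"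
    using F G_C_invertible isotropy_SF by blast+
  have lS: "l s - mat 1 \<in> dg.EE SL" using F by blast
  define \<omega> \<omega>' \<mu> \<mu>' \<psi> \<psi>' where "\<omega> = matrix_inv (k s) ** K" and "\<omega>' = matrix_inv (k s) ** K'"
    and "\<mu> = matrix_inv (l s) ** L" and "\<mu>' = matrix_inv (l s) ** L'"
    and "\<psi> = C ** matrix_inv (f s)" and "\<psi>' = C' ** matrix_inv (f s)"
  \<comment> \<open>Conjugation swaps the two Wirtinger derivatives, and \<open>k\<close> is its own
    conjugate.\<close>
  have K': "K' = cnj_mat K"
  proof -
    have "wd (\<lambda>x. cnj_mat (k x)) s (cnj_mat K') (cnj_mat K)" by (rule wd_antilinear[OF antilinear_cnj K])
    then have "wd k s (cnj_mat K') (cnj_mat K)"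
      by (rule wd_cong[OF _ open_ball s]) (use fac in \<open>auto simp: fact_at_def\<close>)
    then show ?thesis using wd_unique(2)[OF K] by blast
  qed
  have \<omega>': "\<omega>' = cnj_mat \<omega>" "\<omega> = cnj_mat \<omega>'"
    using F matrix_inv_cnj[OF ki] by (simp_all add: \<omega>_def \<omega>'_def K' cnj_mat_mult)
  have \<mu>: "\<mu> \<in> dg.EE SL" "\<mu>' \<in> dg.EE SL"
  proof -
    have LS: "L \<in> dg.EE SL" "L' \<in> dg.EE SL"
      using wd_csub[of "\<lambda>x. l x - mat 1" s L L' "dg.EE SL"] wd_diff[OF L wd_const[of "mat 1" s]]
        eventually_ball[OF s, of "\<lambda>x. l x - mat 1 \<in> dg.EE SL"] fac dg.csub_EE by (auto simp: fact_at_def)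
    have "matrix_inv (l s) = mat 1 + (matrix_inv (l s) - mat 1)" by simp
    moreover have "mat 1 \<in> dg.EE (S0 \<union> SL)" by (rule dg.EE_mono[OF dg.EE_one]) (auto simp: S_defs zero_prod_def)
    moreover have "matrix_inv (l s) - mat 1 \<in> dg.EE (S0 \<union> SL)" by (rule dg.EE_mono[OF inv_SL[OF lS li]]) auto
    ultimately have mi: "matrix_inv (l s) \<in> dg.EE (S0 \<union> SL)" by (metis csub_add dg.csub_EE)
    show "\<mu> \<in> dg.EE SL" unfolding \<mu>_def by (rule dg.EE_mult[OF mi LS(1)]) (auto simp: S_defs)
    show "\<mu>' \<in> dg.EE SL" unfolding \<mu>'_def by (rule dg.EE_mult[OF mi LS(2)]) (auto simp: S_defs)
  qed
  have "wd (\<lambda>x. f x ** matrix_inv (f s)) s \<psi> \<psi>'" unfolding \<psi>_def \<psi>'_def by (rule wd_right_mult[OF f])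
  then have "\<psi> \<in> lie_algebra (isotropy W Q F) \<and> \<psi>' \<in> lie_algebra (isotropy W Q F)"
  proof -
    assume w: "wd (\<lambda>x. f x ** matrix_inv (f s)) s \<psi> \<psi>'"
    have ev: "\<forall>\<^sub>F x in nhds s. f x ** matrix_inv (f s) \<in> isotropy W Q F"
    proof (rule eventually_ball[OF s])
      fix x :: complex assume "x \<in> ball 0 e"
      then show "f x ** matrix_inv (f s) \<in> isotropy W Q F"
        using F fac[of x] unfolding fact_at_def isotropy_stab by (intro stab_mult stab_inv) auto
    qed
    have c: "csub (lie_algebra (isotropy W Q F))" unfolding isotropy_alg_eq by (rule csub_Int)
    show ?thesis using wd_group[OF w matrix_inv(1)[OF fi] ev _ c] by (simp add: isotropy_def)
  qed
  then have \<psi>: "\<psi> \<in> \<gg>" "\<psi> \<in> dg.EE SF" "\<psi>' \<in> \<gg>" "\<psi>' \<in> dg.EE SF" unfolding isotropy_alg_eq by auto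
  then show "C ** matrix_inv (f s) \<in> \<gg> \<inter> dg.EE SF" "C' ** matrix_inv (f s) \<in> \<gg> \<inter> dg.EE SF"
    by (simp_all add: \<psi>_def \<psi>'_def)
  have "wd (\<lambda>x. k x ** l x ** f x) s (k s ** l s ** C + (k s ** L + K ** l s) ** f s)
     (k s ** l s ** C' + (k s ** L' + K' ** l s) ** f s)"
    by (rule wd_mult[OF wd_mult[OF K L] f])
  then have "wd G s (k s ** l s ** C + (k s ** L + K ** l s) ** f s)
     (k s ** l s ** C' + (k s ** L' + K' ** l s) ** f s)"
    by (rule wd_cong[OF _ open_ball s]) (use fac in \<open>auto simp: fact_at_def\<close>)
  then have eqs: "k s ** l s ** C + (k s ** L + K ** l s) ** f s = G1 s"
     "k s ** l s ** C' + (k s ** L' + K' ** l s) ** f s = 0"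
    using wd_unique[OF G_wd[OF sr]] by metis+
  define A where "A X = matrix_inv (l s) ** (matrix_inv (k s) ** X) ** matrix_inv (f s)" for X
  have A: "A (k s ** l s ** D + (k s ** E + H ** l s) ** f s) =
     D ** matrix_inv (f s) + matrix_inv (l s) ** E + matrix_inv (l s) ** (matrix_inv (k s) ** H) ** l s" for D E H
  proof -
    have 1: "A (k s ** l s ** D) = D ** matrix_inv (f s)"
      unfolding A_def matrix_mul_assoc[symmetric] by (simp only: matrix_inv_cancel[OF ki] matrix_inv_cancel[OF li])
    have 2: "A (k s ** E ** f s) = matrix_inv (l s) ** E"
      unfolding A_def matrix_mul_assoc[symmetric]
      by (simp only: matrix_inv_cancel[OF ki] matrix_inv[OF fi] matrix_mul_rid)
    have 3: "A (H ** l s ** f s) = matrix_inv (l s) ** (matrix_inv (k s) ** H) ** l s"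
      unfolding A_def matrix_mul_assoc[symmetric] by (simp only: matrix_inv[OF fi] matrix_mul_rid)
    have "A (X + Y) = A X + A Y" for X Y by (simp add: A_def matrix_add_ldistrib matrix_add_rdistrib')
    then show ?thesis by (simp add: 1 2 3 matrix_add_rdistrib')
  qed
  have Gi: "matrix_inv (G s) = matrix_inv (f s) ** (matrix_inv (l s) ** matrix_inv (k s))"
    using F by (simp add: matrix_inv_mult invertible_mult ki li fi)
  have "A (G1 s) = alpha f s"
    by (simp add: A_def alpha_def \<eta>_def Gi matrix_mul_assoc matrix_inv[OF fi])
  then have e1: "alpha f s = \<psi> + \<mu> + matrix_inv (l s) ** \<omega> ** l s"
    using A[of C L K] eqs(1) by (simp add: \<psi>_def \<mu>_def \<omega>_def)
  have "A 0 = 0" by (simp add: A_def)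
  then have e2: "0 = \<psi>' + \<mu>' + matrix_inv (l s) ** \<omega>' ** l s"
    using A[of C' L' K'] eqs(2) by (simp add: \<psi>'_def \<mu>'_def \<omega>'_def)
  have conj: "l s ** (matrix_inv (l s) ** X ** l s) ** matrix_inv (l s) = X" for X
    by (simp add: matrix_mul_assoc[symmetric] matrix_inv_cancel[OF li] matrix_inv[OF li])
  have t1: "matrix_inv (l s) ** \<omega>' ** l s = twist (l s) (alpha f s - (\<mu> + \<psi>))"
  proof -
    have "alpha f s - (\<mu> + \<psi>) = matrix_inv (l s) ** \<omega> ** l s" using e1 by (simp add: algebra_simps)
    then show ?thesis by (simp add: twist_def conj \<omega>'(1))
  qed
  have t2: "matrix_inv (l s) ** \<omega> ** l s = - twist (l s) (\<mu>' + \<psi>')"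
  proof -
    have "\<mu>' + \<psi>' = matrix_inv (l s) ** (- \<omega>') ** l s" using e2 by (simp add: matrix_neg algebra_simps eq_neg_iff_add_eq_0)
    then have "twist (l s) (\<mu>' + \<psi>') = matrix_inv (l s) ** (- \<omega>) ** l s" by (simp add: twist_def conj \<omega>'(1))
    then show ?thesis by (simp add: matrix_neg)
  qed
  \<comment> \<open>In \<open>p1\<close> and \<open>p2\<close> the form of \<open>k\<close> is gone.
    Their parts in \<open>n_plus\<close> and of shift (0, 0) determine the sum in question, because
    \<open>twist_parts\<close> evaluates every twisted isotropy and \<Lambda> term.\<close>
  have p1: "\<psi>' = twist (l s) (\<mu> + \<psi>) - twist (l s) (alpha f s) - \<mu>'"
  proof -
    have "\<psi>' + (\<mu>' + matrix_inv (l s) ** \<omega>' ** l s) = 0" using e2 by (simp add: add.assoc)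
    then have "\<psi>' = - (\<mu>' + matrix_inv (l s) ** \<omega>' ** l s)" by (rule eq_neg_iff_add_eq_0[THEN iffD2])
    then show ?thesis unfolding t1 twist_simps by simp
  qed
  have p2: "alpha f s = \<psi> + \<mu> - twist (l s) (\<mu>' + \<psi>')" using e1 unfolding t2 by simp
  have S: "dg.epart SP \<mu> = 0" "dg.epart S0 \<mu> = 0" "dg.epart SP \<mu>' = 0" "dg.epart S0 \<mu>' = 0"
    by (rule dg.epart_disjoint[OF \<mu>(1)], force simp: S_defs)+
      (rule dg.epart_disjoint[OF \<mu>(2)], force simp: S_defs)+
  note T = twist_parts[OF lS li \<mu>(1) \<psi>(1,2)] and T' = twist_parts[OF lS li \<mu>(2) \<psi>(3,4)]
  have a: "dg.epart SP \<psi>' = - dg.epart SP (twist (l s) (alpha f s))"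
    by (subst p1) (simp add: dg.epart_diff T S)
  have b: "dg.epart SP (alpha f s) = dg.epart SP \<psi>"
    by (subst p2) (simp add: dg.epart_diff dg.epart_add T' S)
  have c: "dg.epart S0 (alpha f s) = dg.epart S0 \<psi> + h.hadj (dg.epart S0 \<psi>')"
    by (subst p2) (simp add: dg.epart_diff dg.epart_add T' S)
  have "\<psi> + h.hadj \<psi>' = (dg.epart SP \<psi> + dg.epart S0 \<psi>) + h.hadj (dg.epart SP \<psi>' + dg.epart S0 \<psi>')"
    using SF_parts[OF \<psi>(1,2)] SF_parts[OF \<psi>(3,4)] by simp
  also have "\<dots> = Zc l f s" unfolding Zc_def b c by (simp add: h.hadj_add a h.hadj_neg h.hadj_diff)
  finally show "C ** matrix_inv (f s) + h.hadj (C' ** matrix_inv (f s)) = Zc l f s" by (simp add: \<psi>_def \<psi>'_def)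
  show "alpha f s \<in> \<gg>" unfolding alpha_def by (rule glie_Ad[OF fG \<eta>_g[OF sr]])
qed

section \<open>The Gram matrix along the curve\<close>

abbreviation "\<qq> \<equiv> \<gg> \<inter> dg.EE SQ"
abbreviation "pq \<equiv> h.hproj (\<gg> \<inter> dg.EE SQ)"

text \<open>The isotropy representation on the tangent space, that is, the action of
  \<open>Ad f\<close> modulo the isotropy algebra, read on the complement \<qq>.\<close>

definition "Aq f X = dg.epart SQ (f ** X ** matrix_inv f)"

lemma Aq_clinear: "clinear (Aq f)"
  by (simp add: clinear_def Aq_def matrix_add_ldistrib matrix_add_rdistrib' dg.epart_add dg.epart_cscale cscale_mult)

lemma Aq_mem: "f \<in> G_C W Q \<Longrightarrow> X \<in> \<gg> \<Longrightarrow> Aq f X \<in> \<qq>"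
  by (simp add: Aq_def glie_epart glie_Ad)

text \<open>\<open>Ad f\<close> preserves the isotropy algebra, so the isotropy part discarded
  between the two steps cannot influence the final part in \<qq>.\<close>

lemma Aq_inverse:
  assumes f: "f \<in> isotropy W Q F" and X: "X \<in> \<qq>" shows "Aq f (Aq (matrix_inv f) X) = X"
proof -
  note f' = isotropy_SF[OF f]
  define Y where "Y = matrix_inv f ** X ** f"
  have "f ** (Y - dg.epart SQ Y) \<in> dg.EE SF" by (rule dg.EE_mult[OF f'(1) SQ_compl]) (auto simp: S_defs)
  then have "f ** (Y - dg.epart SQ Y) ** matrix_inv f \<in> dg.EE SF"
    by (rule dg.EE_mult[OF _ f'(2)]) (auto simp: S_defs)
  then have "dg.epart SQ (f ** (Y - dg.epart SQ Y) ** matrix_inv f) = 0"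
    by (rule dg.epart_disjoint) (auto simp: S_defs)
  moreover have "f ** Y ** matrix_inv f = X"
    by (simp add: Y_def matrix_mul_assoc[symmetric] matrix_inv_cancel[OF f'(4)] matrix_inv[OF f'(4)])
  ultimately have "dg.epart SQ X = dg.epart SQ (f ** dg.epart SQ Y ** matrix_inv f)"
    by (simp add: matrix_diff_distrib dg.epart_diff)
  moreover have "dg.epart SQ X = X" using X by (simp add: dg.epart_id)
  ultimately show ?thesis using invertible_inv(2)[OF f'(4)] by (simp add: Aq_def Y_def)
qed

lemma Aq_inj:
  assumes f: "f \<in> isotropy W Q F" and X: "X \<in> \<qq>" and z: "Aq f X = 0" shows "X = 0"
proof -
  have fi: "matrix_inv f \<in> isotropy W Q F" using stab_inv f by (simp add: isotropy_stab)
  have "X = Aq (matrix_inv f) (Aq (matrix_inv (matrix_inv f)) X)" using Aq_inverse[OF fi X] by simp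
  also have "\<dots> = Aq (matrix_inv f) (Aq f X)" using invertible_inv(2)[OF isotropy_SF(4)[OF f]] by simp
  also have "\<dots> = 0" unfolding z by (simp add: Aq_def)
  finally show ?thesis .
qed

lemma ad_SF_SQ:
  assumes "\<psi> \<in> dg.EE SF" shows "dg.epart SQ (ad \<psi> X) = dg.epart SQ (ad \<psi> (dg.epart SQ X))"
proof -
  have "ad \<psi> (X - dg.epart SQ X) \<in> dg.EE SF" by (rule dg.EE_ad[OF assms SQ_compl]) (auto simp: S_defs)
  then have "dg.epart SQ (ad \<psi> (X - dg.epart SQ X)) = 0" by (rule dg.epart_disjoint) (auto simp: S_defs)
  then show ?thesis by (simp add: ad_simps dg.epart_diff)
qed

lemma epart_clinear: "clinear (dg.epart S)"
  by (simp add: clinear_def dg.epart_add dg.epart_cscale)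

text \<open>\<open>Ad f S\<close> has as derivative \<open>Ad f\<close> of the derivative of
  \<open>S\<close> plus a bracket with the form of \<open>f\<close>. That form takes values in the
  isotropy algebra, so in the bracket \<open>Ad f S\<close> may be replaced by its part in
  \<qq>.\<close>

lemma wd_Aq:
  assumes e: "e \<le> r" and fac: "\<And>s. s \<in> ball 0 e \<Longrightarrow> fact_at k l f s" and s: "s \<in> ball 0 e" and f: "wd f s C C'"
    and S: "wd S s D 0"
  shows "wd (\<lambda>x. Aq (f x) (S x)) s (Aq (f s) D + dg.epart SQ (ad (C ** matrix_inv (f s)) (Aq (f s) (S s))))
     (dg.epart SQ (ad (C' ** matrix_inv (f s)) (Aq (f s) (S s))))"
proof -
  have fi: "invertible (f s)" using fac[OF s] isotropy_SF(4) by (simp add: fact_at_def)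
  note MC = maurer_cartan[OF e fac s f]
  let ?i = "matrix_inv (f s)"
  have w: "wd (\<lambda>x. f x ** S x ** matrix_inv (f x)) s
      (f s ** S s ** - (?i ** C ** ?i) + (f s ** D + C ** S s) ** ?i)
      (f s ** S s ** - (?i ** C' ** ?i) + (f s ** 0 + C' ** S s) ** ?i)"
    by (rule wd_mult[OF wd_mult[OF f S] wd_inv[OF f fi]])
  have e: "C ** S s ** ?i - f s ** S s ** (?i ** C ** ?i) = ad (C ** ?i) (f s ** S s ** ?i)" for C
  proof -
    have "C ** ?i ** (f s ** S s ** ?i) = C ** (?i ** (f s ** (S s ** ?i)))" by (simp add: matrix_mul_assoc)
    also have "\<dots> = C ** S s ** ?i" by (simp only: matrix_inv_cancel[OF fi] matrix_mul_assoc)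
    finally show ?thesis by (simp add: ad_def matrix_mul_assoc)
  qed
  have e1: "f s ** S s ** - (?i ** C ** ?i) + (f s ** D + C ** S s) ** ?i = f s ** D ** ?i + ad (C ** ?i) (f s ** S s ** ?i)"
    and e2: "f s ** S s ** - (?i ** C' ** ?i) + (f s ** 0 + C' ** S s) ** ?i = ad (C' ** ?i) (f s ** S s ** ?i)"
    unfolding e[symmetric] by (simp_all add: matrix_neg matrix_add_rdistrib')
  have "wd (\<lambda>x. Aq (f x) (S x)) s (dg.epart SQ (f s ** D ** ?i + ad (C ** ?i) (f s ** S s ** ?i)))
     (dg.epart SQ (ad (C' ** ?i) (f s ** S s ** ?i)))"
    unfolding Aq_def using wd_clinear[OF epart_clinear w[unfolded e1 e2]] .
  then show ?thesis
    using ad_SF_SQ[of "C ** ?i" "f s ** S s ** ?i"] ad_SF_SQ[of "C' ** ?i" "f s ** S s ** ?i"] MC(1,2)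
    by (simp add: dg.epart_add Aq_def)
qed

lemma hE_epart: assumes "X \<in> \<gg>" "Y \<in> \<qq>" shows "h.hE (dg.epart SQ X) Y = h.hE X Y" "h.hE Y (dg.epart SQ X) = h.hE Y X"
proof -
  show 1: "h.hE (dg.epart SQ X) Y = h.hE X Y"
    using h.hproj_orth[OF csub_Int assms(2), of X] hproj_q[OF assms(1)] by simp
  show "h.hE Y (dg.epart SQ X) = h.hE Y X" by (subst (1 2) h.hE_cnj) (simp add: 1)
qed

text \<open>
  The holomorphic derivative of the inner product of \<open>a\<^sub>j\<close> with \<open>a\<^sub>i\<close> is the inner product of
  \<open>Aq (f s) (wv l f S\<^sub>j S\<^sub>j' s)\<close> with \<open>a\<^sub>i\<close>.
\<close>

definition "wv l f S S1 s = S1 s + Aq (matrix_inv (f s)) (pq (ad (Zc l f s) (Aq (f s) (S s))))"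

lemma wv_mem:
  assumes "fact_at k l f s" "S1 s \<in> \<qq>" shows "wv l f S S1 s \<in> \<qq>"
proof -
  have fi: "matrix_inv (f s) \<in> G_C W Q" using assms isotropy_SF(3) by (simp add: fact_at_def G_C_inv)
  have "pq X \<in> \<gg>" for X using h.hproj_mem[OF csub_Int] by blast
  then show ?thesis unfolding wv_def by (intro csub_add[OF csub_Int] assms(2) Aq_mem[OF fi])
qed

text \<open>The holomorphic part of the form of \<open>f\<close> acts on the first argument, the
  antiholomorphic part on the second. Moving the latter across by \<open>hE_ad\<close> produces the
  bracket with \<psi> plus the adjoint of \<psi>', and \<open>maurer_cartan\<close> replaces this by
  \<open>Zc\<close>, free of derivatives of \<open>f\<close>.\<close>

lemma gram_wirtinger:
  assumes e: "e \<le> r" and fac: "\<And>s. s \<in> ball 0 e \<Longrightarrow> fact_at k l f s" and s: "s \<in> ball 0 e"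
    and S: "wd S s (S1 s) 0" "S s \<in> \<qq>" "S1 s \<in> \<qq>" and T: "wd T s (T1 s) 0" "T s \<in> \<qq>" "T1 s \<in> \<qq>"
  shows "\<exists>c'. cwd (\<lambda>x. h.hE (Aq (f x) (S x)) (Aq (f x) (T x))) s (h.hE (Aq (f s) (wv l f S S1 s)) (Aq (f s) (T s))) c'"
proof -
  note F = fac[OF s, unfolded fact_at_def]
  have fI: "f s \<in> isotropy W Q F" using F by blast
  have fG: "f s \<in> G_C W Q" by (rule isotropy_SF(3)[OF fI])
  obtain C C' where f: "wd f s C C'" using F wd_ex by blast
  note MC = maurer_cartan[OF e fac s f]
  let ?p = "C ** matrix_inv (f s)" and ?p' = "C' ** matrix_inv (f s)"
  define a b where "a = Aq (f s) (S s)" and "b = Aq (f s) (T s)"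
  have ab: "a \<in> \<qq>" "b \<in> \<qq>" using Aq_mem[OF fG] S(2) T(2) by (auto simp: a_def b_def)
  have w: "cwd (\<lambda>x. h.hE (Aq (f x) (S x)) (Aq (f x) (T x))) s
    (h.hE (Aq (f s) (S1 s) + dg.epart SQ (ad ?p a)) b + h.hE a (dg.epart SQ (ad ?p' b)))
    (h.hE (dg.epart SQ (ad ?p' a)) b + h.hE a (Aq (f s) (T1 s) + dg.epart SQ (ad ?p b)))"
    unfolding a_def b_def by (rule h.cwd_hE[OF wd_Aq[OF e fac s f S(1)] wd_Aq[OF e fac s f T(1)]])
  have g: "ad ?p a \<in> \<gg>" "ad ?p' b \<in> \<gg>" using glie_ad MC(1,2) ab by blast+
  have "h.hE a (dg.epart SQ (ad ?p' b)) = h.hE (ad (h.hadj ?p') a) b"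
    using hE_epart(2)[OF g(2) ab(1)] h.hE_ad[of "h.hadj ?p'" a b] by simp
  moreover have "h.hE (dg.epart SQ (ad ?p a)) b = h.hE (ad ?p a) b" by (rule hE_epart(1)[OF g(1) ab(2)])
  ultimately have "h.hE (Aq (f s) (S1 s) + dg.epart SQ (ad ?p a)) b + h.hE a (dg.epart SQ (ad ?p' b))
     = h.hE (Aq (f s) (S1 s)) b + h.hE (ad (?p + h.hadj ?p') a) b"
    by (simp add: h.hE_add ad_simps)
  also have "h.hE (ad (?p + h.hadj ?p') a) b = h.hE (pq (ad (Zc l f s) a)) b"
    using MC(3) h.hproj_orth[OF csub_Int ab(2), of "ad (Zc l f s) a"] by simp
  \<comment> \<open>Rewritten as a value of \<open>Aq (f s)\<close>, so that the derivative again
    looks like a Gram entry, with \<open>S\<close> replaced by \<open>wv\<close>.\<close>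
  also have "pq (ad (Zc l f s) a) = Aq (f s) (Aq (matrix_inv (f s)) (pq (ad (Zc l f s) a)))"
    by (rule Aq_inverse[OF fI h.hproj_mem[OF csub_Int], symmetric])
  also have "h.hE (Aq (f s) (S1 s)) b + h.hE (Aq (f s) (Aq (matrix_inv (f s)) (pq (ad (Zc l f s) a)))) b
     = h.hE (Aq (f s) (wv l f S S1 s)) b"
    using Aq_clinear[of "f s"] by (simp add: clinear_def wv_def a_def h.hE_add)
  finally show ?thesis using w unfolding b_def by auto
qed

lemma pq_clinear: "clinear pq"
  by (simp add: clinear_def h.hproj_add h.hproj_cscale csub_Int)

lemma antilinear_hadj: "antilinear h.hadj"
  by (simp add: antilinear_def h.hadj_add h.hadj_cscale)

lemma wd_ad:
  assumes f: "wd f s C C'" and g: "wd g s E E'"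
  shows "wd (\<lambda>x. ad (f x) (g x)) s (ad (f s) E + ad C (g s)) (ad (f s) E' + ad C' (g s))"
proof -
  have e: "f s ** E + C ** g s - (g s ** C + E ** f s) = ad (f s) E + ad C (g s)" for C E
    by (simp add: ad_def)
  have "wd (\<lambda>x. f x ** g x - g x ** f x) s (ad (f s) E + ad C (g s)) (ad (f s) E' + ad C' (g s))"
    using wd_diff[OF wd_mult[OF f g] wd_mult[OF g f]] unfolding e .
  then show ?thesis unfolding ad_def .
qed

end

section \<open>The derivative of the connection at the base point\<close>

lemma matrix_inv_one [simp]: "matrix_inv (mat 1 :: 'a::field ^ 'n::finite ^ 'n) = mat 1"
  by (rule matrix_inv_unique) simp

context hodge_line begin

lemma gram_eq:
  assumes e: "e \<le> r" and fac: "fact_at k l f s" and s: "s \<in> ball 0 e"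
  shows "mh_metric_End W Q (filt_act (G s) F)
      (bigraded.epart (mixed_hodge.dg W (filt_act (G s) F)) SQ (G s ** X ** matrix_inv (G s)))
      (bigraded.epart (mixed_hodge.dg W (filt_act (G s) F)) SQ (G s ** Y ** matrix_inv (G s)))
    = h.hE (Aq (f s) X) (Aq (f s) Y)"
proof -
  note F = fac[unfolded fact_at_def]
  have sr: "s \<in> ball 0 r" using s e by auto
  \<comment> \<open>The isotropy factor does not move the point; its effect is shifted to the
    vectors, where it becomes \<open>Aq (f s)\<close>.\<close>
  have "filt_act (f s) F = F" using F by (simp add: isotropy_def)
  then have GF: "filt_act (G s) F = filt_act (k s ** l s) F" using F by (simp add: filt_act_mult)
  have pol: "polarized_hodge W (filt_act (k s ** l s) F) Q" using G_pol[OF sr] by (simp only: GF)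
  interpret mo: moved_hodge W F Q "k s" "l s"
    by (intro moved_hodge.intro moved_hodge_axioms.intro polarized_hodge_axioms pol) (use F in auto)
  have fi: "invertible (f s)" using F isotropy_SF(4) by blast
  have conj: "G s ** X ** matrix_inv (G s) = mo.Ad (f s ** X ** matrix_inv (f s))" for X
    using F matrix_inv_mult[OF mo.\<gamma>_inv fi] by (simp add: mo.\<gamma>_def matrix_mul_assoc)
  have "filt_act (G s) F = filt_act mo.\<gamma> F" by (simp add: GF mo.\<gamma>_def)
  then show ?thesis unfolding conj by (simp add: mo.m.mh_metric_End_eq mo.m_epart mo.m_hE Aq_def)
qed

lemma wd_conj:
  assumes a: "wd a s L L'" "a s = mat 1" and X: "wd X s E E'"
  shows "wd (\<lambda>x. a x ** X x ** matrix_inv (a x)) s (E + ad L (X s)) (E' + ad L' (X s))"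
    and "wd (\<lambda>x. matrix_inv (a x) ** X x ** a x) s (E - ad L (X s)) (E' - ad L' (X s))"
proof -
  have i: "matrix_inv (a s) = mat 1" "invertible (a s)" by (simp_all add: a)
  show "wd (\<lambda>x. a x ** X x ** matrix_inv (a x)) s (E + ad L (X s)) (E' + ad L' (X s))"
    using wd_mult[OF wd_mult[OF a(1) X] wd_inv[OF a(1) i(2)]]
    by (simp add: i a(2) ad_def matrix_neg algebra_simps)
  show "wd (\<lambda>x. matrix_inv (a x) ** X x ** a x) s (E - ad L (X s)) (E' - ad L' (X s))"
    using wd_mult[OF wd_mult[OF wd_inv[OF a(1) i(2)] X] a(1)]
    by (simp add: i a(2) ad_def matrix_neg algebra_simps)
qed

lemma ad_cnj: "cnj_mat (ad X Y) = ad (cnj_mat X) (cnj_mat Y)"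
  by (simp add: ad_def cnj_mat_mult)

text \<open>\<open>S\<close> and \<open>S1\<close> are holomorphic, so the antiholomorphic
  derivative comes from three places: \<open>Zc\<close> gives the terms with the bracket of
  \<open>u\<close> and its conjugate, while \<open>Aq (f x) (S x)\<close> and
  \<open>matrix_inv (f x)\<close> give the two halves of the commutator, because \<open>Zc\<close>
  equals minus the adjoint of \<open>up\<close> at 0.\<close>

lemma wv_wd0:
  assumes k0: "k 0 = mat 1" "l 0 = mat 1" "f 0 = mat 1"
    and l: "wd l 0 (u - dg.epart SM u) (up - cnj_mat (dg.epart SM u))" and f: "wd f 0 0 (- up)"
    and S: "wd S 0 (S1 0) 0" "wd S1 0 S2 0" "S 0 = v" "v \<in> \<qq>"
  shows "\<exists>C. wd (wv l f S S1) 0 C (- (let ub = cnj_mat u; adj = mh_adjoint W Q F; pl = plus_part W Q F in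
          - op_comm (q_op W Q F (ad (adj (pl ub)))) (q_op W Q F (ad (pl ub))) v
          - ad (zero_part W Q F (ad u ub)) v
          - q_op W Q F (ad (pl (ad u ub) + adj (pl (ad u ub)))) v))"
proof -
  define M where "M = dg.epart SM u"
  have r0: "(0::complex) \<in> ball 0 r" using r by simp
  have inv1: "matrix_inv (mat 1 :: complex ^ 'n ^ 'n) = mat 1" by (rule matrix_inv_unique) simp
  obtain G2 where G2: "wd G1 0 G2 0" using G1_wd[OF r0] by blast
  have Gi: "wd (\<lambda>x. matrix_inv (G x)) 0 (- u) 0"
    using wd_inv[OF G_wd[OF r0]] by (simp add: G0 inv1 G1_0)
  have eta: "wd \<eta> 0 (G2 - u ** u) 0"
    unfolding \<eta>_def using wd_mult[OF Gi G2] by (simp add: G0 inv1 G1_0 matrix_neg)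
  have eta0: "\<eta> 0 = u" by (simp add: \<eta>_def G0 inv1 G1_0)
  obtain A where al: "wd (alpha f) 0 A (- ad up u)"
    unfolding alpha_def using wd_conj(1)[OF f k0(3) eta] by (simp add: eta0 ad_simps)
  have al0: "alpha f 0 = u" by (simp add: alpha_def k0 inv1 eta0)
  obtain T where "wd (\<lambda>x. l x ** alpha f x ** matrix_inv (l x)) 0 T (- ad (cnj_mat M) u)"
    using wd_conj(1)[OF l k0(2) al] by (simp add: al0 ad_simps M_def)
  from wd_antilinear[OF antilinear_cnj this]
  have c: "wd (\<lambda>x. cnj_mat (l x ** alpha f x ** matrix_inv (l x))) 0 (- ad M ub) (cnj_mat T)"
    by (simp add: ad_cnj ub_def)
  \<comment> \<open>The derivatives of \<open>l\<close> cancel the contributions of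
    \<open>up\<close> and then of \<open>M\<close>, leaving only the bracket of \<open>u\<close>
    with its conjugate. It is recorded as a holomorphic derivative because \<open>twist\<close>
    conjugates; the adjoint in \<open>Zc\<close> makes it antiholomorphic again.\<close>
  obtain T' where tw: "wd (\<lambda>x. twist (l x) (alpha f x)) 0 (- ad u ub) T'"
    unfolding twist_def using wd_conj(2)[OF l k0(2) c] by (simp add: k0 inv1 al0 ad_simps M_def ub_def algebra_simps)
  have tw0: "twist (l 0) (alpha f 0) = ub" by (simp add: twist_def k0 inv1 al0 ub_def)
  define Z1 where "Z1 = dg.epart SP (- ad up u) + dg.epart S0 (- ad up u) - h.hadj (dg.epart SP (- ad u ub))"
  have "wd (Zc l f) 0 (dg.epart SP A + dg.epart S0 A - h.hadj (dg.epart SP T')) Z1"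
    unfolding Zc_def Z1_def
    by (intro wd_diff wd_add wd_clinear[OF epart_clinear] al wd_antilinear[OF antilinear_hadj] wd_clinear[OF epart_clinear] tw)
  then obtain Z2 where Z: "wd (Zc l f) 0 Z2 Z1" by blast
  have uS: "dg.epart SP u = 0" "dg.epart S0 u = 0"
    by (rule dg.epart_disjoint[OF u(2)], force simp: S_defs)+
  have Z0: "Zc l f 0 = - h.hadj up" unfolding Zc_def tw0 by (simp add: al0 uS up_def)
  have vq: "dg.epart SQ v = v" using S(4) by (simp add: dg.epart_id)
  define B where "B = dg.epart SQ (ad up v)"
  have "\<exists>D. wd (\<lambda>x. Aq (f x) (S x)) 0 D (- B)"
    unfolding Aq_def using wd_clinear[OF epart_clinear[of SQ] wd_conj(1)[OF f k0(3) S(1)]]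
    by (auto simp: S(3) ad_simps B_def dg.epart_neg)
  then obtain D where a: "wd (\<lambda>x. Aq (f x) (S x)) 0 D (- B)" by blast
  have a0: "Aq (f 0) (S 0) = v" by (simp add: Aq_def k0 inv1 S(3) vq)
  define Y where "Y x = pq (ad (Zc l f x) (Aq (f x) (S x)))" for x
  have "wd Y 0 (pq (ad (Zc l f 0) D + ad Z2 v)) (pq (ad (h.hadj up) B + ad Z1 v))"
    unfolding Y_def using wd_clinear[OF pq_clinear wd_ad[OF Z a]] by (simp add: a0 Z0 ad_simps)
  then obtain Y1 where Y: "wd Y 0 Y1 (pq (ad (h.hadj up) B + ad Z1 v))" by blast
  have fi: "wd (\<lambda>x. matrix_inv (f x)) 0 0 up" using wd_inv[OF f] by (simp add: k0 inv1 matrix_neg)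
  have Y0: "Y 0 = - pq (ad (h.hadj up) v)"
    using pq_clinear h.hproj_cscale[OF csub_Int, of SQ "-1" "ad (h.hadj up) v"]
    unfolding Y_def a0 Z0 by (simp add: ad_simps cscale_distrib)
  have "\<exists>C. wd (\<lambda>x. S1 x + Aq (matrix_inv (f x)) (Y x)) 0 C
      (dg.epart SQ (pq (ad (h.hadj up) B + ad Z1 v) + ad up (Y 0)))"
    unfolding Aq_def
    using wd_add[OF S(2) wd_clinear[OF epart_clinear[of SQ] wd_conj(1)[OF fi _ Y]]] by (auto simp: k0 inv1)
  then obtain C where w: "wd (wv l f S S1) 0 C (dg.epart SQ (pq (ad (h.hadj up) B + ad Z1 v) + ad up (Y 0)))"
    unfolding wv_def Y_def by blast
  have q_op: "q_op W Q F (ad X) Z = pq (ad X Z)" for X Z by (simp add: q_op_def orth_proj_eq q_alg_eq)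
  have pqq: "dg.epart SQ (pq X) = pq X" for X using h.hproj_mem[OF csub_Int, of SQ X] by (simp add: dg.epart_id)
  have pqg: "pq X \<in> \<gg>" for X using h.hproj_mem[OF csub_Int, of SQ X] by simp
  have pe: "dg.epart SQ X = pq X" if "X \<in> \<gg>" for X using hproj_q[OF that] by simp
  have vg: "v \<in> \<gg>" using S(4) by simp
  have adub: "ad u ub \<in> \<gg>" by (intro glie_ad u ub_g)
  \<comment> \<open>Replacing \<open>up\<close> by the full conjugate \<open>ub\<close> costs a
    bracket of \<open>u\<close> with an element of \<Lambda>, whose shifts are all in
    \<open>SQ\<close>.\<close>
  have low: "dg.epart S (- ad up u) = dg.epart S (ad u ub)" if "S \<inter> SQ = {}" for S
  proof -
    have "ad u (ub - up) \<in> dg.EE SQ" by (rule dg.EE_ad[OF u(2) ub_low]) (auto simp: S_defs)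
    then have "dg.epart S (ad u (ub - up)) = 0" by (rule dg.epart_disjoint) (use that in auto)
    then have "dg.epart S (ad u ub) = dg.epart S (ad u up)" by (simp add: ad_simps dg.epart_diff)
    moreover have "- ad up u = ad u up" by (simp add: ad_def)
    ultimately show ?thesis by simp
  qed
  define x0 xp where "x0 = dg.epart S0 (ad u ub)" and "xp = dg.epart SP (ad u ub)"
  have Z1': "Z1 = x0 + (xp + h.hadj xp)"
    unfolding Z1_def by (subst (1 2) low) (auto simp: S_defs x0_def xp_def dg.epart_neg h.hadj_neg)
  have x0v: "pq (ad x0 v) = ad x0 v"
  proof (rule h.hproj_id[OF csub_Int])
    have "ad x0 v \<in> dg.EE SQ" unfolding x0_def
      by (rule dg.EE_ad[OF dg.EE_mem[of S0 "ad u ub"], of v SQ]) (use S(4) in \<open>auto simp: S_defs\<close>)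
    moreover have "ad x0 v \<in> \<gg>" unfolding x0_def by (intro glie_ad glie_epart adub vg)
    ultimately show "ad x0 v \<in> \<qq>" by simp
  qed
  have pn: "pq (- X) = - pq X" for X using h.hproj_cscale[OF csub_Int, of SQ "-1" X] by (simp add: cscale_distrib)
  have pa: "pq (X + Y) = pq X + pq Y" for X Y by (rule h.hproj_add[OF csub_Int])
  \<comment> \<open>Collecting the terms: \<open>B\<close> is already projected to \<qq>, bracketing
    with \<open>x0\<close> preserves \<qq>, and \<open>Y 0\<close> carries the sign that turns the
    two products into a commutator.\<close>
  have "dg.epart SQ (pq (ad (h.hadj up) B + ad Z1 v) + ad up (Y 0)) =
     pq (ad (h.hadj up) (pq (ad up v))) + ad x0 v + pq (ad (xp + h.hadj xp) v) - pq (ad up (pq (ad (h.hadj up) v)))"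
    by (simp add: dg.epart_add pqq pe glie_ad up_g vg Y0 ad_simps(6) dg.epart_neg pqg B_def Z1' ad_simps(1)[of x0] pa x0v
        dg.epart_diff pqq[of "ad x0 v", unfolded x0v])
  also have "\<dots> = - (let ub = cnj_mat u; adj = mh_adjoint W Q F; pl = plus_part W Q F in
          - op_comm (q_op W Q F (ad (adj (pl ub)))) (q_op W Q F (ad (pl ub))) v
          - ad (zero_part W Q F (ad u ub)) v
          - q_op W Q F (ad (pl (ad u ub) + adj (pl (ad u ub)))) v)"
    using plus_part_eq[OF ub_g] plus_part_eq[OF adub] zero_part_eq[OF adub]
    by (simp add: Let_def q_op op_comm_def mh_adjoint_eq ub_def[symmetric] x0_def xp_def up_def)
  finally show ?thesis using w by metis
qed

text \<open>The interface to the frame computation: \<open>A s\<close> is \<open>Aq (f s)\<close>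
  and \<open>w j\<close> is \<open>wv\<close> for the frame vector \<open>S j\<close>. The factors
  \<open>k\<close>, \<open>l\<close> and \<open>f\<close> do not appear beyond this point.\<close>

theorem line_curvature:
  assumes S: "\<And>j s. j < d \<Longrightarrow> s \<in> ball 0 r \<Longrightarrow> wd (S j) s (S1 j s) 0"
    and S1: "\<And>j. j < d \<Longrightarrow> \<exists>C. wd (S1 j) 0 C 0"
    and Sq: "\<And>j s. j < d \<Longrightarrow> s \<in> ball 0 r \<Longrightarrow> S j s \<in> \<qq>"
  obtains e A w where "0 < e" "e \<le> r"
    "\<And>s X Y. s \<in> ball 0 e \<Longrightarrow> mh_metric_End W Q (filt_act (G s) F)
      (bigraded.epart (mixed_hodge.dg W (filt_act (G s) F)) SQ (G s ** X ** matrix_inv (G s)))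
      (bigraded.epart (mixed_hodge.dg W (filt_act (G s) F)) SQ (G s ** Y ** matrix_inv (G s)))
      = h.hE (A s X) (A s Y)"
    "\<And>s. s \<in> ball 0 e \<Longrightarrow> clinear (A s)"
    "\<And>s X. s \<in> ball 0 e \<Longrightarrow> X \<in> \<qq> \<Longrightarrow> A s X = 0 \<Longrightarrow> X = 0"
    "\<And>s i j. s \<in> ball 0 e \<Longrightarrow> i < d \<Longrightarrow> j < d \<Longrightarrow>
       \<exists>c'. cwd (\<lambda>x. h.hE (A x (S j x)) (A x (S i x))) s (h.hE (A s (w j s)) (A s (S i s))) c'"
    "\<And>s j. s \<in> ball 0 e \<Longrightarrow> j < d \<Longrightarrow> w j s \<in> \<qq>"
    "\<And>j. j < d \<Longrightarrow> \<exists>C. wd (w j) 0 C (- (let ub = cnj_mat u; adj = mh_adjoint W Q F; pl = plus_part W Q F in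
          - op_comm (q_op W Q F (ad (adj (pl ub)))) (q_op W Q F (ad (pl ub))) (S j 0)
          - ad (zero_part W Q F (ad u ub)) (S j 0)
          - q_op W Q F (ad (pl (ad u ub) + adj (pl (ad u ub)))) (S j 0)))"
proof -
  obtain e k l f where e: "0 < e" "e \<le> r" and fac: "\<And>s. s \<in> ball 0 e \<Longrightarrow> fact_at k l f s"
    and k0: "k 0 = mat 1" "l 0 = mat 1" "f 0 = mat 1"
    and wds: "wd k 0 (dg.epart SM u) (cnj_mat (dg.epart SM u))"
      "wd l 0 (u - dg.epart SM u) (up - cnj_mat (dg.epart SM u))" "wd f 0 0 (- up)"
    by (rule factorization) blast
  have ball: "s \<in> ball 0 r" if "s \<in> ball 0 e" for s :: complex using that e by auto
  have S1q: "S1 j s \<in> \<qq>" if "j < d" "s \<in> ball 0 r" for j s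
    by (rule wd_csub(1)[OF S[OF that] eventually_ball[OF that(2) Sq[OF that(1)]] csub_Int])
  show thesis
  proof (rule that[of e "\<lambda>s. Aq (f s)" "\<lambda>j. wv l f (S j) (S1 j)"])
    show "0 < e" "e \<le> r" by fact+
    show "clinear (Aq (f s))" for s by (rule Aq_clinear)
    show "X = 0" if "s \<in> ball 0 e" "X \<in> \<qq>" "Aq (f s) X = 0" for s X
      using Aq_inj fac[OF that(1)] that(2,3) unfolding fact_at_def by blast
    show "wv l f (S j) (S1 j) s \<in> \<qq>" if "s \<in> ball 0 e" "j < d" for s j
      by (rule wv_mem[where S = "S j" and ?S1.0 = "S1 j", OF fac[OF that(1)] S1q[OF that(2) ball[OF that(1)]]])
    show "\<exists>c'. cwd (\<lambda>x. h.hE (Aq (f x) (S j x)) (Aq (f x) (S i x))) s (h.hE (Aq (f s) (wv l f (S j) (S1 j) s)) (Aq (f s) (S i s))) c'"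
      if "s \<in> ball 0 e" "i < d" "j < d" for s i j
      using that ball S Sq S1q by (intro gram_wirtinger[OF e(2) fac, of s "S j" "S1 j" "S i" "S1 i"]) auto
    show "mh_metric_End W Q (filt_act (G s) F)
      (bigraded.epart (mixed_hodge.dg W (filt_act (G s) F)) SQ (G s ** X ** matrix_inv (G s)))
      (bigraded.epart (mixed_hodge.dg W (filt_act (G s) F)) SQ (G s ** Y ** matrix_inv (G s)))
      = h.hE (Aq (f s) X) (Aq (f s) Y)" if "s \<in> ball 0 e" for s X Y
      by (rule gram_eq[OF e(2) fac[OF that] that])
    show "\<exists>C. wd (wv l f (S j) (S1 j)) 0 C (- (let ub = cnj_mat u; adj = mh_adjoint W Q F; pl = plus_part W Q F in
          - op_comm (q_op W Q F (ad (adj (pl ub)))) (q_op W Q F (ad (pl ub))) (S j 0)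
          - ad (zero_part W Q F (ad u ub)) (S j 0)
          - q_op W Q F (ad (pl (ad u ub) + adj (pl (ad u ub)))) (S j 0)))" if j: "j < d" for j
    proof -
      obtain S2 where "wd (S1 j) 0 S2 0" using S1[OF j] by blast
      then show ?thesis using S[OF j, of 0] Sq[OF j, of 0] r 
        by (intro wv_wd0[where k = k and l = l and f = f and v = "S j 0" and S = "S j" and ?S1.0 = "S1 j" and ?S2.0 = S2, OF k0 wds(2,3)]) auto
    qed
  qed
qed

end

section \<open>The connection matrix in a frame\<close>

lemma bounded_bilinear_cscale: "bounded_bilinear (cscale :: complex \<Rightarrow> complex ^ 'n::finite ^ 'n \<Rightarrow> _)"
proof -
  have "bilinear (cscale :: complex \<Rightarrow> complex ^ 'n ^ 'n \<Rightarrow> _)"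
    unfolding bilinear_def
    by (auto intro!: linearI simp: cscale_distrib) (simp_all add: vec_eq_iff complex_eq_iff algebra_simps)
  then show ?thesis by (simp add: bilinear_conv_bounded_bilinear)
qed

lemma wd_cscale:
  assumes f: "cwd f s c c'" and g: "wd g s E E'"
  shows "wd (\<lambda>x. cscale (f x) (g x)) s (cscale (f s) E + cscale c (g s)) (cscale (f s) E' + cscale c' (g s))"
  using bounded_bilinear.FDERIV[OF bounded_bilinear_cscale f[unfolded cwd_def] g[unfolded wd_def]]
  unfolding wd_def
  by (rule has_derivative_eq_rhs) (simp add: fun_eq_iff cscale_distrib mult_ac)

lemma wd_sum: "(\<And>i. i \<in> I \<Longrightarrow> wd (f i) s (C i) (C' i)) \<Longrightarrow> wd (\<lambda>x. \<Sum>i\<in>I. f i x) s (\<Sum>i\<in>I. C i) (\<Sum>i\<in>I. C' i)"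
  by (induction I rule: infinite_finite_induct) (auto simp: wd_const intro: wd_add)

lemma cwd_ex:
  assumes "f differentiable (at s)" shows "\<exists>c c'. cwd f s c c'"
proof -
  obtain D where D: "(f has_derivative D) (at s)" using assms by (auto simp: differentiable_def)
  then interpret D: bounded_linear D by (rule has_derivative_bounded_linear)
  have "D \<tau> = \<tau> * ((D 1 - \<i> * D \<i>) / 2) + cnj \<tau> * ((D 1 + \<i> * D \<i>) / 2)" for \<tau>
  proof -
    have "D \<tau> = D (Re \<tau> *\<^sub>R 1 + Im \<tau> *\<^sub>R \<i>)" by (rule arg_cong[of _ _ D]) (simp add: complex_eq_iff)
    also have "\<dots> = Re \<tau> *\<^sub>R D 1 + Im \<tau> *\<^sub>R D \<i>" by (simp only: D.add D.scaleR)
    also have "\<dots> = \<tau> * ((D 1 - \<i> * D \<i>) / 2) + cnj \<tau> * ((D 1 + \<i> * D \<i>) / 2)"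
      by (auto simp: complex_eq_iff field_simps)
    finally show ?thesis .
  qed
  then have "D = (\<lambda>\<tau>. \<tau> * ((D 1 - \<i> * D \<i>) / 2) + cnj \<tau> * ((D 1 + \<i> * D \<i>) / 2))" by blast
  then show ?thesis using D unfolding cwd_def by metis
qed

lemma cwd_differentiable: "cwd f s c c' \<Longrightarrow> f differentiable (at s)"
  by (auto simp: cwd_def differentiable_def)

text \<open>The second factor need not be differentiable because the first one vanishes.\<close>

lemma has_derivative_mult_vanishing:
  fixes g \<theta> :: "complex \<Rightarrow> complex"
  assumes g: "(g has_derivative g') (at 0)" "g 0 = 0" and \<theta>: "isCont \<theta> 0"
  shows "((\<lambda>s. g s * \<theta> s) has_derivative (\<lambda>\<tau>. g' \<tau> * \<theta> 0)) (at 0)"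
proof -
  interpret g': bounded_linear g' using g(1) by (rule has_derivative_bounded_linear)
  obtain K where K: "\<And>\<tau>. norm (g' \<tau>) \<le> norm \<tau> * K" "0 < K" using g'.pos_bounded by blast
  have lim: "((\<lambda>y. norm (g y - g' y) / norm y) \<longlongrightarrow> 0) (at 0)"
    using g unfolding has_derivative_iff_norm by simp
  have "((\<lambda>y. norm (g y - g' y) / norm y * norm (\<theta> y) + K * norm (\<theta> y - \<theta> 0)) \<longlongrightarrow> 0 * norm (\<theta> 0) + K * norm (\<theta> 0 - \<theta> 0)) (at 0)"
    using \<theta> by (intro tendsto_intros lim) (auto simp: isCont_def)
  then have lim2: "((\<lambda>y. norm (g y - g' y) / norm y * norm (\<theta> y) + K * norm (\<theta> y - \<theta> 0)) \<longlongrightarrow> 0) (at 0)" by simp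
  have "((\<lambda>y. norm (g y * \<theta> y - g' y * \<theta> 0) / norm y) \<longlongrightarrow> 0) (at 0)"
  proof (rule Lim_null_comparison[OF _ lim2], rule always_eventually, rule allI)
    fix y :: complex
    have "g y * \<theta> y - g' y * \<theta> 0 = (g y - g' y) * \<theta> y + g' y * (\<theta> y - \<theta> 0)" by (simp add: algebra_simps)
    then have "norm (g y * \<theta> y - g' y * \<theta> 0) \<le> norm (g y - g' y) * norm (\<theta> y) + norm (g' y) * norm (\<theta> y - \<theta> 0)"
      by (metis norm_mult norm_triangle_ineq)
    also have "\<dots> \<le> norm (g y - g' y) * norm (\<theta> y) + norm y * K * norm (\<theta> y - \<theta> 0)"
      by (intro add_left_mono mult_right_mono K) auto
    finally have "norm (g y * \<theta> y - g' y * \<theta> 0) / norm y \<le> (norm (g y - g' y) * norm (\<theta> y) + norm y * K * norm (\<theta> y - \<theta> 0)) / norm y"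
      by (intro divide_right_mono) auto
    also have "\<dots> \<le> norm (g y - g' y) / norm y * norm (\<theta> y) + K * norm (\<theta> y - \<theta> 0)"
      using K by (cases "y = 0") (auto simp: field_simps)
    finally show "norm (norm (g y * \<theta> y - g' y * \<theta> 0) / norm y) \<le> norm (g y - g' y) / norm y * norm (\<theta> y) + K * norm (\<theta> y - \<theta> 0)"
      by simp
  qed
  moreover have "bounded_linear (\<lambda>\<tau>. g' \<tau> * \<theta> 0)"
    by (rule bounded_linear_compose[OF bounded_linear_mult_left g'.bounded_linear_axioms])
  ultimately show ?thesis unfolding has_derivative_iff_norm by (simp add: g(2))
qed

text \<open>Nothing is known about the regularity of \<theta> beforehand. As the system has the
  identity as matrix at 0, it gives first boundedness of \<theta>, then continuity, and finally
  differentiability, each time by writing \<theta> as \<open>t\<close> minus vanishing factors times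
  \<theta>.\<close>

lemma solve_differentiable:
  fixes M :: "nat \<Rightarrow> nat \<Rightarrow> complex \<Rightarrow> complex" and \<theta> t :: "nat \<Rightarrow> complex \<Rightarrow> complex"
  assumes M: "\<And>k i. k < d \<Longrightarrow> i < d \<Longrightarrow> M k i differentiable (at 0)"
    and M0: "\<And>k i. k < d \<Longrightarrow> i < d \<Longrightarrow> M k i 0 = (if k = i then 1 else 0)"
    and t: "\<And>k. k < d \<Longrightarrow> t k differentiable (at 0)"
    and ev: "\<And>k. k < d \<Longrightarrow> \<forall>\<^sub>F s in nhds 0. (\<Sum>i<d. M k i s * \<theta> i s) = t k s"
    and k: "k < d"
  shows "\<theta> k differentiable (at 0)"
proof -
  define m where "m k i s = M k i s - M k i 0" for k i s
  have m_lim: "(m k i \<longlongrightarrow> 0) (nhds 0)" if "k < d" "i < d" for k i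
  proof -
    have "isCont (M k i) 0" using differentiable_imp_continuous_within[OF M[OF that]] by simp
    then have "(M k i \<longlongrightarrow> M k i 0) (nhds 0)" unfolding isCont_def tendsto_at_iff_tendsto_nhds .
    then show ?thesis unfolding m_def by (rule LIM_zero)
  qed
  have t_lim: "(t k \<longlongrightarrow> t k 0) (nhds 0)" if "k < d" for k
    using differentiable_imp_continuous_within[OF t[OF that]] unfolding isCont_def tendsto_at_iff_tendsto_nhds by simp
  have eq: "\<forall>\<^sub>F s in nhds 0. \<theta> k s = t k s - (\<Sum>i<d. m k i s * \<theta> i s)" if k: "k < d" for k
    using ev[OF k]
  proof eventually_elim
    case (elim s)
    have "(\<Sum>i<d. M k i s * \<theta> i s) = (\<Sum>i<d. m k i s * \<theta> i s) + (\<Sum>i<d. M k i 0 * \<theta> i s)"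
      by (simp add: m_def algebra_simps sum_subtractf)
    also have "(\<Sum>i<d. M k i 0 * \<theta> i s) = (\<Sum>i<d. if k = i then \<theta> i s else 0)"
      by (intro sum.cong refl) (use M0 k in auto)
    also have "\<dots> = \<theta> k s" using k by simp
    finally show ?case using elim by (simp add: algebra_simps)
  qed
  define N where "N s = (\<Sum>k<d. norm (\<theta> k s))" for s
  define T where "T s = (\<Sum>k<d. norm (t k s))" for s
  define \<mu> where "\<mu> s = (\<Sum>k<d. \<Sum>i<d. norm (m k i s))" for s
  have \<theta>N: "norm (\<theta> i s) \<le> N s" if "i < d" for i s
    unfolding N_def using that by (intro member_le_sum) auto
  have "(\<mu> \<longlongrightarrow> (\<Sum>k<d. \<Sum>i<d. norm (0::complex))) (nhds 0)"
    unfolding \<mu>_def by (intro tendsto_intros m_lim) auto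
  then have "\<forall>\<^sub>F s in nhds 0. \<mu> s < 1/2" by (intro order_tendstoD) auto
  moreover have "(T \<longlongrightarrow> T 0) (nhds 0)"
    unfolding T_def by (intro tendsto_intros t_lim) auto
  then have "\<forall>\<^sub>F s in nhds 0. T s < T 0 + 1" by (intro order_tendstoD) auto
  moreover have "\<forall>\<^sub>F s in nhds 0. \<forall>k\<in>{..<d}. \<theta> k s = t k s - (\<Sum>i<d. m k i s * \<theta> i s)"
    by (rule eventually_ball_finite) (use eq in auto)
  \<comment> \<open>With \<open>\<mu> s < 1/2\<close> the term \<open>\<mu> s * N s\<close> is
    absorbed on the left; this produces the factor 2.\<close>
  ultimately have bound: "\<forall>\<^sub>F s in nhds 0. N s \<le> 2 * (T 0 + 1)"
  proof eventually_elim
    case (elim s)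
    have "N s \<le> (\<Sum>k<d. norm (t k s) + (\<Sum>i<d. norm (m k i s) * N s))"
      unfolding N_def
    proof (rule sum_mono)
      fix k assume k: "k \<in> {..<d}"
      have "norm (\<theta> k s) \<le> norm (t k s) + norm (\<Sum>i<d. m k i s * \<theta> i s)" using elim(3) k norm_triangle_ineq4 by metis
      also have "norm (\<Sum>i<d. m k i s * \<theta> i s) \<le> (\<Sum>i<d. norm (m k i s) * (\<Sum>k<d. norm (\<theta> k s)))"
        using \<theta>N by (intro sum_norm_le) (auto simp: norm_mult N_def intro!: mult_left_mono)
      finally show "norm (\<theta> k s) \<le> norm (t k s) + (\<Sum>i<d. norm (m k i s) * (\<Sum>k<d. norm (\<theta> k s)))" by simp
    qed
    also have "\<dots> = T s + \<mu> s * N s" by (simp add: T_def \<mu>_def sum.distrib sum_distrib_right)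
    also have "\<dots> \<le> T 0 + 1 + 1/2 * N s" using elim by (intro add_mono mult_right_mono) (auto simp: N_def sum_nonneg)
    finally show ?case by simp
  qed
  have cont: "isCont (\<theta> i) 0" if i: "i < d" for i
  proof -
    have z: "((\<lambda>s. m i j s * \<theta> j s) \<longlongrightarrow> 0) (nhds 0)" if j: "j < d" for j
    proof (rule Lim_null_comparison)
      show "\<forall>\<^sub>F s in nhds 0. norm (m i j s * \<theta> j s) \<le> norm (m i j s) * (2 * (T 0 + 1))"
        using bound by eventually_elim (use \<theta>N[OF j] in \<open>auto simp: norm_mult intro!: mult_left_mono intro: order_trans\<close>)
      have "((\<lambda>s. norm (m i j s) * (2 * (T 0 + 1))) \<longlongrightarrow> norm (0::complex) * (2 * (T 0 + 1))) (nhds 0)"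
        by (intro tendsto_intros m_lim i j)
      then show "((\<lambda>s. norm (m i j s) * (2 * (T 0 + 1))) \<longlongrightarrow> 0) (nhds 0)" by simp
    qed
    have "((\<lambda>s. t i s - (\<Sum>j<d. m i j s * \<theta> j s)) \<longlongrightarrow> t i 0 - (\<Sum>j<d. 0)) (nhds 0)"
      by (intro tendsto_intros t_lim i z) auto
    then have "(\<theta> i \<longlongrightarrow> t i 0 - (\<Sum>j<d. 0)) (nhds 0)"
      using eq[OF i] by (subst tendsto_cong) auto
    moreover have "\<theta> i 0 = t i 0" using eventually_nhds_x_imp_x[OF eq[OF i]] by (simp add: m_def)
    ultimately show ?thesis unfolding isCont_def tendsto_at_iff_tendsto_nhds by simp
  qed
  have "(\<lambda>s. m k i s * \<theta> i s) differentiable (at 0)" if i: "i < d" for i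
  proof -
    obtain D where D: "(M k i has_derivative D) (at 0)" using M[OF k i] by (auto simp: differentiable_def)
    have "(m k i has_derivative D) (at 0)" unfolding m_def using D by (auto intro!: derivative_eq_intros)
    moreover have "m k i 0 = 0" by (simp add: m_def)
    ultimately show ?thesis
      using has_derivative_mult_vanishing[of "m k i" D "\<theta> i"] cont[OF i] unfolding differentiable_def by blast
  qed
  then have "(\<lambda>s. t k s - (\<Sum>i<d. m k i s * \<theta> i s)) differentiable (at 0)"
    by (intro differentiable_diff t k differentiable_sum) auto
  then obtain D where D: "((\<lambda>s. t k s - (\<Sum>i<d. m k i s * \<theta> i s)) has_derivative D) (at 0)" by (auto simp: differentiable_def)
  obtain U where U: "open U" "0 \<in> U" "\<And>s. s \<in> U \<Longrightarrow> \<theta> k s = t k s - (\<Sum>i<d. m k i s * \<theta> i s)"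
    using eq[OF k] unfolding eventually_nhds by blast
  have "(\<theta> k has_derivative D) (at 0)"
    by (rule has_derivative_transform_within_open[OF D U(1,2)]) (simp add: U(3))
  then show ?thesis by (auto simp: differentiable_def)
qed

text \<open>Both operators in the direction \<open>a\<close> see only the restriction of
  \<open>f\<close> to the complex line spanned by \<open>a\<close>. Hence the curvature on a vector
  and its own conjugate is computed from the Gram matrix along one line.\<close>

lemma d_holo_line:
  assumes "cwd (\<lambda>s. f (z + s *s a)) s0 c c'"
  shows "d_holo f (z + s0 *s a) a = c" "d_antiholo f (z + s0 *s a) a = c'"
proof -
  have dd: "dir_deriv f (z + s0 *s a) (\<tau> *s a) = \<tau> * c + cnj \<tau> * c'" for \<tau>
  proof -
    have d: "((\<lambda>t. s0 + of_real t * \<tau>) has_derivative (\<lambda>t. of_real t * \<tau>)) (at 0)"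
      by (auto intro!: derivative_eq_intros)
    have "((\<lambda>t. f (z + (s0 + of_real t * \<tau>) *s a)) has_derivative (\<lambda>t. (of_real t * \<tau>) * c + cnj (of_real t * \<tau>) * c')) (at 0)"
      by (rule has_derivative_compose[OF d]) (use assms in \<open>simp add: cwd_def\<close>)
    then have "((\<lambda>t. f (z + (s0 + of_real t * \<tau>) *s a)) has_vector_derivative (\<tau> * c + cnj \<tau> * c')) (at 0)"
      unfolding has_vector_derivative_def
      by (rule has_derivative_eq_rhs) (simp add: fun_eq_iff scaleR_conv_of_real algebra_simps)
    moreover have "z + (s0 + of_real t * \<tau>) *s a = z + s0 *s a + t *\<^sub>R (\<tau> *s a)" for t
      by (simp add: vec_eq_iff complex_eq_iff algebra_simps)
    ultimately show ?thesis unfolding dir_deriv_def by (simp add: vector_derivative_at add.assoc)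
  qed
  have d1: "dir_deriv f (z + s0 *s a) a = c + c'" using dd[of 1] by simp
  show "d_holo f (z + s0 *s a) a = c" "d_antiholo f (z + s0 *s a) a = c'"
    by (simp_all add: d_holo_def d_antiholo_def d1 dd algebra_simps)
qed

context hermitian begin

definition indep :: "nat \<Rightarrow> (nat \<Rightarrow> complex ^ 'n ^ 'n) \<Rightarrow> bool" where
  "indep d a \<longleftrightarrow> (\<forall>c. (\<Sum>i<d. cscale (c i) (a i)) = 0 \<longrightarrow> (\<forall>i<d. c i = 0))"

text \<open>The dual vector of index \<open>j\<close> is the part of \<open>a j\<close> orthogonal
  to the span \<open>V\<close> of the other vectors, normalized; independence makes that part
  nonzero.\<close>

lemma dual_ex:
  assumes ind: "indep d a"
  shows "\<exists>b \<kappa>. (\<forall>j<d. b j = (\<Sum>l<d. cscale (\<kappa> l j) (a l))) \<and>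
    (\<forall>i<d. \<forall>j<d. hE (b j) (a i) = (if i = j then 1 else 0))"
proof -
  have "\<exists>b \<kappa>. b = (\<Sum>l<d. cscale (\<kappa> l) (a l)) \<and> (\<forall>i<d. hE b (a i) = (if i = j then 1 else 0))" if j: "j < d" for j
  proof -
    define V where "V = {(\<Sum>i<d. cscale (c i) (a i)) | c. c j = 0}"
    have V: "csub V"
    proof (rule csubI)
      show "0 \<in> V" unfolding V_def by (intro CollectI exI[of _ "\<lambda>i. 0"]) simp
    next
      fix X Y assume "X \<in> V" "Y \<in> V"
      then obtain c c' where "c j = 0" "c' j = 0" "X = (\<Sum>i<d. cscale (c i) (a i))" "Y = (\<Sum>i<d. cscale (c' i) (a i))"
        by (auto simp: V_def)
      then show "X + Y \<in> V" unfolding V_def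
        by (intro CollectI exI[of _ "\<lambda>i. c i + c' i"]) (simp add: cscale_distrib sum.distrib)
    next
      fix r X assume "X \<in> V"
      then obtain c where "c j = 0" "X = (\<Sum>i<d. cscale (c i) (a i))" by (auto simp: V_def)
      then show "cscale r X \<in> V" unfolding V_def
        by (intro CollectI exI[of _ "\<lambda>i. r * c i"]) (simp add: cscale_sum)
    qed
    obtain c where c: "c j = 0" "hproj V (a j) = (\<Sum>i<d. cscale (c i) (a i))"
      using hproj_mem[OF V, of "a j"] by (auto simp: V_def)
    define x where "x = a j - hproj V (a j)"
    have aj: "a j = (\<Sum>i<d. cscale (if i = j then 1 else 0) (a i))"
    proof -
      have "(\<Sum>i<d. cscale (if i = j then 1 else 0) (a i)) = (\<Sum>i<d. if i = j then a j else 0)"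
        by (intro sum.cong) auto
      then show ?thesis using j by simp
    qed
    have x: "x = (\<Sum>i<d. cscale ((if i = j then 1 else 0) - c i) (a i))"
      unfolding x_def c(2) cscale_distrib sum_subtractf using aj by simp
    have "x \<noteq> 0"
    proof
      assume "x = 0"
      then have "(if j = j then 1 else 0) - c j = 0"
        using ind[unfolded indep_def, rule_format, of "\<lambda>i. (if i = j then 1 else 0) - c i" j] j x by simp
      then show False using c(1) by simp
    qed
    then have xx: "hE x x \<noteq> 0" using hE_nondeg by blast
    have orth: "hE x Z = 0" if "Z \<in> V" for Z unfolding x_def using hproj_orth[OF V that] by (simp add: hE_diff)
    have ai: "a i \<in> V" if "i < d" "i \<noteq> j" for i
    proof -
      have "(\<Sum>l<d. cscale (if l = i then 1 else 0) (a l)) = (\<Sum>l<d. if l = i then a i else 0)"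
        by (intro sum.cong) auto
      then show ?thesis unfolding V_def using that by (intro CollectI exI[of _ "\<lambda>l. if l = i then 1 else 0"]) auto
    qed
    have "hE x (a j) = hE x x + hE x (hproj V (a j))" by (simp add: x_def hE_diff)
    then have xj: "hE x (a j) = hE x x" using orth[OF hproj_mem[OF V]] by simp
    show ?thesis
    proof (intro exI conjI allI impI)
      show "cscale (1 / hE x x) x = (\<Sum>l<d. cscale (1 / hE x x * ((if l = j then 1 else 0) - c l)) (a l))"
        by (subst (2) x) (simp add: cscale_sum)
      show "hE (cscale (1 / hE x x) x) (a i) = (if i = j then 1 else 0)" if "i < d" for i
        using that xj xx orth[OF ai[OF that]] by (auto simp: hE_scale)
    qed
  qed
  then obtain b \<kappa> where "\<And>j. j < d \<Longrightarrow> b j = (\<Sum>l<d. cscale (\<kappa> j l) (a l)) \<and> (\<forall>i<d. hE (b j) (a i) = (if i = j then 1 else 0))"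
    by metis
  then show ?thesis by (intro exI[of _ b] exI[of _ "\<lambda>l j. \<kappa> j l"] conjI allI impI) blast+
qed

text \<open>The coefficients of the dual basis form a two-sided inverse of the Gram matrix, so
  applying it to \<open>H\<close> times \<theta> returns \<theta>. Uniqueness of the inverse is
  included because \<open>mat_inverse\<close> is a definite description.\<close>

lemma mat_inverse_gram:
  assumes ind: "indep d a" and H: "\<And>i k. i < d \<Longrightarrow> k < d \<Longrightarrow> H i k = hE (a k) (a i)"
    and D: "\<And>k. k < d \<Longrightarrow> D k = (\<Sum>l<d. H k l * \<theta> l)" and i: "i < d"
  shows "(\<Sum>k<d. mat_inverse d H i k * D k) = \<theta> i"
proof -
  obtain b \<kappa> where "\<forall>j<d. b j = (\<Sum>l<d. cscale (\<kappa> l j) (a l))"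
    "\<forall>i<d. \<forall>j<d. hE (b j) (a i) = (if i = j then 1 else 0)"
    using dual_ex[OF ind] by (elim exE conjE)
  then have b: "\<And>j. j < d \<Longrightarrow> b j = (\<Sum>l<d. cscale (\<kappa> l j) (a l))"
    and dual: "\<And>i j. i < d \<Longrightarrow> j < d \<Longrightarrow> hE (b j) (a i) = (if i = j then 1 else 0)" by simp_all
  have HK: "(\<Sum>k<d. H i k * \<kappa> k j) = (if i = j then 1 else 0)" if "i < d" "j < d" for i j
  proof -
    have "(\<Sum>k<d. H i k * \<kappa> k j) = hE (b j) (a i)"
      using that by (simp add: b hE_sum hE_scale H mult.commute)
    then show ?thesis using dual that by simp
  qed
  have KH: "(\<Sum>k<d. \<kappa> i k * H k j) = (if i = j then 1 else 0)" if ij: "i < d" "j < d" for i j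
  proof -
    \<comment> \<open>Column \<open>j\<close> of the product minus the identity, read as
      coefficients of the \<open>a i\<close>: the right inverse property makes that vector
      orthogonal to every \<open>a m\<close>, hence 0.\<close>
    define c where "c i = (\<Sum>k<d. \<kappa> i k * H k j) - (if i = j then 1 else 0)" for i
    define x where "x = (\<Sum>i<d. cscale (c i) (a i))"
    have ortho: "hE x (a m) = 0" if m: "m < d" for m
    proof -
      have "hE x (a m) = (\<Sum>i<d. c i * H m i)" using m by (simp add: x_def hE_sum hE_scale H)
      also have "\<dots> = (\<Sum>i<d. \<Sum>k<d. \<kappa> i k * H k j * H m i) - (\<Sum>i<d. (if i = j then 1 else 0) * H m i)"
        by (simp add: c_def left_diff_distrib sum_subtractf sum_distrib_right)
      also have "(\<Sum>i<d. \<Sum>k<d. \<kappa> i k * H k j * H m i) = (\<Sum>k<d. (\<Sum>i<d. H m i * \<kappa> i k) * H k j)"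
        by (subst sum.swap) (simp add: sum_distrib_left sum_distrib_right mult_ac)
      also have "\<dots> = (\<Sum>k<d. if m = k then H k j else 0)" by (intro sum.cong refl) (use m in \<open>auto simp: HK\<close>)
      also have "\<dots> = H m j" using m by simp
      also have "(\<Sum>i<d. (if i = j then 1 else 0) * H m i) = (\<Sum>i<d. if i = j then H m j else 0)"
        by (intro sum.cong refl) auto
      also have "\<dots> = H m j" using ij by simp
      finally show ?thesis by simp
    qed
    have "hE (a m) x = 0" if "m < d" for m by (subst hE_cnj) (simp add: ortho that)
    then have "(\<Sum>m<d. c m * hE (a m) x) = 0" by simp
    moreover have "hE x x = (\<Sum>m<d. c m * hE (a m) x)" by (subst (1) x_def) (simp add: hE_sum hE_scale)
    ultimately have "hE x x = 0" by simp
    then have "x = 0" by (rule hE_nondeg)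
    then have "c i = 0" using ind ij(1) unfolding indep_def x_def by blast
    then show ?thesis by (simp add: c_def)
  qed
  define K0 where "K0 i j = (if i < d \<and> j < d then \<kappa> i j else 0)" for i j
  have K0: "mat_inverse d H = K0"
    unfolding mat_inverse_def
  proof (rule the_equality)
    show "(\<forall>i j. \<not> (i < d \<and> j < d) \<longrightarrow> K0 i j = 0) \<and>
      (\<forall>i<d. \<forall>j<d. (\<Sum>k<d. H i k * K0 k j) = (if i = j then 1 else 0) \<and> (\<Sum>k<d. K0 i k * H k j) = (if i = j then 1 else 0))"
      using HK KH by (auto simp: K0_def)
  next
    fix L assume L: "(\<forall>i j. \<not> (i < d \<and> j < d) \<longrightarrow> L i j = 0) \<and>
      (\<forall>i<d. \<forall>j<d. (\<Sum>k<d. H i k * L k j) = (if i = j then 1 else 0) \<and> (\<Sum>k<d. L i k * H k j) = (if i = j then 1 else 0))"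
    have "L i j = \<kappa> i j" if ij: "i < d" "j < d" for i j
    proof -
      have "L i j = (\<Sum>k<d. L i k * (if k = j then 1 else 0))"
      proof -
        have "(\<Sum>k<d. L i k * (if k = j then 1 else 0)) = (\<Sum>k<d. if k = j then L i j else 0)" by (intro sum.cong) auto
        then show ?thesis using ij by simp
      qed
      also have "\<dots> = (\<Sum>k<d. L i k * (\<Sum>m<d. H k m * \<kappa> m j))" by (intro sum.cong refl) (use ij in \<open>simp add: HK\<close>)
      also have "\<dots> = (\<Sum>m<d. (\<Sum>k<d. L i k * H k m) * \<kappa> m j)"
        by (simp add: sum_distrib_left sum_distrib_right mult.assoc) (rule sum.swap)
      also have "\<dots> = (\<Sum>m<d. if i = m then \<kappa> m j else 0)" by (intro sum.cong refl) (use L ij in auto)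
      also have "\<dots> = \<kappa> i j" using ij by simp
      finally show ?thesis .
    qed
    then show "L = K0" using L by (intro ext) (auto simp: K0_def)
  qed
  have "(\<Sum>k<d. mat_inverse d H i k * D k) = (\<Sum>k<d. \<kappa> i k * (\<Sum>l<d. H k l * \<theta> l))"
    unfolding K0 by (intro sum.cong refl) (use i D in \<open>auto simp: K0_def\<close>)
  also have "\<dots> = (\<Sum>l<d. (\<Sum>k<d. \<kappa> i k * H k l) * \<theta> l)"
    by (simp add: sum_distrib_left sum_distrib_right mult.assoc) (rule sum.swap)
  also have "\<dots> = (\<Sum>l<d. if i = l then \<theta> l else 0)" by (intro sum.cong refl) (use i in \<open>auto simp: KH\<close>)
  also have "\<dots> = \<theta> i" using i by simp
  finally show ?thesis .
qed

text \<open>Here \<open>p\<close> stands for the holomorphic derivative of the Gram matrix.\<close>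

lemma connection_derivative:
  assumes e: "0 < e" and q: "csub q"
    and A: "\<And>s. s \<in> ball 0 e \<Longrightarrow> clinear (A s)"
    and inj: "\<And>s X. s \<in> ball 0 e \<Longrightarrow> X \<in> q \<Longrightarrow> A s X = 0 \<Longrightarrow> X = 0"
    and Sq: "\<And>s j. s \<in> ball 0 e \<Longrightarrow> j < d \<Longrightarrow> S j s \<in> q" and wq: "\<And>s j. s \<in> ball 0 e \<Longrightarrow> j < d \<Longrightarrow> w j s \<in> q"
    and ind: "\<And>s. s \<in> ball 0 e \<Longrightarrow> indep d (\<lambda>j. S j s)"
    and span: "\<And>s X. s \<in> ball 0 e \<Longrightarrow> X \<in> q \<Longrightarrow> \<exists>c. X = (\<Sum>j<d. cscale (c j) (S j s))"
    and H: "\<And>s i j. s \<in> ball 0 e \<Longrightarrow> i < d \<Longrightarrow> j < d \<Longrightarrow> H s i j = hE (A s (S j s)) (A s (S i s))"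
    and p: "\<And>s i j. s \<in> ball 0 e \<Longrightarrow> i < d \<Longrightarrow> j < d \<Longrightarrow> p s i j = hE (A s (w j s)) (A s (S i s))"
    and S: "\<And>j. j < d \<Longrightarrow> wd (S j) 0 (D j) 0" and w: "\<And>j. j < d \<Longrightarrow> \<exists>C. wd (w j) 0 C (R j)" and j: "j < d"
  shows "\<exists>c c'. (\<forall>i<d. cwd (\<lambda>s. \<Sum>k<d. mat_inverse d (H s) i k * p s k j) 0 (c i) (c' i)) \<and>
    (\<Sum>i<d. cscale (c' i) (S i 0)) = R j"
proof -
  define \<theta> where "\<theta> i s = (\<Sum>k<d. mat_inverse d (H s) i k * p s k j)" for i s
  have Asum: "A s (\<Sum>i<d. cscale (c i) (X i)) = (\<Sum>i<d. cscale (c i) (A s (X i)))" if "s \<in> ball 0 e" for s c and X :: "nat \<Rightarrow> _"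
  proof -
    have "A s (\<Sum>i\<in>I. cscale (c i) (X i)) = (\<Sum>i\<in>I. cscale (c i) (A s (X i)))" if "finite I" for I
      using that
    proof (induction I rule: finite_induct)
      case empty
      have "A s (cscale 0 0) = cscale 0 (A s 0)" using A[OF \<open>s \<in> ball 0 e\<close>] unfolding clinear_def by blast
      then show ?case by simp
    next
      case (insert x I) then show ?case using A[OF \<open>s \<in> ball 0 e\<close>] by (auto simp: clinear_def)
    qed
    then show ?thesis by simp
  qed
  \<comment> \<open>The derivative of the Gram matrix is the Gram matrix times the coordinates of
    \<open>w j\<close> in the frame, so the connection coefficients are exactly these
    coordinates.\<close>
  have w_eq: "w j s = (\<Sum>i<d. cscale (\<theta> i s) (S i s))" if s: "s \<in> ball 0 e" for s
  proof -
    obtain c where c: "w j s = (\<Sum>i<d. cscale (c i) (S i s))" using span[OF s wq[OF s j]] by blast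
    have indA: "indep d (\<lambda>i. A s (S i s))"
      unfolding indep_def
    proof (intro allI impI)
      fix c i assume z: "(\<Sum>i<d. cscale (c i) (A s (S i s))) = 0" and i: "i < d"
      have "(\<Sum>i<d. cscale (c i) (S i s)) \<in> q" using Sq[OF s] by (intro csub_sum[OF q] csub_scale[OF q]) auto
      then have "(\<Sum>i<d. cscale (c i) (S i s)) = 0" using inj[OF s] z Asum[OF s, of c "\<lambda>i. S i s"] by simp
      then show "c i = 0" using ind[OF s] i unfolding indep_def by blast
    qed
    have "\<theta> i s = c i" if i: "i < d" for i
      unfolding \<theta>_def
    proof (rule mat_inverse_gram[OF indA _ _ i])
      show "H s i k = hE (A s (S k s)) (A s (S i s))" if "i < d" "k < d" for i k using H[OF s that] .
      show "p s k j = (\<Sum>l<d. H s k l * c l)" if k: "k < d" for k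
        unfolding p[OF s k j] c Asum[OF s, of c "\<lambda>i. S i s"] using k by (simp add: hE_sum hE_scale H[OF s] mult.commute)
    qed
    then show ?thesis using c by simp
  qed
  have z0: "0 \<in> ball (0::complex) e" using e by simp
  obtain b where "\<forall>i<d. \<forall>k<d. hE (b k) (S i 0) = (if i = k then 1 else 0)"
    using dual_ex[OF ind[OF z0]] by (elim exE conjE)
  then have dual: "hE (b k) (S i 0) = (if i = k then 1 else 0)" if "i < d" "k < d" for i k using that by simp
  have dual': "hE (S i 0) (b k) = (if i = k then 1 else 0)" if "i < d" "k < d" for i k
    by (subst hE_cnj) (simp add: dual[OF that])
  \<comment> \<open>Pairing the expansion of \<open>w j\<close> with the dual basis taken at 0 gives
    a linear system for \<theta> whose matrix is the identity at 0.\<close>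
  have dif: "\<theta> i differentiable (at 0)" if i: "i < d" for i
  proof (rule solve_differentiable[of d "\<lambda>k i s. hE (S i s) (b k)" "\<lambda>k s. hE (w j s) (b k)"])
    show "(\<lambda>s. hE (S i s) (b k)) differentiable (at 0)" if "k < d" "i < d" for k i
      by (rule cwd_differentiable[OF cwd_hE[OF S[OF that(2)] wd_const]])
    show "hE (S i 0) (b k) = (if k = i then 1 else 0)" if "k < d" "i < d" for k i using dual' that by auto
    show "(\<lambda>s. hE (w j s) (b k)) differentiable (at 0)" if "k < d" for k
    proof -
      obtain C where "wd (w j) 0 C (R j)" using w[OF j] by blast
      then show ?thesis by (rule cwd_differentiable[OF cwd_hE[OF _ wd_const]])
    qed
    show "\<forall>\<^sub>F s in nhds 0. (\<Sum>i<d. hE (S i s) (b k) * \<theta> i s) = hE (w j s) (b k)" if "k < d" for k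
    proof -
      have "\<forall>\<^sub>F s in nhds 0. s \<in> ball (0::complex) e" using z0 open_ball by (metis eventually_nhds)
      then show ?thesis by eventually_elim (simp add: w_eq hE_sum hE_scale mult.commute)
    qed
  qed fact
  then have "\<forall>i. \<exists>c c'. i < d \<longrightarrow> cwd (\<theta> i) 0 c c'" using cwd_ex by blast
  then obtain c c' where c: "\<And>i. i < d \<Longrightarrow> cwd (\<theta> i) 0 (c i) (c' i)" by metis
  \<comment> \<open>The frame is holomorphic, so the antiholomorphic derivative of the expansion
    falls on the coefficients alone.\<close>
  have "wd (\<lambda>s. \<Sum>i<d. cscale (\<theta> i s) (S i s)) 0 (\<Sum>i<d. cscale (\<theta> i 0) (D i) + cscale (c i) (S i 0))
     (\<Sum>i<d. cscale (\<theta> i 0) 0 + cscale (c' i) (S i 0))"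
    by (intro wd_sum wd_cscale c S) auto
  then have "wd (w j) 0 (\<Sum>i<d. cscale (\<theta> i 0) (D i) + cscale (c i) (S i 0)) (\<Sum>i<d. cscale (c' i) (S i 0))"
    using wd_cong[OF _ open_ball z0, of _ _ _ "w j"] w_eq by simp
  then have "(\<Sum>i<d. cscale (c' i) (S i 0)) = R j" using w[OF j] wd_unique(2) by blast
  then show ?thesis using c unfolding \<theta>_def by blast
qed

end

section \<open>Holomorphic matrix functions\<close>

definition mholo :: "(complex \<Rightarrow> complex ^ 'n::finite ^ 'n) \<Rightarrow> complex set \<Rightarrow> bool" where
  "mholo f A \<longleftrightarrow> (\<forall>i j. (\<lambda>s. f s $ i $ j) holomorphic_on A)"

definition mderiv :: "(complex \<Rightarrow> complex ^ 'n::finite ^ 'n) \<Rightarrow> complex \<Rightarrow> complex ^ 'n ^ 'n" where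
  "mderiv f s = (\<chi> i j. deriv (\<lambda>s. f s $ i $ j) s)"

lemma mholo_const: "mholo (\<lambda>s. c) A"
  by (simp add: mholo_def)

lemma mholo_mult: "mholo f A \<Longrightarrow> mholo g A \<Longrightarrow> mholo (\<lambda>s. f s ** g s) A"
  by (auto simp: mholo_def matrix_matrix_mult_def intro!: holomorphic_intros)

lemma mholo_sum: "(\<And>i. i \<in> I \<Longrightarrow> mholo (f i) A) \<Longrightarrow> mholo (\<lambda>s. \<Sum>i\<in>I. f i s) A"
  by (auto simp: mholo_def intro!: holomorphic_intros)

lemma mholo_add: "mholo f A \<Longrightarrow> mholo g A \<Longrightarrow> mholo (\<lambda>s. f s + g s) A"
  by (auto simp: mholo_def intro!: holomorphic_intros)

lemma mholo_diff: "mholo f A \<Longrightarrow> mholo g A \<Longrightarrow> mholo (\<lambda>s. f s - g s) A"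
  by (auto simp: mholo_def intro!: holomorphic_intros)

lemma mholo_cscale: "c holomorphic_on A \<Longrightarrow> mholo f A \<Longrightarrow> mholo (\<lambda>s. cscale (c s) (f s)) A"
  by (auto simp: mholo_def intro!: holomorphic_intros)

lemma holomorphic_det: "mholo f A \<Longrightarrow> (\<lambda>s. det (f s)) holomorphic_on A"
  by (auto simp: mholo_def det_def intro!: holomorphic_intros)

lemma mholo_inv:
  assumes f: "mholo f A" and i: "\<And>s. s \<in> A \<Longrightarrow> invertible (f s)" shows "mholo (\<lambda>s. matrix_inv (f s)) A"
  unfolding mholo_def
proof (intro allI)
  fix i j
  have "mholo (\<lambda>s. cof i j (f s)) A"
    unfolding mholo_def
  proof (intro allI)
    fix a b show "(\<lambda>s. cof i j (f s) $ a $ b) holomorphic_on A"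
      using f by (cases "b = i") (auto simp: cof_def mholo_def)
  qed
  then have "(\<lambda>s. det (cof i j (f s)) / det (f s)) holomorphic_on A"
    by (intro holomorphic_intros holomorphic_det f) (use i in \<open>auto simp: invertible_det_nz\<close>)
  then show "(\<lambda>s. matrix_inv (f s) $ i $ j) holomorphic_on A"
    by (rule holomorphic_transform) (simp add: matrix_inv_entry i)
qed

lemma mholo_mderiv: "open A \<Longrightarrow> mholo f A \<Longrightarrow> mholo (mderiv f) A"
  by (auto simp: mholo_def mderiv_def intro!: holomorphic_deriv)

lemma wd_mholo:
  assumes A: "open A" "s \<in> A" and f: "mholo f A" shows "wd f s (mderiv f s) 0"
proof -
  have fd: "((\<lambda>s. f s $ i $ j) has_field_derivative mderiv f s $ i $ j) (at s)" for i j
    using f A holomorphic_derivI[of "\<lambda>s. f s $ i $ j" A s] by (simp add: mholo_def mderiv_def)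
  then have "(\<lambda>s. f s $ i $ j) differentiable (at s)" for i j
    by (meson differentiable_def has_field_derivative_def)
  then have "f differentiable (at s)" by (rule differentiable_matI)
  then obtain C C' where w: "wd f s C C'" using wd_ex by blast
  have "C $ i $ j = mderiv f s $ i $ j \<and> C' $ i $ j = 0" for i j
  proof -
    have "((\<lambda>s. f s $ i $ j) has_derivative (\<lambda>\<tau>. \<tau> * C $ i $ j + cnj \<tau> * C' $ i $ j)) (at s)"
      using bounded_linear.has_derivative[OF bounded_linear_entry[of i j] w[unfolded wd_def]] by simp
    then have e: "(\<lambda>\<tau>. \<tau> * C $ i $ j + cnj \<tau> * C' $ i $ j) = (*) (mderiv f s $ i $ j)"
      using fd[of i j] has_derivative_unique unfolding has_field_derivative_def by blast
    have 1: "C $ i $ j + C' $ i $ j = mderiv f s $ i $ j" using fun_cong[OF e, of 1] by simp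
    have "\<i> * C $ i $ j - \<i> * C' $ i $ j = mderiv f s $ i $ j * \<i>" using fun_cong[OF e, of \<i>] by simp
    then have "\<i> * (C $ i $ j - C' $ i $ j) = \<i> * mderiv f s $ i $ j" by (simp add: algebra_simps)
    then have 2: "C $ i $ j - C' $ i $ j = mderiv f s $ i $ j" by simp
    have "C' $ i $ j = ((C $ i $ j + C' $ i $ j) - (C $ i $ j - C' $ i $ j)) / 2" by simp
    then have "C' $ i $ j = 0" unfolding 1 2 by simp
    then show ?thesis using 1 by simp
  qed
  then have "C = mderiv f s" "C' = 0" by (simp_all add: vec_eq_iff)
  then show ?thesis using w by simp
qed

lemma (in bigraded) mholo_epart: "mholo f A \<Longrightarrow> mholo (\<lambda>s. epart S (f s)) A"
  unfolding epart_def
proof (intro mholo_sum)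
  fix x y assume f: "mholo f A"
  show "mholo (\<lambda>s. if y - x \<in> S then P y ** f s ** P x else 0) A"
    by (cases "y - x \<in> S") (auto intro!: mholo_mult mholo_const f)
qed

text \<open>Cauchy's inequality on discs of radius \<open>R / 2\<close> about points of the half
  disc bounds the second derivative by \<open>fact 2 * B / (R/2) ^ 2\<close>, which explains the
  constant 8.\<close>

lemma taylor_remainder:
  assumes f: "f holomorphic_on ball 0 R" and B: "\<And>t. t \<in> ball 0 R \<Longrightarrow> norm (f t) \<le> B" and R: "0 < R" and t: "norm t < R / 2"
  shows "norm (f t - f 0 - t * deriv f 0) \<le> 8 * B / R\<^sup>2 * (norm t)\<^sup>2"
proof -
  have d: "((deriv ^^ i) f has_field_derivative (deriv ^^ Suc i) f x) (at x within ball 0 (R / 2))" if "x \<in> ball 0 (R/2)" for i x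
  proof (rule has_field_derivative_at_within)
    show "((deriv ^^ i) f has_field_derivative (deriv ^^ Suc i) f x) (at x)"
      using that R by (intro has_field_derivative_higher_deriv[OF f]) auto
  qed
  have bd: "norm ((deriv ^^ Suc 1) f x) \<le> 8 * B / R\<^sup>2" if x: "x \<in> ball 0 (R/2)" for x
  proof -
    have sub: "cball x (R/2) \<subseteq> ball 0 R"
    proof
      fix y assume "y \<in> cball x (R/2)"
      then have "norm (y - x) \<le> R/2" by (simp add: dist_norm norm_minus_commute)
      then show "y \<in> ball 0 R" using x norm_triangle_ineq[of "y - x" x] by simp
    qed
    have "norm ((deriv ^^ 2) f x) \<le> fact 2 * B / (R/2) ^ 2"
    proof (rule Cauchy_inequality)
      show "f holomorphic_on ball x (R/2)" using f by (rule holomorphic_on_subset) (use sub ball_subset_cball in blast)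
      show "continuous_on (cball x (R/2)) f" using holomorphic_on_imp_continuous_on[OF f] sub by (rule continuous_on_subset)
      show "0 < R/2" using R by simp
      show "norm (f y) \<le> B" if "norm (x - y) = R/2" for y
        by (rule B) (use that sub in \<open>auto simp: dist_norm subset_iff\<close>)
    qed
    also have "fact 2 * B / (R/2) ^ 2 = 8 * B / R\<^sup>2" using R by (simp add: field_simps power2_eq_square)
    finally show ?thesis by (simp add: numeral_2_eq_2)
  qed
  have "norm ((deriv ^^ 0) f t - (\<Sum>i\<le>1. (deriv ^^ i) f 0 * (t - 0) ^ i / fact i)) \<le> 8 * B / R\<^sup>2 * norm (t - 0) ^ Suc 1 / fact 1"
    by (rule complex_Taylor[of "ball 0 (R/2)"]) (use d bd t R in auto)
  then show ?thesis by (simp add: algebra_simps power2_eq_square)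
qed

text \<open>The derivatives are limits of the difference quotients \<open>q n\<close>, which are
  holomorphic in \<open>s\<close>. The common bound \<open>B\<close> makes the Taylor remainder, and
  hence the convergence, uniform.\<close>

lemma param_deriv_holomorphic:
  fixes h :: "complex \<Rightarrow> complex \<Rightarrow> complex"
  assumes R: "0 < R" and B: "\<And>s t. s \<in> ball 0 R \<Longrightarrow> t \<in> ball 0 R \<Longrightarrow> norm (h s t) \<le> B"
    and hs: "\<And>t. t \<in> ball 0 R \<Longrightarrow> (\<lambda>s. h s t) holomorphic_on ball 0 R"
    and ht: "\<And>s. s \<in> ball 0 R \<Longrightarrow> h s holomorphic_on ball 0 R"
  shows "(\<lambda>s. deriv (h s) 0) holomorphic_on ball 0 R"
proof -
  \<comment> \<open>The denominator is at least 4, so the steps are nonzero and stay inside the half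
    disc on which the remainder estimate holds.\<close>
  define t where "t n = complex_of_real (R / (2 * (real n + 2)))" for n
  define q where "q n s = (h s (t n) - h s 0) / t n" for n s
  have tn: "norm (t n) = R / (2 * (real n + 2))" for n using R by (simp add: t_def del: of_real_divide)
  have t_small: "norm (t n) < R / 2" "t n \<noteq> 0" "t n \<in> ball 0 R" for n
  proof -
    show 1: "norm (t n) < R / 2" unfolding tn using R by (intro divide_strict_left_mono) auto
    show "t n \<noteq> 0" unfolding t_def of_real_eq_0_iff using R by simp
    show "t n \<in> ball 0 R" using 1 R by simp
  qed
  have est: "norm (q n s - deriv (h s) 0) \<le> 8 * B / R\<^sup>2 * norm (t n)" if s: "s \<in> ball 0 R" for n s
  proof -
    have "norm (h s (t n) - h s 0 - t n * deriv (h s) 0) \<le> 8 * B / R\<^sup>2 * (norm (t n))\<^sup>2"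
      by (rule taylor_remainder[OF ht[OF s] B[OF s] R t_small(1)])
    moreover have "q n s - deriv (h s) 0 = (h s (t n) - h s 0 - t n * deriv (h s) 0) / t n"
      using t_small(2)[of n] by (simp add: q_def diff_divide_distrib)
    ultimately have "norm (q n s - deriv (h s) 0) \<le> 8 * B / R\<^sup>2 * (norm (t n))\<^sup>2 / norm (t n)"
      by (simp only: norm_divide) (rule divide_right_mono, simp_all)
    then show ?thesis using t_small(2)[of n] by (simp add: power2_eq_square)
  qed
  have lim: "uniform_limit (ball 0 R) q (\<lambda>s. deriv (h s) 0) sequentially"
  proof (rule uniform_limitI)
    fix e :: real assume e: "0 < e"
    have "(\<lambda>n. 8 * B / R\<^sup>2 * (R / (2 * (real n + 2)))) \<longlonglongrightarrow> 0" by real_asymp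
    then have "(\<lambda>n. 8 * B / R\<^sup>2 * norm (t n)) \<longlonglongrightarrow> 0" by (simp only: tn)
    then have "\<forall>\<^sub>F n in sequentially. 8 * B / R\<^sup>2 * norm (t n) < e" using e by (intro order_tendstoD) auto
    then show "\<forall>\<^sub>F n in sequentially. \<forall>s\<in>ball 0 R. dist (q n s) (deriv (h s) 0) < e"
      by eventually_elim (use le_less_trans[OF est] in \<open>auto simp: dist_norm simp del: times_divide_eq_left\<close>)
  qed
  show ?thesis
  proof (rule holomorphic_uniform_sequence[of _ q])
    show "q n holomorphic_on ball 0 R" for n
      unfolding q_def by (intro holomorphic_intros hs t_small) (use R t_small in auto)
    fix x :: complex assume "x \<in> ball 0 R"
    then obtain d where d: "0 < d" "cball x d \<subseteq> ball 0 R" using open_contains_cball open_ball by blast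
    then show "\<exists>d>0. cball x d \<subseteq> ball 0 R \<and> uniform_limit (cball x d) q (\<lambda>s. deriv (h s) 0) sequentially"
      using uniform_limit_on_subset[OF lim d(2)] by blast
  qed simp
qed

text \<open>Pointwise derivatives give no continuity of \<open>L\<close> by themselves. Reading
  \<open>L (z + s *s a) b\<close> as the derivative in \<open>t\<close> at 0 of
  \<open>g (z + s *s a + t *s b)\<close>, which is separately holomorphic and bounded on a bidisc,
  makes it holomorphic in \<open>s\<close>.\<close>

lemma line_deriv_mholo:
  fixes g :: "complex ^ 'm::finite \<Rightarrow> complex ^ 'n::finite ^ 'n" and L :: "complex ^ 'm \<Rightarrow> complex ^ 'm \<Rightarrow> complex ^ 'n ^ 'n"
  assumes U: "open U" "z \<in> U"
    and g: "\<And>y. y \<in> U \<Longrightarrow> (g has_derivative L y) (at y)"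
    and L: "\<And>y c a. y \<in> U \<Longrightarrow> L y (c *s a) = cscale c (L y a)"
  obtains R where "0 < R" "\<And>s. s \<in> ball 0 R \<Longrightarrow> z + s *s a \<in> U" "mholo (\<lambda>s. g (z + s *s a)) (ball 0 R)"
    "mholo (\<lambda>s. L (z + s *s a) b) (ball 0 R)"
proof -
  define y where "y = (\<lambda>x :: complex \<times> complex. z + fst x *s a + snd x *s b)"
  have sm: "bounded_linear (\<lambda>c. c *s v)" for v :: "complex ^ 'm"
    by (intro linear_conv_bounded_linear[THEN iffD1] linearI) (simp_all add: vec_eq_iff algebra_simps)
  have conty: "continuous_on UNIV y"
    unfolding y_def by (intro continuous_intros bounded_linear.continuous_on[OF sm])
  have "open (y -` U)" using conty U(1) by (auto intro: open_vimage)
  moreover have "(0, 0) \<in> y -` U" using U by (simp add: y_def)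
  ultimately obtain A B where AB: "open A" "open B" "0 \<in> A" "0 \<in> B" "A \<times> B \<subseteq> y -` U"
    using open_prod_elim by (metis mem_Sigma_iff)
  obtain r1 where r1: "0 < r1" "cball 0 r1 \<subseteq> A" using AB open_contains_cball by blast
  obtain r2 where r2: "0 < r2" "cball 0 r2 \<subseteq> B" using AB open_contains_cball by blast
  define R where "R = min r1 r2"
  have R: "0 < R" using r1 r2 by (simp add: R_def)
  have yU: "y (s, t) \<in> U" if "s \<in> cball 0 R" "t \<in> cball 0 R" for s t
    using that r1(2) r2(2) by (intro subsetD[OF AB(5), unfolded vimage_eq]) (auto simp: R_def)
  have gs: "((\<lambda>s. g (z + s *s v + w)) has_derivative (\<lambda>\<tau>. cscale \<tau> (L (z + s *s v + w) v))) (at s)"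
    if "z + s *s v + w \<in> U" for s v w
  proof -
    have "((\<lambda>s. z + s *s v + w) has_derivative (\<lambda>\<tau>. \<tau> *s v)) (at s)"
      by (auto intro!: derivative_eq_intros bounded_linear.has_derivative[OF sm])
    then have "((\<lambda>s. g (z + s *s v + w)) has_derivative (\<lambda>\<tau>. L (z + s *s v + w) (\<tau> *s v))) (at s)"
      by (rule has_derivative_compose) (rule g[OF that])
    then show ?thesis by (simp add: L[OF that])
  qed
  have fd: "((\<lambda>s. g (z + s *s v + w) $ i $ j) has_field_derivative L (z + s *s v + w) v $ i $ j) (at s)"
    if "z + s *s v + w \<in> U" for s v w i j
    using bounded_linear.has_derivative[OF bounded_linear_entry[of i j] gs[OF that]]
    unfolding has_field_derivative_def by (rule has_derivative_eq_rhs) (simp add: fun_eq_iff)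
  have hol1: "(\<lambda>s. g (y (s, t)) $ i $ j) holomorphic_on ball 0 R" if "t \<in> ball 0 R" for t i j
  proof -
    have "((\<lambda>s. g (y (s, t)) $ i $ j) has_field_derivative L (y (s, t)) a $ i $ j) (at s)" if "s \<in> ball 0 R" for s
      using fd[of s a "t *s b" i j] yU[of s t] that \<open>t \<in> ball 0 R\<close> by (simp add: y_def)
    then show ?thesis by (metis holomorphic_onI field_differentiable_def field_differentiable_at_within)
  qed
  have d2: "((\<lambda>t. g (y (s, t)) $ i $ j) has_field_derivative L (y (s, t)) b $ i $ j) (at t)"
    if "s \<in> ball 0 R" "t \<in> ball 0 R" for s t i j
    using fd[of t b "s *s a" i j] yU[of s t] that by (simp add: y_def add_ac)
  have hol2: "(\<lambda>t. g (y (s, t)) $ i $ j) holomorphic_on ball 0 R" if "s \<in> ball 0 R" for s i j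
    using d2[OF that] by (metis holomorphic_onI field_differentiable_def field_differentiable_at_within)
  have ent: "(\<lambda>s. L (z + s *s a) b $ i $ j) holomorphic_on ball 0 R" for i j
  proof -
    have "continuous_on U g" by (intro continuous_at_imp_continuous_on ballI has_derivative_continuous[OF g])
    then have c: "continuous_on (cball 0 R \<times> cball 0 R) (\<lambda>x. g (y x) $ i $ j)"
      by (intro continuous_intros continuous_on_compose2[of U g _ y] continuous_on_subset[OF conty]) (auto intro: yU)
    have "compact ((\<lambda>x. g (y x) $ i $ j) ` (cball 0 R \<times> cball 0 R))"
      by (rule compact_continuous_image[OF c]) (intro compact_Times compact_cball)
    then have "bounded ((\<lambda>x. g (y x) $ i $ j) ` (cball 0 R \<times> cball 0 R))" by (rule compact_imp_bounded)
    then obtain M where M: "\<forall>v \<in> (\<lambda>x. g (y x) $ i $ j) ` (cball 0 R \<times> cball 0 R). norm v \<le> M"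
      unfolding bounded_iff by (elim exE)
    have M: "norm (g (y (s, t)) $ i $ j) \<le> M" if "s \<in> ball 0 R" "t \<in> ball 0 R" for s t
      by (rule bspec[OF M], rule image_eqI[of _ _ "(s, t)"]) (use that in auto)
    have "(\<lambda>s. deriv (\<lambda>t. g (y (s, t)) $ i $ j) 0) holomorphic_on ball 0 R"
      by (rule param_deriv_holomorphic[OF R M hol1 hol2])
    then show ?thesis
    proof (rule holomorphic_transform)
      fix s :: complex assume s: "s \<in> ball 0 R"
      show "deriv (\<lambda>t. g (y (s, t)) $ i $ j) 0 = L (z + s *s a) b $ i $ j"
        using DERIV_imp_deriv[OF d2[OF s, of 0 i j]] R by (simp add: y_def)
    qed
  qed
  show thesis
  proof (rule that[OF R])
    show "z + s *s a \<in> U" if "s \<in> ball 0 R" for s using yU[of s 0] that R by (simp add: y_def)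
    show "mholo (\<lambda>s. g (z + s *s a)) (ball 0 R)" using hol1[of 0] R by (simp add: mholo_def y_def)
    show "mholo (\<lambda>s. L (z + s *s a) b) (ball 0 R)" using ent by (simp add: mholo_def)
  qed
qed

lemma subspace_projection:
  fixes E :: "(complex ^ 'm::finite) set"
  assumes E: "vec.subspace E"
  obtains p :: "complex ^ 'm \<Rightarrow> complex ^ 'm" where "\<And>x y. p (x + y) = p x + p y" "\<And>c x. p (c *s x) = c *s p x"
    "\<And>x. p x \<in> E" "\<And>x. x \<in> E \<Longrightarrow> p x = x"
proof -
  obtain B where B: "B \<subseteq> E" "vec.independent B" "E \<subseteq> vec.span B" using vec.basis_exists by metis
  have BE: "vec.span B = E" using B E by (metis vec.span_eq_iff vec.span_mono subset_antisym)
  define p where "p = vec.construct B (\<lambda>x. x :: complex ^ 'm)"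
  have lin: "Vector_Spaces.linear (*s) (*s) p" unfolding p_def by (rule vec.linear_construct[OF B(2)])
  then interpret p: Vector_Spaces.linear "(*s)" "(*s)" p .
  have pB: "p x = x" if "x \<in> B" for x unfolding p_def using vec.construct_basis[OF B(2) that] .
  have "p x = x" if "x \<in> vec.span B" for x
    using that by (induction rule: vec.span_induct_alt) (auto simp: p.add p.scale pB p.zero)
  moreover have "p x \<in> E" for x
    unfolding p_def using vec.construct_in_span[OF B(2), of "\<lambda>x. x" x] by (simp add: BE)
  ultimately show thesis using that[of p] p.add p.scale BE by auto
qed

section \<open>Lifts of charts\<close>

lemma complex_linear_of_i:
  assumes D: "linear D" and i: "\<And>v :: complex ^ 'm::finite. D (\<i> *s v) = \<i> * (D v :: complex)"
  shows "D (c *s v) = c * D v"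
proof -
  have "D (c *s v) = D (Re c *\<^sub>R v + Im c *\<^sub>R (\<i> *s v))"
    by (rule arg_cong[of _ _ D]) (simp add: vec_eq_iff complex_eq_iff)
  also have "\<dots> = Re c *\<^sub>R D v + Im c *\<^sub>R (\<i> * D v)" by (simp only: linear_add[OF D] linear_scale[OF D] i)
  also have "\<dots> = c * D v" by (simp add: complex_eq_iff)
  finally show ?thesis .
qed

text \<open>Composing with a projection onto \<open>E\<close> extends the lift from a relatively
  open set to an open set of the whole space, where ordinary derivatives are available. Multiplying
  by the inverse of \<open>g0 z\<close>, which fixes \<open>\<phi> z\<close>, normalizes the lift to
  the identity at \<open>z\<close>.\<close>

lemma chart_lift:
  fixes \<phi> :: "complex ^ 'm::finite \<Rightarrow> int \<Rightarrow> (complex ^ 'n::finite) set"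
  assumes chart: "holomorphic_chart W Q h E U \<phi>" and z: "z \<in> U"
  obtains X g L where "open X" "z \<in> X" "X \<inter> E \<subseteq> U" "g z = mat 1"
    "\<And>y. y \<in> X \<Longrightarrow> (g has_derivative L y) (at y)"
    "\<And>y c a. y \<in> X \<Longrightarrow> L y (c *s a) = cscale c (L y a)"
    "\<And>y. y \<in> X \<inter> E \<Longrightarrow> g y \<in> G_C W Q"
    "\<And>y. y \<in> X \<inter> E \<Longrightarrow> \<phi> y = filt_act (g y) (\<phi> z)"
proof -
  have E: "vec.subspace E" using chart by (simp add: holomorphic_chart_def)
  obtain p where p: "\<And>x y. p (x + y) = p x + p y" "\<And>c x. p (c *s x) = c *s p x" "\<And>x. p x \<in> E" "\<And>x. x \<in> E \<Longrightarrow> p x = x"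
    using subspace_projection[OF E] by metis
  have bp: "bounded_linear p"
    by (intro linear_conv_bounded_linear[THEN iffD1] linearI) (simp_all add: p scaleR_vec)
  obtain N g0 where N: "openin (top_of_set E) N" "z \<in> N" "N \<subseteq> U"
    and hol: "\<forall>i j. holo_on E N (\<lambda>y. g0 y $ i $ j)"
    and g0: "\<forall>y\<in>N. g0 y \<in> G_C W Q \<and> \<phi> y = filt_act (g0 y) (\<phi> z)"
    using chart z unfolding holomorphic_chart_def by metis
  obtain T where T: "open T" "N = E \<inter> T" using N(1) by (auto simp: openin_open)
  define X where "X = p -` T"
  have X: "open X" unfolding X_def by (intro open_vimage T linear_continuous_on bp)
  have pN: "p y \<in> N" if "y \<in> X" for y using that p(3) by (simp add: X_def T)
  have XE: "y \<in> N" if "y \<in> X \<inter> E" for y using pN[of y] p(4)[of y] that by simp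
  have zX: "z \<in> X" using N(2) p(4)[of z] by (simp add: X_def T)
  define g where "g y = g0 (p y) ** matrix_inv (g0 z)" for y
  have i: "invertible (g0 z)" using g0 N(2) G_C_invertible by blast
  have "\<exists>D. (g has_derivative D) (at y) \<and> (\<forall>c a. D (c *s a) = cscale c (D a))" if y: "y \<in> X" for y
  proof -
    have ent: "\<exists>l. ((\<lambda>x. g0 (p x) $ i $ j) has_derivative l) (at y) \<and> (\<forall>c a. l (c *s a) = c * l a)" for i j
    proof -
      obtain l where l: "((\<lambda>y. g0 y $ i $ j) has_derivative l) (at (p y) within N)" "\<forall>a\<in>E. l (\<i> *s a) = \<i> * l a"
        using hol pN[OF y] unfolding holo_on_def by metis
      have "((\<lambda>x. g0 (p x) $ i $ j) has_derivative (\<lambda>v. l (p v))) (at y within X)"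
        by (rule has_derivative_in_compose[OF bounded_linear_imp_has_derivative[OF bp] has_derivative_subset[OF l(1)]])
          (use pN in auto)
      then have d: "((\<lambda>x. g0 (p x) $ i $ j) has_derivative (\<lambda>v. l (p v))) (at y)" using at_within_open[OF y X] by simp
      have "l (p (c *s a)) = c * l (p a)" for c a
        using complex_linear_of_i[OF has_derivative_linear[OF d]] l(2) p(2,3) by simp
      then show ?thesis using d by blast
    qed
    then have "(\<lambda>x. g0 (p x)) differentiable (at y)"
      by (intro differentiable_matI) (unfold differentiable_def, blast)
    then obtain D where D: "((\<lambda>x. g0 (p x)) has_derivative D) (at y)" by (auto simp: differentiable_def)
    have "D (c *s a) $ i $ j = c * D a $ i $ j" for c a i j
    proof -
      obtain l where l: "((\<lambda>x. g0 (p x) $ i $ j) has_derivative l) (at y)" "\<forall>c a. l (c *s a) = c * l a" using ent by blast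
      have "(\<lambda>v. D v $ i $ j) = l"
        using bounded_linear.has_derivative[OF bounded_linear_entry D] l(1) by (rule has_derivative_unique)
      then show ?thesis using l(2) by metis
    qed
    then have Dc: "D (c *s a) = cscale c (D a)" for c a by (simp add: vec_eq_iff)
    have "(g has_derivative (\<lambda>v. D v ** matrix_inv (g0 z))) (at y)"
      unfolding g_def using has_derivative_matrix_mult[OF D has_derivative_const[of "matrix_inv (g0 z)"]] by simp
    then show ?thesis by (intro exI[of _ "\<lambda>v. D v ** matrix_inv (g0 z)"]) (simp add: Dc cscale_mult)
  qed
  then obtain L where L: "\<And>y. y \<in> X \<Longrightarrow> (g has_derivative L y) (at y)" "\<And>y c a. y \<in> X \<Longrightarrow> L y (c *s a) = cscale c (L y a)"
    by metis
  have gG: "g y \<in> G_C W Q" "\<phi> y = filt_act (g y) (\<phi> z)" if y: "y \<in> X \<inter> E" for y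
  proof -
    have py: "p y = y" using y p(4) by simp
    show "g y \<in> G_C W Q" unfolding g_def using pN y g0 N(2) by (intro G_C_mult G_C_inv) auto
    have "\<phi> z = filt_act (matrix_inv (g0 z)) (filt_act (g0 z) (\<phi> z))" by (simp add: filt_act_inv[OF i])
    also have "\<dots> = filt_act (matrix_inv (g0 z)) (\<phi> z)" using g0 N(2) by metis
    finally show "\<phi> y = filt_act (g y) (\<phi> z)"
      unfolding g_def filt_act_mult py using g0 XE[OF y] by metis
  qed
  show thesis
  proof (rule that[OF X zX _ _ L gG])
    show "X \<inter> E \<subseteq> U" using XE N(3) by blast
    show "g z = mat 1" unfolding g_def using p(4)[of z] N T by (simp add: matrix_inv[OF i])
  qed
qed

text \<open>The lift along the direction \<open>e\<close>, multiplied by the inverse of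
  \<open>g y\<close>, is a curve in the group through the identity that moves
  \<open>\<phi> y\<close>; its velocity is the derivative of \<open>g\<close> so translated.\<close>

lemma tangent_map_eq:
  fixes \<phi> :: "complex ^ 'm::finite \<Rightarrow> int \<Rightarrow> (complex ^ 'n::finite) set"
  assumes pol: "polarized_hodge W (\<phi> y) Q" and X: "open X" and E: "vec.subspace E" and y: "y \<in> X \<inter> E" and e: "e \<in> E"
    and g: "(g has_derivative D) (at y)" and gG: "\<And>y. y \<in> X \<inter> E \<Longrightarrow> g y \<in> G_C W Q"
    and g\<phi>: "\<And>y. y \<in> X \<inter> E \<Longrightarrow> \<phi> y = filt_act (g y) F"
  shows "D e ** matrix_inv (g y) \<in> glie W Q"
    "tangent_map W Q \<phi> y e = bigraded.epart (mixed_hodge.dg W (\<phi> y)) SQ (D e ** matrix_inv (g y))"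
proof -
  interpret y: polarized_hodge W "\<phi> y" Q by (rule pol)
  define \<gamma> where "\<gamma> t = g (y + t *\<^sub>R e) ** matrix_inv (g y)" for t
  have i: "invertible (g y)" using gG[OF y] by (rule G_C_invertible)
  have "((\<lambda>t. y + t *\<^sub>R e) has_derivative (\<lambda>t. t *\<^sub>R e)) (at 0)" by (auto intro!: derivative_eq_intros)
  then have "((\<lambda>t. g (y + t *\<^sub>R e)) has_derivative (\<lambda>t. D (t *\<^sub>R e))) (at 0)"
    by (rule has_derivative_compose) (simp add: g)
  then have "((\<lambda>t. g (y + t *\<^sub>R e)) has_vector_derivative D e) (at 0)"
    unfolding has_vector_derivative_def using linear_scale[OF has_derivative_linear[OF g]] by simp
  then have d: "(\<gamma> has_vector_derivative D e ** matrix_inv (g y)) (at 0)"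
    unfolding \<gamma>_def using has_vector_derivative_matrix_mult[OF _ has_vector_derivative_const] by force
  have mem: "y + t *\<^sub>R e \<in> E" for t
    using y e by (simp add: scaleR_vec vec.subspace_add[OF E] vec.subspace_scale[OF E])
  have "((\<lambda>t. y + t *\<^sub>R e) \<longlongrightarrow> y + 0 *\<^sub>R e) (nhds 0)" by (intro tendsto_intros filterlim_ident)
  then have "\<forall>\<^sub>F t in nhds 0. y + t *\<^sub>R e \<in> X" using topological_tendstoD[of _ "y + 0 *\<^sub>R e", OF _ X] y by simp
  then have ev: "\<forall>\<^sub>F t in nhds 0. \<gamma> t \<in> G_C W Q \<and> \<phi> (y + t *\<^sub>R e) = filt_act (\<gamma> t) (\<phi> y)"
  proof eventually_elim
    case (elim t)
    have "filt_act (\<gamma> t) (\<phi> y) = filt_act (g (y + t *\<^sub>R e)) F"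
      unfolding \<gamma>_def filt_act_mult g\<phi>[OF y] by (simp add: filt_act_inv[OF i])
    then show ?case using g\<phi>[of "y + t *\<^sub>R e"] gG[of "y + t *\<^sub>R e"] gG[OF y] elim mem
      by (simp add: \<gamma>_def G_C_mult G_C_inv)
  qed
  have \<gamma>0: "\<gamma> 0 = mat 1" by (simp add: \<gamma>_def matrix_inv[OF i])
  show "D e ** matrix_inv (g y) \<in> glie W Q" by (rule y.curve_velocity_eq(1)[OF \<gamma>0 d ev]) simp
  show "tangent_map W Q \<phi> y e = bigraded.epart (mixed_hodge.dg W (\<phi> y)) SQ (D e ** matrix_inv (g y))"
    unfolding tangent_map_def by (rule y.curve_velocity_eq(2)[OF \<gamma>0 d ev]) simp
qed

section \<open>Frames and tangent spaces at different points of a complex line\<close>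

lemma frame_basis:
  fixes \<epsilon> :: "nat \<Rightarrow> complex ^ 'm::finite \<Rightarrow> complex ^ 'm" and T :: "complex ^ 'm \<Rightarrow> complex ^ 'n::finite ^ 'n"
  assumes fr: "holomorphic_frame E U \<epsilon>" and E: "vec.subspace E" and y: "y \<in> U"
    and T: "\<And>e e'. e \<in> E \<Longrightarrow> e' \<in> E \<Longrightarrow> T (e + e') = T e + T e'" "\<And>c e. e \<in> E \<Longrightarrow> T (c *s e) = cscale c (T e)"
    and bij: "bij_betw T E q"
  shows "\<epsilon> j y \<in> E \<or> \<not> j < vec.dim E"
    and "X \<in> q \<Longrightarrow> \<exists>c. X = (\<Sum>j<vec.dim E. cscale (c j) (T (\<epsilon> j y)))"
    and "(\<Sum>j<vec.dim E. cscale (c j) (T (\<epsilon> j y))) = 0 \<Longrightarrow> \<forall>j<vec.dim E. c j = 0"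
proof -
  let ?d = "vec.dim E"
  have inj: "inj_on (\<lambda>j. \<epsilon> j y) {..<?d}" and ind: "vec.independent ((\<lambda>j. \<epsilon> j y) ` {..<?d})"
    and sp: "vec.span ((\<lambda>j. \<epsilon> j y) ` {..<?d}) = E"
    using fr y by (simp_all add: holomorphic_frame_def)
  have mem: "\<epsilon> j y \<in> E" if "j < ?d" for j using vec.span_base[of "\<epsilon> j y" "(\<lambda>j. \<epsilon> j y) ` {..<?d}"] that unfolding sp by simp
  then show "\<epsilon> j y \<in> E \<or> \<not> j < ?d" by blast
  have T0: "T 0 = 0" using T(2)[of 0 0] vec.subspace_0[OF E] by simp
  have sumE: "(\<Sum>j\<in>J. c j *s \<epsilon> j y) \<in> E" if "J \<subseteq> {..<?d}" for J c
    using that mem by (intro vec.subspace_sum[OF E] vec.subspace_scale[OF E]) auto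
  have Tsum: "T (\<Sum>j\<in>J. c j *s \<epsilon> j y) = (\<Sum>j\<in>J. cscale (c j) (T (\<epsilon> j y)))" if "J \<subseteq> {..<?d}" for J c
  proof -
    have "finite J" using that finite_subset by blast
    then show ?thesis using that
    proof (induction J rule: finite_induct)
      case empty then show ?case by (simp add: T0)
    next
      case (insert x J)
      have "T (c x *s \<epsilon> x y + (\<Sum>j\<in>J. c j *s \<epsilon> j y)) = cscale (c x) (T (\<epsilon> x y)) + T (\<Sum>j\<in>J. c j *s \<epsilon> j y)"
        using insert.prems mem sumE[of J c] by (subst T(1)) (auto intro: vec.subspace_scale[OF E] simp: T(2))
      then show ?case using insert by simp
    qed
  qed
  show "\<exists>c. X = (\<Sum>j<?d. cscale (c j) (T (\<epsilon> j y)))" if "X \<in> q"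
  proof -
    obtain e where e: "e \<in> E" "X = T e" using \<open>X \<in> q\<close> bij by (auto simp: bij_betw_def)
    then have "e \<in> vec.span ((\<lambda>j. \<epsilon> j y) ` {..<?d})" using sp by simp
    then obtain c where "e = (\<Sum>b\<in>(\<lambda>j. \<epsilon> j y) ` {..<?d}. c b *s b)" by (auto simp: vec.span_finite)
    then have "e = (\<Sum>j<?d. c (\<epsilon> j y) *s \<epsilon> j y)" using inj by (simp add: sum.reindex)
    then show ?thesis using e Tsum[of "{..<?d}" "\<lambda>j. c (\<epsilon> j y)"] by auto
  qed
  show "\<forall>j<?d. c j = 0" if s: "(\<Sum>j<?d. cscale (c j) (T (\<epsilon> j y))) = 0"
  proof -
    have "T (\<Sum>j<?d. c j *s \<epsilon> j y) = T 0" using s by (simp add: T0 Tsum)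
    then have e: "(\<Sum>j<?d. c j *s \<epsilon> j y) = 0"
      using bij sumE[of "{..<?d}" c] vec.subspace_0[OF E] by (auto simp: bij_betw_def inj_on_def)
    define c' where "c' b = c (the_inv_into {..<?d} (\<lambda>j. \<epsilon> j y) b)" for b
    have 0: "(\<Sum>b\<in>(\<lambda>j. \<epsilon> j y) ` {..<?d}. c' b *s b) = 0"
      unfolding e[symmetric] sum.reindex[OF inj] o_def
      by (intro sum.cong refl) (simp add: c'_def the_inv_into_f_f[OF inj])
    have "c' b = 0" if "b \<in> (\<lambda>j. \<epsilon> j y) ` {..<?d}" for b
      by (rule vec.independentD[OF ind _ _ 0 that]) auto
    then have "c' (\<epsilon> j y) = 0" if "j < ?d" for j using that by blast
    then show ?thesis by (simp add: c'_def the_inv_into_f_f[OF inj])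
  qed
qed

text \<open>An arbitrary group element carries \<open>F\<close> and its isotropy algebra to the
  translate, but need not carry the complement \<open>q_alg\<close>. Tangent vectors are therefore
  moved by \<open>Ad G\<close> followed by the projection \<open>epart SQ\<close> at the new
  point.\<close>

locale hodge_translate = polarized_hodge W F Q + t: polarized_hodge W "filt_act G F" Q
  for W :: "'n::finite weight" and F :: "'n filt" and Q :: "'n forms" and G +
  assumes G: "G \<in> G_C W Q"
begin

lemma Ad_EE_SF: "G ** X ** matrix_inv G \<in> t.dg.EE SF \<longleftrightarrow> X \<in> dg.EE SF"
proof -
  note i = G_C_invertible[OF G]
  have "(\<forall>p. \<forall>v\<in>filt_act G F p. (G ** X ** matrix_inv G) *v v \<in> filt_act G F p) \<longleftrightarrow> (\<forall>p. \<forall>v\<in>F p. X *v v \<in> F p)"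
    by (simp add: filt_act_def matrix_vector_mul_assoc[symmetric] matrix_inv_cancel[OF i] mem_image_matrix[OF i])
  then show ?thesis by (simp add: pres_F_iff t.pres_F_iff)
qed

lemma epart_Ad_epart: "t.dg.epart SQ (G ** dg.epart SQ X ** matrix_inv G) = t.dg.epart SQ (G ** X ** matrix_inv G)"
proof -
  have "G ** (X - dg.epart SQ X) ** matrix_inv G \<in> t.dg.EE SF" by (simp add: Ad_EE_SF SQ_compl)
  then have "t.dg.epart SQ (G ** (X - dg.epart SQ X) ** matrix_inv G) = 0"
    by (rule t.dg.epart_disjoint) (auto simp: S_defs)
  then show ?thesis by (simp add: matrix_diff_distrib t.dg.epart_diff)
qed

lemma epart_Ad_mem: "X \<in> \<gg> \<Longrightarrow> t.dg.epart SQ (G ** X ** matrix_inv G) \<in> q_alg W Q (filt_act G F)"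
  by (simp add: t.q_alg_eq t.glie_epart glie_Ad G)

lemma epart_Ad_eq_0:
  assumes X: "X \<in> dg.EE SQ" and 0: "t.dg.epart SQ (G ** X ** matrix_inv G) = 0" shows "X = 0"
proof -
  have "G ** X ** matrix_inv G \<in> t.dg.EE SF" using t.SQ_compl[of "G ** X ** matrix_inv G"] 0 by simp
  then have "dg.epart SQ X = 0" unfolding Ad_EE_SF by (rule dg.epart_disjoint) (auto simp: S_defs)
  then show ?thesis using dg.epart_id[OF X] by simp
qed

end

lemma holomorphic_on_line:
  fixes f :: "complex ^ 'm::finite \<Rightarrow> complex"
  assumes f: "holo_on E U f" and a: "a \<in> E" and line: "\<And>s. s \<in> ball 0 r \<Longrightarrow> z + s *s a \<in> U"
  shows "(\<lambda>s. f (z + s *s a)) holomorphic_on ball 0 r"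
proof (rule holomorphic_onI)
  fix s :: complex assume s: "s \<in> ball 0 r"
  obtain l where l: "(f has_derivative l) (at (z + s *s a) within U)" "l (\<i> *s a) = \<i> * l a"
    using f line[OF s] a unfolding holo_on_def by metis
  have sm: "bounded_linear (\<lambda>c. c *s a)"
    by (intro linear_conv_bounded_linear[THEN iffD1] linearI) (simp_all add: vec_eq_iff algebra_simps)
  have "((\<lambda>s. z + s *s a) has_derivative (\<lambda>\<tau>. \<tau> *s a)) (at s within ball 0 r)"
    by (auto intro!: derivative_eq_intros bounded_linear.has_derivative[OF sm])
  then have "((\<lambda>s. f (z + s *s a)) has_derivative (\<lambda>\<tau>. l (\<tau> *s a))) (at s within ball 0 r)"
    by (rule has_derivative_in_compose) (rule has_derivative_subset[OF l(1)], use line in auto)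
  moreover have "l (\<tau> *s a) = l a * \<tau>" for \<tau>
  proof -
    note li = has_derivative_linear[OF l(1)]
    have "l (\<tau> *s a) = l (Re \<tau> *\<^sub>R a + Im \<tau> *\<^sub>R (\<i> *s a))"
      by (rule arg_cong[of _ _ l]) (simp add: vec_eq_iff complex_eq_iff)
    also have "\<dots> = l a * \<tau>" by (simp add: linear_add[OF li] linear_scale[OF li] l(2) complex_eq_iff)
    finally show ?thesis .
  qed
  ultimately have "((\<lambda>s. f (z + s *s a)) has_field_derivative l a) (at s within ball 0 r)"
    by (simp add: has_field_derivative_def)
  then show "(\<lambda>s. f (z + s *s a)) field_differentiable at s within ball 0 r"
    by (auto simp: field_differentiable_def)
qed

text \<open>The Cayley transform doubles directions at 0, so the parameter \<open>- (s / 2)\<close>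
  gives velocity \<open>- Y\<close>.\<close>

lemma wd_cay_line:
  assumes "P = (\<lambda>s. cay (cscale (- (s / 2)) Y))" shows "wd P 0 (- Y) 0"
proof -
  have b: "bounded_linear (\<lambda>s. cscale (- (s / 2)) Y)"
    by (intro linear_conv_bounded_linear[THEN iffD1] linearI) (simp_all add: vec_eq_iff complex_eq_iff field_simps)
  have "(P has_derivative (\<lambda>s. cayD (cscale (- (0 / 2)) Y) (cscale (- (s / 2)) Y))) (at 0)"
    unfolding assms by (rule has_derivative_compose[OF bounded_linear_imp_has_derivative[OF b]])
      (simp add: cay_has_derivative)
  then show ?thesis unfolding wd_def by (rule has_derivative_eq_rhs) (simp add: fun_eq_iff cayD_0 vec_eq_iff scaleR_conv_of_real)
qed

lemma mholo_cay_line: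
  assumes "\<And>s. s \<in> A \<Longrightarrow> regular (cscale (- (s / 2)) Y)"
  shows "mholo (\<lambda>s. cay (cscale (- (s / 2)) Y)) A"
  unfolding cay_def using assms
  by (intro mholo_mult mholo_inv mholo_diff mholo_add mholo_const mholo_cscale holomorphic_intros) (auto simp: regular_def)

lemma eventually_regular: "\<exists>r>0. \<forall>s\<in>ball 0 r. regular (cscale (- (s / 2)) Y)" for Y :: "complex ^ 'n::finite ^ 'n"
proof -
  have b: "bounded_linear (\<lambda>s. cscale (- (s / 2)) Y)"
    by (intro linear_conv_bounded_linear[THEN iffD1] linearI) (simp_all add: vec_eq_iff complex_eq_iff field_simps)
  have "open ((\<lambda>s. cscale (- (s / 2)) Y) -` {X. regular X})"
    by (intro open_vimage open_regular linear_continuous_on b)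
  moreover have "0 \<in> (\<lambda>s. cscale (- (s / 2)) Y) -` {X. regular X}" by simp
  ultimately have "\<exists>r>0. ball 0 r \<subseteq> (\<lambda>s. cscale (- (s / 2)) Y) -` {X. regular X}" unfolding open_contains_ball by blast
  then show ?thesis by blast
qed

text \<open>The frame directions vary along the line, so their images under \<open>L\<close> are
  later expanded over the axes; finitely many axes admit a common radius.\<close>

lemma line_deriv_mholo_axes:
  fixes g :: "complex ^ 'm::finite \<Rightarrow> complex ^ 'n::finite ^ 'n" and L :: "complex ^ 'm \<Rightarrow> complex ^ 'm \<Rightarrow> complex ^ 'n ^ 'n"
  assumes "open U" "z \<in> U"
    and "\<And>y. y \<in> U \<Longrightarrow> (g has_derivative L y) (at y)"
    and "\<And>y c a. y \<in> U \<Longrightarrow> L y (c *s a) = cscale c (L y a)"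
  obtains R where "0 < R" "\<And>s. s \<in> ball 0 R \<Longrightarrow> z + s *s a \<in> U" "mholo (\<lambda>s. g (z + s *s a)) (ball 0 R)"
    "\<And>k. mholo (\<lambda>s. L (z + s *s a) (axis k 1)) (ball 0 R)"
proof -
  have "\<exists>R>0. (\<forall>s\<in>ball 0 R. z + s *s a \<in> U) \<and> mholo (\<lambda>s. g (z + s *s a)) (ball 0 R) \<and>
    mholo (\<lambda>s. L (z + s *s a) (axis k 1)) (ball 0 R)" for k
    by (rule line_deriv_mholo[OF assms, of a "axis k 1"]) blast+
  then obtain R where R: "\<And>k. 0 < R k" "\<And>k s. s \<in> ball 0 (R k) \<Longrightarrow> z + s *s a \<in> U"
    "\<And>k. mholo (\<lambda>s. g (z + s *s a)) (ball 0 (R k))" "\<And>k. mholo (\<lambda>s. L (z + s *s a) (axis k 1)) (ball 0 (R k))"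
    by metis
  define R0 where "R0 = Min (range R)"
  have R0: "0 < R0" "\<And>k. R0 \<le> R k" using R(1) by (auto simp: R0_def)
  then have sub: "ball 0 R0 \<subseteq> (ball 0 (R k) :: complex set)" for k by (meson subset_ball)
  have mono: "mholo f A" if "mholo f B" "A \<subseteq> B" for A B and f :: "complex \<Rightarrow> complex ^ 'n ^ 'n"
    using that holomorphic_on_subset unfolding mholo_def by blast
  show thesis
  proof (rule that[OF R0(1)])
    show "z + s *s a \<in> U" if "s \<in> ball 0 R0" for s using R(2)[of s undefined] sub that by blast
    show "mholo (\<lambda>s. g (z + s *s a)) (ball 0 R0)" using mono[OF R(3) sub] .
    show "mholo (\<lambda>s. L (z + s *s a) (axis k 1)) (ball 0 R0)" for k using mono[OF R(4) sub] .
  qed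
qed

lemma clinear_vec_expand:
  fixes D :: "complex ^ 'm::finite \<Rightarrow> complex ^ 'n::finite ^ 'n"
  assumes "linear D" "\<And>c a. D (c *s a) = cscale c (D a)"
  shows "D v = (\<Sum>k\<in>UNIV. cscale (v $ k) (D (axis k 1)))"
proof -
  have "D v = D (\<Sum>k\<in>UNIV. v $ k *s axis k 1)" by (simp add: basis_expansion)
  also have "\<dots> = (\<Sum>k\<in>UNIV. cscale (v $ k) (D (axis k 1)))" by (simp add: linear_sum[OF assms(1)] assms(2))
  finally show ?thesis .
qed

context polarized_hodge begin

text \<open>The lift \<open>g\<close> of the chart has derivative \<open>u\<close> only up to an
  element \<open>p0\<close> of the isotropy algebra. Right multiplication by the Cayley curve
  \<open>P\<close> in the isotropy group removes \<open>p0\<close> without changing the points of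
  the line.\<close>

theorem chart_line:
  fixes \<phi> :: "complex ^ 'm::finite \<Rightarrow> int \<Rightarrow> (complex ^ 'a) set"
  assumes chart: "holomorphic_chart W Q h E U \<phi>" and z: "z \<in> U" "\<phi> z = F"
    and u: "u \<in> \<gg>" "u \<in> dg.EE SQ" and a: "a \<in> E" "tangent_map W Q \<phi> z a = u"
    and fr: "holomorphic_frame E U \<epsilon>"
  obtains G G1 r S S1 where "hodge_line W F Q G G1 r u"
    "\<And>s. s \<in> ball 0 r \<Longrightarrow> z + s *s a \<in> U"
    "\<And>s. s \<in> ball 0 r \<Longrightarrow> \<phi> (z + s *s a) = filt_act (G s) F"
    "\<And>j s. j < vec.dim E \<Longrightarrow> s \<in> ball 0 r \<Longrightarrow> wd (S j) s (S1 j s) 0"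
    "\<And>j. j < vec.dim E \<Longrightarrow> \<exists>C. wd (S1 j) 0 C 0"
    "\<And>j s. j < vec.dim E \<Longrightarrow> s \<in> ball 0 r \<Longrightarrow> S j s \<in> \<gg> \<inter> dg.EE SQ"
    "\<And>j s. j < vec.dim E \<Longrightarrow> s \<in> ball 0 r \<Longrightarrow> frame_vector W Q \<phi> \<epsilon> (z + s *s a) j =
       bigraded.epart (mixed_hodge.dg W (filt_act (G s) F)) SQ (G s ** S j s ** matrix_inv (G s))"
    "\<And>s e e'. s \<in> ball 0 r \<Longrightarrow> e \<in> E \<Longrightarrow> e' \<in> E \<Longrightarrow> tangent_map W Q \<phi> (z + s *s a) (e + e') =
       tangent_map W Q \<phi> (z + s *s a) e + tangent_map W Q \<phi> (z + s *s a) e'"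
    "\<And>s c e. s \<in> ball 0 r \<Longrightarrow> e \<in> E \<Longrightarrow> tangent_map W Q \<phi> (z + s *s a) (c *s e) = cscale c (tangent_map W Q \<phi> (z + s *s a) e)"
proof -
  have E: "vec.subspace E" and UE: "U \<subseteq> E" using chart openin_imp_subset by (auto simp: holomorphic_chart_def)
  obtain X g L where X: "open X" "z \<in> X" "X \<inter> E \<subseteq> U" and gz: "g z = mat 1"
    and L: "\<And>y. y \<in> X \<Longrightarrow> (g has_derivative L y) (at y)" "\<And>y c a. y \<in> X \<Longrightarrow> L y (c *s a) = cscale c (L y a)"
    and gG: "\<And>y. y \<in> X \<inter> E \<Longrightarrow> g y \<in> G_C W Q" and g\<phi>: "\<And>y. y \<in> X \<inter> E \<Longrightarrow> \<phi> y = filt_act (g y) F"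
    by (rule chart_lift[OF chart z(1)]) (use z(2) in blast)
  note Ladd = linear_add[OF has_derivative_linear[OF L(1)]]
  have pol': "polarized_hodge W (\<phi> y) Q" if "y \<in> U" for y
  proof (rule polarized_hodgeI)
    show "weight_filtration W" "graded_forms W Q" by (fact weight forms)+
    show "\<phi> y \<in> classifying_space W Q h" using chart that by (auto simp: holomorphic_chart_def)
  qed
  have tm_g: "L y e ** matrix_inv (g y) \<in> \<gg>"
    and tm_eq: "tangent_map W Q \<phi> y e = bigraded.epart (mixed_hodge.dg W (\<phi> y)) SQ (L y e ** matrix_inv (g y))"
    if "y \<in> X \<inter> E" "e \<in> E" for y e
    using tangent_map_eq[OF pol'[of y] X(1) E that L(1)[of y] gG g\<phi>] that X(3) by blast+
  have zE: "z \<in> X \<inter> E" using X(2) z(1) UE by blast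
  define p0 where "p0 = L z a - u"
  have Lz: "L z a \<in> \<gg>" "u = dg.epart SQ (L z a)"
    using tm_g[OF zE a(1)] tm_eq[OF zE a(1)] a(2) by (simp_all add: gz matrix_inv_unique z(2))
  have p0: "p0 \<in> \<gg>" "p0 \<in> dg.EE SF"
    using csub_diff[OF csub_glie Lz(1) u(1)] SQ_compl[of "L z a"] Lz(2) by (simp_all add: p0_def)
  define P where "P = (\<lambda>s. cay (cscale (- (s / 2)) p0))"
  obtain r1 where r1: "0 < r1" "\<And>s. s \<in> ball 0 r1 \<Longrightarrow> z + s *s a \<in> X" "mholo (\<lambda>s. g (z + s *s a)) (ball 0 r1)"
    "\<And>k. mholo (\<lambda>s. L (z + s *s a) (axis k 1)) (ball 0 r1)"
  proof (rule line_deriv_mholo_axes[of X z g L a])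
    show "open X" "z \<in> X" by fact+
  qed (use L that in auto)
  obtain r2 where r2: "0 < r2" "\<And>s. s \<in> ball 0 r2 \<Longrightarrow> regular (cscale (- (s / 2)) p0)"
    using eventually_regular[of p0] by blast
  define r where "r = min r1 r2"
  have r: "0 < r" using r1(1) r2(1) by (simp add: r_def)
  have sub: "ball 0 r \<subseteq> (ball 0 r1 :: complex set)" "s \<in> ball 0 r \<Longrightarrow> s \<in> ball 0 r2" for s :: complex by (auto simp: r_def)
  have mono: "mholo f (ball 0 r)" if "mholo f (ball 0 r1)" for f :: "complex \<Rightarrow> complex ^ 'a ^ 'a"
    using that sub(1) holomorphic_on_subset unfolding mholo_def by blast
  have yX: "z + s *s a \<in> X \<inter> E" if "s \<in> ball 0 r" for s
    using r1(2)[of s] that sub(1) zE a(1) by (auto intro: vec.subspace_add[OF E] vec.subspace_scale[OF E])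
  then have yU: "z + s *s a \<in> U" if "s \<in> ball 0 r" for s using X(3) that by blast
  have Piso: "P s \<in> isotropy W Q F" if "s \<in> ball 0 r" for s
    unfolding P_def using p0 r2(2)[OF sub(2)[OF that]]
    by (intro cay_isotropy csub_scale[OF csub_glie] csub_scale[OF dg.csub_EE])
  define G where "G s = g (z + s *s a) ** P s" for s
  have GG: "G s \<in> G_C W Q" if "s \<in> ball 0 r" for s
    unfolding G_def using gG[OF yX[OF that]] Piso[OF that] by (simp add: G_C_mult isotropy_def)
  have GF: "\<phi> (z + s *s a) = filt_act (G s) F" if "s \<in> ball 0 r" for s
    unfolding G_def filt_act_mult using g\<phi>[OF yX[OF that]] Piso[OF that] by (simp add: isotropy_def)
  have Gi: "invertible (G s)" if "s \<in> ball 0 r" for s by (rule G_C_invertible[OF GG[OF that]])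
  have Gh: "mholo G (ball 0 r)" unfolding G_def P_def
    by (intro mholo_mult mono r1 mholo_cay_line r2(2) sub(2))
  have wdG: "wd G s (mderiv G s) 0" if "s \<in> ball 0 r" for s by (rule wd_mholo[OF open_ball that Gh])
  have G0: "G 0 = mat 1" by (simp add: G_def P_def gz)
  have G10: "mderiv G 0 = u"
  proof -
    have sm: "bounded_linear (\<lambda>c. c *s a)"
      by (intro linear_conv_bounded_linear[THEN iffD1] linearI) (simp_all add: vec_eq_iff algebra_simps)
    have "((\<lambda>s. z + s *s a) has_derivative (\<lambda>\<tau>. \<tau> *s a)) (at 0)"
      by (auto intro!: derivative_eq_intros bounded_linear.has_derivative[OF sm])
    then have "((\<lambda>s. g (z + s *s a)) has_derivative (\<lambda>\<tau>. L z (\<tau> *s a))) (at 0)"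
      by (rule has_derivative_compose) (simp add: L(1)[OF X(2)])
    then have "wd (\<lambda>s. g (z + s *s a)) 0 (L z a) 0" unfolding wd_def by (simp add: L(2)[OF X(2)])
    from wd_mult[OF this wd_cay_line[OF P_def]] have "wd G 0 (- p0 + L z a) 0"
      unfolding G_def by (simp add: gz P_def)
    from wd_unique(1)[OF wdG this] r show ?thesis by (simp add: p0_def)
  qed
  \<comment> \<open>\<open>Z j s\<close> represents the frame vector at the moved point; pulling it
    back by \<open>G s\<close> and projecting at the fixed point \<open>F\<close> keeps holomorphy,
    which a projection at the moving point would not obviously do.\<close>
  define Z where "Z j s = L (z + s *s a) (\<epsilon> j (z + s *s a)) ** matrix_inv (g (z + s *s a))" for j s
  define S where "S j s = dg.epart SQ (matrix_inv (G s) ** Z j s ** G s)" for j s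
  have \<epsilon>E: "\<epsilon> j y \<in> E" if "j < vec.dim E" "y \<in> U" for j y
    using fr that vec.span_base[of "\<epsilon> j y" "(\<lambda>j. \<epsilon> j y) ` {..<vec.dim E}"] by (auto simp: holomorphic_frame_def)
  have Sh: "mholo (S j) (ball 0 r)" if j: "j < vec.dim E" for j
  proof -
    have D: "mholo (\<lambda>s. \<Sum>k\<in>UNIV. cscale (\<epsilon> j (z + s *s a) $ k) (L (z + s *s a) (axis k 1))) (ball 0 r)"
      by (intro mholo_sum mholo_cscale mono r1 holomorphic_on_line[of E U])
        (use fr j a yU in \<open>auto simp: holomorphic_frame_def\<close>)
    have "mholo (\<lambda>s. L (z + s *s a) (\<epsilon> j (z + s *s a))) (ball 0 r)"
      unfolding mholo_def
    proof (intro allI)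
      fix i k
      show "(\<lambda>s. L (z + s *s a) (\<epsilon> j (z + s *s a)) $ i $ k) holomorphic_on ball 0 r"
        by (rule holomorphic_transform[OF D[unfolded mholo_def, rule_format, of i k]])
          (use yX clinear_vec_expand[OF has_derivative_linear[OF L(1)] L(2)] in simp)
    qed
    moreover have "mholo (\<lambda>s. matrix_inv (g (z + s *s a))) (ball 0 r)"
      by (rule mholo_inv[OF mono[OF r1(3)]]) (use gG[OF yX] G_C_invertible in blast)
    ultimately have "mholo (Z j) (ball 0 r)" unfolding Z_def by (rule mholo_mult)
    then show ?thesis unfolding S_def by (intro dg.mholo_epart mholo_mult mholo_inv Gh Gi)
  qed
  have Zg: "Z j s \<in> \<gg>" if "j < vec.dim E" "s \<in> ball 0 r" for j s
    unfolding Z_def using that by (intro tm_g yX \<epsilon>E yU)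
  show thesis
  proof (rule that[of G "mderiv G" r S "\<lambda>j. mderiv (S j)"])
    show "hodge_line W F Q G (mderiv G) r u"
    proof (intro hodge_line.intro hodge_line_axioms.intro)
      show "polarized_hodge W F Q" by unfold_locales
      show "polarized_hodge W (filt_act (G s) F) Q" if "s \<in> ball 0 r" for s
        using pol'[OF yU[OF that]] GF[OF that] by simp
      show "\<exists>C. wd (mderiv G) s C 0" if "s \<in> ball 0 r" for s
        using wd_mholo[OF open_ball that mholo_mderiv[OF open_ball Gh]] by blast
    qed (use r G0 GG wdG G10 u in auto)
    show "z + s *s a \<in> U" "\<phi> (z + s *s a) = filt_act (G s) F" if "s \<in> ball 0 r" for s
      using yU[OF that] GF[OF that] by blast+
    show "wd (S j) s (mderiv (S j) s) 0" if "j < vec.dim E" "s \<in> ball 0 r" for j s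
      by (rule wd_mholo[OF open_ball that(2) Sh[OF that(1)]])
    show "\<exists>C. wd (mderiv (S j)) 0 C 0" if "j < vec.dim E" for j
      using wd_mholo[OF open_ball _ mholo_mderiv[OF open_ball Sh[OF that]], of 0] r by auto
    show "S j s \<in> \<gg> \<inter> dg.EE SQ" if "j < vec.dim E" "s \<in> ball 0 r" for j s
      using glie_Ad[OF G_C_inv[OF GG[OF that(2)]] Zg[OF that]]
      by (simp add: S_def glie_epart invertible_inv[OF Gi[OF that(2)]])
    show "frame_vector W Q \<phi> \<epsilon> (z + s *s a) j =
       bigraded.epart (mixed_hodge.dg W (filt_act (G s) F)) SQ (G s ** S j s ** matrix_inv (G s))"
      if "j < vec.dim E" "s \<in> ball 0 r" for j s
    proof -
      interpret t: polarized_hodge W "filt_act (G s) F" Q using pol'[OF yU[OF that(2)]] GF[OF that(2)] by simp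
      interpret tr: hodge_translate W F Q "G s" by unfold_locales (rule GG[OF that(2)])
      have "t.dg.epart SQ (G s ** S j s ** matrix_inv (G s)) = t.dg.epart SQ (Z j s)"
        unfolding S_def tr.epart_Ad_epart by (simp add: matrix_mul_assoc matrix_inv[OF Gi[OF that(2)]] matrix_inv_cancel[OF Gi[OF that(2)]])
      then show ?thesis unfolding frame_vector_def Z_def
        using tm_eq[OF yX[OF that(2)] \<epsilon>E[OF that(1) yU[OF that(2)]]] GF[OF that(2)] by simp
    qed
    fix s c :: complex and e e' assume s: "s \<in> ball 0 r" and e: "e \<in> E"
    interpret y: polarized_hodge W "\<phi> (z + s *s a)" Q by (rule pol'[OF yU[OF s]])
    note y = yX[OF s]
    have "L (z + s *s a) (e + e') = L (z + s *s a) e + L (z + s *s a) e'" using Ladd y by blast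
    then show "tangent_map W Q \<phi> (z + s *s a) (e + e') =
       tangent_map W Q \<phi> (z + s *s a) e + tangent_map W Q \<phi> (z + s *s a) e'" if "e' \<in> E"
      using tm_eq[OF y e] tm_eq[OF y that] tm_eq[OF y vec.subspace_add[OF E e that]]
      by (simp add: matrix_add_rdistrib' y.dg.epart_add)
    show "tangent_map W Q \<phi> (z + s *s a) (c *s e) = cscale c (tangent_map W Q \<phi> (z + s *s a) e)"
      using tm_eq[OF y e] tm_eq[OF y vec.subspace_scale[OF E e]] L(2)[of "z + s *s a" c e] y
      by (simp add: cscale_mult y.dg.epart_cscale)
  qed
qed

end

lemma clinear_sum:
  assumes T: "clinear T" and J: "finite J"
  shows "T (\<Sum>j\<in>J. cscale (c j) (X j)) = (\<Sum>j\<in>J. cscale (c j) (T (X j)))"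
  using J
proof (induction J rule: finite_induct)
  case empty
  have "T (cscale 0 0) = cscale 0 (T 0)" using T unfolding clinear_def by blast
  then show ?case by simp
next
  case (insert x J) then show ?case using T by (auto simp: clinear_def)
qed

context hodge_translate begin

lemma clinear_epart_Ad: "clinear (\<lambda>X. t.dg.epart SQ (G ** X ** matrix_inv G))"
  by (simp add: clinear_def matrix_add_ldistrib matrix_add_rdistrib' t.dg.epart_add t.dg.epart_cscale cscale_mult)

text \<open>Moving tangent vectors from \<open>F\<close> to the translate is complex linear and
  injective on \<open>q_alg\<close>, and it sends the \<open>S j\<close> to a basis; so they form a
  basis already at \<open>F\<close>.\<close>

lemma transported_basis:
  assumes S: "\<And>j. j < d \<Longrightarrow> S j \<in> \<gg> \<inter> dg.EE SQ"
    and span: "\<And>X. X \<in> q_alg W Q (filt_act G F) \<Longrightarrow> \<exists>c. X = (\<Sum>j<d. cscale (c j) (t.dg.epart SQ (G ** S j ** matrix_inv G)))"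
    and ind: "\<And>c. (\<Sum>j<d. cscale (c j) (t.dg.epart SQ (G ** S j ** matrix_inv G))) = 0 \<Longrightarrow> \<forall>j<d. c j = 0"
  shows "h.indep d S" and "X \<in> \<gg> \<inter> dg.EE SQ \<Longrightarrow> \<exists>c. X = (\<Sum>j<d. cscale (c j) (S j))"
proof -
  note lin = clinear_sum[OF clinear_epart_Ad finite_lessThan, of _ S d]
  show "h.indep d S" unfolding h.indep_def
  proof (intro allI impI)
    fix c j assume 0: "(\<Sum>i<d. cscale (c i) (S i)) = 0" and j: "j < d"
    have "(\<Sum>j<d. cscale (c j) (t.dg.epart SQ (G ** S j ** matrix_inv G))) = 0"
      unfolding lin[symmetric] 0 by simp
    then show "c j = 0" using ind j by blast
  qed
  assume X: "X \<in> \<gg> \<inter> dg.EE SQ"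
  then obtain c where c: "t.dg.epart SQ (G ** X ** matrix_inv G) = (\<Sum>j<d. cscale (c j) (t.dg.epart SQ (G ** S j ** matrix_inv G)))"
    using span[OF epart_Ad_mem] by blast
  define Y where "Y = X - (\<Sum>j<d. cscale (c j) (S j))"
  have "Y \<in> \<gg> \<inter> dg.EE SQ"
    unfolding Y_def using X S by (intro csub_diff[OF csub_Int] csub_sum[OF csub_Int] csub_scale[OF csub_Int]) auto
  moreover have "t.dg.epart SQ (G ** Y ** matrix_inv G) = 0"
    using c unfolding lin[symmetric] by (simp add: Y_def matrix_diff_distrib t.dg.epart_diff)
  ultimately have "Y = 0" using epart_Ad_eq_0 by blast
  then show "\<exists>c. X = (\<Sum>j<d. cscale (c j) (S j))" by (auto simp: Y_def)
qed

end

section \<open>The curvature in an arbitrary chart and frame\<close>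

context polarized_hodge begin

definition curv :: "complex ^ 'a ^ 'a \<Rightarrow> complex ^ 'a ^ 'a \<Rightarrow> complex ^ 'a ^ 'a" where
  "curv u v = (let ub = cnj_mat u; adj = mh_adjoint W Q F; pl = plus_part W Q F
     in - op_comm (q_op W Q F (ad (adj (pl ub)))) (q_op W Q F (ad (pl ub))) v
        - ad (zero_part W Q F (ad u ub)) v
        - q_op W Q F (ad (pl (ad u ub) + adj (pl (ad u ub)))) v)"

text \<open>The curvature is obtained on the frame vectors at the base point; linearity extends the
  formula to all of \<open>q_alg\<close>.\<close>

lemma clinear_curv: "clinear (curv u)"
proof -
  have ad_c: "ad A (cscale c X) = cscale c (ad A X)" for A c and X :: "complex ^ 'a ^ 'a"
    by (simp add: ad_def cscale_mult cscale_distrib)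
  have q: "clinear (q_op W Q F (ad A))" for A
    unfolding clinear_def q_op_def orth_proj_eq q_alg_eq
    by (simp add: ad_simps ad_c h.hproj_add h.hproj_cscale csub_Int)
  have "clinear (op_comm (q_op W Q F (ad A)) (q_op W Q F (ad B)))" for A B
    using q[of A] q[of B] by (simp add: clinear_def op_comm_def cscale_distrib)
  then show ?thesis using q
    by (simp add: clinear_def curv_def Let_def ad_simps ad_c cscale_distrib)
qed

text \<open>Both tangent arguments are \<open>u\<close>, with coordinate vector \<open>a\<close>.
  Connection and curvature are therefore derivatives along the line \<open>z + s *s a\<close>, where
  \<open>line_curvature\<close> describes the Gram matrix.\<close>

theorem chern_curvature_eq:
  fixes \<phi> :: "complex ^ 'm::finite \<Rightarrow> int \<Rightarrow> (complex ^ 'a) set"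
  assumes chart: "holomorphic_chart W Q h E U \<phi>" and z: "z \<in> U" "\<phi> z = F"
    and fr: "holomorphic_frame E U \<epsilon>"
    and u: "u \<in> q_alg W Q F" and v: "v \<in> q_alg W Q F"
  shows "chern_curvature W Q E \<phi> \<epsilon> z u u v = curv u v"
proof -
  define d where "d = vec.dim E"
  define a where "a = the_inv_into E (tangent_map W Q \<phi> z) u"
  have E: "vec.subspace E" using chart by (simp add: holomorphic_chart_def)
  have bij: "bij_betw (tangent_map W Q \<phi> y) E (q_alg W Q (\<phi> y))" if "y \<in> U" for y
    using chart that by (simp add: holomorphic_chart_def)
  have aE: "a \<in> E" and au: "tangent_map W Q \<phi> z a = u"
    using bij[OF z(1)] u z(2) unfolding a_def bij_betw_def
    by (auto intro: the_inv_into_into f_the_inv_into_f)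
  obtain G G1 r S S1 where hl: "hodge_line W F Q G G1 r u"
    and yU: "\<And>s. s \<in> ball 0 r \<Longrightarrow> z + s *s a \<in> U"
    and \<phi>G: "\<And>s. s \<in> ball 0 r \<Longrightarrow> \<phi> (z + s *s a) = filt_act (G s) F"
    and S: "\<And>j s. j < d \<Longrightarrow> s \<in> ball 0 r \<Longrightarrow> wd (S j) s (S1 j s) 0"
    and S1: "\<And>j. j < d \<Longrightarrow> \<exists>C. wd (S1 j) 0 C 0"
    and Sq: "\<And>j s. j < d \<Longrightarrow> s \<in> ball 0 r \<Longrightarrow> S j s \<in> \<gg> \<inter> dg.EE SQ"
    and frame: "\<And>j s. j < d \<Longrightarrow> s \<in> ball 0 r \<Longrightarrow> frame_vector W Q \<phi> \<epsilon> (z + s *s a) j =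
       bigraded.epart (mixed_hodge.dg W (filt_act (G s) F)) SQ (G s ** S j s ** matrix_inv (G s))"
    and T: "\<And>s e e'. s \<in> ball 0 r \<Longrightarrow> e \<in> E \<Longrightarrow> e' \<in> E \<Longrightarrow> tangent_map W Q \<phi> (z + s *s a) (e + e') =
       tangent_map W Q \<phi> (z + s *s a) e + tangent_map W Q \<phi> (z + s *s a) e'"
    "\<And>s c e. s \<in> ball 0 r \<Longrightarrow> e \<in> E \<Longrightarrow> tangent_map W Q \<phi> (z + s *s a) (c *s e) = cscale c (tangent_map W Q \<phi> (z + s *s a) e)"
  proof (rule chart_line[OF chart z _ _ aE au fr])
    show "u \<in> \<gg>" "u \<in> dg.EE SQ" using u by (auto simp: q_alg_eq)
  qed (rule that, unfold d_def)
  interpret hodge_line W F Q G G1 r u by (rule hl)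
  obtain e A w where e: "0 < e" "e \<le> r"
    and metric: "\<And>s X Y. s \<in> ball 0 e \<Longrightarrow> mh_metric_End W Q (filt_act (G s) F)
      (bigraded.epart (mixed_hodge.dg W (filt_act (G s) F)) SQ (G s ** X ** matrix_inv (G s)))
      (bigraded.epart (mixed_hodge.dg W (filt_act (G s) F)) SQ (G s ** Y ** matrix_inv (G s)))
      = h.hE (A s X) (A s Y)"
    and A: "\<And>s. s \<in> ball 0 e \<Longrightarrow> clinear (A s)"
    and inj: "\<And>s X. s \<in> ball 0 e \<Longrightarrow> X \<in> \<gg> \<inter> dg.EE SQ \<Longrightarrow> A s X = 0 \<Longrightarrow> X = 0"
    and dgram: "\<And>s i j. s \<in> ball 0 e \<Longrightarrow> i < d \<Longrightarrow> j < d \<Longrightarrow>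
       \<exists>c'. cwd (\<lambda>x. h.hE (A x (S j x)) (A x (S i x))) s (h.hE (A s (w j s)) (A s (S i s))) c'"
    and wq: "\<And>s j. s \<in> ball 0 e \<Longrightarrow> j < d \<Longrightarrow> w j s \<in> \<gg> \<inter> dg.EE SQ"
    and w: "\<And>j. j < d \<Longrightarrow> \<exists>C. wd (w j) 0 C (- curv u (S j 0))"
  proof (rule line_curvature[of d S S1, folded curv_def])
    show "wd (S j) s (S1 j s) 0" "S j s \<in> \<gg> \<inter> dg.EE SQ" if "j < d" "s \<in> ball 0 r" for j s
      by (fact S[OF that] Sq[OF that])+
    show "\<exists>C. wd (S1 j) 0 C 0" if "j < d" for j by (fact S1[OF that])
  qed (rule that)
  have ball: "s \<in> ball 0 r" if "s \<in> ball 0 e" for s :: complex using that e by auto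
  define H where "H s = gram_matrix W Q \<phi> \<epsilon> (z + s *s a)" for s
  have H: "H s i j = h.hE (A s (S j s)) (A s (S i s))" if "s \<in> ball 0 e" "i < d" "j < d" for s i j
    unfolding H_def gram_matrix_def frame[OF that(2) ball[OF that(1)]] frame[OF that(3) ball[OF that(1)]]
      \<phi>G[OF ball[OF that(1)]] by (rule metric[OF that(1)])
  have basis: "h.indep d (\<lambda>j. S j s)" "X \<in> \<gg> \<inter> dg.EE SQ \<Longrightarrow> \<exists>c. X = (\<Sum>j<d. cscale (c j) (S j s))"
    if s: "s \<in> ball 0 e" for s X
  proof -
    note s' = ball[OF s]
    interpret t: polarized_hodge W "filt_act (G s) F" Q by (rule G_pol[OF s'])
    interpret tr: hodge_translate W F Q "G s" by unfold_locales (rule G_mem[OF s'])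
    note fb = frame_basis[OF fr E yU[OF s'] T[OF s'] bij[OF yU[OF s']], folded d_def frame_vector_def, unfolded \<phi>G[OF s']]
    have fs: "(\<Sum>j<d. cscale (c j) (frame_vector W Q \<phi> \<epsilon> (z + s *s a) j)) =
      (\<Sum>j<d. cscale (c j) (t.dg.epart SQ (G s ** S j s ** matrix_inv (G s))))" for c
      by (intro sum.cong refl) (simp add: frame[OF _ s'])
    show "h.indep d (\<lambda>j. S j s)"
      by (rule tr.transported_basis(1)) (use Sq[OF _ s'] fb(2,3)[unfolded fs] in blast)+
    show "\<exists>c. X = (\<Sum>j<d. cscale (c j) (S j s))" if "X \<in> \<gg> \<inter> dg.EE SQ"
      by (rule tr.transported_basis(2)[OF _ _ _ that]) (use Sq[OF _ s'] fb(2,3)[unfolded fs] in blast)+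
  qed
  define p where "p s k j = h.hE (A s (w j s)) (A s (S k s))" for s k j
  have dH: "d_holo (\<lambda>y. gram_matrix W Q \<phi> \<epsilon> y k j) (z + s *s a) a = p s k j"
    if skj: "s \<in> ball 0 e" "k < d" "j < d" for s k j
  proof -
    obtain c' where "cwd (\<lambda>x. h.hE (A x (S j x)) (A x (S k x))) s (p s k j) c'"
      using dgram[OF skj] unfolding p_def by blast
    then have "cwd (\<lambda>x. H x k j) s (p s k j) c'"
      by (rule cwd_cong[OF _ open_ball skj(1)]) (simp add: H skj(2,3))
    then show ?thesis unfolding H_def by (rule d_holo_line(1))
  qed
  have conn: "connection_form d (gram_matrix W Q \<phi> \<epsilon>) (z + s *s a) a i j = (\<Sum>k<d. mat_inverse d (H s) i k * p s k j)"
    if "s \<in> ball 0 e" "j < d" for s i j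
    unfolding connection_form_def H_def using dH[OF that(1) _ that(2)] by (intro sum.cong refl) simp
  define R where "R = curvature_matrix d (gram_matrix W Q \<phi> \<epsilon>) z a a"
  have 0: "(0::complex) \<in> ball 0 e" using e by simp
  have R: "(\<Sum>i<d. cscale (R i j) (S i 0)) = curv u (S j 0)" if j: "j < d" for j
  proof -
    have cd: "\<exists>c c'. (\<forall>i<d. cwd (\<lambda>s. \<Sum>k<d. mat_inverse d (H s) i k * p s k j) 0 (c i) (c' i)) \<and>
        (\<Sum>i<d. cscale (c' i) (S i 0)) = - curv u (S j 0)"
    proof (rule h.connection_derivative[where R = "\<lambda>j. - curv u (S j 0)" and D = "\<lambda>j. S1 j 0" and A = A and w = w, OF e(1) csub_Int])
      show "clinear (A s)" if "s \<in> ball 0 e" for s by (rule A[OF that])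
      show "X = 0" if "s \<in> ball 0 e" "X \<in> \<gg> \<inter> dg.EE SQ" "A s X = 0" for s X by (rule inj[OF that])
      show "S j s \<in> \<gg> \<inter> dg.EE SQ" "w j s \<in> \<gg> \<inter> dg.EE SQ" if "s \<in> ball 0 e" "j < d" for s j
        by (rule Sq[OF that(2) ball[OF that(1)]], rule wq[OF that])
      show "h.indep d (\<lambda>j. S j s)" if "s \<in> ball 0 e" for s by (rule basis(1)[OF that])
      show "\<exists>c. X = (\<Sum>j<d. cscale (c j) (S j s))" if "s \<in> ball 0 e" "X \<in> \<gg> \<inter> dg.EE SQ" for s X
        by (rule basis(2)[OF that])
      show "H s i j = h.hE (A s (S j s)) (A s (S i s))" if "s \<in> ball 0 e" "i < d" "j < d" for s i j by (rule H[OF that])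
      show "p s i j = h.hE (A s (w j s)) (A s (S i s))" for s i j by (rule p_def)
      show "wd (S j) 0 (S1 j 0) 0" if "j < d" for j by (rule S[OF that ball[OF 0]])
      show "\<exists>C. wd (w j) 0 C (- curv u (S j 0))" if "j < d" for j by (rule w[OF that])
    qed (rule j)
    obtain c c' where cc: "\<forall>i<d. cwd (\<lambda>s. \<Sum>k<d. mat_inverse d (H s) i k * p s k j) 0 (c i) (c' i)"
      and sum: "(\<Sum>i<d. cscale (c' i) (S i 0)) = - curv u (S j 0)"
      using cd by (elim exE conjE)
    \<comment> \<open>The minus sign in \<open>curvature_matrix\<close> cancels the one in front of
      \<open>curv u\<close> in the derivative of \<open>w j\<close>.\<close>
    have "R i j = - c' i" if i: "i < d" for i
    proof -
      have "cwd (\<lambda>s. connection_form d (gram_matrix W Q \<phi> \<epsilon>) (z + s *s a) a i j) 0 (c i) (c' i)"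
        by (rule cwd_cong[OF cc[rule_format, OF i] open_ball 0]) (simp add: conn j)
      from d_holo_line(2)[OF this] show ?thesis by (simp add: R_def curvature_matrix_def)
    qed
    then have "(\<Sum>i<d. cscale (R i j) (S i 0)) = - (\<Sum>i<d. cscale (c' i) (S i 0))"
      by (simp add: sum_negf[symmetric] vec_eq_iff)
    then show ?thesis by (simp add: sum)
  qed
  have f0: "frame_vector W Q \<phi> \<epsilon> z j = S j 0" if "j < d" for j
    using frame[OF that ball[OF 0]] Sq[OF that ball[OF 0]] by (simp add: G0 matrix_inv_unique dg.epart_id)
  obtain c0 where c0: "v = (\<Sum>j<d. cscale (c0 j) (S j 0))" using basis(2)[OF 0, of v] v by (auto simp: q_alg_eq)
  \<comment> \<open>\<open>frame_coords\<close> prescribes the value 0 beyond \<open>d\<close>,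
    which makes the coordinate function unique.\<close>
  define c where "c j = (if j < d then c0 j else 0)" for j
  have c: "v = (\<Sum>j<d. cscale (c j) (S j 0))" unfolding c0 by (intro sum.cong) (auto simp: c_def)
  have coords: "frame_coords W Q E \<phi> \<epsilon> z v = c"
    unfolding frame_coords_def d_def[symmetric]
  proof (rule the_equality)
    show "(\<forall>j\<ge>d. c j = 0) \<and> v = (\<Sum>j<d. cscale (c j) (frame_vector W Q \<phi> \<epsilon> z j))"
      using c f0 by (auto simp: c_def)
    fix b assume b: "(\<forall>j\<ge>d. b j = 0) \<and> v = (\<Sum>j<d. cscale (b j) (frame_vector W Q \<phi> \<epsilon> z j))"
    then have "(\<Sum>j<d. cscale (b j - c j) (S j 0)) = 0" using c f0 by (simp add: cscale_distrib sum_subtractf)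
    then have "\<forall>j<d. b j - c j = 0" using basis(1)[OF 0] unfolding h.indep_def by metis
    then show "b = c" using b by (auto simp: fun_eq_iff c_def not_less)
  qed
  have "chern_curvature W Q E \<phi> \<epsilon> z u u v = (\<Sum>i<d. cscale (\<Sum>j<d. R i j * c j) (S i 0))"
    unfolding chern_curvature_def Let_def coords d_def[symmetric] a_def[symmetric] R_def[symmetric]
    by (intro sum.cong refl) (simp add: f0)
  also have "\<dots> = (\<Sum>i<d. \<Sum>j<d. cscale (c j) (cscale (R i j) (S i 0)))"
    by (intro sum.cong refl) (simp add: vec_eq_iff sum_distrib_left mult_ac)
  also have "\<dots> = (\<Sum>j<d. cscale (c j) (\<Sum>i<d. cscale (R i j) (S i 0)))"
    by (subst sum.swap) (simp add: cscale_sum)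
  also have "\<dots> = (\<Sum>j<d. cscale (c j) (curv u (S j 0)))" by (intro sum.cong refl) (simp add: R)
  also have "\<dots> = curv u v" unfolding c by (rule clinear_sum[OF clinear_curv, symmetric]) simp
  finally show ?thesis .
qed

end

theorem theorem3p4:
  fixes W :: "int \<Rightarrow> (real ^ 'n::finite) set"
    and Q :: "int \<Rightarrow> real ^ 'n \<Rightarrow> real ^ 'n \<Rightarrow> real"
    and h :: "int \<Rightarrow> int \<Rightarrow> nat"
    and F :: "int \<Rightarrow> (complex ^ 'n) set"
    and E U :: "(complex ^ 'm::finite) set"
    and \<phi> :: "complex ^ 'm \<Rightarrow> int \<Rightarrow> (complex ^ 'n) set"
    and \<epsilon> :: "nat \<Rightarrow> complex ^ 'm \<Rightarrow> complex ^ 'm"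
    and z :: "complex ^ 'm"
    and u :: "complex ^ 'n ^ 'n"
  assumes "weight_filtration W" and "graded_forms W Q"
    and "F \<in> classifying_space W Q h"
    and "holomorphic_chart W Q h E U \<phi>" and "z \<in> U" and "\<phi> z = F"
    and "holomorphic_frame E U \<epsilon>"
    and "u \<in> q_alg W Q F"
  shows "\<forall>v \<in> q_alg W Q F.
    (let ub = cnj_mat u; adj = mh_adjoint W Q F; pl = plus_part W Q F
     in chern_curvature W Q E \<phi> \<epsilon> z u u v =
          - op_comm (q_op W Q F (ad (adj (pl ub)))) (q_op W Q F (ad (pl ub))) v
          - ad (zero_part W Q F (ad u ub)) v
          - q_op W Q F (ad (pl (ad u ub) + adj (pl (ad u ub)))) v)"
proof -
  interpret polarized_hodge W F Q by (rule polarized_hodgeI[OF assms(1-3)])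
  show ?thesis using chern_curvature_eq[OF assms(4-8)] unfolding curv_def Let_def by blast
qed


end
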